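(* Let $n\ge 1$ and let $\Gamma$ be a finite index subgroup of $\mathrm{SL}_n(\mathcal{O})$ in the Euclidean case with $n$ even, of $\mathrm{GL}_n(\mathcal{O})$ in the Euclidean case with $n$ odd, and of $\mathrm{GL}_n(\mathcal{O})$ in the Hermitian case for any $n$. Let $\mathrm{Vor}_\Gamma=(V_*,d_* )$ be the Voronoi complex of $\Gamma$, where for every $\sigma\in\Sigma_{d(n)}(\Gamma)$ the space $\mathbb{R}(\sigma)=\mathcal{H}_n(K)$ is given one and the same fixed orientation of $\mathcal{H}_n(K)$. Then $H_{d(n)}(\mathrm{Vor}_\Gamma\otimes\mathbb{Q})\cong\mathbb{Q}$, and the element $$\sum_{\sigma\in\Sigma_{d(n)}(\Gamma)}\frac{1}{|\Gamma_\sigma|}\,\sigma\ \in\ V_{d(n)}\otimes\mathbb{Q}$$ is a (canonical) non-trivial cycle, i.e. it lies in the kernel of $d_{d(n)}\otimes\mathbb{Q}$ and its class in $H_{d(n)}(\mathrm{Vor}_\Gamma\otimes\mathbb{Q})$ is non-zero.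
   Context: Euclidean case: $F=\mathbb{Q}$, $\mathcal{O}=\mathbb{Z}$, $K=\mathbb{R}$. Hermitian case: $F$ is an imaginary quadratic field embedded in $K=\mathbb{C}$, with ring of integers $\mathcal{O}$. $\mathcal{H}_n(K)$ is the real vector space of $n\times n$ Hermitian matrices over $K$; its dimension is $d(n)+1$, where $d(n)=\frac{n(n+1)}{2}-1$ in the Euclidean case and $d(n)=n^2-1$ in the Hermitian case. For $h\in\mathcal{H}_n(K)$ write $h(x)=x^*hx$. $C_n\subset\mathcal{H}_n(K)$ is the cone of positive definite forms; $C_n^*$ is the cone of non-negative definite forms whose kernel is spanned by a proper linear subspace of $F^n$; $\partial C_n^*=C_n^*\setminus C_n$. For $h\in C_n$ put $\mu(h)=\min_{x\in\mathcal{O}^n\setminus\{0\}}h(x)$ and $m(h)=\{x\in\mathcal{O}^n\setminus\{0\}: h(x)=\mu(h)\}$. The form $h$ is perfect if $\{xx^*: x\in m(h)\}$ spans $\mathcal{H}_n(K)$ over $\mathbb{R}$; $\mathcal{P}_n$ is the set of perfect forms up to homothety. The Voronoi domain of $h\in\mathcal{P}_n$ is $\mathcal{D}(h)=\{\sum_{x\in m(h)}\lambda_x xx^*:\lambda_x\ge 0\}$, a full-dimensional convex polyhedral cone whose extreme rays are spanned by the $xx^*$, $x\in m(h)$. $\mathcal{F}^k(\sigma)$ is the set of codimension-$k$ faces of a polyhedral cone $\sigma$ (faces are nonzero cones, so $\{0\}$ is not counted). $\mathrm{GL}_n(\mathcal{O})$ acts on $\mathcal{H}_n(K)$ by $\gamma\cdot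 X=\gamma X\gamma^*$; this action permutes the Voronoi domains of perfect forms and their faces. Let $\Gamma<\mathrm{GL}_n(\mathcal{O})$ be of finite index. $\Sigma^*_{d(n)-k}(\Gamma)$ is the set of those $\sigma$, in a fixed set of representatives of the $\Gamma$-orbits of $\bigcup_{h\in\mathcal{P}_n}\mathcal{F}^k(\mathcal{D}(h))$, whose relative interior does not meet $\partial C_n^*$. (One has $\Sigma_k^*(\Gamma)=\emptyset$ for $k<n-1$ and $k>d(n)$.) For such $\sigma$ let $\mathbb{R}(\sigma)$ be its real linear span, $m(\sigma)=\{x\in\mathcal{O}^n: xx^*\text{ is one of the generators } xx^* \text{ of the extreme rays of }\sigma\}$, and $\Gamma_\sigma=\{\gamma\in\Gamma:\gamma\cdot\sigma=\sigma\}$. $\Sigma_k(\Gamma)\subset\Sigma_k^*(\Gamma)$ consists of the $\sigma$ such that no element of $\Gamma_\sigma$ reverses the orientation of $\mathbb{R}(\sigma)$. Fix orientations on all the spaces $\mathbb{R}(\sigma)$. For $\sigma\in\Sigma_k^*(\Gamma)$ and $\tau'\in\mathcal{F}^1(\sigma)$ with $\tau'=\gamma\cdot\tau$, $\gamma\in\Gamma$, $\tau\in\Sigma_{k-1}^*(\Gamma)$: let $\mathcal{B}'$ be a positively oriented basis of $\mathbb{R}(\tau')$ and $x\in m(\sigma)\setminus m(\tau')$; $\varepsilon(\sigma,\tau')=1$ if $(\mathcal{B}',xx^* )$ is a positively oriented basis of $\mathbb{R}(\sigma)$ and $-1$ otherwise (independent of $x$). $\eta(\tau,\tau')=1$ if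 $\gamma$ sends a positively oriented basis of $\mathbb{R}(\tau)$ to a positively oriented basis of $\mathbb{R}(\tau')$, and $-1$ otherwise. With $\mathrm{Orb}_\sigma(\tau)=\{\tau'\in\mathcal{F}^1(\sigma):\exists\gamma\in\Gamma,\ \tau'=\gamma\cdot\tau\}$ put $[\sigma:\tau]=\sum_{\tau'\in\mathrm{Orb}_\sigma(\tau)}\eta(\tau,\tau')\varepsilon(\sigma,\tau')$. The Voronoi complex $\mathrm{Vor}_\Gamma=(V_*,d_* )$ has $V_k$ the free abelian group on $\Sigma_k(\Gamma)$ and $d_k(\sigma)=\sum_{\tau\in\Sigma_{k-1}(\Gamma)}[\sigma:\tau]\tau$. It is known to be a finite chain complex concentrated in degrees $n-1\le k\le d(n)$. The word "canonical" is descriptive: the cycle is given by the collection of all perfect forms of rank $n$ modulo $\Gamma$ and their stabilizers. *)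

theory Defs
  imports
    "HOL-Analysis.Analysis"
    "HOL-Algebra.Coset"
    "HOL-Library.Poly_Mapping"
    "Jordan_Normal_Form.Determinant"
begin

no_notation Matrix.vec_index (infixl \<open>$\<close> 100)
no_notation Matrix.mult_mat_vec (infixl \<open>*\<^sub>v\<close> 70)
hide_const (open) Matrix.mat Matrix.vec Determinant.det

section \<open>Ground fields and lattices\<close>

text \<open>
  Both cases live inside the complex numbers: the field \<open>F\<close> is a subset of \<open>\<complex>\<close>, either
  \<open>\<rat>\<close> (Euclidean case) or an imaginary quadratic field (Hermitian case).  The rank \<open>n\<close> is
  \<open>CARD('n)\<close>.  For \<open>K = \<real>\<close>, real vectors and real symmetric matrices are the complex ones
  with entries in \<open>\<real>\<close>.
\<close>

definition imaginary_quadratic :: "complex set \<Rightarrow> bool" where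
  "imaginary_quadratic F \<longleftrightarrow>
     (\<exists>d::nat. d > 0 \<and> F = {of_rat a + of_rat b * (\<i> * of_real (sqrt (real d))) | a b. True})"

definition local_field :: "complex set \<Rightarrow> complex set" where
  "local_field F = (if F = \<rat> then \<real> else UNIV)"

definition ring_of_ints :: "complex set \<Rightarrow> complex set" where
  "ring_of_ints F = {x \<in> F. algebraic_int x}"

lemma ring_of_ints_Rats: "ring_of_ints \<rat> = \<int>"
  unfolding ring_of_ints_def
  using rational_algebraic_int_is_int Ints_subset_Rats int_imp_algebraic_int by blast

definition vecs :: "complex set \<Rightarrow> (complex ^ 'n) set" where
  "vecs S = {x. \<forall>i. x $ i \<in> S}"

definition mats :: "complex set \<Rightarrow> (complex ^ 'n ^ 'n) set" where
  "mats S = {A. \<forall>i j. A $ i $ j \<in> S}"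

definition conj_transpose :: "complex ^ 'n ^ 'n \<Rightarrow> complex ^ 'n ^ 'n" where
  "conj_transpose A = (\<chi> i j. cnj (A $ j $ i))"

definition GL :: "complex set \<Rightarrow> (complex ^ 'n ^ 'n) monoid" where
  "GL S = \<lparr>carrier = {A \<in> mats S. \<exists>B \<in> mats S. A ** B = mat 1 \<and> B ** A = mat 1},
           monoid.mult = (**), one = mat 1\<rparr>"

definition SL :: "complex set \<Rightarrow> (complex ^ 'n ^ 'n) monoid" where
  "SL S = (GL S)\<lparr>carrier := {A \<in> carrier (GL S). det A = 1}\<rparr>"

definition finite_index_subgroup :: "'a set \<Rightarrow> 'a monoid \<Rightarrow> bool" where
  "finite_index_subgroup H G \<longleftrightarrow> subgroup H G \<and> finite (rcosets\<^bsub>G\<^esub> H)"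


section \<open>Hermitian forms and perfect forms\<close>

text \<open>\<open>\<H>\<^sub>n(K)\<close> with \<open>K = local_field F\<close>.\<close>

definition herm :: "complex set \<Rightarrow> (complex ^ 'n ^ 'n) set" where
  "herm F = {X \<in> mats (local_field F). conj_transpose X = X}"

text \<open>\<open>h(x) = x\<^sup>* h x\<close>, which is a real number for Hermitian \<open>h\<close>.\<close>

definition form_at :: "complex ^ 'n ^ 'n \<Rightarrow> complex ^ 'n \<Rightarrow> real" where
  "form_at h x = Re (\<Sum>i\<in>UNIV. \<Sum>j\<in>UNIV. cnj (x $ i) * h $ i $ j * x $ j)"

text \<open>\<open>x x\<^sup>*\<close>\<close>

definition rank_one :: "complex ^ 'n \<Rightarrow> complex ^ 'n ^ 'n" where
  "rank_one x = (\<chi> i j. x $ i * cnj (x $ j))"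

definition pos_cone :: "complex set \<Rightarrow> (complex ^ 'n ^ 'n) set" where
  "pos_cone F = {h \<in> herm F. \<forall>x \<in> vecs (local_field F) - {0}. form_at h x > 0}"

definition linear_subspace :: "complex set \<Rightarrow> (complex ^ 'n) set \<Rightarrow> bool" where
  "linear_subspace k W \<longleftrightarrow>
     0 \<in> W \<and> (\<forall>x\<in>W. \<forall>y\<in>W. x + y \<in> W) \<and> (\<forall>c\<in>k. \<forall>x\<in>W. c *s x \<in> W)"

text \<open>
  \<open>C\<^sub>n\<^sup>*\<close>: the kernel in \<open>K\<^sup>n\<close> is the \<open>K\<close>-linear span (\<open>linear_subspace K hull _\<close>) of a
  proper \<open>F\<close>-linear subspace \<open>W\<close> of \<open>F\<^sup>n\<close>.
\<close>

definition pos_cone_star :: "complex set \<Rightarrow> (complex ^ 'n ^ 'n) set" where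
  "pos_cone_star F = {h \<in> herm F.
     (\<forall>x \<in> vecs (local_field F). form_at h x \<ge> 0) \<and>
     (\<exists>W. linear_subspace F W \<and> W \<subset> vecs F \<and>
          {x \<in> vecs (local_field F). h *v x = 0} = linear_subspace (local_field F) hull W)}"

definition pos_cone_star_boundary :: "complex set \<Rightarrow> (complex ^ 'n ^ 'n) set" where
  "pos_cone_star_boundary F = pos_cone_star F - pos_cone F"

text \<open>The infimum below is attained for \<open>h\<close> in \<open>pos_cone F\<close>, and \<open>min_vecs F h\<close> is then finite.\<close>

definition minimum :: "complex set \<Rightarrow> complex ^ 'n ^ 'n \<Rightarrow> real" where
  "minimum F h = (INF x \<in> vecs (ring_of_ints F) - {0}. form_at h x)"

definition min_vecs :: "complex set \<Rightarrow> complex ^ 'n ^ 'n \<Rightarrow> (complex ^ 'n) set" where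
  "min_vecs F h = {x \<in> vecs (ring_of_ints F) - {0}. form_at h x = minimum F h}"

definition perfect_form :: "complex set \<Rightarrow> complex ^ 'n ^ 'n \<Rightarrow> bool" where
  "perfect_form F h \<longleftrightarrow> h \<in> pos_cone F \<and> span (rank_one ` min_vecs F h) = herm F"


section \<open>Voronoi cones\<close>

definition voronoi_domain ::
  "complex set \<Rightarrow> complex ^ 'n ^ 'n \<Rightarrow> (complex ^ 'n ^ 'n) set" where
  "voronoi_domain F h =
     {(\<Sum>x\<in>min_vecs F h. l x *\<^sub>R rank_one x) | l :: complex ^ 'n \<Rightarrow> real. \<forall>x. 0 \<le> l x}"

definition faces_codim :: "nat \<Rightarrow> 'a::euclidean_space set \<Rightarrow> 'a set set" where
  "faces_codim k \<sigma> = {\<tau>. \<tau> face_of \<sigma> \<and> \<tau> \<noteq> {} \<and> \<tau> \<noteq> {0} \<and> dim \<tau> + k = dim \<sigma>}"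

text \<open>
  The union is over all perfect forms instead of homothety classes; this gives the same
  collection, since \<open>voronoi_domain F (t *\<^sub>R h) = voronoi_domain F h\<close> for \<open>t > 0\<close>.
\<close>

definition voronoi_cones_codim :: "complex set \<Rightarrow> nat \<Rightarrow> (complex ^ 'n ^ 'n) set set" where
  "voronoi_cones_codim F k = (\<Union>h \<in> {h. perfect_form F h}. faces_codim k (voronoi_domain F h))"

definition voronoi_cones :: "complex set \<Rightarrow> (complex ^ 'n ^ 'n) set set" where
  "voronoi_cones F = (\<Union>k. voronoi_cones_codim F k)"

definition act :: "complex ^ 'n ^ 'n \<Rightarrow> complex ^ 'n ^ 'n \<Rightarrow> complex ^ 'n ^ 'n" where
  "act \<gamma> X = \<gamma> ** X ** conj_transpose \<gamma>"

text \<open>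
  One representative for every \<open>\<Gamma>\<close>-orbit of Voronoi cones, in all codimensions at once
  (the action preserves the codimension).
\<close>

definition orbit_representatives ::
  "complex set \<Rightarrow> (complex ^ 'n ^ 'n) set \<Rightarrow> (complex ^ 'n ^ 'n) set set \<Rightarrow> bool" where
  "orbit_representatives F \<Gamma> R \<longleftrightarrow>
     R \<subseteq> voronoi_cones F \<and>
     (\<forall>\<sigma> \<in> voronoi_cones F. \<exists>!\<tau>. \<tau> \<in> R \<and> (\<exists>\<gamma>\<in>\<Gamma>. \<sigma> = act \<gamma> ` \<tau>))"

text \<open>The number \<open>d(n)\<close>.\<close>

definition top_degree :: "complex set \<Rightarrow> nat \<Rightarrow> int" where
  "top_degree F n =
     (if F = \<rat> then int n * (int n + 1) div 2 - 1 else (int n)\<^sup>2 - 1)"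

text \<open>
  \<open>\<Sigma>\<^sub>j\<^sup>*(\<Gamma>)\<close>, where \<open>R\<close> is the fixed set of orbit representatives.  Degrees are integers, so
  that nothing is truncated below degree 0.
\<close>

definition Sigma_star ::
  "complex set \<Rightarrow> (complex ^ 'n ^ 'n) set set \<Rightarrow> int \<Rightarrow> (complex ^ 'n ^ 'n) set set" where
  "Sigma_star F R j = {\<sigma> \<in> R.
     (\<exists>k::nat. j = top_degree F CARD('n) - int k \<and> \<sigma> \<in> voronoi_cones_codim F k) \<and>
     rel_interior \<sigma> \<inter> pos_cone_star_boundary F = {}}"

text \<open>
  \<open>m(\<sigma>)\<close>: the generators of the extreme rays of a face \<open>\<sigma>\<close> of \<open>\<D>(h)\<close> are those \<open>x x\<^sup>*\<close> with
  \<open>x \<in> m(h)\<close> whose ray is a face of \<open>\<sigma>\<close>.  The choice of \<open>h\<close> does not matter: if \<open>x \<in> m(h)\<close> and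
  \<open>s x \<in> m(h')\<close> for perfect \<open>h\<close>, \<open>h'\<close>, then \<open>\<bar>s\<bar> = 1\<close>.
\<close>

definition cone_vecs ::
  "complex set \<Rightarrow> (complex ^ 'n ^ 'n) set \<Rightarrow> (complex ^ 'n) set" where
  "cone_vecs F \<sigma> = {x \<in> vecs (ring_of_ints F).
     \<exists>h. perfect_form F h \<and> \<sigma> face_of voronoi_domain F h \<and> x \<in> min_vecs F h \<and>
         (\<lambda>t. t *\<^sub>R rank_one x) ` {0..} face_of \<sigma>}"

definition stabilizer ::
  "(complex ^ 'n ^ 'n) set \<Rightarrow> (complex ^ 'n ^ 'n) set \<Rightarrow> (complex ^ 'n ^ 'n) set" where
  "stabilizer \<Gamma> \<sigma> = {\<gamma> \<in> \<Gamma>. act \<gamma> ` \<sigma> = \<sigma>}"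


section \<open>Orientations\<close>

definition ordered_bases :: "'a::euclidean_space set \<Rightarrow> 'a list set" where
  "ordered_bases W = {B. distinct B \<and> independent (set B) \<and> span (set B) = W}"

text \<open>
  The change-of-basis determinant has a size depending on \<open>W\<close>, hence the determinant of
  carrier-based matrices.  Its columns are the coordinates of the \<open>C ! j\<close> in the basis \<open>B\<close>.
\<close>

definition basis_change_det :: "'a::euclidean_space list \<Rightarrow> 'a list \<Rightarrow> real" where
  "basis_change_det B C = Determinant.det
     (Matrix.mat (length B) (length B) (\<lambda>(i, j). representation (set B) (C ! j) (B ! i)))"

definition same_orientation :: "'a::euclidean_space set \<Rightarrow> ('a list \<times> 'a list) set" where
  "same_orientation W =
     {(B, C). B \<in> ordered_bases W \<and> C \<in> ordered_bases W \<and> basis_change_det B C > 0}"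

text \<open>
  An orientation of \<open>W\<close> is an equivalence class of ordered bases; its members are the
  positively oriented bases.
\<close>

definition orientations :: "'a::euclidean_space set \<Rightarrow> 'a list set set" where
  "orientations W = ordered_bases W // same_orientation W"

definition reverses_orientation ::
  "complex ^ 'n ^ 'n \<Rightarrow> (complex ^ 'n ^ 'n) set \<Rightarrow> bool" where
  "reverses_orientation \<gamma> W \<longleftrightarrow>
     (\<exists>B \<in> ordered_bases W. basis_change_det B (map (act \<gamma>) B) < 0)"

definition Sigma_orientable ::
  "complex set \<Rightarrow> (complex ^ 'n ^ 'n) set \<Rightarrow> (complex ^ 'n ^ 'n) set set \<Rightarrow> int
    \<Rightarrow> (complex ^ 'n ^ 'n) set set" where
  "Sigma_orientable F \<Gamma> R j = {\<sigma> \<in> Sigma_star F R j.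
     \<not> (\<exists>\<gamma> \<in> stabilizer \<Gamma> \<sigma>. reverses_orientation \<gamma> (span \<sigma>))}"


section \<open>The Voronoi complex\<close>

text \<open>
  In what follows \<open>ori \<sigma>\<close> is the chosen orientation of \<open>\<real>(\<sigma>) = span \<sigma>\<close>, given as its set of
  positively oriented bases.  The signs \<open>\<epsilon>(\<sigma>,\<tau>')\<close> and, for \<open>\<tau> \<in> \<Sigma>\<^sub>k(\<Gamma>)\<close>, \<open>\<eta>(\<tau>,\<tau>')\<close> do not
  depend on the choices of bases, of \<open>x\<close> and of \<open>\<gamma>\<close>, so the existential quantifiers could as
  well be universal.
\<close>

type_synonym 'n cone = "(complex ^ 'n ^ 'n) set"
type_synonym 'n orientation = "(complex ^ 'n ^ 'n) list set"

definition sign_eps ::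
  "complex set \<Rightarrow> ('n cone \<Rightarrow> 'n orientation) \<Rightarrow> 'n cone \<Rightarrow> 'n::finite cone \<Rightarrow> int" where
  "sign_eps F ori \<sigma> \<tau>' =
     (if \<exists>B' \<in> ori \<tau>'. \<exists>x \<in> cone_vecs F \<sigma> - cone_vecs F \<tau>'. B' @ [rank_one x] \<in> ori \<sigma>
      then 1 else -1)"

definition sign_eta ::
  "(complex ^ 'n ^ 'n) set \<Rightarrow> ('n cone \<Rightarrow> 'n orientation) \<Rightarrow> 'n cone \<Rightarrow> 'n::finite cone \<Rightarrow> int"
  where
  "sign_eta \<Gamma> ori \<tau> \<tau>' =
     (if \<exists>\<gamma> \<in> \<Gamma>. \<tau>' = act \<gamma> ` \<tau> \<and> (\<exists>B \<in> ori \<tau>. map (act \<gamma>) B \<in> ori \<tau>')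
      then 1 else -1)"

definition facet_orbit ::
  "(complex ^ 'n ^ 'n) set \<Rightarrow> 'n cone \<Rightarrow> 'n cone \<Rightarrow> 'n::finite cone set" where
  "facet_orbit \<Gamma> \<sigma> \<tau> = {\<tau>' \<in> faces_codim 1 \<sigma>. \<exists>\<gamma>\<in>\<Gamma>. \<tau>' = act \<gamma> ` \<tau>}"

definition incidence ::
  "complex set \<Rightarrow> (complex ^ 'n ^ 'n) set \<Rightarrow> ('n cone \<Rightarrow> 'n orientation)
    \<Rightarrow> 'n cone \<Rightarrow> 'n::finite cone \<Rightarrow> int" where
  "incidence F \<Gamma> ori \<sigma> \<tau> =
     (\<Sum>\<tau>' \<in> facet_orbit \<Gamma> \<sigma> \<tau>. sign_eta \<Gamma> ori \<tau> \<tau>' * sign_eps F ori \<sigma> \<tau>')"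

text \<open>
  The complex with coefficients in a ring \<open>'r\<close>: finitely supported functions on
  \<open>\<Sigma>\<^sub>k(\<Gamma>)\<close>.  For \<open>'r = int\<close> this is \<open>(V\<^sub>*, d\<^sub>*)\<close>, and for \<open>'r = rat\<close> it is \<open>(V\<^sub>*, d\<^sub>*) \<otimes> \<rat>\<close>.
\<close>

definition vor_chains ::
  "complex set \<Rightarrow> (complex ^ 'n ^ 'n) set \<Rightarrow> 'n::finite cone set \<Rightarrow> int
    \<Rightarrow> ('n cone \<Rightarrow>\<^sub>0 'r::comm_ring_1) monoid" where
  "vor_chains F \<Gamma> R k =
     \<lparr>carrier = {c. Poly_Mapping.keys c \<subseteq> Sigma_orientable F \<Gamma> R k}, monoid.mult = (+), one = 0\<rparr>"

definition vor_boundary ::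
  "complex set \<Rightarrow> (complex ^ 'n ^ 'n) set \<Rightarrow> 'n::finite cone set
    \<Rightarrow> ('n cone \<Rightarrow> 'n orientation) \<Rightarrow> int
    \<Rightarrow> ('n cone \<Rightarrow>\<^sub>0 'r) \<Rightarrow> ('n cone \<Rightarrow>\<^sub>0 'r::comm_ring_1)" where
  "vor_boundary F \<Gamma> R ori k c =
     (\<Sum>\<sigma> \<in> Poly_Mapping.keys c. \<Sum>\<tau> \<in> Sigma_orientable F \<Gamma> R (k - 1).
        Poly_Mapping.single \<tau> (Poly_Mapping.lookup c \<sigma> * of_int (incidence F \<Gamma> ori \<sigma> \<tau>)))"

definition vor_cycles ::
  "complex set \<Rightarrow> (complex ^ 'n ^ 'n) set \<Rightarrow> 'n::finite cone set
    \<Rightarrow> ('n cone \<Rightarrow> 'n orientation) \<Rightarrow> int \<Rightarrow> ('n cone \<Rightarrow>\<^sub>0 'r::comm_ring_1) set" where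
  "vor_cycles F \<Gamma> R ori k =
     kernel (vor_chains F \<Gamma> R k) (vor_chains F \<Gamma> R (k - 1)) (vor_boundary F \<Gamma> R ori k)"

definition vor_boundaries ::
  "complex set \<Rightarrow> (complex ^ 'n ^ 'n) set \<Rightarrow> 'n::finite cone set
    \<Rightarrow> ('n cone \<Rightarrow> 'n orientation) \<Rightarrow> int \<Rightarrow> ('n cone \<Rightarrow>\<^sub>0 'r::comm_ring_1) set" where
  "vor_boundaries F \<Gamma> R ori k =
     vor_boundary F \<Gamma> R ori (k + 1) ` carrier (vor_chains F \<Gamma> R (k + 1))"

definition vor_homology ::
  "complex set \<Rightarrow> (complex ^ 'n ^ 'n) set \<Rightarrow> 'n::finite cone set
    \<Rightarrow> ('n cone \<Rightarrow> 'n orientation) \<Rightarrow> int \<Rightarrow> ('n cone \<Rightarrow>\<^sub>0 'r::comm_ring_1) set monoid" where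
  "vor_homology F \<Gamma> R ori k =
     (vor_chains F \<Gamma> R k)\<lparr>carrier := vor_cycles F \<Gamma> R ori k\<rparr> Mod vor_boundaries F \<Gamma> R ori k"

definition homology_class ::
  "complex set \<Rightarrow> (complex ^ 'n ^ 'n) set \<Rightarrow> 'n::finite cone set
    \<Rightarrow> ('n cone \<Rightarrow> 'n orientation) \<Rightarrow> int
    \<Rightarrow> ('n cone \<Rightarrow>\<^sub>0 'r) \<Rightarrow> ('n cone \<Rightarrow>\<^sub>0 'r::comm_ring_1) set" where
  "homology_class F \<Gamma> R ori k z = vor_boundaries F \<Gamma> R ori k #>\<^bsub>vor_chains F \<Gamma> R k\<^esub> z"

definition rat_additive :: "rat monoid" where
  "rat_additive = \<lparr>carrier = UNIV, monoid.mult = (+), one = 0\<rparr>"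

definition fundamental_chain ::
  "complex set \<Rightarrow> (complex ^ 'n ^ 'n) set \<Rightarrow> 'n::finite cone set \<Rightarrow> ('n cone \<Rightarrow>\<^sub>0 rat)" where
  "fundamental_chain F \<Gamma> R =
     (\<Sum>\<sigma> \<in> Sigma_orientable F \<Gamma> R (top_degree F CARD('n)).
        Poly_Mapping.single \<sigma> (1 / of_nat (card (stabilizer \<Gamma> \<sigma>))))"

end

theory Submission
  imports Defs
begin

hide_const (open) Matrix.orthogonal
no_notation Matrix.scalar_prod (infix \<open>\<bullet>\<close> 70)

text \<open>
  The Voronoi domains of the perfect forms tile the cone of positive definite forms, together
  with some of its rational boundary, and \<open>\<Gamma>\<close> permutes the tiles. A chain of top degree
  assigns a number to every orbit of tiles. Multiplied by the orders of the stabilizers, it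
  becomes a \<open>\<Gamma>\<close>-invariant function on the set of all tiles. The point of the proof is that the
  boundary of the chain vanishes exactly if this function takes equal values on any two tiles
  with a common facet. Since one can pass from any tile to any other through such facets, a
  cycle is a constant function; the constant \<open>1\<close> is the fundamental chain. As there are no
  cells of higher degree, the cycles are the homology.

  Perfect forms are normalised to have minimum \<open>1\<close>. They are then the vertices of the Ryshkov
  polyhedron, the set of forms that are at least \<open>1\<close> on all nonzero lattice vectors. Let \<open>\<psi>\<close>
  be the inner normal of a facet of the Voronoi domain of \<open>h\<close>. If \<open>\<psi>\<close> is positive
  semidefinite, the facet lies in the boundary of the cone (\<open>facet_boundary\<close>) and carries no
  cell of the complex. Otherwise the ray \<open>h + t \<psi>\<close> meets a second vertex, and precisely two
  domains contain the facet (\<open>facet_neighbour\<close>, \<open>facet_shared_unique\<close>). That any two domains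
  are joined by a chain of facets of the second kind is Voronoi's algorithm
  (\<open>adjacent_chain\<close>): the value at an interior point of the target domain decreases at every
  step, and only finitely many perfect forms have a value below a given bound. The orbits of
  domains are finite in number, as the inverses of the bases formed by minimal vectors have
  bounded denominators (\<open>finite_unit_perfect_mod_GLO\<close>).

  For the link between incidence numbers and neighbouring domains, fix a facet \<open>\<tau>\<close> with the
  two domains \<open>D\<close>, \<open>D'\<close> at its sides, and count the \<open>\<gamma> \<in> \<Gamma>\<close> for which \<open>\<gamma> \<tau>\<close> is a facet of a
  given representative \<open>\<sigma>\<close>. Grouped by the facet \<open>\<gamma> \<tau>\<close> this gives \<open>\<bar>\<Gamma>\<^sub>\<tau>\<bar> [\<sigma>:\<tau>]\<close>, when every
  \<open>\<gamma>\<close> is counted with its sign; grouped by the domain that is carried to \<open>\<sigma>\<close> it gives \<open>\<bar>\<Gamma>\<^sub>\<sigma>\<bar>\<close>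
  for \<open>D\<close> and \<open>- \<bar>\<Gamma>\<^sub>\<sigma>\<bar>\<close> for \<open>D'\<close>, up to a common sign, because \<open>D\<close> and \<open>D'\<close> lie at opposite
  sides and \<open>\<Gamma>\<close> preserves the orientation of the space of Hermitian matrices (\<open>sign_product\<close>,
  \<open>incidence_formula\<close>). If \<open>\<tau>\<close> is not in \<open>\<Sigma>\<close> because an element of \<open>\<Gamma>\<^sub>\<tau>\<close> reverses its
  orientation, then this element must exchange \<open>D\<close> and \<open>D'\<close> (\<open>reversing_swaps\<close>), so that the
  two domains have the same coefficient anyway.

  The parity conditions on \<open>n\<close> serve to preserve the orientation (\<open>act_det_positive\<close>): the
  determinant of \<open>X \<mapsto> \<gamma> X \<gamma>\<^sup>*\<close> on Hermitian matrices is positive for \<open>K = \<complex>\<close>, by connectedness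
  of \<open>GL\<^sub>n(\<complex>)\<close>, and for \<open>K = \<real>\<close> and \<open>det \<gamma> > 0\<close>; in odd dimension \<open>- \<gamma>\<close> acts as \<open>\<gamma>\<close> and the
  sign of \<open>det \<gamma>\<close> can be chosen.
\<close>

section \<open>Rings of integers\<close>

lemma cnj_of_rat: "cnj (of_rat a) = of_rat a"
proof -
  obtain p q where "a = of_int p / of_int q" by (metis quotient_of_div surj_pair)
  then show ?thesis by (simp add: of_rat_divide)
qed

lemma Rats_subset_Reals: "\<rat> \<subseteq> (\<real> :: complex set)"
  by (metis Rats_cases Reals_cnj_iff cnj_of_rat subsetI)

lemma finite_vec_entries: "finite S \<Longrightarrow> finite {x :: 'a ^ 'n. \<forall>i. x $ i \<in> S}"
proof -
  assume "finite S"
  have "{x :: 'a ^ 'n. \<forall>i. x $ i \<in> S} \<subseteq> vec_lambda ` (PiE UNIV (\<lambda>_. S))"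
  proof
    fix x :: "'a ^ 'n" assume "x \<in> {x. \<forall>i. x $ i \<in> S}"
    then have "vec_nth x \<in> PiE UNIV (\<lambda>_. S)" by (simp add: PiE_UNIV_domain)
    then show "x \<in> vec_lambda ` (PiE UNIV (\<lambda>_. S))" by (metis imageI vec_nth_inverse)
  qed
  moreover have "finite (PiE (UNIV :: 'n set) (\<lambda>_. S))"
    using \<open>finite S\<close> by (intro finite_PiE) auto
  ultimately show ?thesis by (meson finite_imageI finite_subset)
qed

lemma finite_vecs: "finite S \<Longrightarrow> finite (vecs S :: (complex ^ 'n) set)"
  unfolding vecs_def by (rule finite_vec_entries)

text \<open>
  If \<open>r = p / q\<close> in lowest terms, then \<open>q\<^sup>k\<close> divides \<open>D\<close> for all \<open>k\<close>. The exponent \<open>k = D\<close>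
  already excludes \<open>q \<ge> 2\<close>, since \<open>2\<^sup>D > D\<close>.
\<close>

lemma Ints_of_bounded_denominators:
  fixes r :: rat
  assumes D: "D > 0" and *: "\<And>k. of_nat D * r ^ k \<in> \<int>"
  shows "r \<in> \<int>"
proof -
  obtain p q where pq: "quotient_of r = (p, q)" by force
  then have r: "r = of_int p / of_int q" and q: "q > 0" and cop: "coprime p q"
    using quotient_of_div quotient_of_denom_pos quotient_of_coprime by blast+
  have dvd: "q ^ k dvd int D" for k
  proof -
    obtain z where "of_nat D * r ^ k = of_int z" using *[of k] by (auto elim: Ints_cases)
    then have "of_int (int D * p ^ k) = (of_int (z * q ^ k) :: rat)"
      using q by (simp add: r power_divide field_simps)
    then have "int D * p ^ k = z * q ^ k" unfolding of_int_eq_iff .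
    then have "q ^ k dvd int D * p ^ k" by simp
    moreover have "coprime (q ^ k) (p ^ k)" using cop by (simp add: coprime_commute)
    ultimately show ?thesis by (simp add: coprime_dvd_mult_left_iff)
  qed
  have "q = 1"
  proof (rule ccontr)
    assume "q \<noteq> 1"
    then have "2 \<le> q" using q by simp
    then have "2 ^ D \<le> q ^ D" by (simp add: power_mono)
    also have "\<dots> \<le> int D" using dvd[of D] D by (simp add: zdvd_imp_le)
    finally have "(2::nat) ^ D \<le> D" by (metis of_nat_le_iff of_nat_numeral of_nat_power)
    then show False using less_exp[of D] by simp
  qed
  then show ?thesis using r by simp
qed

text \<open>
  One description for both cases: \<open>d = 0\<close> gives the rational numbers, and \<open>d > 0\<close> an imaginary
  quadratic field.
\<close>

locale ground =
  fixes F :: "complex set" and d :: nat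
  assumes F_eq: "F = {of_rat a + of_rat b * (\<i> * of_real (sqrt (real d))) | a b. True}"
begin

definition w :: complex where "w = \<i> * of_real (sqrt (real d))"

abbreviation K where "K \<equiv> local_field F"
abbreviation Oi where "Oi \<equiv> ring_of_ints F"

lemma w_sq: "w * w = - of_nat d"
proof -
  have "complex_of_real (sqrt (real d)) * of_real (sqrt (real d)) = of_nat d"
    by (metis abs_of_nat of_real_mult of_real_of_nat_eq real_sqrt_mult_self)
  then show ?thesis unfolding w_def
    by (simp add: algebra_simps)
qed

lemma cnj_w: "cnj w = - w" by (simp add: w_def)

lemma mem_F_iff: "x \<in> F \<longleftrightarrow> (\<exists>a b. x = of_rat a + of_rat b * w)"
  using F_eq unfolding w_def by auto

lemma Rats_F: "of_rat a \<in> F"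
  unfolding mem_F_iff by (rule exI[of _ a], rule exI[of _ 0]) simp

lemma w_F: "w \<in> F"
  unfolding mem_F_iff by (rule exI[of _ 0], rule exI[of _ 1]) simp

lemma F_add: "x \<in> F \<Longrightarrow> y \<in> F \<Longrightarrow> x + y \<in> F"
proof -
  assume "x \<in> F" "y \<in> F"
  then obtain a b a' b' where "x = of_rat a + of_rat b * w" "y = of_rat a' + of_rat b' * w"
    unfolding mem_F_iff by auto
  then have "x + y = of_rat (a + a') + of_rat (b + b') * w" by (simp add: of_rat_add algebra_simps)
  then show ?thesis unfolding mem_F_iff by blast
qed

lemma F_mult: "x \<in> F \<Longrightarrow> y \<in> F \<Longrightarrow> x * y \<in> F"
proof -
  assume "x \<in> F" "y \<in> F"
  then obtain a b a' b' where "x = of_rat a + of_rat b * w" "y = of_rat a' + of_rat b' * w"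
    unfolding mem_F_iff by auto
  then have "x * y = of_rat (a * a') + of_rat (a * b' + a' * b) * w + of_rat (b * b') * (w * w)"
    by (simp add: of_rat_add of_rat_mult algebra_simps)
  also have "\<dots> = of_rat (a * a' - b * b' * of_nat d) + of_rat (a * b' + a' * b) * w"
    by (simp add: w_sq of_rat_add of_rat_mult of_rat_diff)
  finally show ?thesis unfolding mem_F_iff by blast
qed

lemma F_cnj: "x \<in> F \<Longrightarrow> cnj x \<in> F"
proof -
  assume "x \<in> F"
  then obtain a b where "x = of_rat a + of_rat b * w" unfolding mem_F_iff by auto
  then have "cnj x = of_rat a + of_rat (-b) * w"
    by (simp add: cnj_w cnj_of_rat of_rat_minus)
  then show ?thesis unfolding mem_F_iff by blast
qed

lemma F_power: "x \<in> F \<Longrightarrow> x ^ k \<in> F"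
  using Rats_F[of 1] by (induction k) (auto simp: F_mult)

text \<open>
  An order of \<open>F\<close>. It may be smaller than the ring of integers, but its elements are explicit
  and every element of \<open>F\<close> has a positive multiple in it.
\<close>

definition Zw :: "complex set" where "Zw = {of_int a + of_int b * w | a b. True}"

lemma Zw_I: "of_int a + of_int b * w \<in> Zw" unfolding Zw_def by blast

lemma Zw_int: "of_int a \<in> Zw" using Zw_I[of a 0] by simp

lemma Zw_add: "x \<in> Zw \<Longrightarrow> y \<in> Zw \<Longrightarrow> x + y \<in> Zw"
proof -
  assume "x \<in> Zw" "y \<in> Zw"
  then obtain a b a' b' where "x = of_int a + of_int b * w" "y = of_int a' + of_int b' * w"
    unfolding Zw_def by auto
  then have "x + y = of_int (a + a') + of_int (b + b') * w" by (simp add: algebra_simps)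
  then show ?thesis using Zw_I by metis
qed

lemma Zw_mult: "x \<in> Zw \<Longrightarrow> y \<in> Zw \<Longrightarrow> x * y \<in> Zw"
proof -
  assume "x \<in> Zw" "y \<in> Zw"
  then obtain a b a' b' where "x = of_int a + of_int b * w" "y = of_int a' + of_int b' * w"
    unfolding Zw_def by auto
  then have "x * y = of_int (a * a') + of_int (a * b' + a' * b) * w + of_int (b * b') * (w * w)"
    by (simp add: algebra_simps)
  also have "\<dots> = of_int (a * a' - b * b' * int d) + of_int (a * b' + a' * b) * w"
    by (simp add: w_sq)
  finally show ?thesis using Zw_I by metis
qed

lemma Zw_sum: "(\<And>i. i \<in> A \<Longrightarrow> f i \<in> Zw) \<Longrightarrow> sum f A \<in> Zw"
  using Zw_int[of 0] by (induction A rule: infinite_finite_induct) (auto intro: Zw_add)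

lemma Zw_norm: "x \<in> Zw \<Longrightarrow> x * cnj x \<in> \<int>"
proof -
  assume "x \<in> Zw"
  then obtain a b where x: "x = of_int a + of_int b * w" unfolding Zw_def by auto
  have "x * cnj x = of_int (a * a) - of_int (b * b) * (w * w)"
    by (simp add: x cnj_w algebra_simps)
  also have "\<dots> = of_int (a * a + b * b * int d)" by (simp add: w_sq)
  finally show ?thesis by simp
qed

lemma F_denominator: "x \<in> F \<Longrightarrow> \<exists>D::nat>0. of_nat D * x \<in> Zw"
proof -
  assume "x \<in> F"
  then obtain a b where x: "x = of_rat a + of_rat b * w" unfolding mem_F_iff by auto
  obtain p q where pq: "quotient_of a = (p, q)" by force
  obtain p' q' where pq': "quotient_of b = (p', q')" by force
  have a: "a = of_int p / of_int q" "q > 0" and b: "b = of_int p' / of_int q'" "q' > 0"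
    using pq pq' quotient_of_div quotient_of_denom_pos by blast+
  have "of_nat (nat (q * q')) * x = of_int (q' * p) + of_int (q * p') * w"
    using a(2) b(2) by (simp add: x a(1) b(1) of_rat_divide field_simps)
  moreover have "nat (q * q') > 0" using a b by simp
  ultimately show ?thesis using Zw_I by metis
qed

text \<open>
  Integrality of \<open>x\<close> without polynomials: the powers of \<open>x\<close> have a common denominator. In this
  form it passes to sums and products directly.
\<close>

definition bounded_powers :: "complex \<Rightarrow> bool" where
  "bounded_powers x \<longleftrightarrow> (\<exists>D::nat>0. \<forall>k. of_nat D * x ^ k \<in> Zw)"

lemma bounded_powers_mult:
  assumes "bounded_powers x" "bounded_powers y"
  shows "bounded_powers (x * y)"
proof -
  obtain D E where D: "D > 0" "\<And>k. of_nat D * x ^ k \<in> Zw" and E: "E > 0" "\<And>k. of_nat E * y ^ k \<in> Zw"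
    using assms unfolding bounded_powers_def by metis
  have "of_nat (D * E) * (x * y) ^ k \<in> Zw" for k
    using Zw_mult[OF D(2)[of k] E(2)[of k]] by (simp add: power_mult_distrib algebra_simps)
  then show ?thesis unfolding bounded_powers_def using D(1) E(1) by (metis nat_0_less_mult_iff)
qed

text \<open>
  By the binomial theorem, the product of a denominator for the powers of \<open>x\<close> and one for the
  powers of \<open>y\<close> serves for \<open>x + y\<close>.
\<close>

lemma bounded_powers_add:
  assumes "bounded_powers x" "bounded_powers y"
  shows "bounded_powers (x + y)"
proof -
  obtain D E where D: "D > 0" "\<And>k. of_nat D * x ^ k \<in> Zw" and E: "E > 0" "\<And>k. of_nat E * y ^ k \<in> Zw"
    using assms unfolding bounded_powers_def by metis
  have "of_nat (D * E) * (x + y) ^ k \<in> Zw" for k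
  proof -
    have "of_nat (D * E) * (x + y) ^ k
      = (\<Sum>i\<le>k. of_int (int (k choose i)) * ((of_nat D * x ^ i) * (of_nat E * y ^ (k - i))))"
      unfolding binomial_ring sum_distrib_left
      by (rule sum.cong) (auto simp: algebra_simps)
    moreover have "\<dots> \<in> Zw" by (intro Zw_sum Zw_mult Zw_int D(2) E(2))
    ultimately show ?thesis by simp
  qed
  then show ?thesis unfolding bounded_powers_def using D(1) E(1) by (metis nat_0_less_mult_iff)
qed

lemma bounded_powers_int: "bounded_powers (of_int a)"
proof -
  have "of_nat 1 * of_int a ^ k \<in> Zw" for k using Zw_int[of "a ^ k"] by simp
  then show ?thesis unfolding bounded_powers_def by (intro exI[of _ "1::nat"]) simp
qed

text \<open>
  The norm is rational, and its powers have the common denominator \<open>D\<^sup>2\<close>, because norms from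
  the order are integers.
\<close>

lemma bounded_powers_norm:
  assumes "x \<in> F" "bounded_powers x"
  shows "x * cnj x \<in> \<int>"
proof -
  obtain D where D: "D > 0" "\<And>k. of_nat D * x ^ k \<in> Zw"
    using assms(2) unfolding bounded_powers_def by metis
  obtain a b where x: "x = of_rat a + of_rat b * w" using assms(1) unfolding mem_F_iff by auto
  have "x * cnj x = of_rat (a * a) - of_rat (b * b) * (w * w)"
    by (simp add: x cnj_w cnj_of_rat algebra_simps of_rat_mult)
  then have N: "x * cnj x = of_rat (a * a + b * b * of_nat d)" (is "_ = of_rat ?r")
    by (simp add: w_sq of_rat_add of_rat_mult)
  have "of_nat (D * D) * ?r ^ k \<in> \<int>" for k
  proof -
    have "(of_nat D * x ^ k) * cnj (of_nat D * x ^ k) \<in> \<int>" using Zw_norm D(2) by blast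
    also have "(of_nat D * x ^ k) * cnj (of_nat D * x ^ k) = of_nat (D * D) * (x * cnj x) ^ k"
      by (simp add: power_mult_distrib)
    also have "\<dots> = of_rat (of_nat (D * D) * ?r ^ k)"
      by (simp only: N of_rat_mult of_rat_power of_rat_of_nat_eq)
    finally obtain z where "(of_rat (of_nat (D * D) * ?r ^ k) :: complex) = of_int z"
      by (auto elim: Ints_cases)
    then have "of_nat (D * D) * ?r ^ k = of_int z" by (metis of_rat_eq_iff of_rat_of_int_eq)
    then show ?thesis by simp
  qed
  then have "?r \<in> \<int>" using Ints_of_bounded_denominators[of "D * D" ?r] D(1) by simp
  then show ?thesis unfolding N by (auto elim!: Ints_cases)
qed

text \<open>
  A monic equation of degree \<open>m\<close> expresses every power through lower ones, so the product of
  denominators of \<open>1, x, \<dots>, x\<^sup>m\<^sup>-\<^sup>1\<close> serves for all powers. Conversely, the norms of \<open>x\<close> and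
  \<open>x + 1\<close> are integers, hence so is the trace, and \<open>x\<close> is a root of the polynomial with these
  coefficients.
\<close>

lemma Oi_iff: "x \<in> Oi \<longleftrightarrow> x \<in> F \<and> bounded_powers x"
proof
  assume "x \<in> Oi"
  then have xF: "x \<in> F" and "algebraic_int x" unfolding ring_of_ints_def by auto
  then obtain p where p: "lead_coeff p = 1" "\<And>i. coeff p i \<in> \<int>" "poly p x = 0"
    by (auto elim: algebraic_int.cases)
  define m where "m = degree p"
  have xm: "x ^ m = - (\<Sum>i<m. coeff p i * x ^ i)"
  proof -
    have "poly p x = (\<Sum>i\<le>m. coeff p i * x ^ i)" by (simp add: poly_altdef m_def)
    also have "{..m} = insert m {..<m}" by auto
    finally have "0 = x ^ m + (\<Sum>i<m. coeff p i * x ^ i)" using p(1,3) by (simp add: m_def)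
    then show ?thesis by (simp add: eq_neg_iff_add_eq_0)
  qed
  have "\<forall>i. \<exists>D::nat>0. of_nat D * x ^ i \<in> Zw" using F_denominator F_power[OF xF] by blast
  then obtain E :: "nat \<Rightarrow> nat" where E: "\<And>i. E i > 0" "\<And>i. of_nat (E i) * x ^ i \<in> Zw" by metis
  \<comment> \<open>The denominators of the powers below the degree; higher powers follow by the recursion
    \<open>xm\<close>.\<close>
  define D where "D = (\<Prod>i<m. E i)"
  have "of_nat D * x ^ k \<in> Zw" for k
  proof (induction k rule: less_induct)
    case (less k)
    show ?case
    proof (cases "k < m")
      case True
      then have "D = (\<Prod>i\<in>{..<m}-{k}. E i) * E k"
        unfolding D_def by (subst prod.remove[of _ k]) auto
      then have "of_nat D * x ^ k = of_int (int (\<Prod>i\<in>{..<m}-{k}. E i)) * (of_nat (E k) * x ^ k)"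
        by simp
      then show ?thesis using Zw_mult Zw_int E(2) by metis
    next
      case False
      then have "x ^ k = x ^ (k - m) * x ^ m" by (simp flip: power_add)
      then have "of_nat D * x ^ k = (\<Sum>i<m. (- coeff p i) * (of_nat D * x ^ (k - m + i)))"
        unfolding xm by (simp add: sum_distrib_left sum_negf power_add algebra_simps)
      moreover have "(- coeff p i) * (of_nat D * x ^ (k - m + i)) \<in> Zw" if "i < m" for i
      proof (rule Zw_mult)
        show "- coeff p i \<in> Zw" using p(2)[of i] Zw_int by (metis Ints_cases of_int_minus)
        show "of_nat D * x ^ (k - m + i) \<in> Zw" using less that False by simp
      qed
      ultimately show ?thesis using Zw_sum[of "{..<m}"] by (metis (no_types, lifting) lessThan_iff)
    qed
  qed
  moreover have "D > 0" using E(1) by (simp add: D_def prod_pos)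
  ultimately show "x \<in> F \<and> bounded_powers x" using xF unfolding bounded_powers_def by blast
next
  assume x: "x \<in> F \<and> bounded_powers x"
  then have N: "x * cnj x \<in> \<int>" using bounded_powers_norm by blast
  have "x + of_int 1 \<in> F" using x F_add Rats_F[of 1] by simp
  moreover have "bounded_powers (x + of_int 1)" using x bounded_powers_add bounded_powers_int by blast
  ultimately have "(x + of_int 1) * cnj (x + of_int 1) \<in> \<int>" by (rule bounded_powers_norm)
  then have "(x + 1) * cnj (x + 1) \<in> \<int>" by (simp only: of_int_1)
  moreover have "(x + 1) * cnj (x + 1) - x * cnj x - 1 = x + cnj x" by (simp add: algebra_simps)
  ultimately have T: "x + cnj x \<in> \<int>" using N by (metis Ints_1 Ints_diff)
  have "algebraic_int x"
  proof (rule algebraic_int.intros)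
    show "lead_coeff [:x * cnj x, - (x + cnj x), 1:] = 1" by simp
    show "\<forall>i. coeff [:x * cnj x, - (x + cnj x), 1:] i \<in> \<int>"
      using N Ints_minus[OF T] by (auto simp: coeff_pCons split: nat.split)
    show "poly [:x * cnj x, - (x + cnj x), 1:] x = 0" by (simp add: algebra_simps)
  qed
  then show "x \<in> Oi" unfolding ring_of_ints_def using x by auto
qed

lemma Oi_F: "x \<in> Oi \<Longrightarrow> x \<in> F" by (simp add: Oi_iff)

lemma Oi_add: "x \<in> Oi \<Longrightarrow> y \<in> Oi \<Longrightarrow> x + y \<in> Oi"
  by (simp add: Oi_iff F_add bounded_powers_add)

lemma Oi_mult: "x \<in> Oi \<Longrightarrow> y \<in> Oi \<Longrightarrow> x * y \<in> Oi"
  by (simp add: Oi_iff F_mult bounded_powers_mult)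

lemma Oi_int: "of_int a \<in> Oi"
  using Rats_F[of "of_int a"] by (simp add: Oi_iff bounded_powers_int)

lemma Oi_0: "0 \<in> Oi" and Oi_1: "1 \<in> Oi" using Oi_int[of 0] Oi_int[of 1] by auto

lemma Oi_minus: "x \<in> Oi \<Longrightarrow> - x \<in> Oi" using Oi_mult[OF Oi_int[of "-1"]] by simp

lemma Oi_diff: "x \<in> Oi \<Longrightarrow> y \<in> Oi \<Longrightarrow> x - y \<in> Oi" using Oi_add[OF _ Oi_minus] by simp

lemma Oi_sum: "(\<And>i. i \<in> A \<Longrightarrow> f i \<in> Oi) \<Longrightarrow> sum f A \<in> Oi"
  using Oi_0 by (induction A rule: infinite_finite_induct) (auto intro: Oi_add)

lemma Oi_w: "w \<in> Oi"
proof -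
  have "algebraic_int w"
  proof (rule algebraic_int.intros)
    show "lead_coeff [:of_nat d, 0, 1:] = (1::complex)" by simp
    show "\<forall>i. coeff [:of_nat d, 0, 1:] i \<in> (\<int>::complex set)"
      by (auto simp: coeff_pCons split: nat.split)
    show "poly [:of_nat d, 0, 1:] w = 0" by (simp add: w_sq)
  qed
  then show ?thesis unfolding ring_of_ints_def using w_F by auto
qed

lemma Oi_Zw: "of_int a + of_int b * w \<in> Oi"
  using Oi_add Oi_mult Oi_int Oi_w by blast

text \<open>
  The square of the absolute value is the norm, a positive integer.
\<close>

lemma Oi_norm_ge_1: "x \<in> Oi \<Longrightarrow> x \<noteq> 0 \<Longrightarrow> 1 \<le> cmod x"
proof -
  assume x: "x \<in> Oi" "x \<noteq> 0"
  then have "x * cnj x \<in> \<int>" using bounded_powers_norm by (simp add: Oi_iff)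
  then obtain z where "x * cnj x = of_int z" by (auto elim: Ints_cases)
  then have z: "(cmod x)\<^sup>2 = of_int z"
    by (metis complex_norm_square of_real_eq_iff of_real_of_int_eq)
  then have "z > 0" using x(2) by (metis of_int_0_less_iff zero_less_norm_iff zero_less_power2 norm_eq_zero)
  then have "1 \<le> (cmod x)\<^sup>2" using z by simp
  then show ?thesis by (simp add: abs_le_square_iff[of 1 "cmod x", simplified])
qed

text \<open>
  Distinct integers of \<open>F\<close> have distance at least \<open>1\<close>, while an infinite bounded set of
  complex numbers contains distinct points that are arbitrarily close.
\<close>

lemma finite_Oi_ball: "finite {x \<in> Oi. cmod x \<le> c}" (is "finite ?T")
proof (rule ccontr)
  assume "infinite ?T"
  moreover have "?T \<subseteq> cball 0 c" by auto
  ultimately obtain l where l: "l islimpt ?T"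
    using compact_cball[THEN compact_eq_Bolzano_Weierstrass[THEN iffD1]] by blast
  have near: "\<exists>x\<in>?T. x \<noteq> l \<and> dist x l < e" if "e > 0" for e
    using l that unfolding islimpt_approachable by blast
  obtain a where a: "a \<in> ?T" "a \<noteq> l" "dist a l < 1/2" using near[of "1/2"] by auto
  then have "0 < min (1/2) (dist a l)" by simp
  then obtain b where b: "b \<in> ?T" "b \<noteq> l" "dist b l < min (1/2) (dist a l)"
    using near by blast
  then have "a \<noteq> b" by auto
  moreover have "a - b \<in> Oi" using a b Oi_diff by auto
  ultimately have "1 \<le> cmod (a - b)" using Oi_norm_ge_1 by simp
  moreover have "dist a b < 1" using a(3) b(3) dist_triangle2[of a b l] by linarith
  ultimately show False by (simp add: dist_norm)
qed

lemma F_eq_Rats_iff: "F = \<rat> \<longleftrightarrow> d = 0"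
proof
  assume "F = \<rat>"
  then have "w \<in> \<real>" using w_F Rats_subset_Reals by blast
  then have "Im w = 0" by (simp add: complex_is_Real_iff)
  then show "d = 0" by (simp add: w_def)
next
  assume "d = 0"
  then have w0: "w = 0" unfolding w_def by simp
  show "F = \<rat>"
    unfolding set_eq_iff mem_F_iff Rats_def image_iff by (simp add: w0)
qed

lemma K_decomp: "z \<in> K \<Longrightarrow> \<exists>a b::real. z = of_real a + of_real b * w"
proof (cases "d = 0")
  case True
  assume "z \<in> K"
  then have "z = of_real (Re z) + of_real 0 * w"
    using True F_eq_Rats_iff by (simp add: local_field_def complex_is_Real_iff complex_eq_iff)
  then show ?thesis by blast
next
  case False
  have "z = of_real (Re z) + of_real (Im z / sqrt (real d)) * w"
    using False by (simp add: w_def complex_eq_iff)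
  then show ?thesis by blast
qed

lemma K_cases: "K = \<real> \<or> K = UNIV" by (simp add: local_field_def)

lemma K_add: "x \<in> K \<Longrightarrow> y \<in> K \<Longrightarrow> x + y \<in> K"
  and K_mult: "x \<in> K \<Longrightarrow> y \<in> K \<Longrightarrow> x * y \<in> K"
  and K_minus: "x \<in> K \<Longrightarrow> - x \<in> K"
  and K_diff: "x \<in> K \<Longrightarrow> y \<in> K \<Longrightarrow> x - y \<in> K"
  and K_cnj: "x \<in> K \<Longrightarrow> cnj x \<in> K"
  and K_divide: "x \<in> K \<Longrightarrow> y \<in> K \<Longrightarrow> x / y \<in> K"
  and K_real: "of_real r \<in> K"
  and K_nat: "of_nat m \<in> K"
proof -
  have "cnj z \<in> \<real>" if "z \<in> \<real>" for z using that Reals_cnj_iff[of z] by simp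
  then show "x \<in> K \<Longrightarrow> y \<in> K \<Longrightarrow> x + y \<in> K" "x \<in> K \<Longrightarrow> y \<in> K \<Longrightarrow> x * y \<in> K"
    "x \<in> K \<Longrightarrow> - x \<in> K" "x \<in> K \<Longrightarrow> y \<in> K \<Longrightarrow> x - y \<in> K" "x \<in> K \<Longrightarrow> cnj x \<in> K"
    "x \<in> K \<Longrightarrow> y \<in> K \<Longrightarrow> x / y \<in> K" "of_real r \<in> K" "of_nat m \<in> K"
    using K_cases by (elim disjE; simp)+
qed

lemma K_0: "0 \<in> K" and K_1: "1 \<in> K" using K_real[of 0] K_real[of 1] by auto

lemma K_scaleR: "x \<in> K \<Longrightarrow> r *\<^sub>R x \<in> K" by (simp add: scaleR_conv_of_real K_mult K_real)

lemma K_sum: "(\<And>i. i \<in> A \<Longrightarrow> f i \<in> K) \<Longrightarrow> sum f A \<in> K"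
  using K_0 by (induction A rule: infinite_finite_induct) (auto intro: K_add)

lemma F_K: "x \<in> F \<Longrightarrow> x \<in> K"
  using Rats_subset_Reals by (auto simp: local_field_def)

lemma Oi_K: "x \<in> Oi \<Longrightarrow> x \<in> K" using F_K Oi_F by blast

text \<open>
  Dirichlet's theorem, with a bound \<open>B\<close> that depends on \<open>e\<close> only. The multiples of \<open>y\<close> modulo
  the lattice spanned by \<open>1\<close> and \<open>w\<close> are sorted into boxes of side \<open>1 / Q\<close>; two of the first
  \<open>card S + 1\<close> multiples share a box, and their difference is close to a lattice vector.
\<close>

lemma simultaneous_approximation:
  fixes e :: real
  assumes "e > 0"
  shows "\<exists>B::nat. \<forall>y::complex ^ 'n::finite \<in> vecs K. \<exists>k\<in>{1..B}. \<exists>p\<in>vecs Oi.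
           \<forall>i. cmod (of_nat k * y $ i - p $ i) < e"
proof -
  \<comment> \<open>A box of side \<open>1 / Q\<close> in the coordinates has diameter at most \<open>c / Q\<close> in \<open>\<complex>\<close>.\<close>
  define c where "c = 1 + cmod w"
  have c: "c > 0" unfolding c_def by (rule add_pos_nonneg) auto
  obtain Q :: nat where Q': "c / e < real Q" using reals_Archimedean2 by blast
  moreover have "0 < c / e" using c assms by (rule divide_pos_pos)
  ultimately have Q0: "0 < real Q" by linarith
  have Q: "Q > 0" "c / real Q < e"
  proof -
    show "Q > 0" using Q0 by simp
    have "c < real Q * e" using Q' assms by (simp only: pos_divide_less_eq)
    then show "c / real Q < e" using Q0 by (simp add: pos_divide_less_eq mult.commute)
  qed
  define S where "S = PiE (UNIV :: 'n set) (\<lambda>_. {0..<int Q} \<times> {0..<int Q})"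
  have "finite S" unfolding S_def by (intro finite_PiE) auto
  show ?thesis
  proof (intro exI[of _ "card S"] ballI)
    fix y :: "complex ^ 'n" assume "y \<in> vecs K"
    then have "y $ i \<in> K" for i by (simp add: vecs_def)
    then have "\<forall>i. \<exists>z::real \<times> real. y $ i = of_real (fst z) + of_real (snd z) * w"
      using K_decomp by (metis fst_conv snd_conv)
    then obtain g :: "'n \<Rightarrow> real \<times> real" where
      g: "\<forall>i. y $ i = of_real (fst (g i)) + of_real (snd (g i)) * w"
      by (rule choice[THEN exE])
    define a b where "a i = fst (g i)" and "b i = snd (g i)" for i
    have ab: "y $ i = of_real (a i) + of_real (b i) * w" for i using g by (simp add: a_def b_def)
    define f where "f k = (\<lambda>i. (\<lfloor>real Q * frac (real k * a i)\<rfloor>, \<lfloor>real Q * frac (real k * b i)\<rfloor>))" for k :: nat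
    have box: "\<lfloor>real Q * frac r\<rfloor> \<in> {0..<int Q}" for r
      using frac_ge_0[of r] frac_lt_1[of r] Q(1) by (auto simp: floor_less_iff)
    have "f k \<in> S" for k unfolding S_def f_def
      by (rule PiE_I) (blast intro: SigmaI box, simp)
    then have "f ` {0..card S} \<subseteq> S" by blast
    then have "card (f ` {0..card S}) \<le> card S" using card_mono[OF \<open>finite S\<close>] by blast
    then have "\<not> inj_on f {0..card S}" by (auto dest: card_image)
    then obtain k' l' where kl': "k' \<in> {0..card S}" "l' \<in> {0..card S}" "k' \<noteq> l'" "f k' = f l'"
      unfolding inj_on_def by blast
    define k l where "k = min k' l'" and "l = max k' l'"
    have kl: "k \<in> {0..card S}" "l \<in> {0..card S}" "k < l" "f k = f l"
      using kl' unfolding k_def l_def min_def max_def by auto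
    define p :: "complex ^ 'n" where
      "p = (\<chi> i. of_int (\<lfloor>real l * a i\<rfloor> - \<lfloor>real k * a i\<rfloor>) + of_int (\<lfloor>real l * b i\<rfloor> - \<lfloor>real k * b i\<rfloor>) * w)"
    have p: "p \<in> vecs Oi" unfolding p_def vecs_def by (simp add: Oi_Zw del: of_int_diff)
    have floor_close: "\<bar>x - y\<bar> < 1" if "\<lfloor>x\<rfloor> = \<lfloor>y\<rfloor>" for x y :: real
      using floor_correct[of x] floor_correct[of y] that by linarith
    have close: "\<bar>frac r - frac s\<bar> < 1 / real Q" if "\<lfloor>real Q * frac r\<rfloor> = \<lfloor>real Q * frac s\<rfloor>" for r s
    proof -
      have "\<bar>real Q * (frac r - frac s)\<bar> < 1"
        using floor_close[OF that] by (simp only: right_diff_distrib)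
      then have "real Q * \<bar>frac r - frac s\<bar> < 1" by (simp only: abs_mult abs_of_nat)
      then show ?thesis using Q0 by (simp only: pos_less_divide_eq mult.commute)
    qed
    have "cmod (of_nat (l - k) * y $ i - p $ i) < e" for i
    proof -
      have fe: "\<lfloor>real Q * frac (real l * a i)\<rfloor> = \<lfloor>real Q * frac (real k * a i)\<rfloor>"
        "\<lfloor>real Q * frac (real l * b i)\<rfloor> = \<lfloor>real Q * frac (real k * b i)\<rfloor>"
        using fun_cong[OF kl(4), of i] by (simp_all add: f_def)
      have "of_nat (l - k) * y $ i - p $ i =
          of_real (frac (real l * a i) - frac (real k * a i)) + of_real (frac (real l * b i) - frac (real k * b i)) * w"
        using kl(3) by (simp add: ab p_def frac_def of_nat_diff algebra_simps)
      also have "cmod \<dots> \<le> \<bar>frac (real l * a i) - frac (real k * a i)\<bar> + \<bar>frac (real l * b i) - frac (real k * b i)\<bar> * cmod w"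
        by (rule order_trans[OF norm_triangle_ineq]) (simp only: norm_mult norm_of_real order_refl)
      also have "\<dots> \<le> 1 / real Q + 1 / real Q * cmod w"
        using close[OF fe(1)] close[OF fe(2)] by (intro add_mono mult_right_mono) auto
      also have "\<dots> = c / real Q" by (simp add: c_def add_divide_distrib)
      finally show ?thesis using Q(2) by simp
    qed
    moreover have "l - k \<in> {1..card S}" using kl by auto
    ultimately show "\<exists>k\<in>{1..card S}. \<exists>p\<in>vecs Oi. \<forall>i. cmod (of_nat k * y $ i - p $ i) < e"
      using p by blast
  qed
qed

end

text \<open>
  An imaginary quadratic field contains a number that is not real.
\<close>

lemma imaginary_quadratic_not_Rats:
  assumes "imaginary_quadratic F"
  shows "F \<noteq> \<rat>"
proof
  assume F: "F = \<rat>"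
  obtain e :: nat where e: "e > 0" "F = {of_rat a + of_rat b * (\<i> * of_real (sqrt (real e))) | a b. True}"
    using assms unfolding imaginary_quadratic_def by blast
  have "of_rat 0 + of_rat 1 * (\<i> * of_real (sqrt (real e))) \<in> F" unfolding e(2) by blast
  then have "\<i> * of_real (sqrt (real e)) \<in> (\<real> :: complex set)" using F Rats_subset_Reals by auto
  then show False using e(1) by (simp add: complex_is_Real_iff)
qed

lemma ground_cases:
  assumes "F = \<rat> \<or> imaginary_quadratic F"
  shows "\<exists>d. ground F d"
  using assms
proof
  assume F: "F = \<rat>"
  have "\<rat> = {of_rat a + of_rat b * (\<i> * of_real (sqrt (real 0))) | a b. True}"
    unfolding Rats_def image_def by simp
  then show ?thesis unfolding F ground_def by blast
next
  assume "imaginary_quadratic F"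
  then obtain d where "F = {of_rat a + of_rat b * (\<i> * of_real (sqrt (real d))) | a b. True}"
    unfolding imaginary_quadratic_def by blast
  then show ?thesis by (intro exI ground.intro)
qed

section \<open>Hermitian forms\<close>

lemma inner_mat: "(X :: complex ^ 'n ^ 'm) \<bullet> Y = Re (\<Sum>i\<in>UNIV. \<Sum>j\<in>UNIV. X $ i $ j * cnj (Y $ i $ j))"
  by (simp add: inner_vec_def Re_sum inner_complex_def)

text \<open>
  Evaluation of forms is the inner product of the Euclidean space of matrices. This makes
  Hermitian forms and linear functionals on Hermitian matrices the same thing, and it lets
  convex geometry speak about minimal vectors.
\<close>

lemma form_at_inner: "form_at h x = h \<bullet> rank_one x"
  by (simp add: form_at_def inner_mat rank_one_def mult.assoc mult.commute mult.left_commute)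

lemma form_at_add_left: "form_at (h + g) x = form_at h x + form_at g x"
  and form_at_scaleR_left: "form_at (r *\<^sub>R h) x = r * form_at h x"
  and form_at_diff_left: "form_at (h - g) x = form_at h x - form_at g x"
  and form_at_minus_left: "form_at (- h) x = - form_at h x"
  and form_at_zero_left: "form_at 0 x = 0"
  by (simp_all add: form_at_inner inner_add_left inner_diff_left)

definition cdot :: "complex ^ 'n \<Rightarrow> complex ^ 'n \<Rightarrow> complex" where
  "cdot x y = (\<Sum>i\<in>UNIV. cnj (x $ i) * y $ i)"

lemma cdot_self: "cdot x x = of_real ((norm x)\<^sup>2)"
proof -
  have "cdot x x = of_real (\<Sum>i\<in>UNIV. (cmod (x $ i))\<^sup>2)"
    unfolding cdot_def by (simp add: complex_norm_square mult.commute flip: of_real_power)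
  also have "(\<Sum>i\<in>UNIV. (cmod (x $ i))\<^sup>2) = (norm x)\<^sup>2"
    by (simp add: norm_vec_def L2_set_def sum_nonneg)
  finally show ?thesis .
qed

lemma Re_cdot_self: "Re (cdot x x) = (norm x)\<^sup>2"
  by (simp add: cdot_self)

lemma cdot_add_right: "cdot x (y + z) = cdot x y + cdot x z"
  and cdot_add_left: "cdot (x + y) z = cdot x z + cdot y z"
  and cdot_diff_right: "cdot x (y - z) = cdot x y - cdot x z"
  and cdot_smult_right: "cdot x (c *s y) = c * cdot x y"
  and cdot_cnj: "cnj (cdot x y) = cdot y x"
  and cdot_zero_right: "cdot x 0 = 0"
  and cdot_zero_left: "cdot 0 x = 0"
  by (simp_all add: cdot_def sum.distrib sum_subtractf sum_distrib_left algebra_simps)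

lemma scaleR_conv_smult: "r *\<^sub>R x = of_real r *s (x :: complex ^ 'n)"
  by (simp add: Finite_Cartesian_Product.vec_eq_iff scaleR_conv_of_real[where 'a = complex])

lemma rank_one_mult_vec: "rank_one y *v x = cdot y x *s y"
  by (simp add: Finite_Cartesian_Product.vec_eq_iff matrix_vector_mult_def rank_one_def cdot_def sum_distrib_left sum_distrib_right
      mult.assoc mult.commute mult.left_commute)

lemma form_at_cdot: "form_at h x = Re (cdot x (h *v x))"
  by (simp add: form_at_def cdot_def matrix_vector_mult_def sum_distrib_left mult.assoc)

lemma form_at_rank_one: "form_at (rank_one y) x = (cmod (cdot y x))\<^sup>2"
proof -
  have "form_at (rank_one y) x = Re (cdot y x * cnj (cdot y x))"
    by (simp add: form_at_cdot rank_one_mult_vec cdot_smult_right cdot_cnj)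
  then show ?thesis by (simp add: complex_norm_square[symmetric])
qed

lemma norm_rank_one: "norm (rank_one x) = (norm x)\<^sup>2"
proof -
  have "(norm (rank_one x))\<^sup>2 = form_at (rank_one x) x"
    by (simp add: form_at_inner power2_norm_eq_inner)
  also have "\<dots> = ((norm x)\<^sup>2)\<^sup>2" by (simp add: form_at_rank_one cdot_self norm_of_real norm_power)
  finally have "(norm (rank_one x))\<^sup>2 = ((norm x)\<^sup>2)\<^sup>2" .
  then show ?thesis by (simp only: power2_eq_iff_nonneg norm_ge_zero zero_le_power2)
qed

lemma rank_one_eq_0_iff: "rank_one x = 0 \<longleftrightarrow> x = 0"
  using norm_rank_one[of x] by (metis norm_eq_zero power_eq_0_iff zero_power2)

lemma rank_one_smult: "rank_one (c *s x) = (cmod c)\<^sup>2 *\<^sub>R rank_one x"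
proof -
  have "c * x $ i * (cnj c * cnj (x $ j)) = of_real ((cmod c)\<^sup>2) * (x $ i * cnj (x $ j))" for i j
    by (simp only: complex_norm_square mult_ac)
  then show ?thesis
    by (simp add: Finite_Cartesian_Product.vec_eq_iff rank_one_def scaleR_conv_of_real[where 'a = complex])
qed

lemma form_at_smult: "form_at h (c *s x) = (cmod c)\<^sup>2 * form_at h x"
  by (simp add: form_at_inner rank_one_smult)

lemma form_at_zero: "form_at h 0 = 0"
  by (simp add: form_at_cdot cdot_zero_left)

lemma conj_transpose_conj_transpose: "conj_transpose (conj_transpose A) = A"
  by (simp add: conj_transpose_def Finite_Cartesian_Product.vec_eq_iff)

lemma conj_transpose_mult: "conj_transpose (A ** B) = conj_transpose B ** conj_transpose A"
  by (simp add: conj_transpose_def matrix_matrix_mult_def Finite_Cartesian_Product.vec_eq_iff mult.commute)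

lemma conj_transpose_mat: "conj_transpose (mat 1) = mat 1"
  by (auto simp: conj_transpose_def Finite_Cartesian_Product.mat_def Finite_Cartesian_Product.vec_eq_iff)

lemma conj_transpose_add: "conj_transpose (A + B) = conj_transpose A + conj_transpose B"
  and conj_transpose_scaleR: "conj_transpose (r *\<^sub>R A) = r *\<^sub>R conj_transpose A"
  and conj_transpose_zero: "conj_transpose 0 = 0"
  by (simp_all add: conj_transpose_def Finite_Cartesian_Product.vec_eq_iff)

lemma conj_transpose_rank_one: "conj_transpose (rank_one x) = rank_one x"
  by (simp add: conj_transpose_def rank_one_def Finite_Cartesian_Product.vec_eq_iff mult.commute)

lemma cdot_conj_transpose: "cdot x (A *v y) = cdot (conj_transpose A *v x) y"
proof -
  have "cdot x (A *v y) = (\<Sum>i\<in>UNIV. \<Sum>j\<in>UNIV. cnj (x $ i) * (A $ i $ j * y $ j))"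
    by (simp add: cdot_def matrix_vector_mult_def sum_distrib_left)
  also have "\<dots> = (\<Sum>j\<in>UNIV. \<Sum>i\<in>UNIV. cnj (x $ i) * (A $ i $ j * y $ j))" by (rule sum.swap)
  also have "\<dots> = cdot (conj_transpose A *v x) y"
    by (simp add: cdot_def matrix_vector_mult_def sum_distrib_left sum_distrib_right conj_transpose_def mult_ac)
  finally show ?thesis .
qed

lemma form_at_add:
  assumes "conj_transpose h = h"
  shows "form_at h (x + y) = form_at h x + form_at h y + 2 * Re (cdot x (h *v y))"
proof -
  have "Re (cdot y (h *v x)) = Re (cdot x (h *v y))"
    using cdot_conj_transpose[of y h x] assms cdot_cnj[of x "h *v y"] by (metis cdot_cnj cnj.simps(1))
  then show ?thesis
    by (simp add: form_at_cdot matrix_vector_right_distrib cdot_add_left cdot_add_right)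
qed

lemma inner_mult_left:
  fixes A X Y :: "complex ^ 'n ^ 'n"
  shows "(A ** X) \<bullet> Y = X \<bullet> (conj_transpose A ** Y)"
proof -
  have "(\<Sum>i\<in>UNIV. \<Sum>j\<in>UNIV. (A ** X) $ i $ j * cnj (Y $ i $ j))
      = (\<Sum>i\<in>UNIV. \<Sum>j\<in>UNIV. \<Sum>k\<in>UNIV. A $ i $ k * X $ k $ j * cnj (Y $ i $ j))"
    by (simp add: matrix_matrix_mult_def sum_distrib_right)
  also have "\<dots> = (\<Sum>i\<in>UNIV. \<Sum>k\<in>UNIV. \<Sum>j\<in>UNIV. A $ i $ k * X $ k $ j * cnj (Y $ i $ j))"
    by (rule sum.cong[OF refl], rule sum.swap)
  also have "\<dots> = (\<Sum>k\<in>UNIV. \<Sum>i\<in>UNIV. \<Sum>j\<in>UNIV. A $ i $ k * X $ k $ j * cnj (Y $ i $ j))"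
    by (rule sum.swap)
  also have "\<dots> = (\<Sum>k\<in>UNIV. \<Sum>j\<in>UNIV. \<Sum>i\<in>UNIV. A $ i $ k * X $ k $ j * cnj (Y $ i $ j))"
    by (rule sum.cong[OF refl], rule sum.swap)
  also have "\<dots> = (\<Sum>k\<in>UNIV. \<Sum>j\<in>UNIV. X $ k $ j * cnj ((conj_transpose A ** Y) $ k $ j))"
    by (simp add: matrix_matrix_mult_def conj_transpose_def sum_distrib_left mult_ac)
  finally show ?thesis by (simp only: inner_mat)
qed

lemma inner_conj_transpose: "conj_transpose X \<bullet> conj_transpose Y = X \<bullet> Y"
proof -
  have "conj_transpose X \<bullet> conj_transpose Y = (\<Sum>i\<in>UNIV. \<Sum>j\<in>UNIV. X $ j $ i \<bullet> Y $ j $ i)"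
    by (simp add: inner_vec_def conj_transpose_def inner_complex_def)
  also have "\<dots> = (\<Sum>j\<in>UNIV. \<Sum>i\<in>UNIV. X $ j $ i \<bullet> Y $ j $ i)" by (rule sum.swap)
  finally show ?thesis by (simp add: inner_vec_def)
qed

lemma inner_mult_right:
  fixes A X Y :: "complex ^ 'n ^ 'n"
  shows "(X ** A) \<bullet> Y = X \<bullet> (Y ** conj_transpose A)"
  using inner_mult_left[of "conj_transpose A" "conj_transpose X" "conj_transpose Y"]
  by (metis conj_transpose_mult inner_conj_transpose conj_transpose_conj_transpose)

lemma act_adjoint: "act A X \<bullet> Y = X \<bullet> act (conj_transpose A) Y"
proof -
  have "act A X \<bullet> Y = X \<bullet> (conj_transpose A ** (Y ** conj_transpose (conj_transpose A)))"
    unfolding act_def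
    using inner_mult_right[where X = "A ** X" and A = "conj_transpose A" and Y = Y]
      inner_mult_left[of A X] by metis
  then show ?thesis by (simp only: act_def matrix_mul_assoc)
qed

lemma act_mult: "act (A ** B) X = act A (act B X)"
  by (simp add: act_def conj_transpose_mult matrix_mul_assoc)

lemma act_one: "act (mat 1) X = X"
  by (simp add: act_def conj_transpose_mat)

lemma matrix_mult_add_right: "A ** (B + C) = A ** B + A ** (C :: complex ^ 'n ^ 'n)"
  and matrix_mult_add_left: "(B + C) ** A = B ** A + C ** (A :: complex ^ 'n ^ 'n)"
  by (simp_all add: Finite_Cartesian_Product.vec_eq_iff matrix_matrix_mult_def sum.distrib algebra_simps)

lemma linear_act: "linear (act A)"
proof (rule linearI)
  show "act A (X + Y) = act A X + act A Y" for X Y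
    by (simp add: act_def matrix_mult_add_right matrix_mult_add_left)
  show "act A (r *\<^sub>R X) = r *\<^sub>R act A X" for r X
    by (simp add: act_def matrix_matrix_mult_def Finite_Cartesian_Product.vec_eq_iff scaleR_sum_right sum_distrib_right)
qed

lemma inj_act: "B ** A = mat 1 \<Longrightarrow> inj (act A)"
  by (metis act_mult act_one injI)

lemma act_image_mult: "act (A ** B) ` S = act A ` act B ` S"
  by (simp add: act_mult image_image)

lemma act_image_one: "act (mat 1) ` S = S"
  by (simp add: act_one)

lemma act_rank_one: "act A (rank_one x) = rank_one (A *v x)"
proof -
  have "(A ** rank_one x) $ i $ j = (A *v x) $ i * cnj (x $ j)" for i j
    by (simp add: matrix_matrix_mult_def matrix_vector_mult_def rank_one_def sum_distrib_right mult.assoc)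
  then have "act A (rank_one x) $ i $ j = (\<Sum>k\<in>UNIV. (A *v x) $ i * cnj (x $ k) * cnj (A $ j $ k))" for i j
    unfolding act_def by (simp add: matrix_matrix_mult_def[of "A ** rank_one x"] conj_transpose_def)
  then show ?thesis
    by (simp add: Finite_Cartesian_Product.vec_eq_iff rank_one_def matrix_vector_mult_def[of A x] sum_distrib_left mult_ac)
qed

lemma form_at_act: "form_at (act (conj_transpose A) h) x = form_at h (A *v x)"
  using act_adjoint[of "conj_transpose A" h "rank_one x"]
  by (simp add: form_at_inner act_rank_one conj_transpose_conj_transpose)

context ground
begin

lemma vecs_D: "x \<in> vecs S \<Longrightarrow> x $ i \<in> S"
  by (simp add: vecs_def)

lemma vecs_Oi_K: "x \<in> vecs Oi \<Longrightarrow> x \<in> vecs K"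
  by (simp add: vecs_def Oi_K)

lemma vecs_Oi_F: "x \<in> vecs Oi \<Longrightarrow> x \<in> vecs F"
  by (simp add: vecs_def Oi_F)

lemma vecs_Oi_diff: "x \<in> vecs Oi \<Longrightarrow> y \<in> vecs Oi \<Longrightarrow> x - y \<in> vecs Oi"
  by (simp add: vecs_def Oi_diff)

lemma vecs_K_add: "x \<in> vecs K \<Longrightarrow> y \<in> vecs K \<Longrightarrow> x + y \<in> vecs K"
  and vecs_K_diff: "x \<in> vecs K \<Longrightarrow> y \<in> vecs K \<Longrightarrow> x - y \<in> vecs K"
  and vecs_K_smult: "c \<in> K \<Longrightarrow> x \<in> vecs K \<Longrightarrow> c *s x \<in> vecs K"
  and vecs_K_scaleR: "x \<in> vecs K \<Longrightarrow> r *\<^sub>R x \<in> vecs K"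
  by (simp_all add: vecs_def K_add K_diff K_mult K_scaleR)

lemma mats_Oi_K: "A \<in> mats Oi \<Longrightarrow> A \<in> mats K"
  by (simp add: mats_def Oi_K)

lemma mats_Oi_mult: "A \<in> mats Oi \<Longrightarrow> B \<in> mats Oi \<Longrightarrow> A ** B \<in> mats Oi"
  by (simp add: mats_def matrix_matrix_mult_def Oi_mult Oi_sum)

lemma mats_Oi_one: "mat 1 \<in> mats Oi"
  by (auto simp: mats_def Finite_Cartesian_Product.mat_def Oi_0 Oi_1)

lemma mats_K_mult: "A \<in> mats K \<Longrightarrow> B \<in> mats K \<Longrightarrow> A ** B \<in> mats K"
  by (simp add: mats_def matrix_matrix_mult_def K_mult K_sum)

lemma mats_K_conj_transpose: "A \<in> mats K \<Longrightarrow> conj_transpose A \<in> mats K"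
  by (simp add: mats_def conj_transpose_def K_cnj)

lemma mats_Oi_vecs: "A \<in> mats Oi \<Longrightarrow> x \<in> vecs Oi \<Longrightarrow> A *v x \<in> vecs Oi"
  by (simp add: mats_def vecs_def matrix_vector_mult_def Oi_mult Oi_sum)

lemma mats_K_vecs: "A \<in> mats K \<Longrightarrow> x \<in> vecs K \<Longrightarrow> A *v x \<in> vecs K"
  by (simp add: mats_def vecs_def matrix_vector_mult_def K_mult K_sum)

lemma subspace_herm: "subspace (herm F)"
  by (rule subspaceI)
    (auto simp: herm_def mats_def K_0 K_add K_scaleR conj_transpose_add conj_transpose_scaleR conj_transpose_zero)

lemma herm_sym: "h \<in> herm F \<Longrightarrow> conj_transpose h = h" and herm_K: "h \<in> herm F \<Longrightarrow> h \<in> mats K"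
  by (simp_all add: herm_def)

lemma rank_one_herm: "x \<in> vecs K \<Longrightarrow> rank_one x \<in> herm F"
  by (simp add: herm_def conj_transpose_rank_one) (simp add: mats_def vecs_def rank_one_def K_mult K_cnj)

lemma act_herm: "A \<in> mats K \<Longrightarrow> X \<in> herm F \<Longrightarrow> act A X \<in> herm F"
  by (simp add: herm_def act_def mats_K_mult mats_K_conj_transpose conj_transpose_mult
      conj_transpose_conj_transpose matrix_mul_assoc)

lemma span_herm: "S \<subseteq> herm F \<Longrightarrow> span S \<subseteq> herm F"
  using subspace_herm span_minimal by blast

definition psd :: "complex ^ 'n ^ 'n \<Rightarrow> bool" where
  "psd h \<longleftrightarrow> (\<forall>x\<in>vecs K. 0 \<le> form_at h x)"

text \<open>
  With \<open>x = h v\<close>, the value \<open>h(x + t v) = h(x) + 2 t |x|\<^sup>2\<close> would become negative for some \<open>t\<close>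
  if \<open>x\<close> were nonzero.
\<close>

lemma psd_null_vector:
  assumes h: "h \<in> herm F" "psd h" and v: "v \<in> vecs K" "form_at h v = 0"
  shows "h *v v = 0"
proof -
  define x where "x = h *v v"
  have x: "x \<in> vecs K" unfolding x_def using h v mats_K_vecs herm_K by blast
  have lin: "0 \<le> form_at h x + t * (2 * (norm x)\<^sup>2)" for t :: real
  proof -
    have "x + t *\<^sub>R v \<in> vecs K" using x v by (simp add: vecs_K_add vecs_K_scaleR)
    then have "0 \<le> form_at h (x + t *\<^sub>R v)" using h by (simp add: psd_def)
    also have "\<dots> = form_at h x + 2 * Re (cdot x (h *v (t *\<^sub>R v)))"
      using v(2) by (simp add: form_at_add[OF herm_sym[OF h(1)]] scaleR_conv_smult form_at_smult)
    also have "h *v (t *\<^sub>R v) = of_real t *s x"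
      by (simp add: x_def scaleR_conv_smult vector_scalar_commute)
    finally show ?thesis by (simp add: cdot_smult_right cdot_self)
  qed
  have "norm x = 0"
  proof (rule ccontr)
    assume "norm x \<noteq> 0"
    then have p: "(norm x)\<^sup>2 > 0" by simp
    have "- ((form_at h x + 1) / (2 * (norm x)\<^sup>2)) * (2 * (norm x)\<^sup>2) = - (form_at h x + 1)"
      using p by simp
    then show False using lin[of "- ((form_at h x + 1) / (2 * (norm x)\<^sup>2))"] by linarith
  qed
  then show ?thesis by (simp add: x_def)
qed

lemma psd_antisym:
  assumes h: "h \<in> herm F" "psd h" "psd (- h)"
  shows "h = 0"
proof -
  have "form_at h x = 0" if "x \<in> vecs K" for x
    using h(2,3) that unfolding psd_def form_at_minus_left by force
  then have *: "h *v x = 0" if "x \<in> vecs K" for x using psd_null_vector h that by blast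
  have "h $ i $ j = 0" for i j
  proof -
    have "axis j 1 \<in> vecs K" by (auto simp: vecs_def axis_def K_0 K_1)
    then have "(h *v axis j 1) $ i = 0" using * by simp
    moreover have "(h *v axis j 1) $ i = h $ i $ j"
      by (simp add: matrix_vector_mult_def axis_def if_distrib cong: if_cong)
    ultimately show ?thesis by simp
  qed
  then show ?thesis by (simp add: Finite_Cartesian_Product.vec_eq_iff)
qed

lemma herm_eq_0:
  assumes "h \<in> herm F" "\<And>x. x \<in> vecs K \<Longrightarrow> form_at h x = 0"
  shows "h = 0"
  using assms by (intro psd_antisym) (auto simp: psd_def form_at_minus_left)

lemma closed_vecs_K: "closed (vecs K :: (complex ^ 'n) set)"
proof -
  have "closed K" using K_cases closed_complex_Reals by auto
  then have "closed {x :: complex ^ 'n. x $ i \<in> K}" for i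
    using continuous_closed_vimage[of K "\<lambda>x :: complex ^ 'n. x $ i"] by (simp add: vimage_def)
  moreover have "vecs K = (\<Inter>i. {x :: complex ^ 'n. x $ i \<in> K})" by (auto simp: vecs_def)
  ultimately show ?thesis by (simp add: closed_INT)
qed

lemma continuous_form_at: "continuous_on S (\<lambda>x. form_at h x)"
  unfolding form_at_def by (intro continuous_intros)

text \<open>
  The values at unit vectors form a continuous function on a compact set, so they have a
  positive minimum.
\<close>

lemma uniformly_positive:
  fixes A :: "(complex ^ 'n ^ 'n) set"
  assumes A: "compact A" and pos: "\<And>h x. h \<in> A \<Longrightarrow> x \<in> vecs K \<Longrightarrow> x \<noteq> 0 \<Longrightarrow> 0 < form_at h x"
  shows "\<exists>c>0. \<forall>h\<in>A. \<forall>x\<in>vecs K. c * (norm x)\<^sup>2 \<le> form_at h x"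
proof (cases "A = {}")
  case False
  define S where "S = (vecs K \<inter> sphere 0 1 :: (complex ^ 'n) set)"
  have "compact S" unfolding S_def by (intro closed_Int_compact closed_vecs_K compact_sphere)
  then have AS: "compact (A \<times> S)" using A by (rule compact_Times[rotated])
  have S1: "axis undefined 1 \<in> S" by (simp add: S_def) (auto simp: vecs_def axis_def K_0 K_1)
  have cont: "continuous_on (A \<times> S) (\<lambda>p. form_at (fst p) (snd p))"
    unfolding form_at_def by (intro continuous_intros)
  obtain h0 x0 where m: "h0 \<in> A" "x0 \<in> S" "\<And>h x. h \<in> A \<Longrightarrow> x \<in> S \<Longrightarrow> form_at h0 x0 \<le> form_at h x"
    using continuous_attains_inf[OF AS _ cont] False S1 by force
  have "x0 \<noteq> 0" using m(2) by (auto simp: S_def)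
  then have c: "0 < form_at h0 x0" using pos m(1,2) by (auto simp: S_def)
  have "form_at h0 x0 * (norm x)\<^sup>2 \<le> form_at h x" if "h \<in> A" "x \<in> vecs K" for h x
  proof (cases "x = 0")
    case True
    then show ?thesis by (simp add: form_at_zero)
  next
    case False
    define y where "y = (1 / norm x) *\<^sub>R x"
    have "y \<in> S" using False that by (simp add: S_def y_def vecs_K_scaleR)
    then have "form_at h0 x0 \<le> form_at h y" using m that by blast
    also have "\<dots> = form_at h x / (norm x)\<^sup>2"
      by (simp add: y_def scaleR_conv_smult form_at_smult norm_divide power_divide)
    finally show ?thesis using False by (simp add: pos_le_divide_eq)
  qed
  then show ?thesis using c by blast
qed (auto intro: exI[of _ 1])

lemma form_at_bound: "\<bar>form_at h x\<bar> \<le> norm h * (norm x)\<^sup>2"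
  unfolding form_at_inner using Cauchy_Schwarz_ineq2[of h "rank_one x"] by (simp add: norm_rank_one)

lemma finite_lattice_ball: "finite {x \<in> vecs Oi. norm (x :: complex ^ 'n) \<le> c}"
proof -
  have "{x \<in> vecs Oi. norm (x :: complex ^ 'n) \<le> c} \<subseteq> vecs {a \<in> Oi. cmod a \<le> c}"
    by (auto simp: vecs_def intro: order_trans[OF Finite_Cartesian_Product.norm_nth_le])
  then show ?thesis using finite_vecs[OF finite_Oi_ball] finite_subset by blast
qed

end

section \<open>The Ryshkov polyhedron\<close>

lemma norm_le_sum_norm: "norm (x :: complex ^ 'n) \<le> (\<Sum>i\<in>UNIV. cmod (x $ i))"
  unfolding norm_vec_def by (rule L2_set_le_sum) simp

lemma finite_mats: "finite S \<Longrightarrow> finite (mats S :: (complex ^ 'n ^ 'n) set)"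
proof -
  assume "finite S"
  have "mats S = {A :: complex ^ 'n ^ 'n. \<forall>i. A $ i \<in> {x. \<forall>j. x $ j \<in> S}}" by (auto simp: mats_def)
  then show ?thesis using finite_vec_entries[OF finite_vec_entries[OF \<open>finite S\<close>]] by simp
qed

context ground
begin

lemma approximation:
  fixes e :: real
  assumes "e > 0"
  shows "\<exists>B::nat. \<forall>v::complex ^ 'n \<in> vecs K. \<exists>k\<in>{1..B}. \<exists>p\<in>vecs Oi. norm (real k *\<^sub>R v - p) < e"
proof -
  define e' where "e' = e / real CARD('n)"
  have e': "e' > 0" using assms by (simp add: e'_def)
  obtain B where B: "\<forall>y::complex ^ 'n \<in> vecs K. \<exists>k\<in>{1..B}. \<exists>p\<in>vecs Oi.
           \<forall>i. cmod (of_nat k * y $ i - p $ i) < e'"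
    using simultaneous_approximation[OF e'] by blast
  show ?thesis
  proof (intro exI[of _ B] ballI)
    fix v :: "complex ^ 'n" assume "v \<in> vecs K"
    then obtain k p where kp: "k \<in> {1..B}" "p \<in> vecs Oi" "\<forall>i. cmod (of_nat k * v $ i - p $ i) < e'"
      using B by blast
    have "norm (real k *\<^sub>R v - p) \<le> (\<Sum>i\<in>UNIV. cmod ((real k *\<^sub>R v - p) $ i))"
      by (rule norm_le_sum_norm)
    also have "\<dots> < (\<Sum>i\<in>(UNIV::'n set). e')"
      by (rule sum_strict_mono) (use kp(3) in \<open>simp_all add: scaleR_conv_of_real[where 'a = complex]\<close>)
    also have "\<dots> = e" by (simp add: e'_def)
    finally show "\<exists>k\<in>{1..B}. \<exists>p\<in>vecs Oi. norm (real k *\<^sub>R v - p) < e" using kp by blast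
  qed
qed

text \<open>
  The form is negative near \<open>v\<close>, hence at a point \<open>p / k\<close> with \<open>p\<close> in the lattice, and the
  sign at \<open>p\<close> is the same.
\<close>

lemma lattice_vector_negative:
  fixes h :: "complex ^ 'n ^ 'n"
  assumes v: "v \<in> vecs K" and neg: "form_at h v < 0"
  shows "\<exists>x\<in>vecs Oi - {0}. form_at h x < 0"
proof -
  have "isCont (form_at h) v" using continuous_form_at[of UNIV h] by (simp add: continuous_on_eq_continuous_at)
  then have "(form_at h \<longlongrightarrow> form_at h v) (at v)" by (simp add: isCont_def)
  then have "\<forall>\<^sub>F y in at v. form_at h y < 0" using neg by (rule order_tendstoD(2))
  then obtain e where e: "e > 0" "\<And>y. y \<noteq> v \<Longrightarrow> dist y v < e \<Longrightarrow> form_at h y < 0"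
    unfolding eventually_at by blast
  then have e': "form_at h y < 0" if "dist y v < e" for y using neg that by (cases "y = v") auto
  obtain k p where kp: "(k::nat) \<ge> 1" "p \<in> vecs Oi" "norm (real k *\<^sub>R v - p) < e"
    using approximation[OF e(1)] v by (metis atLeastAtMost_iff)
  have "dist ((1 / real k) *\<^sub>R p) v = norm ((1 / real k) *\<^sub>R (real k *\<^sub>R v - p))"
    using kp(1) by (simp add: dist_norm norm_minus_commute scaleR_right_diff_distrib)
  also have "\<dots> \<le> 1 * norm (real k *\<^sub>R v - p)"
    unfolding norm_scaleR using kp(1) by (intro mult_right_mono) auto
  finally have "form_at h ((1 / real k) *\<^sub>R p) < 0" using e' kp(3) by simp
  then have "form_at h p < 0"
    by (simp add: scaleR_conv_smult form_at_smult mult_less_0_iff)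
  moreover have "p \<noteq> 0" using calculation by (auto simp: form_at_zero)
  ultimately show ?thesis using kp(2) by blast
qed

text \<open>
  The Ryshkov polyhedron: its vertices are the perfect forms of minimum \<open>1\<close>, and its bounded
  edges join neighbouring perfect forms.
\<close>

definition ryshkov :: "(complex ^ 'n ^ 'n) set" where
  "ryshkov = {h \<in> herm F. \<forall>x\<in>vecs Oi - {0}. 1 \<le> form_at h x}"

text \<open>
  For a form in the Ryshkov polyhedron these are the minimal vectors, as soon as there is one.
\<close>

definition min1 :: "complex ^ 'n ^ 'n \<Rightarrow> (complex ^ 'n) set" where
  "min1 h = {x \<in> vecs Oi - {0}. form_at h x = 1}"

lemma ryshkov_herm: "h \<in> ryshkov \<Longrightarrow> h \<in> herm F" by (simp add: ryshkov_def)

lemma ryshkov_psd: "h \<in> ryshkov \<Longrightarrow> psd h"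
  unfolding psd_def using lattice_vector_negative
  by (metis (mono_tags, lifting) mem_Collect_eq not_le not_one_less_zero order_less_imp_le order_le_less_trans ryshkov_def)

text \<open>
  Suppose that a semidefinite form has a null vector \<open>u\<close>. Lattice vectors close to the line of
  \<open>u\<close> exist by approximation; as \<open>u\<close> is in the kernel, the form depends only on their small
  distance from the line and takes values below \<open>1\<close>.
\<close>

lemma ryshkov_pos:
  fixes h :: "complex ^ 'n ^ 'n"
  assumes h: "h \<in> ryshkov"
  shows "h \<in> pos_cone F"
proof -
  have "0 < form_at h v" if v: "v \<in> vecs K" "v \<noteq> 0" for v
  proof (rule ccontr)
    assume "\<not> 0 < form_at h v"
    then have fv: "form_at h v = 0" using ryshkov_psd[OF h] v unfolding psd_def by force
    then have hv: "h *v v = 0" using psd_null_vector v ryshkov_psd[OF h] ryshkov_herm[OF h] by blast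
    \<comment> \<open>Chosen so that the value of \<open>h\<close> at a vector shorter than \<open>e\<close> is below \<open>1\<close>.\<close>
    define e where "e = 1 / (norm h + 1)"
    have "norm h + 1 > 0" by (simp add: add_nonneg_pos)
    then have e: "e > 0" "e \<le> 1" "norm h * e < 1"
      by (simp_all add: e_def divide_simps)
    define u where "u = (1 / norm v) *\<^sub>R v"
    have u: "norm u = 1" "u \<in> vecs K" using v by (simp_all add: u_def vecs_K_scaleR)
    have hu: "h *v u = 0" using hv by (simp add: u_def scaleR_conv_smult vector_scalar_commute)
    obtain k p where kp: "(k::nat) \<ge> 1" "p \<in> vecs Oi" "norm (real k *\<^sub>R u - p) < e"
      using approximation[OF e(1)] u(2) by (metis atLeastAtMost_iff)
    define r where "r = p - real k *\<^sub>R u"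
    have r: "norm r < e" using kp(3) by (simp add: r_def norm_minus_commute)
    have "p \<noteq> 0"
    proof
      assume "p = 0"
      then have "real k < e" using kp(3) u(1) by simp
      then show False using kp(1) e(2) by simp
    qed
    then have "1 \<le> form_at h p" using kp(2) h by (simp add: ryshkov_def)
    also have "p = r + real k *\<^sub>R u" by (simp add: r_def)
    also have "form_at h (r + real k *\<^sub>R u) = form_at h r"
    proof -
      have "h *v (real k *\<^sub>R u) = 0" using hu by (simp add: scaleR_conv_smult vector_scalar_commute)
      moreover from this have "form_at h (real k *\<^sub>R u) = 0" by (simp only: form_at_cdot cdot_zero_right) simp
      ultimately show ?thesis
        by (simp only: form_at_add[OF herm_sym[OF ryshkov_herm[OF h]]] cdot_zero_right) simp
    qed
    also have "\<dots> \<le> norm h * (norm r)\<^sup>2" using form_at_bound[of h r] by simp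
    also have "\<dots> \<le> norm h * (e * 1)"
    proof -
      have "(norm r)\<^sup>2 \<le> e * 1" unfolding power2_eq_square using r e by (intro mult_mono) auto
      then show ?thesis by (rule mult_left_mono) simp
    qed
    finally show False using e(3) by simp
  qed
  then show ?thesis using ryshkov_herm[OF h] by (simp add: pos_cone_def)
qed

lemma pos_cone_uniform:
  assumes "h \<in> pos_cone F"
  shows "\<exists>c>0. \<forall>x\<in>vecs K. c * (norm x)\<^sup>2 \<le> form_at h x"
  using uniformly_positive[of "{h}"] assms by (auto simp: pos_cone_def)

lemma finite_sublevel:
  fixes h :: "complex ^ 'n ^ 'n"
  assumes c: "c > 0" "\<forall>x\<in>vecs K. c * (norm x)\<^sup>2 \<le> form_at h x"
  shows "finite {x \<in> vecs Oi. form_at h x \<le> b}"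
proof (rule finite_subset[OF _ finite_lattice_ball])
  show "{x \<in> vecs Oi. form_at h x \<le> b} \<subseteq> {x \<in> vecs Oi. norm x \<le> sqrt (b / c)}"
  proof clarify
    fix x assume x: "x \<in> vecs Oi" "form_at h x \<le> b"
    then have "c * (norm x)\<^sup>2 \<le> b" using c(2) vecs_Oi_K by force
    then have "(norm x)\<^sup>2 \<le> b / c" using c(1) by (simp add: field_simps)
    then show "norm x \<le> sqrt (b / c)" by (rule real_le_rsqrt)
  qed
qed

lemma finite_sublevel_pos: "h \<in> pos_cone F \<Longrightarrow> finite {x \<in> vecs Oi. form_at h x \<le> b}"
  using pos_cone_uniform finite_sublevel by blast

lemma finite_min1: "h \<in> ryshkov \<Longrightarrow> finite (min1 h)"
  by (rule finite_subset[OF _ finite_sublevel_pos[OF ryshkov_pos, of h 1]]) (auto simp: min1_def)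

lemma min1_K: "x \<in> min1 h \<Longrightarrow> x \<in> vecs K"
  by (simp add: min1_def vecs_Oi_K)

lemma min1_herm: "rank_one ` min1 h \<subseteq> herm F"
  using min1_K rank_one_herm by blast

text \<open>
  The ray \<open>h + s \<psi>\<close> has to leave the polyhedron, and the place where it does so gives the new
  form. The constraint of a lattice vector \<open>x\<close> is violated beyond the parameter \<open>\<rho> x\<close>. Near a
  positive definite point of the ray only finitely many constraints matter; hence the infimum
  of \<open>\<rho>\<close> is positive, because it is so near \<open>s = 0\<close>, and it is attained, because the point
  where it is reached is again positive definite.
\<close>

lemma ryshkov_neighbour:
  fixes h \<psi> :: "complex ^ 'n ^ 'n"
  assumes h: "h \<in> ryshkov" and \<psi>: "\<psi> \<in> herm F" "\<not> psd \<psi>"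
    and nonneg: "\<And>x. x \<in> min1 h \<Longrightarrow> 0 \<le> form_at \<psi> x"
  shows "\<exists>t>0. h + t *\<^sub>R \<psi> \<in> ryshkov \<and> (\<exists>y\<in>min1 (h + t *\<^sub>R \<psi>). form_at \<psi> y < 0)"
proof -
  define S where "S = {x \<in> vecs Oi - {0}. form_at \<psi> x < 0}"
  \<comment> \<open>The value at \<open>x\<close> drops to \<open>1\<close> at this parameter.\<close>
  define \<rho> where "\<rho> x = (form_at h x - 1) / (- form_at \<psi> x)" for x
  have "S \<noteq> {}"
    using \<psi>(2) lattice_vector_negative unfolding psd_def S_def by (metis (no_types, lifting) empty_iff mem_Collect_eq not_le)
  have \<rho>_nonneg: "0 \<le> \<rho> x" if "x \<in> S" for x
    using that h by (simp add: \<rho>_def S_def ryshkov_def divide_nonneg_neg)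
  have \<rho>_le_iff: "\<rho> x \<le> s \<longleftrightarrow> form_at (h + s *\<^sub>R \<psi>) x \<le> 1" if "x \<in> S" for x s
  proof -
    have "\<rho> x \<le> s \<longleftrightarrow> form_at h x - 1 \<le> s * (- form_at \<psi> x)"
      unfolding \<rho>_def using that by (intro pos_divide_le_eq) (simp add: S_def)
    then show ?thesis by (simp add: form_at_add_left form_at_scaleR_left algebra_simps)
  qed
  have local_finite: "\<exists>\<epsilon>>0. finite {x \<in> S. \<rho> x \<le> s + \<epsilon>}" if s: "h + s *\<^sub>R \<psi> \<in> pos_cone F" for s
  proof -
    obtain c where c: "c > 0" "\<forall>x\<in>vecs K. c * (norm x)\<^sup>2 \<le> form_at (h + s *\<^sub>R \<psi>) x"
      using pos_cone_uniform[OF s] by blast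
    define m where "m = norm \<psi> + 1"
    define \<epsilon> where "\<epsilon> = c / 2 / m"
    have m: "m > 0" by (simp add: m_def add_nonneg_pos)
    then have \<epsilon>: "\<epsilon> > 0" using c(1) by (simp add: \<epsilon>_def)
    have "\<epsilon> * m = c / 2" using m by (simp add: \<epsilon>_def)
    then have \<epsilon>': "\<epsilon> * norm \<psi> \<le> c / 2" using \<epsilon> by (simp add: m_def distrib_left)
    have "c / 2 * (norm x)\<^sup>2 \<le> form_at (h + (s + \<epsilon>) *\<^sub>R \<psi>) x" if "x \<in> vecs K" for x
    proof -
      have "\<bar>\<epsilon> * form_at \<psi> x\<bar> \<le> \<epsilon> * (norm \<psi> * (norm x)\<^sup>2)"
        using form_at_bound[of \<psi> x] \<epsilon> by (simp add: abs_mult)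
      also have "\<dots> \<le> c / 2 * (norm x)\<^sup>2"
        unfolding mult.assoc[symmetric] using \<epsilon>' by (rule mult_right_mono) simp
      finally have "- (c / 2 * (norm x)\<^sup>2) \<le> \<epsilon> * form_at \<psi> x" by linarith
      moreover have "c * (norm x)\<^sup>2 \<le> form_at (h + s *\<^sub>R \<psi>) x" using c(2) that by blast
      ultimately show ?thesis by (simp add: form_at_add_left form_at_scaleR_left algebra_simps)
    qed
    then have "finite {x \<in> vecs Oi. form_at (h + (s + \<epsilon>) *\<^sub>R \<psi>) x \<le> 1}"
      using c(1) by (intro finite_sublevel[of "c / 2"]) auto
    moreover have "{x \<in> S. \<rho> x \<le> s + \<epsilon>} \<subseteq> {x \<in> vecs Oi. form_at (h + (s + \<epsilon>) *\<^sub>R \<psi>) x \<le> 1}"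
      using \<rho>_le_iff by (auto simp: S_def)
    ultimately show ?thesis using \<epsilon> finite_subset by blast
  qed
  define t where "t = Inf (\<rho> ` S)"
  have bdd: "bdd_below (\<rho> ` S)" by (rule bdd_belowI2[of _ 0]) (rule \<rho>_nonneg)
  have t_le: "t \<le> \<rho> x" if "x \<in> S" for x
    unfolding t_def using bdd that by (simp add: cInf_lower)
  have t_pos: "t > 0"
  proof -
    obtain \<epsilon> where \<epsilon>: "\<epsilon> > 0" "finite {x \<in> S. \<rho> x \<le> 0 + \<epsilon>}"
      using local_finite[of 0] ryshkov_pos[OF h] by auto
    define m where "m = Min (insert \<epsilon> (\<rho> ` {x \<in> S. \<rho> x \<le> 0 + \<epsilon>}))"
    have "0 < \<rho> x" if "x \<in> S" for x
    proof -
      have "form_at h x \<noteq> 1"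
        using that nonneg[of x] by (auto simp: S_def min1_def)
      then have "\<rho> x \<noteq> 0" using that by (simp add: \<rho>_def S_def)
      then show ?thesis using \<rho>_nonneg[OF that] by simp
    qed
    then have "0 < m" unfolding m_def using \<epsilon> by (subst Min_gr_iff) auto
    moreover have "m \<le> \<rho> x" if "x \<in> S" for x
    proof (cases "\<rho> x \<le> 0 + \<epsilon>")
      case True
      then show ?thesis unfolding m_def using \<epsilon> that by (intro Min_le) auto
    next
      case False
      moreover have "m \<le> \<epsilon>" unfolding m_def using \<epsilon> by (intro Min_le) auto
      ultimately show ?thesis by simp
    qed
    then have "m \<le> t" unfolding t_def using \<open>S \<noteq> {}\<close> by (intro cInf_greatest) auto
    ultimately show ?thesis by simp
  qed
  have ht: "h + t *\<^sub>R \<psi> \<in> ryshkov"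
  proof -
    have "h + t *\<^sub>R \<psi> \<in> herm F"
      by (intro subspace_add[OF subspace_herm] subspace_scale[OF subspace_herm] ryshkov_herm[OF h] \<psi>(1))
    moreover have "1 \<le> form_at (h + t *\<^sub>R \<psi>) x" if x: "x \<in> vecs Oi - {0}" for x
    proof (cases "x \<in> S")
      case True
      have "form_at \<psi> x < 0" using True by (simp add: S_def)
      moreover have "t \<le> (form_at h x - 1) / (- form_at \<psi> x)" using t_le[OF True] by (simp add: \<rho>_def)
      ultimately have "t * (- form_at \<psi> x) \<le> form_at h x - 1" by (simp only: pos_le_divide_eq neg_0_less_iff_less)
      then show ?thesis by (simp add: form_at_add_left form_at_scaleR_left)
    next
      case False
      then have "0 \<le> form_at \<psi> x" using x by (simp add: S_def)
      moreover have "1 \<le> form_at h x" using x h by (simp add: ryshkov_def)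
      ultimately show ?thesis using t_pos by (simp add: form_at_add_left form_at_scaleR_left add_increasing2)
    qed
    ultimately show ?thesis by (simp add: ryshkov_def)
  qed
  obtain \<epsilon> where \<epsilon>: "\<epsilon> > 0" "finite {x \<in> S. \<rho> x \<le> t + \<epsilon>}"
    using local_finite[OF ryshkov_pos[OF ht]] by blast
  define T where "T = {x \<in> S. \<rho> x \<le> t + \<epsilon>}"
  have "t < t + \<epsilon>" using \<epsilon>(1) by simp
  then have "\<exists>z\<in>\<rho> ` S. z < t + \<epsilon>"
    unfolding t_def using \<open>S \<noteq> {}\<close> bdd by (subst cInf_less_iff[symmetric]) auto
  then have "T \<noteq> {}" by (auto simp: T_def)
  then obtain y where y: "y \<in> T" "\<And>x. x \<in> T \<Longrightarrow> \<rho> y \<le> \<rho> x"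
    using \<epsilon>(2) T_def arg_min_if_finite[of T \<rho>] by (metis not_le)
  have "\<rho> y \<le> \<rho> x" if "x \<in> S" for x
    using y that by (cases "x \<in> T") (auto simp: T_def)
  then have "\<rho> y \<le> t" unfolding t_def using \<open>S \<noteq> {}\<close> by (intro cInf_greatest) auto
  moreover have yS: "y \<in> S" using y by (simp add: T_def)
  ultimately have "form_at (h + t *\<^sub>R \<psi>) y \<le> 1" using \<rho>_le_iff by blast
  moreover have "1 \<le> form_at (h + t *\<^sub>R \<psi>) y" using ht yS by (simp add: ryshkov_def S_def)
  ultimately have "y \<in> min1 (h + t *\<^sub>R \<psi>)" using yS by (simp add: min1_def S_def)
  then show ?thesis using t_pos ht yS by (auto simp: S_def)
qed

text \<open>
  Perfect forms of minimum \<open>1\<close>, one for every homothety class.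
\<close>

definition unit_perfect :: "complex ^ 'n ^ 'n \<Rightarrow> bool" where
  "unit_perfect h \<longleftrightarrow> h \<in> ryshkov \<and> span (rank_one ` min1 h) = herm F"

lemma herm_eq_0_of_span:
  assumes "span (rank_one ` A) = herm F" "g \<in> herm F" "\<And>x. x \<in> A \<Longrightarrow> form_at g x = 0"
  shows "g = 0"
proof -
  have "g \<bullet> X = 0" if "X \<in> span (rank_one ` A)" for X
    using that
  proof (induction rule: span_induct)
    case base
    show ?case by (rule subspace_hyperplane)
  next
    case (step X)
    then show ?case using assms(3) by (auto simp: form_at_inner)
  qed
  then have "g \<bullet> g = 0" using assms(1,2) by blast
  then show ?thesis by simp
qed

text \<open>
  The linear equations \<open>h'(x) = 1\<close> for minimal \<open>x\<close> determine \<open>h'\<close>, because the matrices \<open>x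
  x\<^sup>*\<close> span.
\<close>

lemma unit_perfect_unique:
  assumes "unit_perfect h" "h' \<in> herm F" "\<And>x. x \<in> min1 h \<Longrightarrow> form_at h' x = 1"
  shows "h' = h"
proof -
  have "h' - h = 0"
  proof (rule herm_eq_0_of_span)
    show "span (rank_one ` min1 h) = herm F" using assms by (simp add: unit_perfect_def)
    show "h' - h \<in> herm F"
      using assms subspace_diff[OF subspace_herm] ryshkov_herm by (auto simp: unit_perfect_def)
    show "form_at (h' - h) x = 0" if "x \<in> min1 h" for x
      using assms(3)[OF that] that by (simp add: form_at_diff_left min1_def)
  qed
  then show ?thesis by simp
qed

lemma ryshkov_nonempty: "mat 1 \<in> (ryshkov :: (complex ^ 'n ^ 'n) set)"
proof -
  have "mat 1 \<in> (herm F :: (complex ^ 'n ^ 'n) set)"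
    unfolding herm_def using mats_Oi_K mats_Oi_one conj_transpose_mat by blast
  moreover have "1 \<le> form_at (mat 1) x" if x: "x \<in> vecs Oi - {0}" for x :: "complex ^ 'n"
  proof -
    obtain i where i: "x $ i \<noteq> 0" using x by (auto simp: Finite_Cartesian_Product.vec_eq_iff)
    then have "1 \<le> cmod (x $ i)" using x Oi_norm_ge_1 by (simp add: vecs_def)
    also have "\<dots> \<le> norm x" by (rule Finite_Cartesian_Product.norm_nth_le)
    finally have "1 \<le> (norm x)\<^sup>2" by simp
    then show ?thesis by (simp add: form_at_cdot Re_cdot_self)
  qed
  ultimately show ?thesis by (simp add: ryshkov_def)
qed

text \<open>
  As long as the \<open>x x\<^sup>*\<close> do not span, some form that is not semidefinite vanishes on all
  minimal vectors. Moving in its direction keeps them and produces a new one outside their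
  span. So a form for which the span has maximal dimension is perfect.
\<close>

lemma unit_perfect_exists: "\<exists>h :: complex ^ 'n ^ 'n. unit_perfect h"
proof -
  define f where "f h = dim (rank_one ` min1 h :: (complex ^ 'n ^ 'n) set)" for h
  have bound: "\<forall>h. h \<in> ryshkov \<longrightarrow> f h < Suc (DIM(complex ^ 'n ^ 'n))"
    unfolding f_def using dim_subset_UNIV by (metis le_imp_less_Suc)
  obtain h :: "complex ^ 'n ^ 'n" where h: "h \<in> ryshkov" "\<And>g. g \<in> ryshkov \<Longrightarrow> f g \<le> f h"
    using ex_has_greatest_nat[of "\<lambda>h. h \<in> ryshkov" "mat 1" f "Suc (DIM(complex ^ 'n ^ 'n))"] ryshkov_nonempty bound
    by blast
  have "span (rank_one ` min1 h) = herm F"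
  proof (rule ccontr)
    assume ne: "span (rank_one ` min1 h) \<noteq> herm F"
    have "span (rank_one ` min1 h) \<subset> span (herm F)"
      using ne span_herm[OF min1_herm] span_superset by blast
    then obtain \<psi> where \<psi>: "\<psi> \<noteq> 0" "\<psi> \<in> span (herm F)"
      "\<And>y. y \<in> span (rank_one ` min1 h) \<Longrightarrow> orthogonal \<psi> y"
      using orthogonal_to_subspace_exists_gen by blast
    have \<psi>_herm: "\<psi> \<in> herm F" using \<psi>(2) span_herm by blast
    have \<psi>0: "form_at \<psi> x = 0" if "x \<in> min1 h" for x
      using \<psi>(3)[OF span_base] that by (simp add: form_at_inner real_inner_class.orthogonal_def)
    obtain \<phi> where \<phi>: "\<phi> \<in> herm F" "\<not> psd \<phi>" "\<And>x. x \<in> min1 h \<Longrightarrow> form_at \<phi> x = 0"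
    proof (cases "psd \<psi>")
      case True
      then have "\<not> psd (- \<psi>)" using psd_antisym \<psi>_herm \<psi>(1) by blast
      moreover have "form_at (- \<psi>) x = 0" if "x \<in> min1 h" for x
        using \<psi>0[OF that] by (simp add: form_at_minus_left)
      ultimately show ?thesis using that[of "- \<psi>"] subspace_neg[OF subspace_herm \<psi>_herm] by blast
    qed (use that \<psi>0 \<psi>_herm in blast)
    obtain t y where ty: "t > 0" "h + t *\<^sub>R \<phi> \<in> ryshkov" "y \<in> min1 (h + t *\<^sub>R \<phi>)" "form_at \<phi> y < 0"
      using ryshkov_neighbour[OF h(1) \<phi>(1,2)] \<phi>(3) by force
    have "insert (rank_one y) (rank_one ` min1 h) \<subseteq> rank_one ` min1 (h + t *\<^sub>R \<phi>)"
      using ty(3) \<phi>(3) by (auto simp: min1_def form_at_add_left form_at_scaleR_left)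
    then have "dim (insert (rank_one y) (rank_one ` min1 h)) \<le> f (h + t *\<^sub>R \<phi>)"
      unfolding f_def by (rule dim_subset)
    moreover have "rank_one y \<notin> span (rank_one ` min1 h)"
    proof
      assume "rank_one y \<in> span (rank_one ` min1 h)"
      then have "\<phi> \<bullet> rank_one y = 0"
      proof (induction rule: span_induct)
        case base
        show ?case by (rule subspace_hyperplane)
      next
        case (step X)
        then show ?case using \<phi>(3) by (auto simp: form_at_inner)
      qed
      then show False using ty(4) by (simp add: form_at_inner)
    qed
    ultimately have "f h < f (h + t *\<^sub>R \<phi>)" by (simp add: dim_insert f_def)
    then show False using h(2)[OF ty(2)] by simp
  qed
  then show ?thesis using h(1) unit_perfect_def by blast
qed


subsection \<open>Finiteness modulo the general linear group\<close>

lemma cdot_axis: "cdot (axis i 1) z = z $ i"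
  by (simp add: cdot_def axis_def if_distrib[of cnj] if_distrib[of "\<lambda>c. c * _"] cong: if_cong)

lemma mult_axis: "A *v axis j 1 = column j (A :: complex ^ 'n ^ 'n)"
  by (simp add: Finite_Cartesian_Product.vec_eq_iff matrix_vector_mult_def axis_def column_def if_distrib cong: if_cong)

lemma axis_Oi: "axis j 1 \<in> vecs Oi"
  by (auto simp: vecs_def axis_def Oi_0 Oi_1)

lemma axis_K: "axis j 1 \<in> vecs K"
  by (simp add: vecs_Oi_K axis_Oi)

text \<open>
  Evaluate \<open>h\<close> at \<open>e\<^sub>i + c e\<^sub>j\<close>, where the unit \<open>c\<close> makes the mixed term negative.
\<close>

lemma psd_entry_bound:
  assumes h: "h \<in> herm F" "psd h" and b: "form_at h (axis i 1) \<le> b" "form_at h (axis j 1) \<le> b"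
  shows "cmod (h $ i $ j) \<le> b"
proof (cases "h $ i $ j = 0")
  case True
  have "0 \<le> form_at h (axis i 1)" using h(2) axis_K unfolding psd_def by blast
  then show ?thesis using True b(1) by simp
next
  case False
  \<comment> \<open>The unit with \<open>c h\<^sub>i\<^sub>j = - |h\<^sub>i\<^sub>j|\<close>; it lies in \<open>K\<close>.\<close>
  define c where "c = - cnj (h $ i $ j) / of_real (cmod (h $ i $ j))"
  have "h $ i $ j \<in> K" using herm_K[OF h(1)] by (simp add: mats_def)
  then have cK: "c \<in> K" unfolding c_def by (intro K_divide K_minus K_cnj K_real)
  have c1: "cmod c = 1" using False by (simp add: c_def norm_divide)
  have ch: "c * h $ i $ j = - of_real (cmod (h $ i $ j))"
    using False complex_norm_square[of "h $ i $ j"] by (simp add: c_def power2_eq_square field_simps)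
  have "axis i 1 + c *s axis j 1 \<in> vecs K" by (intro vecs_K_add vecs_K_smult axis_K cK)
  then have "0 \<le> form_at h (axis i 1 + c *s axis j 1)" using h(2) by (simp add: psd_def)
  also have "\<dots> = form_at h (axis i 1) + form_at h (axis j 1) + 2 * Re (c * h $ i $ j)"
    by (simp add: form_at_add[OF herm_sym[OF h(1)]] form_at_smult c1 vector_scalar_commute
        cdot_smult_right cdot_axis mult_axis column_def)
  also have "\<dots> = form_at h (axis i 1) + form_at h (axis j 1) - 2 * cmod (h $ i $ j)"
    by (simp add: ch)
  finally show ?thesis using b by linarith
qed

lemma bounded_psd: "bounded {h \<in> herm F. psd h \<and> (\<forall>i. form_at h (axis i 1) \<le> b)}"
proof (rule boundedI)
  fix h :: "complex ^ 'n ^ 'n"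
  assume h: "h \<in> {h \<in> herm F. psd h \<and> (\<forall>i. form_at h (axis i 1) \<le> b)}"
  have "norm h \<le> (\<Sum>i\<in>UNIV. norm (h $ i))"
    unfolding norm_vec_def[of h] by (rule L2_set_le_sum) simp
  also have "\<dots> \<le> (\<Sum>i\<in>(UNIV::'n set). \<Sum>j\<in>(UNIV::'n set). b)"
  proof (rule sum_mono)
    fix i :: 'n
    have "norm (h $ i) \<le> (\<Sum>j\<in>UNIV. cmod (h $ i $ j))" by (rule norm_le_sum_norm)
    also have "\<dots> \<le> (\<Sum>j\<in>(UNIV::'n set). b)" using h by (intro sum_mono psd_entry_bound) auto
    finally show "norm (h $ i) \<le> (\<Sum>j\<in>(UNIV::'n set). b)" .
  qed
  finally show "norm h \<le> (\<Sum>i\<in>(UNIV::'n set). \<Sum>j\<in>(UNIV::'n set). b)" .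
qed

lemma psd_act: "psd h \<Longrightarrow> M \<in> mats K \<Longrightarrow> psd (act (conj_transpose M) h)"
  by (simp add: psd_def form_at_act mats_K_vecs)

text \<open>
  The condition cuts out a compact set of positive definite forms, so all their minimal
  vectors lie in one finite set, and a perfect form is determined by its minimal vectors. The
  columns of \<open>M\<close> form a basis, which bounds the entries of \<open>h\<close>.
\<close>

lemma finite_unit_perfect_bounded:
  fixes M M' :: "complex ^ 'n ^ 'n"
  assumes M: "M \<in> mats K" "M ** M' = mat 1"
  shows "finite {h. unit_perfect h \<and> (\<forall>j. form_at h (M *v axis j 1) \<le> b)}" (is "finite ?P")
proof -
  define A where "A = {h \<in> ryshkov. \<forall>j. form_at h (M *v axis j 1) \<le> b}"
  have A_eq: "A = herm F \<inter> (\<Inter>x\<in>vecs Oi - {0}. {h. 1 \<le> h \<bullet> rank_one x})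
      \<inter> (\<Inter>j. {h. h \<bullet> rank_one (M *v axis j 1) \<le> b})"
    by (auto simp: A_def ryshkov_def form_at_inner)
  have "closed A"
    unfolding A_eq
    by (intro closed_Int closed_INT ballI closed_subspace subspace_herm closed_Collect_le continuous_intros)
  have "act (conj_transpose M) ` A \<subseteq> {h \<in> herm F. psd h \<and> (\<forall>i. form_at h (axis i 1) \<le> b)}"
    using psd_act[OF ryshkov_psd M(1)] act_herm[OF mats_K_conj_transpose[OF M(1)] ryshkov_herm]
    by (auto simp: A_def form_at_act)
  then have "bounded (act (conj_transpose M) ` A)" using bounded_psd bounded_subset by blast
  then have "bounded (act (conj_transpose M') ` act (conj_transpose M) ` A)"
    by (rule bounded_linear_image) (simp add: linear_conv_bounded_linear[symmetric] linear_act)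
  moreover have "act (conj_transpose M') ` act (conj_transpose M) ` A = A"
    using M(2) by (simp flip: act_image_mult conj_transpose_mult add: conj_transpose_mat act_image_one)
  ultimately have "compact A" using \<open>closed A\<close> by (simp add: compact_eq_bounded_closed)
  moreover have "0 < form_at h x" if "h \<in> A" "x \<in> vecs K" "x \<noteq> 0" for h x
    using that ryshkov_pos[of h] by (simp add: A_def pos_cone_def)
  ultimately have "\<exists>c>0. \<forall>h\<in>A. \<forall>x\<in>vecs K. c * (norm x)\<^sup>2 \<le> form_at h x"
    by (rule uniformly_positive)
  then obtain c where c: "c > 0" "\<And>h x. h \<in> A \<Longrightarrow> x \<in> vecs K \<Longrightarrow> c * (norm x)\<^sup>2 \<le> form_at h x"
    by blast
  have "min1 h \<subseteq> {x \<in> vecs Oi. norm x \<le> sqrt (1 / c)}" if "h \<in> A" for h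
  proof
    fix x assume x: "x \<in> min1 h"
    then have "c * (norm x)\<^sup>2 \<le> 1" using c(2)[OF that min1_K[OF x]] by (simp add: min1_def)
    then have "(norm x)\<^sup>2 \<le> 1 / c" using c(1) by (simp add: field_simps)
    then show "x \<in> {x \<in> vecs Oi. norm x \<le> sqrt (1 / c)}" using x real_le_rsqrt by (auto simp: min1_def)
  qed
  then have sub: "min1 ` ?P \<subseteq> Pow {x \<in> vecs Oi. norm x \<le> sqrt (1 / c)}"
    by (auto simp: A_def unit_perfect_def)
  have inj: "inj_on min1 ?P"
  proof (rule inj_onI)
    fix h h' assume hh: "h \<in> ?P" "h' \<in> ?P" "min1 h = min1 h'"
    have "h' = h"
    proof (rule unit_perfect_unique)
      show "unit_perfect h" using hh(1) by blast
      have "unit_perfect h'" using hh(2) by blast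
      then show "h' \<in> herm F" by (simp add: unit_perfect_def ryshkov_herm)
      show "form_at h' x = 1" if "x \<in> min1 h" for x using that unfolding hh(3) by (simp add: min1_def)
    qed
    then show "h = h'" by (rule sym)
  qed
  have "finite (Pow {x \<in> vecs Oi. norm (x :: complex ^ 'n) \<le> sqrt (1 / c)})"
    unfolding finite_Pow_iff by (rule finite_lattice_ball)
  then show ?thesis by (rule inj_on_finite[OF inj sub])
qed

text \<open>
  If \<open>v \<in> K\<^sup>n\<close> is orthogonal to the minimal vectors, the form \<open>v v\<^sup>*\<close> vanishes on them and
  must be \<open>0\<close>. For \<open>K = \<real>\<close> this applies to the real and the imaginary part of \<open>v\<close>.
\<close>

lemma cdot_min1_separates:
  assumes h: "unit_perfect h" and v: "\<And>x. x \<in> min1 h \<Longrightarrow> cdot x v = 0"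
  shows "v = 0"
proof -
  have in_K: "u = 0" if u: "u \<in> vecs K" "\<And>x. x \<in> min1 h \<Longrightarrow> cdot x u = 0" for u
  proof -
    have "form_at (rank_one u) x = 0" if "x \<in> min1 h" for x
    proof -
      have "cdot u x = cnj (cdot x u)" by (simp only: cdot_cnj)
      then have "cdot u x = 0" by (simp only: u(2)[OF that] complex_cnj_zero)
      then show ?thesis by (simp add: form_at_rank_one)
    qed
    moreover have "span (rank_one ` min1 h) = herm F" using h by (simp add: unit_perfect_def)
    ultimately have "rank_one u = 0" using herm_eq_0_of_span rank_one_herm[OF u(1)] by blast
    then show ?thesis by (simp add: rank_one_eq_0_iff)
  qed
  show ?thesis
  proof (cases "K = UNIV")
    case True
    then show ?thesis using in_K v by (simp add: vecs_def)
  next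
    case False
    then have KR: "K = \<real>" using K_cases by blast
    define a b :: "complex ^ 'a" where "a = (\<chi> i. of_real (Re (v $ i)))" and "b = (\<chi> i. of_real (Im (v $ i)))"
    have real: "Im (x $ i) = 0" if "x \<in> min1 h" for x i
      using min1_K[OF that] KR by (simp add: vecs_def complex_is_Real_iff)
    have "cdot x a = of_real (Re (cdot x v))" "cdot x b = of_real (Im (cdot x v))" if "x \<in> min1 h" for x
      using real[OF that] by (simp_all add: cdot_def a_def b_def complex_eq_iff)
    then have "cdot x a = 0" "cdot x b = 0" if "x \<in> min1 h" for x using v that by simp_all
    moreover have "a \<in> vecs K" "b \<in> vecs K" using KR by (simp_all add: vecs_def a_def b_def)
    ultimately have "a = 0" "b = 0" using in_K by blast+
    then have "Re (v $ i) = 0" "Im (v $ i) = 0" for i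
      by (simp_all add: a_def b_def Finite_Cartesian_Product.vec_eq_iff)
    then show ?thesis by (simp add: Finite_Cartesian_Product.vec_eq_iff complex_eq_iff)
  qed
qed

lemma sum_matrix_vector: "(\<Sum>x\<in>A. f x) *v v = (\<Sum>x\<in>A. f x *v (v :: complex ^ 'n))"
  by (induction A rule: infinite_finite_induct) (simp_all add: matrix_vector_mult_add_rdistrib)

text \<open>
  The minimal vectors span \<open>\<complex>\<^sup>n\<close>, because the sum of the \<open>x x\<^sup>*\<close> is invertible; a basis
  selected from them gives the columns of \<open>M\<close>.
\<close>

lemma min1_frame:
  fixes h :: "complex ^ 'n ^ 'n"
  assumes h: "unit_perfect h"
  shows "\<exists>M M' :: complex ^ 'n ^ 'n. M \<in> mats Oi \<and> M ** M' = mat 1 \<and> (\<forall>j. M *v axis j 1 \<in> min1 h)"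
proof -
  have fin: "finite (min1 h)" using h finite_min1 by (auto simp: unit_perfect_def)
  define P where "P = (\<Sum>x\<in>min1 h. rank_one x)"
  have Pv: "P *v v = (\<Sum>x\<in>min1 h. cdot x v *s x)" for v
    by (simp add: P_def sum_matrix_vector rank_one_mult_vec)
  have "inj ((*v) P)"
  proof (rule injI)
    fix u v assume "P *v u = P *v v"
    then have "P *v (u - v) = 0" by (simp add: matrix_vector_mult_diff_distrib)
    then have "0 = form_at P (u - v)" by (simp add: form_at_cdot cdot_zero_right)
    also have "\<dots> = (\<Sum>x\<in>min1 h. (cmod (cdot x (u - v)))\<^sup>2)"
      by (simp add: form_at_inner P_def inner_sum_left flip: form_at_rank_one)
    finally have "\<forall>x\<in>min1 h. (cmod (cdot x (u - v)))\<^sup>2 = 0"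
      using fin by (metis (no_types, lifting) sum_nonneg_eq_0_iff zero_le_power2)
    then have "cdot x (u - v) = 0" if "x \<in> min1 h" for x using that by simp
    then have "u - v = 0" by (rule cdot_min1_separates[OF h])
    then show "u = v" by simp
  qed
  then obtain B where "B ** P = mat 1" using matrix_left_invertible_injective by blast
  then have "P ** B = mat 1" using matrix_left_right_inverse by blast
  then have PB: "P *v (B *v v) = v" for v by (simp add: matrix_vector_mul_assoc)
  have "P *v (B *v v) \<in> vec.span (min1 h)" for v
    unfolding Pv by (intro vec.span_sum vec.span_scale vec.span_base)
  then have span: "vec.span (min1 h) = UNIV" unfolding PB by blast
  obtain S where S: "S \<subseteq> min1 h" "vec.independent S" "min1 h \<subseteq> vec.span S" "card S = vec.dim (min1 h)"
    using vec.basis_exists by blast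
  have "vec.span (min1 h) \<subseteq> vec.span S" by (rule vec.span_minimal[OF S(3) vec.subspace_span])
  then have "vec.span S = UNIV" using span by blast
  moreover have "card S = CARD('n)"
    unfolding S(4) vec.dim_span[of "min1 h", symmetric] span vec_dim_card ..
  ultimately obtain f where f: "bij_betw f (UNIV :: 'n set) S"
    using finite_same_card_bij[of UNIV S] fin S(1) finite_subset by (metis finite)
  define M :: "complex ^ 'n ^ 'n" where "M = (\<chi> i j. f j $ i)"
  have col: "column j M = f j" for j by (simp add: column_def M_def Finite_Cartesian_Product.vec_eq_iff)
  then have "columns M = S" using f by (auto simp: columns_def bij_betw_def)
  then obtain M' where "M ** M' = mat 1"
    using matrix_right_invertible_span_columns[of M] \<open>vec.span S = UNIV\<close> by blast
  moreover have fS: "f j \<in> min1 h" for j using f S(1) by (auto simp: bij_betw_def)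
  moreover have "M \<in> mats Oi" using fS by (auto simp: mats_def M_def min1_def vecs_def)
  ultimately show ?thesis using col mult_axis by metis
qed

text \<open>
  For \<open>K = \<real>\<close>, the complex conjugate of \<open>M'\<close> is an inverse of \<open>M\<close> as well.
\<close>

lemma inverse_K:
  fixes M M' :: "complex ^ 'n ^ 'n"
  assumes "M \<in> mats K" "M ** M' = mat 1"
  shows "M' \<in> mats K"
proof (cases "K = UNIV")
  case False
  then have KR: "K = \<real>" using K_cases by blast
  have re: "cnj (M $ i $ j) = M $ i $ j" for i j
    using assms(1) KR by (simp add: mats_def Reals_cnj_iff)
  define N :: "complex ^ 'n ^ 'n" where "N = (\<chi> i j. cnj (M' $ i $ j))"
  have "(M ** N) $ i $ j = cnj ((M ** M') $ i $ j)" for i j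
    by (simp add: matrix_matrix_mult_def N_def re)
  then have "M ** N = mat 1"
    by (simp add: assms(2) Finite_Cartesian_Product.vec_eq_iff Finite_Cartesian_Product.mat_def)
  moreover have "M' ** M = mat 1" using assms(2) matrix_left_right_inverse by blast
  ultimately have "N = M'" by (metis matrix_mul_assoc matrix_mul_lid matrix_mul_rid)
  then have "cnj (M' $ i $ j) = M' $ i $ j" for i j
    unfolding N_def Finite_Cartesian_Product.vec_eq_iff by simp
  then show ?thesis using KR by (simp add: mats_def Reals_cnj_iff)
qed (simp add: mats_def)

text \<open>
  The Cauchy-Schwarz inequality for \<open>h\<close>, in the form \<open>2 Re \<langle>a, h b\<rangle> \<le> h(a) + h(b)\<close>.
\<close>

lemma psd_sum:
  assumes h: "h \<in> herm F" "psd h" and I: "finite I" and y: "\<And>i. i \<in> I \<Longrightarrow> y i \<in> vecs K"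
  shows "form_at h (\<Sum>i\<in>I. y i) \<le> real (card I) * (\<Sum>i\<in>I. form_at h (y i))"
proof -
  have cross: "Re (cdot a (h *v b)) \<le> (form_at h a + form_at h b) / 2" if "a \<in> vecs K" "b \<in> vecs K" for a b
  proof -
    have "a + (- 1) *s b \<in> vecs K" using that K_minus[OF K_1] by (intro vecs_K_add vecs_K_smult)
    then have "0 \<le> form_at h (a + (- 1) *s b)" using h(2) unfolding psd_def by blast
    also have "\<dots> = form_at h a + form_at h b - 2 * Re (cdot a (h *v b))"
      unfolding form_at_add[OF herm_sym[OF h(1)]] vector_scalar_commute cdot_smult_right form_at_smult by simp
    finally show ?thesis by simp
  qed
  have cdot_sum: "cdot (\<Sum>i\<in>I. y i) z = (\<Sum>i\<in>I. cdot (y i) z)" for z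
    using I by (induction I rule: finite_induct) (simp_all add: cdot_zero_left cdot_add_left)
  have cdot_sum_r: "cdot z (h *v (\<Sum>i\<in>I. y i)) = (\<Sum>i\<in>I. cdot z (h *v y i))" for z
    using I by (induction I rule: finite_induct) (simp_all add: cdot_zero_right cdot_add_right matrix_vector_right_distrib)
  have "form_at h (\<Sum>i\<in>I. y i) = (\<Sum>i\<in>I. Re (cdot (y i) (h *v (\<Sum>j\<in>I. y j))))"
    unfolding form_at_cdot cdot_sum Re_sum ..
  also have "\<dots> = (\<Sum>i\<in>I. \<Sum>j\<in>I. Re (cdot (y i) (h *v y j)))"
    unfolding cdot_sum_r Re_sum ..
  also have "\<dots> \<le> (\<Sum>i\<in>I. \<Sum>j\<in>I. (form_at h (y i) + form_at h (y j)) / 2)"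
    using y by (intro sum_mono cross)
  also have "\<dots> = real (card I) * (\<Sum>i\<in>I. form_at h (y i))"
    by (simp add: add_divide_distrib sum.distrib flip: sum_divide_distrib sum_distrib_left)
  finally show ?thesis .
qed

text \<open>
  Let \<open>t\<close> be a column of \<open>M\<^sup>-\<^sup>1\<close>, so that \<open>M t = e\<^sub>j\<close>, and let \<open>p / k\<close> be an approximation of
  \<open>t\<close> with \<open>k \<le> B\<close>. For the remainder \<open>r = k t - p\<close>, the vector \<open>M r\<close> belongs to the lattice;
  its value under \<open>h\<close> is below \<open>1\<close>, since \<open>h\<close> is \<open>1\<close> on the columns of \<open>M\<close> and \<open>r\<close> is small.
  Hence \<open>M r = 0\<close>, and \<open>k t = p\<close> is integral. So \<open>B!\<close> is a denominator for every \<open>M\<close> and every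
  \<open>h\<close>.
\<close>

lemma frame_inverse_denominator:
  "\<exists>N::nat>0. \<forall>h\<in>ryshkov. \<forall>M\<in>mats Oi. \<forall>M' :: complex ^ 'n ^ 'n. M ** M' = mat 1 \<and> (\<forall>j. M *v axis j 1 \<in> min1 h)
     \<longrightarrow> (\<forall>i j. of_nat N * M' $ i $ j \<in> Oi)"
proof -
  define n where "n = CARD('n)"
  have n: "n > 0" by (simp add: n_def)
  obtain B where B: "\<forall>y::complex ^ 'n \<in> vecs K. \<exists>k\<in>{1..B}. \<exists>p\<in>vecs Oi.
           \<forall>i. cmod (of_nat k * y $ i - p $ i) < 1 / real n"
    using simultaneous_approximation[of "1 / real n"] n by auto
  have "of_nat (fact B) * M' $ i $ j \<in> Oi"
    if h: "h \<in> ryshkov" and M: "M \<in> mats Oi" "M ** M' = mat 1" "\<forall>j. M *v axis j 1 \<in> min1 h"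
    for h M M' :: "complex ^ 'n ^ 'n" and i j
  proof -
    define t where "t = M' *v axis j 1"
    have M'M: "M' ** M = mat 1" using M(2) matrix_left_right_inverse by blast
    have t: "t \<in> vecs K" unfolding t_def by (intro mats_K_vecs inverse_K[OF _ M(2)] mats_Oi_K M axis_K)
    have Mt: "M *v t = axis j 1" by (simp add: t_def matrix_vector_mul_assoc M)
    obtain k p where kp: "k \<in> {1..B}" "p \<in> vecs Oi" "\<forall>i. cmod (of_nat k * t $ i - p $ i) < 1 / real n"
      using B t by blast
    define r where "r = of_nat k *s t - p"
    have r: "cmod (r $ i) < 1 / real n" for i using kp(3) by (simp add: r_def)
    have rK: "r \<in> vecs K" unfolding r_def by (intro vecs_K_diff vecs_K_smult t K_nat vecs_Oi_K kp)
    have "M *v r = of_nat k *s axis j 1 - M *v p"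
      by (simp add: r_def matrix_vector_mult_diff_distrib vector_scalar_commute Mt)
    moreover have "of_nat k *s axis j 1 \<in> vecs Oi"
      using axis_Oi[of j] Oi_int[of "int k"] by (simp add: vecs_def Oi_mult)
    ultimately have MrO: "M *v r \<in> vecs Oi" using mats_Oi_vecs[OF M(1) kp(2)] vecs_Oi_diff by simp
    have Mr: "M *v r = (\<Sum>i\<in>UNIV. r $ i *s column i M)" by (rule matrix_mult_sum)
    have "form_at h (M *v r) \<le> real n * (\<Sum>i\<in>UNIV. form_at h (r $ i *s column i M))"
    proof -
      have "column i M \<in> vecs K" for i using M(3) min1_K by (metis mult_axis)
      then have "r $ i *s column i M \<in> vecs K" for i using vecs_D[OF rK] vecs_K_smult by blast
      then show ?thesis
        unfolding Mr n_def
        by (intro psd_sum[OF ryshkov_herm[OF h] ryshkov_psd[OF h]]) auto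
    qed
    also have "(\<Sum>i\<in>UNIV. form_at h (r $ i *s column i M)) = (\<Sum>i\<in>UNIV. (cmod (r $ i))\<^sup>2)"
      using M(3) by (simp add: form_at_smult mult_axis min1_def)
    also have "\<dots> < (\<Sum>i\<in>(UNIV::'n set). (1 / real n)\<^sup>2)"
      by (rule sum_strict_mono) (auto intro!: power_strict_mono r)
    also have "\<dots> = 1 / real n" using n by (simp add: power2_eq_square n_def[symmetric])
    finally have "form_at h (M *v r) < 1" using n by simp
    then have "M *v r = 0" using MrO h unfolding ryshkov_def by force
    then have "M' *v (M *v r) = 0" by simp
    then have "r = 0" by (simp add: matrix_vector_mul_assoc M'M)
    then have "of_nat k * t $ i = p $ i"
      unfolding r_def Finite_Cartesian_Product.vec_eq_iff by simp
    moreover obtain m where "fact B = k * m" using dvd_fact[of k B] kp(1) by auto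
    ultimately have "of_nat (fact B) * t $ i = of_int (int m) * p $ i" by (simp add: mult_ac)
    also have "\<dots> \<in> Oi" using kp(2) by (intro Oi_mult Oi_int) (simp add: vecs_def)
    finally show ?thesis by (simp add: t_def mult_axis column_def)
  qed
  then show ?thesis by (intro exI[of _ "fact B"]) (auto simp del: of_nat_fact)
qed

text \<open>
  Subtract the integral parts of the two real coordinates of \<open>z / N\<close> with respect to \<open>1\<close> and
  \<open>w\<close>.
\<close>

lemma finite_residues:
  assumes N: "N > (0::nat)"
  shows "\<exists>S. finite S \<and> S \<subseteq> Oi \<and> (\<forall>z\<in>Oi. \<exists>r\<in>S. \<exists>q\<in>Oi. z = r + of_nat N * q)"
proof (intro exI conjI ballI)
  define c where "c = real N * (1 + cmod w)"
  show "finite {x \<in> Oi. cmod x \<le> c}" by (rule finite_Oi_ball)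
  show "{x \<in> Oi. cmod x \<le> c} \<subseteq> Oi" by blast
  fix z assume z: "z \<in> Oi"
  then obtain a b :: real where ab: "z = of_real a + of_real b * w" using K_decomp Oi_K by blast
  define q where "q = of_int \<lfloor>a / N\<rfloor> + of_int \<lfloor>b / N\<rfloor> * w"
  define r where "r = z - of_nat N * q"
  have q: "q \<in> Oi" unfolding q_def by (rule Oi_Zw)
  have rO: "r \<in> Oi" unfolding r_def using z q Oi_int[of "int N"] by (simp add: Oi_diff Oi_mult)
  have "r = of_nat N * (of_real (frac (a / N)) + of_real (frac (b / N)) * w)"
    using N by (simp add: r_def q_def ab frac_def field_simps)
  then have "cmod r = real N * cmod (of_real (frac (a / N)) + of_real (frac (b / N)) * w)"
    by (simp add: norm_mult)
  also have "cmod (of_real (frac (a / N)) + of_real (frac (b / N)) * w) \<le> 1 + 1 * cmod w"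
    by (rule order_trans[OF norm_triangle_ineq], unfold norm_mult norm_of_real)
      (intro add_mono mult_right_mono, auto simp: frac_ge_0 less_imp_le[OF frac_lt_1])
  finally have "cmod r \<le> c" by (simp add: c_def mult_left_mono)
  then show "\<exists>r\<in>{x \<in> Oi. cmod x \<le> c}. \<exists>q\<in>Oi. z = r + of_nat N * q"
    using rO q by (intro bexI[of _ r] bexI[of _ q]) (auto simp: r_def)
qed

abbreviation GLO where "GLO \<equiv> carrier (GL Oi)"

lemma GLO_iff: "\<gamma> \<in> GLO \<longleftrightarrow> \<gamma> \<in> mats Oi \<and> (\<exists>\<delta>\<in>mats Oi. \<gamma> ** \<delta> = mat 1 \<and> \<delta> ** \<gamma> = mat 1)"
  by (auto simp: GL_def)

lemma GLO_inverse:
  assumes "\<gamma> \<in> GLO"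
  obtains \<delta> where "\<delta> \<in> GLO" "\<gamma> ** \<delta> = mat 1" "\<delta> ** \<gamma> = mat 1"
  using assms unfolding GLO_iff by blast

lemma GLO_Oi: "\<gamma> \<in> GLO \<Longrightarrow> \<gamma> \<in> mats Oi" and GLO_K: "\<gamma> \<in> GLO \<Longrightarrow> \<gamma> \<in> mats K"
  by (simp_all add: GLO_iff mats_Oi_K)

lemma ryshkov_act:
  assumes g: "\<gamma> \<in> GLO" and h: "h \<in> ryshkov"
  shows "act (conj_transpose \<gamma>) h \<in> ryshkov"
proof -
  obtain \<delta> where \<delta>: "\<delta> ** \<gamma> = mat 1" using GLO_inverse[OF g] by blast
  have "\<gamma> *v x \<noteq> 0" if "x \<noteq> 0" for x
  proof
    assume "\<gamma> *v x = 0"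
    then have "\<delta> *v (\<gamma> *v x) = 0" by simp
    then show False using that by (simp add: matrix_vector_mul_assoc \<delta>)
  qed
  then show ?thesis
    using h act_herm[OF mats_K_conj_transpose[OF GLO_K[OF g]]] mats_Oi_vecs[OF GLO_Oi[OF g]]
    by (auto simp: ryshkov_def form_at_act)
qed

lemma min1_act:
  assumes g: "\<gamma> \<in> GLO" and d: "\<gamma> ** \<delta> = mat 1" "\<delta> ** \<gamma> = mat 1" "\<delta> \<in> mats Oi"
  shows "min1 (act (conj_transpose \<gamma>) h) = (*v) \<delta> ` min1 h"
proof -
  have inv: "\<delta> *v (\<gamma> *v x) = x" "\<gamma> *v (\<delta> *v x) = x" for x
    using d by (simp_all add: matrix_vector_mul_assoc)
  show ?thesis
  proof (intro equalityI subsetI)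
    fix x assume x: "x \<in> min1 (act (conj_transpose \<gamma>) h)"
    then have "\<gamma> *v x \<in> min1 h"
      using mats_Oi_vecs[OF GLO_Oi[OF g], of x] inv(1)[of x] by (auto simp: min1_def form_at_act)
    then show "x \<in> (*v) \<delta> ` min1 h" using inv(1)[of x] by (metis imageI)
  next
    fix x assume "x \<in> (*v) \<delta> ` min1 h"
    then obtain y where y: "y \<in> min1 h" "x = \<delta> *v y" by blast
    then have "x \<noteq> 0" using inv(2)[of y] by (auto simp: min1_def)
    then show "x \<in> min1 (act (conj_transpose \<gamma>) h)"
      using y mats_Oi_vecs[OF d(3), of y] inv(2)[of y] by (auto simp: min1_def form_at_act)
  qed
qed

lemma act_image_herm:
  assumes "\<gamma> \<in> GLO"
  shows "act \<gamma> ` herm F = herm F"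
proof -
  obtain \<delta> where \<delta>: "\<delta> \<in> GLO" "\<gamma> ** \<delta> = mat 1" using GLO_inverse[OF assms] by blast
  have "act \<gamma> ` herm F \<subseteq> herm F" using act_herm GLO_K assms by blast
  moreover have "herm F = act \<gamma> ` act \<delta> ` herm F"
    using \<delta>(2) by (simp flip: act_image_mult add: act_image_one)
  moreover have "act \<delta> ` herm F \<subseteq> herm F" using act_herm GLO_K \<delta>(1) by blast
  ultimately show ?thesis by blast
qed

lemma unit_perfect_act:
  assumes g: "\<gamma> \<in> GLO" and h: "unit_perfect h"
  shows "unit_perfect (act (conj_transpose \<gamma>) h)"
proof -
  obtain \<delta> where \<delta>: "\<delta> \<in> GLO" "\<gamma> ** \<delta> = mat 1" "\<delta> ** \<gamma> = mat 1" using GLO_inverse[OF g] by blast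
  have "rank_one ` min1 (act (conj_transpose \<gamma>) h) = act \<delta> ` rank_one ` min1 h"
    using min1_act[OF g \<delta>(2,3) GLO_Oi[OF \<delta>(1)], of h] by (simp add: image_image act_rank_one)
  then have "span (rank_one ` min1 (act (conj_transpose \<gamma>) h)) = act \<delta> ` span (rank_one ` min1 h)"
    by (simp add: linear_span_image linear_act)
  then show ?thesis using h ryshkov_act[OF g] act_image_herm[OF \<delta>(1)] by (auto simp: unit_perfect_def)
qed

text \<open>
  Attach to every perfect form a basis \<open>M\<close> of minimal vectors. By the bounded denominators of
  \<open>M\<^sup>-\<^sup>1\<close>, two such bases that are congruent modulo \<open>N\<close> differ by an element of \<open>GL\<^sub>n(\<O>)\<close> on
  the left. Hence every perfect form can be moved to one for which the columns of one of
  finitely many matrices are minimal, and for each matrix there are only finitely many such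
  forms.
\<close>

theorem finite_unit_perfect_mod_GLO:
  "\<exists>S :: (complex ^ 'n ^ 'n) set. finite S \<and> (\<forall>h\<in>S. unit_perfect h) \<and>
     (\<forall>h. unit_perfect h \<longrightarrow> (\<exists>\<gamma>\<in>GLO. act (conj_transpose \<gamma>) h \<in> S))"
proof -
  define fr where "fr M M' h \<longleftrightarrow> unit_perfect h \<and> M \<in> mats Oi \<and> M ** M' = mat 1 \<and> (\<forall>j. M *v axis j 1 \<in> min1 h)"
    for M M' h :: "complex ^ 'n ^ 'n"
  obtain N :: nat where N0: "N > 0" "\<forall>h\<in>ryshkov. \<forall>M\<in>mats Oi. \<forall>M' :: complex ^ 'n ^ 'n.
      M ** M' = mat 1 \<and> (\<forall>j. M *v axis j 1 \<in> min1 h) \<longrightarrow> (\<forall>i j. of_nat N * M' $ i $ j \<in> Oi)"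
    using frame_inverse_denominator by blast
  have N: "N > 0" "\<And>h M M' :: complex ^ 'n ^ 'n. fr M M' h \<Longrightarrow> \<forall>i j. of_nat N * M' $ i $ j \<in> Oi"
    using N0 unfolding fr_def unit_perfect_def by blast+
  obtain Rs where Rs: "finite Rs" "\<forall>z\<in>Oi. \<exists>r\<in>Rs. \<exists>q\<in>Oi. z = r + of_nat N * q"
    using finite_residues[OF N(1)] by blast
  define cong where "cong M D \<longleftrightarrow> (\<exists>Q\<in>mats Oi. M = D + (\<chi> i j. of_nat N * Q $ i $ j))" for M D :: "complex ^ 'n ^ 'n"
  have res: "\<exists>D\<in>mats Rs. cong M D" if "M \<in> mats Oi" for M :: "complex ^ 'n ^ 'n"
  proof -
    have "\<exists>r q. r \<in> Rs \<and> q \<in> Oi \<and> M $ i $ j = r + of_nat N * q" for i j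
      using that Rs(2) unfolding mats_def by blast
    then obtain r q where p: "\<And>i j. r i j \<in> Rs" "\<And>i j. q i j \<in> Oi"
      "\<And>i j. M $ i $ j = r i j + of_nat N * q i j" by metis
    define D Q :: "complex ^ 'n ^ 'n" where "D = (\<chi> i j. r i j)" and "Q = (\<chi> i j. q i j)"
    have "D \<in> mats Rs" "Q \<in> mats Oi" "M = D + (\<chi> i j. of_nat N * Q $ i $ j)"
      by (simp_all add: mats_def D_def Q_def p(1,2) Finite_Cartesian_Product.vec_eq_iff) (simp add: p(3))
    then show ?thesis unfolding cong_def by blast
  qed
  define \<D> where "\<D> = {D \<in> mats Rs. \<exists>M M' h. fr M M' h \<and> cong M D}"
  have "finite \<D>" unfolding \<D>_def
    by (rule finite_subset[OF _ finite_mats[OF Rs(1)]]) auto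
  have "\<forall>D\<in>\<D>. \<exists>p. fr (fst p) (fst (snd p)) (snd (snd p)) \<and> cong (fst p) D"
    unfolding \<D>_def by force
  from bchoice[OF this] obtain p where
    p: "\<And>D. D \<in> \<D> \<Longrightarrow> fr (fst (p D)) (fst (snd (p D))) (snd (snd (p D))) \<and> cong (fst (p D)) D"
    by blast
  define S where "S = (\<Union>D\<in>\<D>. {h. unit_perfect h \<and> (\<forall>j. form_at h (fst (p D) *v axis j 1) \<le> 1)})"
  have "finite S"
    unfolding S_def
  proof (rule finite_UN_I[OF \<open>finite \<D>\<close>])
    fix D assume "D \<in> \<D>"
    then have "fr (fst (p D)) (fst (snd (p D))) (snd (snd (p D)))" using p by blast
    then show "finite {h. unit_perfect h \<and> (\<forall>j. form_at h (fst (p D) *v axis j 1) \<le> 1)}"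
      unfolding fr_def by (intro finite_unit_perfect_bounded[where M' = "fst (snd (p D))"]) (auto simp: mats_Oi_K)
  qed
  \<comment> \<open>\<open>L M\<^sup>-\<^sup>1 = 1 + (L - M) M\<^sup>-\<^sup>1\<close>, where \<open>N\<close> divides \<open>L - M\<close> and clears the denominators of
    \<open>M\<^sup>-\<^sup>1\<close>.\<close>
  have quotient: "L ** M' \<in> mats Oi" if "fr M M' h" "L \<in> mats Oi" "cong L D" "cong M D" for L M M' h D
  proof -
    obtain Q where Q1: "Q \<in> mats Oi" "L = D + (\<chi> i j. of_nat N * Q $ i $ j)"
      using \<open>cong L D\<close> unfolding cong_def by blast
    obtain Q' where Q2: "Q' \<in> mats Oi" "M = D + (\<chi> i j. of_nat N * Q' $ i $ j)"
      using \<open>cong M D\<close> unfolding cong_def by blast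
    note Q = Q1(1) Q2(1) Q1(2) Q2(2)
    have "L = M + (\<chi> i j. of_nat N * (Q - Q') $ i $ j)"
      by (simp add: Q(3,4) Finite_Cartesian_Product.vec_eq_iff algebra_simps)
    then have "L ** M' = mat 1 + (\<chi> i j. of_nat N * (Q - Q') $ i $ j) ** M'"
      using that(1) by (simp add: fr_def matrix_mult_add_left)
    also have "(\<chi> i j. of_nat N * (Q - Q') $ i $ j) ** M' = (Q - Q') ** (\<chi> i j. of_nat N * M' $ i $ j)"
      by (simp add: matrix_matrix_mult_def Finite_Cartesian_Product.vec_eq_iff mult_ac)
    finally have "L ** M' = mat 1 + (Q - Q') ** (\<chi> i j. of_nat N * M' $ i $ j)" .
    moreover have "(Q - Q') ** (\<chi> i j. of_nat N * M' $ i $ j) \<in> mats Oi"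
      using Q N(2)[OF that(1)] by (intro mats_Oi_mult) (auto simp: mats_def Oi_diff)
    moreover have "A + B \<in> mats Oi" if "A \<in> mats Oi" "B \<in> mats Oi" for A B :: "complex ^ 'n ^ 'n"
      using that by (simp add: mats_def Oi_add)
    ultimately show ?thesis using mats_Oi_one by simp
  qed
  have "\<exists>\<gamma>\<in>GLO. act (conj_transpose \<gamma>) h \<in> S" if h: "unit_perfect h" for h
  proof -
    obtain M M' where M: "fr M M' h" using min1_frame[OF h] h unfolding fr_def by blast
    obtain D where D: "D \<in> mats Rs" "cong M D" using res M unfolding fr_def by blast
    then have "D \<in> \<D>" unfolding \<D>_def using M by blast
    define L L' h0 where "L = fst (p D)" and "L' = fst (snd (p D))" and "h0 = snd (snd (p D))"
    have L: "fr L L' h0" "cong L D" using p[OF \<open>D \<in> \<D>\<close>] by (simp_all add: L_def L'_def h0_def)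
    have "M ** L' \<in> mats Oi" using quotient[OF L(1) _ D(2) L(2)] M by (simp add: fr_def)
    moreover have "L ** M' \<in> mats Oi" using quotient[OF M _ L(2) D(2)] L by (simp add: fr_def)
    moreover have LL: "L' ** L = mat 1" "M' ** M = mat 1"
      using L M matrix_left_right_inverse unfolding fr_def by blast+
    have one: "(M ** L') ** (L ** M') = mat 1"
    proof -
      have "(M ** L') ** (L ** M') = M ** ((L' ** L) ** M')" by (simp only: matrix_mul_assoc)
      then show ?thesis using M LL by (simp add: fr_def)
    qed
    ultimately have g: "M ** L' \<in> GLO" unfolding GLO_iff using matrix_left_right_inverse by blast
    have "form_at (act (conj_transpose (M ** L')) h) (L *v axis j 1) \<le> 1" for j
    proof -
      have "(M ** L') *v (L *v axis j 1) = (M ** (L' ** L)) *v axis j 1"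
        by (simp only: matrix_vector_mul_assoc matrix_mul_assoc)
      also have "\<dots> = M *v axis j 1" by (simp add: LL)
      finally have "form_at (act (conj_transpose (M ** L')) h) (L *v axis j 1) = form_at h (M *v axis j 1)"
        by (simp only: form_at_act)
      then show ?thesis using M by (simp add: fr_def min1_def)
    qed
    then have "act (conj_transpose (M ** L')) h \<in> S"
      unfolding S_def using \<open>D \<in> \<D>\<close> unit_perfect_act[OF g h] L_def by blast
    then show ?thesis using g by blast
  qed
  moreover have "\<forall>h\<in>S. unit_perfect h" by (simp add: S_def)
  ultimately show ?thesis using \<open>finite S\<close> by blast
qed

end

section \<open>Voronoi domains and their facets\<close>

definition vcone :: "(complex ^ 'n) set \<Rightarrow> (complex ^ 'n ^ 'n) set" where
  "vcone S = {(\<Sum>x\<in>S. l x *\<^sub>R rank_one x) | l :: complex ^ 'n \<Rightarrow> real. \<forall>x. 0 \<le> l x}"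

lemma vcone_I: "(\<And>x. 0 \<le> l x) \<Longrightarrow> (\<Sum>x\<in>S. l x *\<^sub>R rank_one x) \<in> vcone S"
  unfolding vcone_def by blast

lemma vcone_0: "0 \<in> vcone S"
  using vcone_I[of "\<lambda>_. 0" S] by simp

lemma vcone_add: "X \<in> vcone S \<Longrightarrow> Y \<in> vcone S \<Longrightarrow> X + Y \<in> vcone S"
proof -
  assume "X \<in> vcone S" "Y \<in> vcone S"
  then obtain l m where "X = (\<Sum>x\<in>S. l x *\<^sub>R rank_one x)" "Y = (\<Sum>x\<in>S. m x *\<^sub>R rank_one x)"
    and nn: "\<And>x. 0 \<le> l x" "\<And>x. 0 \<le> m x" unfolding vcone_def by blast
  then have "X + Y = (\<Sum>x\<in>S. (l x + m x) *\<^sub>R rank_one x)"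
    by (simp add: scaleR_add_left sum.distrib)
  then show ?thesis using vcone_I[of "\<lambda>x. l x + m x" S] nn by simp
qed

lemma vcone_scaleR: "X \<in> vcone S \<Longrightarrow> 0 \<le> c \<Longrightarrow> c *\<^sub>R X \<in> vcone S"
proof -
  assume "X \<in> vcone S" and c: "0 \<le> c"
  then obtain l where "X = (\<Sum>x\<in>S. l x *\<^sub>R rank_one x)" and nn: "\<And>x. 0 \<le> l x"
    unfolding vcone_def by blast
  then have "c *\<^sub>R X = (\<Sum>x\<in>S. (c * l x) *\<^sub>R rank_one x)" by (simp add: scaleR_sum_right)
  then show ?thesis using vcone_I[of "\<lambda>x. c * l x" S] nn c by simp
qed

lemma rank_one_vcone: "finite S \<Longrightarrow> x \<in> S \<Longrightarrow> rank_one x \<in> vcone S"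
  using vcone_I[of "\<lambda>y. if y = x then 1 else 0" S] by (simp add: if_distrib[of "\<lambda>r. r *\<^sub>R _"] cong: if_cong)

lemma convex_cone_vcone: "convex_cone (vcone S)"
  unfolding convex_cone_iff using vcone_0 vcone_add vcone_scaleR by blast

lemma convex_vcone: "convex (vcone S)"
  using convex_cone_vcone[of S] by (simp add: convex_cone_def)

lemma vcone_eq_hull:
  assumes "finite S"
  shows "vcone S = convex_cone hull (rank_one ` S)"
proof (rule hull_unique[symmetric])
  show "rank_one ` S \<subseteq> vcone S" using rank_one_vcone[OF assms] by blast
  show "convex_cone (vcone S)" by (rule convex_cone_vcone)
  fix T assume T: "rank_one ` S \<subseteq> T" "convex_cone T"
  have "(\<Sum>x\<in>S'. l x *\<^sub>R rank_one x) \<in> T" if "S' \<subseteq> S" "\<And>x. 0 \<le> l x" for l S'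
    using finite_subset[OF that(1) assms] that(1)
  proof (induction S' rule: finite_induct)
    case empty
    then show ?case using convex_cone_contains_0[OF T(2)] by simp
  next
    case (insert x S')
    then have "rank_one x \<in> T" using T(1) by blast
    then have "l x *\<^sub>R rank_one x \<in> T" using convex_cone_scaleR[OF T(2)] that(2) by blast
    then show ?case using insert convex_cone_add[OF T(2)] by simp
  qed
  then show "vcone S \<subseteq> T" unfolding vcone_def by blast
qed

lemma polyhedron_vcone: "finite S \<Longrightarrow> polyhedron (vcone S)"
  by (simp add: vcone_eq_hull polyhedron_convex_cone_hull)

lemma span_vcone:
  assumes "finite S"
  shows "span (vcone S) = span (rank_one ` S)"
proof (rule span_eq[THEN iffD2], intro conjI subsetI)
  fix X assume "X \<in> vcone S"
  then obtain l where "X = (\<Sum>x\<in>S. l x *\<^sub>R rank_one x)" unfolding vcone_def by blast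
  then show "X \<in> span (rank_one ` S)" by (simp add: span_sum span_scale span_base)
next
  fix X assume "X \<in> rank_one ` S"
  then show "X \<in> span (vcone S)" using rank_one_vcone[OF assms] span_base by blast
qed

lemma inner_vcone_nonneg:
  assumes "\<And>x. x \<in> S \<Longrightarrow> 0 \<le> form_at \<psi> x" "X \<in> vcone S"
  shows "0 \<le> \<psi> \<bullet> X"
  using assms unfolding vcone_def by (auto simp: inner_sum_right form_at_inner intro!: sum_nonneg)

lemma vcone_mono_zero:
  assumes "finite S" "S' \<subseteq> S"
  shows "vcone S' \<subseteq> vcone S"
proof
  fix X assume "X \<in> vcone S'"
  then obtain l where X: "X = (\<Sum>x\<in>S'. l x *\<^sub>R rank_one x)" and nn: "\<And>x. 0 \<le> l x"
    unfolding vcone_def by blast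
  have "X = (\<Sum>x\<in>S. (if x \<in> S' then l x else 0) *\<^sub>R rank_one x)"
    unfolding X using assms by (intro sum.mono_neutral_cong_left) auto
  then show "X \<in> vcone S" using vcone_I[of "\<lambda>x. if x \<in> S' then l x else 0" S] nn by simp
qed

lemma vcone_Int_hyperplane:
  assumes S: "finite S" and nn: "\<And>x. x \<in> S \<Longrightarrow> 0 \<le> form_at \<psi> x"
  shows "vcone S \<inter> {X. \<psi> \<bullet> X = 0} = vcone {x \<in> S. form_at \<psi> x = 0}"
proof (intro equalityI subsetI)
  fix X assume X: "X \<in> vcone S \<inter> {X. \<psi> \<bullet> X = 0}"
  then obtain l where l: "X = (\<Sum>x\<in>S. l x *\<^sub>R rank_one x)" "\<And>x. 0 \<le> l x" unfolding vcone_def by blast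
  have "(\<Sum>x\<in>S. l x * form_at \<psi> x) = 0" using X l(1) by (simp add: inner_sum_right form_at_inner)
  then have zero: "\<forall>x\<in>S. l x * form_at \<psi> x = 0"
    using sum_nonneg_eq_0_iff[OF S, of "\<lambda>x. l x * form_at \<psi> x"] l(2) nn by simp
  have "X = (\<Sum>x\<in>{x \<in> S. form_at \<psi> x = 0}. l x *\<^sub>R rank_one x)"
    unfolding l(1) using S zero by (intro sum.mono_neutral_right) auto
  then show "X \<in> vcone {x \<in> S. form_at \<psi> x = 0}" using vcone_I[of l] l(2) by simp
next
  fix X assume X: "X \<in> vcone {x \<in> S. form_at \<psi> x = 0}"
  then obtain l where l: "X = (\<Sum>x\<in>{x \<in> S. form_at \<psi> x = 0}. l x *\<^sub>R rank_one x)" unfolding vcone_def by blast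
  then have "\<psi> \<bullet> X = 0" by (simp add: inner_sum_right form_at_inner[symmetric])
  moreover have "X \<in> vcone S" using vcone_mono_zero[OF S, of "{x \<in> S. form_at \<psi> x = 0}"] X by blast
  ultimately show "X \<in> vcone S \<inter> {X. \<psi> \<bullet> X = 0}" by blast
qed

lemma form_at_vcone:
  "form_at (\<Sum>x\<in>S. l x *\<^sub>R rank_one x) v = (\<Sum>x\<in>S. l x * (cmod (cdot x v))\<^sup>2)"
  by (simp add: form_at_inner inner_sum_left flip: form_at_rank_one)

lemma vcone_psd: "X \<in> vcone S \<Longrightarrow> 0 \<le> form_at X v"
  unfolding vcone_def by (auto simp: form_at_vcone intro!: sum_nonneg)

lemma vcone_image:
  assumes "inj_on ((*v) A) S"
  shows "vcone ((*v) A ` S) = act A ` vcone S"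
proof -
  have eq: "act A (\<Sum>x\<in>S. l x *\<^sub>R rank_one x) = (\<Sum>y\<in>(*v) A ` S. l (inv_into S ((*v) A) y) *\<^sub>R rank_one y)" for l
    by (simp add: linear_sum[OF linear_act] linear_cmul[OF linear_act] act_rank_one sum.reindex[OF assms] inv_into_f_f[OF assms])
  show ?thesis
  proof (intro equalityI subsetI)
    fix X assume "X \<in> vcone ((*v) A ` S)"
    then obtain l where l: "X = (\<Sum>y\<in>(*v) A ` S. l y *\<^sub>R rank_one y)" "\<And>y. 0 \<le> l y" unfolding vcone_def by blast
    have "X = act A (\<Sum>x\<in>S. l (A *v x) *\<^sub>R rank_one x)"
      by (simp add: l(1) linear_sum[OF linear_act] linear_cmul[OF linear_act] act_rank_one sum.reindex[OF assms])
    then show "X \<in> act A ` vcone S" using vcone_I[of "\<lambda>x. l (A *v x)" S] l(2) by blast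
  next
    fix X assume "X \<in> act A ` vcone S"
    then obtain l where l: "X = act A (\<Sum>x\<in>S. l x *\<^sub>R rank_one x)" "\<And>y. 0 \<le> l y" unfolding vcone_def by blast
    then show "X \<in> vcone ((*v) A ` S)"
      using vcone_I[of "\<lambda>y. l (inv_into S ((*v) A) y)" "(*v) A ` S"] by (simp add: eq)
  qed
qed

text \<open>
  All coefficients of the sum are positive, so a segment from any point of the cone to it can
  be prolonged a little inside the cone.
\<close>

lemma bary_rel_interior:
  assumes S: "finite S"
  shows "(\<Sum>x\<in>S. rank_one x) \<in> rel_interior (vcone S)"
proof -
  have ne: "vcone S \<noteq> {}" using vcone_0 by blast
  show ?thesis
    unfolding convex_rel_interior_iff[OF convex_vcone ne]
  proof
    fix X assume "X \<in> vcone S"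
    then obtain l where l: "X = (\<Sum>x\<in>S. l x *\<^sub>R rank_one x)" "\<And>x. 0 \<le> l x" unfolding vcone_def by blast
    define m where "m = 1 + (\<Sum>x\<in>S. l x)"
    have m: "m > 0" unfolding m_def using l(2) by (simp add: add_pos_nonneg sum_nonneg)
    \<comment> \<open>Small enough for the coefficients \<open>(1 - e) l\<^sub>x + e\<close> to stay nonnegative, as \<open>l\<^sub>x \<le> m\<close>.\<close>
    define e where "e = 1 + 1 / m"
    have le: "l x \<le> m" if "x \<in> S" for x
      using member_le_sum[of x S l] that l(2) S by (simp add: m_def)
    have "(1 - e) *\<^sub>R X + e *\<^sub>R (\<Sum>x\<in>S. rank_one x) = (\<Sum>x\<in>S. ((1 - e) * l x + e) *\<^sub>R rank_one x)"
      by (simp add: l(1) scaleR_sum_right scaleR_add_left sum.distrib)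
    also have "\<dots> = (\<Sum>x\<in>S. (if x \<in> S then (1 - e) * l x + e else 0) *\<^sub>R rank_one x)"
      by (rule sum.cong) auto
    also have "\<dots> \<in> vcone S"
    proof (rule vcone_I)
      fix x
      have "l x / m \<le> 1" if "x \<in> S" using le[OF that] m by simp
      then show "0 \<le> (if x \<in> S then (1 - e) * l x + e else 0)" using m by (auto simp: e_def add_increasing2)
    qed
    finally show "\<exists>e>1. (1 - e) *\<^sub>R X + e *\<^sub>R (\<Sum>x\<in>S. rank_one x) \<in> vcone S"
      using m by (intro exI[of _ e]) (auto simp: e_def)
  qed
qed

text \<open>
  A point \<open>x \<noteq> 0\<close> of the face is inside the segment from \<open>0\<close> to \<open>2 x\<close>.
\<close>

lemma cone_face_contains_0:
  fixes \<sigma> :: "'a::euclidean_space set"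
  assumes \<sigma>: "convex_cone \<sigma>" and \<tau>: "\<tau> face_of \<sigma>" "\<tau> \<noteq> {}"
  shows "0 \<in> \<tau>"
proof -
  obtain x where x: "x \<in> \<tau>" using \<tau>(2) by blast
  show ?thesis
  proof (cases "x = 0")
    case False
    have "x \<in> open_segment 0 (2 *\<^sub>R x)"
      using False by (auto simp: in_segment intro: exI[of _ "1/2"])
    moreover have "x \<in> \<sigma>" using x \<tau>(1) face_of_imp_subset by blast
    then have "0 \<in> \<sigma>" "2 *\<^sub>R x \<in> \<sigma>" using convex_cone_contains_0[OF \<sigma>] convex_cone_scaleR[OF \<sigma>] by auto
    ultimately show ?thesis using face_ofD[OF \<tau>(1)] x by blast
  qed (use x in simp)
qed

lemma aff_dim_cone_face:
  assumes "0 \<in> \<tau>"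
  shows "aff_dim \<tau> = int (dim \<tau>)"
  using assms by (intro aff_dim_zero) (simp add: hull_inc)

lemma faces_codim_0:
  assumes \<sigma>: "convex_cone \<sigma>" "\<sigma> \<noteq> {0}"
  shows "faces_codim 0 \<sigma> = {\<sigma>}"
proof -
  have cv: "convex \<sigma>" using \<sigma>(1) by (simp add: convex_cone_def)
  have "\<tau> = \<sigma>" if "\<tau> face_of \<sigma>" "\<tau> \<noteq> {}" "dim \<tau> = dim \<sigma>" for \<tau>
  proof (rule ccontr)
    assume "\<tau> \<noteq> \<sigma>"
    then have "aff_dim \<tau> < aff_dim \<sigma>" using face_of_aff_dim_lt[OF cv] that by blast
    then show False
      using aff_dim_cone_face cone_face_contains_0[OF \<sigma>(1) that(1,2)] convex_cone_contains_0[OF \<sigma>(1)] that(3)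
      by (metis less_irrefl)
  qed
  moreover have "\<sigma> \<noteq> {}" using convex_cone_contains_0[OF \<sigma>(1)] by blast
  ultimately show ?thesis using face_of_refl[OF cv] \<sigma>(2) by (auto simp: faces_codim_def)
qed

lemma faces_codim_image:
  assumes "linear f" "inj f"
  shows "faces_codim k (f ` \<sigma>) = (`) f ` faces_codim k \<sigma>"
proof -
  have dim: "dim (f ` \<tau>) = dim \<tau>" for \<tau>
    using assms by (intro dim_image_eq) (auto intro: inj_on_subset)
  have f0: "f ` \<tau> = {0} \<longleftrightarrow> \<tau> = {0}" for \<tau>
  proof
    assume "f ` \<tau> = {0}"
    then have "f ` \<tau> = f ` {0}" using linear_0[OF assms(1)] by simp
    then show "\<tau> = {0}" by (simp only: inj_image_eq_iff[OF assms(2)])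
  qed (simp add: linear_0[OF assms(1)])
  show ?thesis
  proof (intro equalityI subsetI)
    fix \<tau> assume \<tau>: "\<tau> \<in> faces_codim k (f ` \<sigma>)"
    then have "\<tau> \<subseteq> f ` \<sigma>" by (auto simp: faces_codim_def dest: face_of_imp_subset)
    then obtain \<tau>' where \<tau>': "\<tau> = f ` \<tau>'" by (meson subset_imageE)
    then have "\<tau>' \<in> faces_codim k \<sigma>"
      using \<tau> f0[of \<tau>'] by (auto simp: faces_codim_def dim face_of_linear_image[OF assms])
    then show "\<tau> \<in> (`) f ` faces_codim k \<sigma>" using \<tau>' by blast
  next
    fix \<tau> assume "\<tau> \<in> (`) f ` faces_codim k \<sigma>"
    then obtain \<tau>' where t: "\<tau>' face_of \<sigma>" "\<tau>' \<noteq> {}" "\<tau>' \<noteq> {0}" "dim \<tau>' + k = dim \<sigma>" "\<tau> = f ` \<tau>'"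
      unfolding faces_codim_def by blast
    have "f ` \<tau>' \<noteq> {0}" using t(3) f0 by blast
    then show "\<tau> \<in> faces_codim k (f ` \<sigma>)"
      unfolding faces_codim_def mem_Collect_eq t(5) dim face_of_linear_image[OF assms]
      using t(1,2,4) by blast
  qed
qed

text \<open>
  The remainder term of the Cauchy-Schwarz inequality; it vanishes only for multiples of \<open>x\<close>.
\<close>

lemma Cauchy_Schwarz_defect:
  "(norm (of_real ((norm x)\<^sup>2) *s y - cdot x y *s x))\<^sup>2
     = (norm x)\<^sup>2 * ((norm x)\<^sup>2 * (norm y)\<^sup>2 - (cmod (cdot x y))\<^sup>2)" (is "(norm ?z)\<^sup>2 = _")
proof -
  have xz: "cdot x ?z = 0"
    by (simp add: cdot_diff_right cdot_smult_right cdot_self)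
  have zx: "cdot ?z x = 0" using cdot_cnj[of x ?z] xz by simp
  have "cdot ?z ?z = of_real ((norm x)\<^sup>2) * cdot ?z y"
    by (simp only: cdot_diff_right[of ?z] cdot_smult_right zx) simp
  also have "cdot ?z y = of_real ((norm x)\<^sup>2) * cdot y y - cnj (cdot x y) * cdot x y"
  proof -
    have "cdot ?z y = cnj (cdot y ?z)" by (simp only: cdot_cnj)
    also have "\<dots> = of_real ((norm x)\<^sup>2) * cnj (cdot y y) - cnj (cdot x y) * cnj (cdot y x)"
      by (simp add: cdot_diff_right cdot_smult_right)
    finally show ?thesis by (simp only: cdot_cnj)
  qed
  also have "cnj (cdot x y) * cdot x y = of_real ((cmod (cdot x y))\<^sup>2)"
    by (metis complex_norm_square mult.commute of_real_power)
  finally have "complex_of_real ((norm ?z)\<^sup>2) = of_real ((norm x)\<^sup>2 * ((norm x)\<^sup>2 * (norm y)\<^sup>2 - (cmod (cdot x y))\<^sup>2))"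
    by (simp only: cdot_self of_real_mult of_real_diff)
  then show ?thesis by (simp only: of_real_eq_iff)
qed

text \<open>
  The form \<open>\<psi>(y) = |x|\<^sup>2 |y|\<^sup>2 - |\<langle>x, y\<rangle>|\<^sup>2\<close> is nonnegative and vanishes exactly on the
  multiples of \<open>x\<close>, so it defines a supporting hyperplane that cuts out the ray of \<open>x x\<^sup>*\<close>.
\<close>

lemma ray_face_of_vcone:
  fixes x :: "complex ^ 'n"
  assumes S: "finite S" and x: "x \<in> S" "x \<noteq> 0"
  shows "(\<lambda>t. t *\<^sub>R rank_one x) ` {0..} face_of vcone S"
proof -
  define \<psi> where "\<psi> = (norm x)\<^sup>2 *\<^sub>R mat 1 - rank_one x"
  have \<psi>: "form_at \<psi> y = (norm x)\<^sup>2 * (norm y)\<^sup>2 - (cmod (cdot x y))\<^sup>2" for y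
    by (simp add: \<psi>_def form_at_diff_left form_at_scaleR_left form_at_rank_one form_at_cdot[of "mat 1"] Re_cdot_self)
  have nx: "(norm x)\<^sup>2 > 0" using x by simp
  have nn: "0 \<le> form_at \<psi> y" for y
  proof -
    have "0 \<le> (norm x)\<^sup>2 * form_at \<psi> y"
      unfolding \<psi> Cauchy_Schwarz_defect[symmetric] by simp
    then show ?thesis using nx by (simp add: zero_le_mult_iff)
  qed
  have multiple: "\<exists>c. y = c *s x" if "form_at \<psi> y = 0" for y
  proof -
    have "(norm (of_real ((norm x)\<^sup>2) *s y - cdot x y *s x))\<^sup>2 = 0"
      using Cauchy_Schwarz_defect[of x y] that \<psi>[of y] by simp
    then have "of_real ((norm x)\<^sup>2) *s y = cdot x y *s x" by simp
    then have "inverse (of_real ((norm x)\<^sup>2)) *s (of_real ((norm x)\<^sup>2) *s y) = inverse (of_real ((norm x)\<^sup>2)) *s (cdot x y *s x)"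
      by simp
    then have "y = (inverse (of_real ((norm x)\<^sup>2)) * cdot x y) *s x"
      using x(2) by (simp add: vector_smult_assoc)
    then show ?thesis by blast
  qed
  have "vcone S \<inter> {X. \<psi> \<bullet> X = 0} face_of vcone S"
    using inner_vcone_nonneg[of S \<psi>] nn by (intro face_of_Int_supporting_hyperplane_ge convex_vcone) blast
  moreover have "vcone S \<inter> {X. \<psi> \<bullet> X = 0} = (\<lambda>t. t *\<^sub>R rank_one x) ` {0..}"
  proof (intro equalityI subsetI)
    fix X assume "X \<in> vcone S \<inter> {X. \<psi> \<bullet> X = 0}"
    then have "X \<in> vcone {y \<in> S. form_at \<psi> y = 0}" using vcone_Int_hyperplane[OF S] nn by blast
    then obtain l where l: "X = (\<Sum>y\<in>{y \<in> S. form_at \<psi> y = 0}. l y *\<^sub>R rank_one y)" "\<And>y. 0 \<le> l y"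
      unfolding vcone_def by blast
    have "\<forall>y. \<exists>c. form_at \<psi> y = 0 \<longrightarrow> y = c *s x" using multiple by blast
    then obtain c where c: "\<forall>y. form_at \<psi> y = 0 \<longrightarrow> y = c y *s x" by (rule choice[THEN exE])
    have "rank_one y = (cmod (c y))\<^sup>2 *\<^sub>R rank_one x" if "form_at \<psi> y = 0" for y
      unfolding rank_one_smult[symmetric] using c that by simp
    then have "X = (\<Sum>y\<in>{y \<in> S. form_at \<psi> y = 0}. l y * (cmod (c y))\<^sup>2) *\<^sub>R rank_one x"
      unfolding l(1) scaleR_sum_left by (intro sum.cong) auto
    moreover have "0 \<le> (\<Sum>y\<in>{y \<in> S. form_at \<psi> y = 0}. l y * (cmod (c y))\<^sup>2)"
      using l(2) by (intro sum_nonneg) simp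
    ultimately show "X \<in> (\<lambda>t. t *\<^sub>R rank_one x) ` {0..}" by blast
  next
    fix X assume "X \<in> (\<lambda>t. t *\<^sub>R rank_one x) ` {0..}"
    then obtain t where t: "X = t *\<^sub>R rank_one x" "t \<ge> 0" by auto
    have "cmod (cdot x x) = (norm x)\<^sup>2" by (simp only: cdot_self norm_of_real abs_power2)
    then have "\<psi> \<bullet> rank_one x = 0"
      using \<psi>[of x] by (simp add: form_at_inner[symmetric] power2_eq_square)
    then show "X \<in> vcone S \<inter> {X. \<psi> \<bullet> X = 0}"
      using t vcone_scaleR[OF rank_one_vcone[OF S x(1)]] by simp
  qed
  ultimately show ?thesis by simp
qed


context ground
begin

definition vdom :: "complex ^ 'n ^ 'n \<Rightarrow> (complex ^ 'n ^ 'n) set" where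
  "vdom h = vcone (min1 h)"

text \<open>
  An interior point of the Voronoi domain that depends on \<open>h\<close> only.
\<close>

definition bary :: "complex ^ 'n ^ 'n \<Rightarrow> complex ^ 'n ^ 'n" where
  "bary h = (\<Sum>x\<in>min1 h. rank_one x)"

lemma unit_perfect_ryshkov: "unit_perfect h \<Longrightarrow> h \<in> ryshkov"
  and unit_perfect_herm: "unit_perfect h \<Longrightarrow> h \<in> herm F"
  and unit_perfect_finite: "unit_perfect h \<Longrightarrow> finite (min1 h)"
  and unit_perfect_span: "unit_perfect h \<Longrightarrow> span (rank_one ` min1 h) = herm F"
  by (simp_all add: unit_perfect_def ryshkov_herm finite_min1)

lemma ryshkov_ge_1: "h \<in> ryshkov \<Longrightarrow> x \<in> min1 g \<Longrightarrow> 1 \<le> form_at h x"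
  by (simp add: ryshkov_def min1_def)

lemma min1_eq_1: "x \<in> min1 h \<Longrightarrow> form_at h x = 1"
  by (simp add: min1_def)

lemma mat_1_herm: "mat 1 \<in> herm F"
  using ryshkov_nonempty ryshkov_herm by blast

lemma mat_1_form: "form_at (mat 1) x = (norm x)\<^sup>2"
  by (simp add: form_at_cdot Re_cdot_self)

lemma mat_1_nonzero: "(mat 1 :: complex ^ 'n ^ 'n) \<noteq> 0"
proof
  assume "(mat 1 :: complex ^ 'n ^ 'n) = 0"
  then have "(mat 1 :: complex ^ 'n ^ 'n) $ undefined $ undefined = 0" by simp
  then show False by (simp add: Finite_Cartesian_Product.mat_def)
qed

lemma unit_perfect_nonempty:
  assumes "unit_perfect (h :: complex ^ 'n ^ 'n)"
  shows "min1 h \<noteq> {}"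
proof
  assume "min1 h = {}"
  then have "(herm F :: (complex ^ 'n ^ 'n) set) = {0}" using unit_perfect_span[OF assms] by simp
  then show False using mat_1_herm mat_1_nonzero by blast
qed

lemma pos_cone_minimum:
  fixes h :: "complex ^ 'n ^ 'n"
  assumes h: "h \<in> pos_cone F"
  shows "\<exists>y\<in>vecs Oi - {0}. minimum F h = form_at h y \<and> (\<forall>x\<in>vecs Oi - {0}. form_at h y \<le> form_at h x)"
proof -
  define e :: "complex ^ 'n" where "e = axis undefined 1"
  have e: "e \<in> vecs Oi - {0}" unfolding e_def using axis_Oi by (simp add: axis_eq_0_iff)
  define S where "S = {x \<in> vecs Oi. form_at h x \<le> form_at h e} - {0}"
  have "finite S" "S \<noteq> {}" using finite_sublevel_pos[OF h] e by (auto simp: S_def)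
  then obtain y where y: "y \<in> S" "\<And>x. x \<in> S \<Longrightarrow> form_at h y \<le> form_at h x"
    using arg_min_if_finite[of S "form_at h"] by (metis not_le)
  have ye: "form_at h y \<le> form_at h e" using y(1) by (simp add: S_def)
  have le: "form_at h y \<le> form_at h x" if x: "x \<in> vecs Oi - {0}" for x
  proof (cases "x \<in> S")
    case False
    then have "form_at h e \<le> form_at h x" using x by (simp add: S_def)
    then show ?thesis using ye by simp
  qed (use y(2) in blast)
  have "minimum F h = form_at h y"
    unfolding minimum_def using y(1) le by (intro cInf_eq_minimum) (auto simp: S_def)
  then show ?thesis using y(1) le by (auto simp: S_def)
qed

lemma unit_perfect_imp_perfect:
  assumes "unit_perfect h"
  shows "perfect_form F h" "min_vecs F h = min1 h"
proof -
  have pos: "h \<in> pos_cone F" using ryshkov_pos unit_perfect_ryshkov assms by blast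
  obtain y where y: "y \<in> vecs Oi - {0}" "minimum F h = form_at h y"
    "\<forall>x\<in>vecs Oi - {0}. form_at h y \<le> form_at h x" using pos_cone_minimum[OF pos] by blast
  obtain x where "x \<in> min1 h" using unit_perfect_nonempty[OF assms] by blast
  then have "form_at h y \<le> 1" using y(3) by (force simp: min1_def)
  moreover have "1 \<le> form_at h y" using unit_perfect_ryshkov[OF assms] y(1) by (simp add: ryshkov_def)
  ultimately have "minimum F h = 1" using y(2) by simp
  then show eq: "min_vecs F h = min1 h" by (simp add: min_vecs_def min1_def)
  show "perfect_form F h" using pos unit_perfect_span[OF assms] by (simp add: perfect_form_def eq)
qed

lemma perfect_imp_unit_perfect:
  assumes "perfect_form F h"
  shows "\<exists>g. unit_perfect g \<and> min_vecs F h = min1 g"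
proof -
  have pos: "h \<in> pos_cone F" and span: "span (rank_one ` min_vecs F h) = herm F"
    using assms by (auto simp: perfect_form_def)
  obtain y where y: "y \<in> vecs Oi - {0}" "minimum F h = form_at h y"
    "\<forall>x\<in>vecs Oi - {0}. form_at h y \<le> form_at h x" using pos_cone_minimum[OF pos] by blast
  define m where "m = form_at h y"
  have m: "m > 0" using pos y(1) vecs_Oi_K by (auto simp: m_def pos_cone_def)
  define g where "g = (1 / m) *\<^sub>R h"
  have g: "form_at g x = form_at h x / m" for x by (simp add: g_def form_at_scaleR_left)
  have eq: "min_vecs F h = min1 g"
    using m y(2) by (auto simp: min_vecs_def min1_def g m_def)
  have "g \<in> herm F" using pos subspace_scale[OF subspace_herm] by (auto simp: g_def pos_cone_def)
  moreover have "1 \<le> form_at g x" if "x \<in> vecs Oi - {0}" for x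
    using y(3) that m by (simp add: g m_def)
  ultimately have "unit_perfect g" using span by (simp add: unit_perfect_def ryshkov_def eq)
  then show ?thesis using eq by blast
qed

lemma voronoi_domain_vcone: "voronoi_domain F h = vcone (min_vecs F h)"
  by (simp add: voronoi_domain_def vcone_def)

text \<open>
  Scaling a perfect form to minimum \<open>1\<close> does not change its minimal vectors.
\<close>

lemma voronoi_cones_codim_eq: "voronoi_cones_codim F k = (\<Union>h\<in>{h. unit_perfect h}. faces_codim k (vdom h))"
proof (intro equalityI subsetI)
  fix \<sigma> assume "\<sigma> \<in> voronoi_cones_codim F k"
  then obtain h where h: "perfect_form F h" "\<sigma> \<in> faces_codim k (voronoi_domain F h)"
    by (auto simp: voronoi_cones_codim_def)
  obtain g where g: "unit_perfect g" "min_vecs F h = min1 g" using perfect_imp_unit_perfect[OF h(1)] by blast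
  have "\<sigma> \<in> faces_codim k (vdom g)" using h(2) by (simp add: voronoi_domain_vcone vdom_def g(2))
  then show "\<sigma> \<in> (\<Union>h\<in>{h. unit_perfect h}. faces_codim k (vdom h))" using g(1) by blast
next
  fix \<sigma> assume "\<sigma> \<in> (\<Union>h\<in>{h. unit_perfect h}. faces_codim k (vdom h))"
  then obtain h where h: "unit_perfect h" "\<sigma> \<in> faces_codim k (vdom h)" by blast
  have "\<sigma> \<in> faces_codim k (voronoi_domain F h)"
    using h(2) by (simp add: voronoi_domain_vcone vdom_def unit_perfect_imp_perfect(2)[OF h(1)])
  then show "\<sigma> \<in> voronoi_cones_codim F k"
    unfolding voronoi_cones_codim_def using unit_perfect_imp_perfect(1)[OF h(1)] by blast
qed

lemma span_vdom: "unit_perfect h \<Longrightarrow> span (vdom h) = herm F"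
  by (simp add: vdom_def span_vcone unit_perfect_finite unit_perfect_span)

lemma vdom_herm: "unit_perfect h \<Longrightarrow> vdom h \<subseteq> herm F"
  using span_vdom span_superset by blast

lemma convex_cone_vdom: "convex_cone (vdom h)"
  by (simp add: vdom_def convex_cone_vcone)

lemma vdom_nonzero:
  assumes "unit_perfect (h :: complex ^ 'n ^ 'n)"
  shows "vdom h \<noteq> {0}"
proof
  assume "vdom h = {0}"
  then have "(herm F :: (complex ^ 'n ^ 'n) set) = {0}" using span_vdom[OF assms] by simp
  then show False using mat_1_herm mat_1_nonzero by blast
qed

lemma top_cones: "voronoi_cones_codim F 0 = vdom ` {h. unit_perfect h}"
  unfolding voronoi_cones_codim_eq using faces_codim_0[OF convex_cone_vdom vdom_nonzero] by blast

text \<open>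
  The Voronoi domain lies in the normal cone of the vertex \<open>h\<close>: the points of the domain are
  functionals whose minimum on the Ryshkov polyhedron is attained at \<open>h\<close>.
\<close>

lemma inner_vdom: "X \<in> vdom h \<Longrightarrow> g \<in> ryshkov \<Longrightarrow> h \<bullet> X \<le> g \<bullet> X"
proof -
  assume X: "X \<in> vdom h" and g: "g \<in> ryshkov"
  have "0 \<le> form_at (g - h) x" if "x \<in> min1 h" for x
    using that ryshkov_ge_1[OF g that] by (simp add: form_at_diff_left min1_eq_1)
  then have "0 \<le> (g - h) \<bullet> X" using X inner_vcone_nonneg unfolding vdom_def by blast
  then show ?thesis by (simp add: inner_diff_left)
qed

lemma bary_vdom: "unit_perfect h \<Longrightarrow> bary h \<in> vdom h"
  unfolding bary_def vdom_def using vcone_I[of "\<lambda>_. 1" "min1 h"] by simp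

text \<open>
  If \<open>bary h\<close> lies in the domain of \<open>g\<close>, then \<open>g\<close> minimises the sum of the values at the
  minimal vectors of \<open>h\<close>. Each of these values is then \<open>1\<close>, and perfection of \<open>h\<close> gives \<open>g =
  h\<close>.
\<close>

lemma bary_vdom_unique:
  assumes h: "unit_perfect h" and g: "unit_perfect g" and b: "bary h \<in> vdom g"
  shows "g = h"
proof (rule unit_perfect_unique[OF h unit_perfect_herm[OF g]])
  have "(\<Sum>x\<in>min1 h. form_at g x) \<le> (\<Sum>x\<in>min1 h. form_at h x)"
    using inner_vdom[OF b unit_perfect_ryshkov[OF h]] by (simp add: bary_def inner_sum_right form_at_inner)
  also have "\<dots> = (\<Sum>x\<in>min1 h. 1)" by (rule sum.cong) (auto simp: min1_eq_1)
  finally have "(\<Sum>x\<in>min1 h. form_at g x - 1) \<le> 0" by (simp add: sum_subtractf)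
  moreover have nn: "\<And>x. x \<in> min1 h \<Longrightarrow> 0 \<le> form_at g x - 1" using ryshkov_ge_1[OF unit_perfect_ryshkov[OF g]] by simp
  ultimately have "(\<Sum>x\<in>min1 h. form_at g x - 1) = 0" using sum_nonneg[of "min1 h" "\<lambda>x. form_at g x - 1"] by force
  then have "\<forall>x\<in>min1 h. form_at g x - 1 = 0"
    using sum_nonneg_eq_0_iff[OF unit_perfect_finite[OF h], of "\<lambda>x. form_at g x - 1"] nn by blast
  then show "form_at g x = 1" if "x \<in> min1 h" for x using that by simp
qed

lemma vdom_inj: "unit_perfect h \<Longrightarrow> unit_perfect g \<Longrightarrow> vdom h = vdom g \<Longrightarrow> h = g"
  using bary_vdom_unique[of g h] bary_vdom[of g] by simp

subsection \<open>Facets\<close>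

text \<open>
  The last condition says that the rays of \<open>vdom h\<close> in the hyperplane of \<open>\<psi>\<close> span it, so that
  the hyperplane cuts out a facet.
\<close>

definition facet_normal :: "complex ^ 'n ^ 'n \<Rightarrow> complex ^ 'n ^ 'n \<Rightarrow> bool" where
  "facet_normal h \<psi> \<longleftrightarrow> \<psi> \<in> herm F \<and> \<psi> \<noteq> 0 \<and> (\<forall>x\<in>min1 h. 0 \<le> form_at \<psi> x) \<and>
     span (rank_one ` {x \<in> min1 h. form_at \<psi> x = 0}) = {X \<in> herm F. \<psi> \<bullet> X = 0}"

definition facet :: "complex ^ 'n ^ 'n \<Rightarrow> complex ^ 'n ^ 'n \<Rightarrow> (complex ^ 'n ^ 'n) set" where
  "facet h \<psi> = vcone {x \<in> min1 h. form_at \<psi> x = 0}"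

lemma facet_normalD:
  assumes "facet_normal h \<psi>"
  shows "\<psi> \<in> herm F" "\<psi> \<noteq> 0" "\<And>x. x \<in> min1 h \<Longrightarrow> 0 \<le> form_at \<psi> x"
    "span (rank_one ` {x \<in> min1 h. form_at \<psi> x = 0}) = {X \<in> herm F. \<psi> \<bullet> X = 0}"
  using assms by (auto simp: facet_normal_def)

lemma subspace_hyperplane_herm: "subspace {X \<in> herm F. \<psi> \<bullet> X = 0}"
proof -
  have "{X \<in> herm F. \<psi> \<bullet> X = 0} = herm F \<inter> {X. \<psi> \<bullet> X = 0}" by blast
  then show ?thesis using subspace_inter[OF subspace_herm subspace_hyperplane] by simp
qed

lemma facet_eq:
  assumes "unit_perfect h" "\<And>x. x \<in> min1 h \<Longrightarrow> 0 \<le> form_at \<psi> x"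
  shows "facet h \<psi> = vdom h \<inter> {X. \<psi> \<bullet> X = 0}"
  using vcone_Int_hyperplane[OF unit_perfect_finite[OF assms(1)], of \<psi>] assms(2) by (simp add: facet_def vdom_def)

lemma span_facet:
  assumes "unit_perfect h" "facet_normal h \<psi>"
  shows "span (facet h \<psi>) = {X \<in> herm F. \<psi> \<bullet> X = 0}"
proof -
  have "finite {x \<in> min1 h. form_at \<psi> x = 0}" using unit_perfect_finite[OF assms(1)] by simp
  then show ?thesis using facet_normalD(4)[OF assms(2)] by (simp add: facet_def span_vcone)
qed

lemma facet_normalI:
  fixes h \<psi> :: "complex ^ 'n ^ 'n"
  assumes h: "unit_perfect h" and \<psi>: "\<psi> \<in> herm F" "\<And>x. x \<in> min1 h \<Longrightarrow> 0 \<le> form_at \<psi> x"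
    and dim: "dim (facet h \<psi>) + 1 = dim (herm F :: (complex ^ 'n ^ 'n) set)"
  shows "facet_normal h \<psi>"
proof -
  define H where "H = {X \<in> herm F. \<psi> \<bullet> X = 0}"
  have fin: "finite {x \<in> min1 h. form_at \<psi> x = 0}" using unit_perfect_finite[OF h] by simp
  have ne: "\<psi> \<noteq> 0"
  proof
    assume "\<psi> = 0"
    then have "facet h \<psi> = vdom h" by (simp add: facet_def vdom_def form_at_zero_left)
    then have "dim (facet h \<psi>) = dim (herm F :: (complex ^ 'n ^ 'n) set)"
      using span_vdom[OF h] dim_span by metis
    then show False using dim by simp
  qed
  have "\<psi> \<notin> H" using ne by (simp add: H_def)
  moreover have "H \<subseteq> herm F" by (auto simp: H_def)
  ultimately have "H \<subset> herm F" using \<psi>(1) by blast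
  moreover have "span H = H" unfolding H_def span_eq_iff by (rule subspace_hyperplane_herm)
  moreover have "span (herm F) = (herm F :: (complex ^ 'n ^ 'n) set)" unfolding span_eq_iff by (rule subspace_herm)
  ultimately have "span H \<subset> span (herm F)" by (simp only:)
  then have "dim H < dim (herm F :: (complex ^ 'n ^ 'n) set)" by (rule dim_psubset)
  then have "dim H \<le> dim (span (facet h \<psi>))" using dim by simp
  moreover have "span (facet h \<psi>) \<subseteq> H"
  proof (rule span_minimal)
    show "facet h \<psi> \<subseteq> H" using facet_eq[OF h \<psi>(2)] vdom_herm[OF h] by (auto simp: H_def)
    show "subspace H" unfolding H_def by (rule subspace_hyperplane_herm)
  qed
  ultimately have "span (facet h \<psi>) = H"
    using subspace_dim_equal[OF subspace_span, of H] subspace_hyperplane_herm[of \<psi>] unfolding H_def by blast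
  then show ?thesis
    unfolding facet_normal_def using \<psi> ne span_vcone[OF fin] by (simp add: facet_def H_def)
qed

text \<open>
  Faces of a polyhedral cone are exposed. The normal vector becomes Hermitian after orthogonal
  projection, without any change of the functional on Hermitian matrices.
\<close>

lemma codim_1_face_facet:
  fixes h :: "complex ^ 'n ^ 'n"
  assumes h: "unit_perfect h" and \<tau>: "\<tau> face_of vdom h" "\<tau> \<noteq> {}" "dim \<tau> + 1 = dim (vdom h)"
  shows "\<exists>\<psi>. facet_normal h \<psi> \<and> \<tau> = facet h \<psi>"
proof -
  have fin: "finite (min1 h)" using unit_perfect_finite[OF h] .
  have t0: "0 \<in> \<tau>" using cone_face_contains_0[OF convex_cone_vdom \<tau>(1,2)] .
  have "\<tau> exposed_face_of vdom h"
    using exposed_face_of_polyhedron polyhedron_vcone[OF fin] \<tau>(1) unfolding vdom_def by blast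
  then obtain a b where ab: "vdom h \<subseteq> {x. a \<bullet> x \<le> b}" "\<tau> = vdom h \<inter> {x. a \<bullet> x = b}"
    unfolding exposed_face_of_def by blast
  then have "b = 0" using t0 by auto
  obtain y z where yz: "y \<in> span (herm F)" "\<And>w. w \<in> span (herm F) \<Longrightarrow> orthogonal z w" "- a = y + z"
    using orthogonal_subspace_decomp_exists[of "herm F" "- a"] by blast
  have y: "y \<in> herm F" using yz(1) span_herm by blast
  have inner: "y \<bullet> X = - (a \<bullet> X)" if "X \<in> herm F" for X
  proof -
    have "z \<bullet> X = 0" using yz(2)[OF span_base[OF that]] by (simp add: real_inner_class.orthogonal_def)
    then have "(- a) \<bullet> X = y \<bullet> X" unfolding yz(3) by (simp add: inner_add_left)
    then show ?thesis by simp
  qed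
  have nn: "0 \<le> form_at y x" if "x \<in> min1 h" for x
  proof -
    have "rank_one x \<in> vdom h" unfolding vdom_def by (rule rank_one_vcone[OF fin that])
    then have "a \<bullet> rank_one x \<le> 0" "rank_one x \<in> herm F" using ab(1) \<open>b = 0\<close> vdom_herm[OF h] by auto
    then show ?thesis using inner by (simp add: form_at_inner)
  qed
  have eq: "\<tau> = facet h y"
  proof -
    have "facet h y = vdom h \<inter> {X. y \<bullet> X = 0}" by (rule facet_eq[OF h nn])
    also have "\<dots> = \<tau>" unfolding ab(2) \<open>b = 0\<close> using inner vdom_herm[OF h] by auto
    finally show ?thesis ..
  qed
  have "dim (vdom h) = dim (herm F :: (complex ^ 'n ^ 'n) set)" using span_vdom[OF h] dim_span by metis
  then have "facet_normal h y" using facet_normalI[OF h y nn] \<tau>(3) by (simp add: eq)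
  then show ?thesis using eq by blast
qed

lemma herm_decomp:
  assumes "\<psi> \<bullet> Y \<noteq> 0"
  shows "X = (X - ((\<psi> \<bullet> X) / (\<psi> \<bullet> Y)) *\<^sub>R Y) + ((\<psi> \<bullet> X) / (\<psi> \<bullet> Y)) *\<^sub>R Y"
    "\<psi> \<bullet> (X - ((\<psi> \<bullet> X) / (\<psi> \<bullet> Y)) *\<^sub>R Y) = 0"
  using assms by (simp_all add: inner_diff_right)

lemma facet_faces_codim:
  fixes h \<psi> :: "complex ^ 'n ^ 'n"
  assumes h: "unit_perfect h" and \<psi>: "facet_normal h \<psi>" and ne: "facet h \<psi> \<noteq> {0}"
  shows "facet h \<psi> \<in> faces_codim 1 (vdom h)"
proof -
  have nn: "\<And>x. x \<in> min1 h \<Longrightarrow> 0 \<le> form_at \<psi> x" using facet_normalD[OF \<psi>] by blast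
  have "vdom h \<inter> {X. \<psi> \<bullet> X = 0} face_of vdom h"
    using inner_vcone_nonneg[of "min1 h" \<psi>] nn
    unfolding vdom_def by (intro face_of_Int_supporting_hyperplane_ge convex_vcone) blast
  then have face: "facet h \<psi> face_of vdom h" using facet_eq[OF h nn] by simp
  define H where "H = {X \<in> herm F. \<psi> \<bullet> X = 0}"
  have sH: "span H = H" unfolding H_def span_eq_iff by (rule subspace_hyperplane_herm)
  have \<psi>n: "\<psi> \<notin> span H" unfolding sH using facet_normalD(2)[OF \<psi>] by (simp add: H_def)
  have "herm F \<subseteq> span (insert \<psi> H)"
  proof
    fix X :: "complex ^ 'n ^ 'n" assume X: "X \<in> herm F"
    have n: "\<psi> \<bullet> \<psi> \<noteq> 0" using facet_normalD(2)[OF \<psi>] by simp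
    have "X - ((\<psi> \<bullet> X) / (\<psi> \<bullet> \<psi>)) *\<^sub>R \<psi> \<in> H"
      unfolding H_def using X facet_normalD(1)[OF \<psi>] herm_decomp(2)[OF n]
      by (simp add: subspace_diff[OF subspace_herm] subspace_scale[OF subspace_herm])
    then have "(X - ((\<psi> \<bullet> X) / (\<psi> \<bullet> \<psi>)) *\<^sub>R \<psi>) + ((\<psi> \<bullet> X) / (\<psi> \<bullet> \<psi>)) *\<^sub>R \<psi> \<in> span (insert \<psi> H)"
      by (intro span_add span_scale span_base) auto
    then show "X \<in> span (insert \<psi> H)" by simp
  qed
  moreover have "span (insert \<psi> H) \<subseteq> herm F"
    using facet_normalD(1)[OF \<psi>] by (intro span_herm) (auto simp: H_def)
  ultimately have "span (insert \<psi> H) = herm F" by blast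
  then have "dim (herm F :: (complex ^ 'n ^ 'n) set) = dim (insert \<psi> H)" using dim_span by metis
  also have "\<dots> = dim H + 1" using \<psi>n by (simp add: dim_insert)
  also have "dim H = dim (facet h \<psi>)" using span_facet[OF h \<psi>] dim_span unfolding H_def by metis
  finally have "dim (facet h \<psi>) + 1 = dim (vdom h)" using span_vdom[OF h] dim_span by metis
  moreover have "facet h \<psi> \<noteq> {}" using vcone_0 unfolding facet_def by blast
  ultimately show ?thesis using face ne by (simp add: faces_codim_def)
qed

lemma orthogonal_to_hyperplane:
  assumes \<psi>: "\<psi> \<in> herm F" "\<psi> \<noteq> 0" and g: "g \<in> herm F" "\<And>X. X \<in> herm F \<Longrightarrow> \<psi> \<bullet> X = 0 \<Longrightarrow> g \<bullet> X = 0"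
  shows "\<exists>s. g = s *\<^sub>R \<psi>"
proof -
  define s where "s = (\<psi> \<bullet> g) / (\<psi> \<bullet> \<psi>)"
  have n: "\<psi> \<bullet> \<psi> \<noteq> 0" using \<psi>(2) by simp
  have r: "g - s *\<^sub>R \<psi> \<in> herm F"
    using \<psi>(1) g(1) by (simp add: subspace_diff[OF subspace_herm] subspace_scale[OF subspace_herm])
  moreover have o: "\<psi> \<bullet> (g - s *\<^sub>R \<psi>) = 0" unfolding s_def using herm_decomp(2)[OF n] .
  ultimately have "g \<bullet> (g - s *\<^sub>R \<psi>) = 0" using g(2) by blast
  then have "(g - s *\<^sub>R \<psi>) \<bullet> (g - s *\<^sub>R \<psi>) = 0" using o by (simp add: inner_diff_left)
  then have "g = s *\<^sub>R \<psi>" by simp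
  then show ?thesis by blast
qed

text \<open>
  Voronoi's neighbour: on the ray \<open>h + t \<psi>\<close> the minimal vectors in the facet are kept until a
  new one, with \<open>\<psi>(y) < 0\<close>, appears. Together with the facet it spans, so the new form is
  perfect, and it has the facet in common with \<open>h\<close>, seen from the other side.
\<close>

lemma facet_neighbour:
  fixes h \<psi> :: "complex ^ 'n ^ 'n"
  assumes h: "unit_perfect h" and \<psi>: "facet_normal h \<psi>" and np: "\<not> psd \<psi>"
  shows "\<exists>t>0. unit_perfect (h + t *\<^sub>R \<psi>) \<and> facet_normal (h + t *\<^sub>R \<psi>) (- \<psi>) \<and>
           facet (h + t *\<^sub>R \<psi>) (- \<psi>) = facet h \<psi>"
proof -
  obtain t y where t: "t > 0" "h + t *\<^sub>R \<psi> \<in> ryshkov" and y: "y \<in> min1 (h + t *\<^sub>R \<psi>)" "form_at \<psi> y < 0"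
    using ryshkov_neighbour[OF unit_perfect_ryshkov[OF h] facet_normalD(1)[OF \<psi>] np facet_normalD(3)[OF \<psi>]] by blast
  define h' where "h' = h + t *\<^sub>R \<psi>"
  have form: "form_at h' x = form_at h x + t * form_at \<psi> x" for x
    by (simp add: h'_def form_at_add_left form_at_scaleR_left)
  have same: "{x \<in> min1 h'. form_at (- \<psi>) x = 0} = {x \<in> min1 h. form_at \<psi> x = 0}"
    by (auto simp: min1_def form form_at_minus_left)
  define H where "H = {X \<in> herm F. \<psi> \<bullet> X = 0}"
  have H: "span (rank_one ` {x \<in> min1 h'. form_at (- \<psi>) x = 0}) = H"
    unfolding same H_def by (rule facet_normalD(4)[OF \<psi>])
  have "herm F \<subseteq> span (rank_one ` min1 h')"
  proof
    fix X :: "complex ^ 'n ^ 'n" assume X: "X \<in> herm F"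
    have n: "\<psi> \<bullet> rank_one y \<noteq> 0" using y(2) by (simp add: form_at_inner)
    have "rank_one y \<in> herm F" using y(1) min1_K rank_one_herm by blast
    then have "X - ((\<psi> \<bullet> X) / (\<psi> \<bullet> rank_one y)) *\<^sub>R rank_one y \<in> H"
      unfolding H_def using X herm_decomp(2)[OF n]
      by (simp add: subspace_diff[OF subspace_herm] subspace_scale[OF subspace_herm])
    also have "H \<subseteq> span (rank_one ` min1 h')" unfolding H[symmetric] by (intro span_mono image_mono) auto
    finally have "X - ((\<psi> \<bullet> X) / (\<psi> \<bullet> rank_one y)) *\<^sub>R rank_one y \<in> span (rank_one ` min1 h')" .
    then have "(X - ((\<psi> \<bullet> X) / (\<psi> \<bullet> rank_one y)) *\<^sub>R rank_one y) + ((\<psi> \<bullet> X) / (\<psi> \<bullet> rank_one y)) *\<^sub>R rank_one y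
        \<in> span (rank_one ` min1 h')"
    proof (rule span_add)
      show "((\<psi> \<bullet> X) / (\<psi> \<bullet> rank_one y)) *\<^sub>R rank_one y \<in> span (rank_one ` min1 h')"
        using y(1) unfolding h'_def by (intro span_scale span_base imageI)
    qed
    then show "X \<in> span (rank_one ` min1 h')" by simp
  qed
  then have "span (rank_one ` min1 h') = herm F" using span_herm[OF min1_herm] by blast
  then have up: "unit_perfect h'" using t(2) by (simp add: unit_perfect_def h'_def)
  have "0 \<le> form_at (- \<psi>) x" if "x \<in> min1 h'" for x
  proof -
    have "1 \<le> form_at h x" using ryshkov_ge_1[OF unit_perfect_ryshkov[OF h] that] .
    then have "t * form_at \<psi> x \<le> 0" using min1_eq_1[OF that] by (simp add: form)
    then show ?thesis using t(1) by (simp add: form_at_minus_left mult_le_0_iff)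
  qed
  then have "facet_normal h' (- \<psi>)"
    unfolding facet_normal_def H using facet_normalD(1,2)[OF \<psi>] subspace_neg[OF subspace_herm]
    by (auto simp: H_def)
  moreover have "facet h' (- \<psi>) = facet h \<psi>" unfolding facet_def same ..
  ultimately show ?thesis using t(1) up unfolding h'_def by blast
qed

text \<open>
  If \<open>g\<close> has the facet in its domain, it agrees with \<open>h\<close> on the hyperplane and is of the form
  \<open>h + s \<psi>\<close>. Here \<open>s > 0\<close>, since \<open>g\<close> is at least \<open>1\<close> on a minimal vector \<open>x\<close> of \<open>h\<close> with \<open>\<psi>(x)
  > 0\<close>; the minimal vectors of \<open>g\<close> off the hyperplane lie on its negative side.
\<close>

lemma facet_shared:
  assumes h: "unit_perfect h" and \<psi>: "facet_normal h \<psi>"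
    and g: "unit_perfect g" "g \<noteq> h" "facet h \<psi> \<subseteq> vdom g"
  shows "\<exists>s>0. g = h + s *\<^sub>R \<psi> \<and> (\<exists>y\<in>min1 g. form_at \<psi> y < 0)"
proof -
  have fin: "finite {x \<in> min1 h. form_at \<psi> x = 0}" using unit_perfect_finite[OF h] by simp
  have one: "form_at g x = 1" if x: "x \<in> min1 h" "form_at \<psi> x = 0" for x
  proof -
    have "rank_one x \<in> facet h \<psi>" unfolding facet_def using fin x by (intro rank_one_vcone) auto
    then have "g \<bullet> rank_one x \<le> h \<bullet> rank_one x" using g(3) inner_vdom unit_perfect_ryshkov[OF h] by blast
    then show ?thesis
      using ryshkov_ge_1[OF unit_perfect_ryshkov[OF g(1)] x(1)] min1_eq_1[OF x(1)] by (simp add: form_at_inner)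
  qed
  have gh: "g - h \<in> herm F"
    by (intro subspace_diff[OF subspace_herm] unit_perfect_herm h g(1))
  have "(g - h) \<bullet> X = 0" if X: "X \<in> herm F" "\<psi> \<bullet> X = 0" for X
  proof -
    have "X \<in> span (rank_one ` {x \<in> min1 h. form_at \<psi> x = 0})" using X facet_normalD(4)[OF \<psi>] by blast
    then show ?thesis
    proof (induction rule: span_induct)
      case base
      show ?case by (rule subspace_hyperplane)
    next
      case (step X)
      then show ?case using one min1_eq_1 by (auto simp: inner_diff_left form_at_inner[symmetric])
    qed
  qed
  then obtain s where s: "g - h = s *\<^sub>R \<psi>" using orthogonal_to_hyperplane[OF facet_normalD(1,2)[OF \<psi>] gh] by blast
  then have gs: "g = h + s *\<^sub>R \<psi>" by (simp add: algebra_simps)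
  then have form: "form_at g x = form_at h x + s * form_at \<psi> x" for x
    by (simp add: form_at_add_left form_at_scaleR_left)
  have s0: "s \<noteq> 0" using gs g(2) by auto
  have nonzero: "\<exists>x\<in>min1 f. form_at \<psi> x \<noteq> 0" if "unit_perfect f" for f
    using herm_eq_0_of_span[OF unit_perfect_span[OF that] facet_normalD(1)[OF \<psi>]] facet_normalD(2)[OF \<psi>] by blast
  obtain x where x: "x \<in> min1 h" "form_at \<psi> x > 0"
    using nonzero[OF h] facet_normalD(3)[OF \<psi>] by force
  have "0 \<le> s * form_at \<psi> x"
    using ryshkov_ge_1[OF unit_perfect_ryshkov[OF g(1)] x(1)] min1_eq_1[OF x(1)] by (simp add: form)
  then have sp: "s > 0" using x(2) s0 by (simp add: zero_le_mult_iff)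
  obtain y where y: "y \<in> min1 g" "form_at \<psi> y \<noteq> 0" using nonzero[OF g(1)] by blast
  have "s * form_at \<psi> y \<le> 0"
    using ryshkov_ge_1[OF unit_perfect_ryshkov[OF h] y(1)] min1_eq_1[OF y(1)] by (simp add: form)
  then have "form_at \<psi> y < 0" using sp y(2) by (simp add: mult_le_0_iff)
  then show ?thesis using sp gs y(1) by blast
qed

text \<open>
  Both forms lie on the ray \<open>h + s \<psi>\<close>, and the one with the larger \<open>s\<close> would violate the
  condition of a minimal vector of the other.
\<close>

lemma facet_shared_unique:
  assumes h: "unit_perfect h" and \<psi>: "facet_normal h \<psi>"
    and g: "unit_perfect g" "g \<noteq> h" "facet h \<psi> \<subseteq> vdom g"
    and g': "unit_perfect g'" "g' \<noteq> h" "facet h \<psi> \<subseteq> vdom g'"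
  shows "g = g'"
proof -
  have le: "s' \<le> s" if "unit_perfect (h + s' *\<^sub>R \<psi>)" "y \<in> min1 (h + s *\<^sub>R \<psi>)" "form_at \<psi> y < 0" for s s' :: real and y
  proof (rule ccontr)
    assume "\<not> s' \<le> s"
    then have "(s' - s) * form_at \<psi> y < 0" using that(3) by (simp add: mult_less_0_iff)
    moreover have "1 \<le> form_at (h + s' *\<^sub>R \<psi>) y"
      by (rule ryshkov_ge_1[OF unit_perfect_ryshkov[OF that(1)] that(2)])
    moreover have "form_at (h + s *\<^sub>R \<psi>) y = 1" by (rule min1_eq_1[OF that(2)])
    ultimately show False by (simp add: form_at_add_left form_at_scaleR_left algebra_simps)
  qed
  obtain s y where s: "g = h + s *\<^sub>R \<psi>" "y \<in> min1 g" "form_at \<psi> y < 0"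
    using facet_shared[OF h \<psi> g] by blast
  obtain s' y' where s': "g' = h + s' *\<^sub>R \<psi>" "y' \<in> min1 g'" "form_at \<psi> y' < 0"
    using facet_shared[OF h \<psi> g'] by blast
  have "s' \<le> s" using le[of s' y s] s s' g'(1) by simp
  moreover have "s \<le> s'" using le[of s y' s'] s s' g(1) by simp
  ultimately show ?thesis using s(1) s'(1) by simp
qed

end

section \<open>Interiors of Voronoi domains and of their facets\<close>

lemma vcone_rel_interior_null:
  assumes Z: "Z \<in> rel_interior (vcone S)" "form_at Z v = 0" and X: "X \<in> vcone S"
  shows "form_at X v = 0"
proof -
  have ne: "vcone S \<noteq> {}" using vcone_0 by blast
  obtain e where e: "e > 1" "(1 - e) *\<^sub>R X + e *\<^sub>R Z \<in> vcone S"
    using Z(1) X unfolding convex_rel_interior_iff[OF convex_vcone ne] by blast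
  have "0 \<le> form_at ((1 - e) *\<^sub>R X + e *\<^sub>R Z) v" by (rule vcone_psd[OF e(2)])
  then have "0 \<le> (1 - e) * form_at X v" by (simp add: form_at_add_left form_at_scaleR_left Z(2))
  then have "form_at X v \<le> 0" using e(1) by (simp add: zero_le_mult_iff)
  then show ?thesis using vcone_psd[OF X, of v] by simp
qed

context ground
begin

text \<open>
  A vector at which one interior point of the cone degenerates is a null vector of all points,
  because the nonnegative values at it are a linear function on the cone.
\<close>

lemma rel_interior_vcone_cases:
  assumes S: "S \<subseteq> vecs K" and Z: "Z \<in> rel_interior (vcone S)" "Z \<notin> pos_cone F"
  shows "\<exists>v\<in>vecs K. v \<noteq> 0 \<and> (\<forall>X\<in>vcone S. form_at X v = 0)"
proof -
  have ZS: "Z \<in> vcone S" using Z(1) rel_interior_subset by blast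
  then obtain l where "Z = (\<Sum>x\<in>S. l x *\<^sub>R rank_one x)" unfolding vcone_def by blast
  then have "Z \<in> herm F"
    using S rank_one_herm by (auto intro!: subspace_sum[OF subspace_herm] subspace_scale[OF subspace_herm])
  then obtain v where v: "v \<in> vecs K" "v \<noteq> 0" "\<not> 0 < form_at Z v"
    using Z(2) by (auto simp: pos_cone_def)
  then have "form_at Z v = 0" using vcone_psd[OF ZS, of v] by simp
  then show ?thesis using vcone_rel_interior_null[OF Z(1)] v by blast
qed

lemma vdom_interior:
  assumes h: "unit_perfect h"
  shows "rel_interior (vdom h) \<subseteq> pos_cone F"
proof
  fix Z assume Z: "Z \<in> rel_interior (vdom h)"
  show "Z \<in> pos_cone F"
  proof (rule ccontr)
    assume "Z \<notin> pos_cone F"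
    then obtain v where v: "v \<in> vecs K" "v \<noteq> 0" "\<forall>X\<in>vdom h. form_at X v = 0"
      using rel_interior_vcone_cases[of "min1 h" Z] Z min1_K unfolding vdom_def by blast
    have "form_at (rank_one v) x = 0" if x: "x \<in> min1 h" for x
    proof -
      have "rank_one x \<in> vdom h" unfolding vdom_def by (rule rank_one_vcone[OF unit_perfect_finite[OF h] x])
      then have "form_at (rank_one x) v = 0" using v(3) by blast
      then show ?thesis by (simp only: form_at_inner inner_commute)
    qed
    then have "rank_one v = 0"
      by (rule herm_eq_0_of_span[OF unit_perfect_span[OF h] rank_one_herm[OF v(1)]])
    then show False using v(2) by (simp add: rank_one_eq_0_iff)
  qed
qed

text \<open>
  If an interior point of the facet has the null vector \<open>v\<close>, then \<open>v v\<^sup>*\<close> is orthogonal to the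
  whole hyperplane and is a positive multiple of \<open>\<psi>\<close>, which makes \<open>\<psi>\<close> semidefinite.
\<close>

lemma facet_interior:
  assumes h: "unit_perfect h" and \<psi>: "facet_normal h \<psi>" and np: "\<not> psd \<psi>"
  shows "rel_interior (facet h \<psi>) \<subseteq> pos_cone F"
proof
  fix Z assume Z: "Z \<in> rel_interior (facet h \<psi>)"
  define S where "S = {x \<in> min1 h. form_at \<psi> x = 0}"
  have fin: "finite S" using unit_perfect_finite[OF h] by (simp add: S_def)
  show "Z \<in> pos_cone F"
  proof (rule ccontr)
    assume "Z \<notin> pos_cone F"
    moreover have "S \<subseteq> vecs K" using min1_K by (auto simp: S_def)
    ultimately obtain v where v: "v \<in> vecs K" "v \<noteq> 0" "\<forall>X\<in>vcone S. form_at X v = 0"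
      using rel_interior_vcone_cases[of S Z] Z unfolding facet_def S_def by blast
    have "rank_one v \<bullet> X = 0" if X: "X \<in> herm F" "\<psi> \<bullet> X = 0" for X
    proof -
      have "X \<in> span (rank_one ` S)" using X facet_normalD(4)[OF \<psi>] unfolding S_def by blast
      then show ?thesis
      proof (induction rule: span_induct)
        case base
        show ?case by (rule subspace_hyperplane)
      next
        case (step Y)
        then have "Y \<in> vcone S" using rank_one_vcone[OF fin] by blast
        then have "form_at Y v = 0" using v(3) by blast
        then show ?case by (simp only: form_at_inner inner_commute)
      qed
    qed
    then obtain c where c: "rank_one v = c *\<^sub>R \<psi>"
      using orthogonal_to_hyperplane[OF facet_normalD(1,2)[OF \<psi>] rank_one_herm[OF v(1)]] by blast
    have c0: "c \<noteq> 0" using c v(2) by (auto simp: rank_one_eq_0_iff)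
    have form: "c * form_at \<psi> x = (cmod (cdot v x))\<^sup>2" for x
      unfolding form_at_rank_one[symmetric] c form_at_scaleR_left ..
    obtain x where x: "x \<in> min1 h" "form_at \<psi> x \<noteq> 0"
      using herm_eq_0_of_span[OF unit_perfect_span[OF h] facet_normalD(1)[OF \<psi>]] facet_normalD(2)[OF \<psi>] by blast
    then have "form_at \<psi> x > 0" using facet_normalD(3)[OF \<psi> x(1)] by simp
    moreover have "0 \<le> c * form_at \<psi> x" unfolding form by simp
    ultimately have "c > 0" using c0 by (simp add: zero_le_mult_iff)
    moreover have "0 \<le> c * form_at \<psi> y" for y unfolding form by simp
    ultimately have "0 \<le> form_at \<psi> y" for y by (simp add: zero_le_mult_iff)
    then show False using np by (simp add: psd_def)
  qed
qed

subsection \<open>Rational kernels\<close>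

lemma F_inverse: "x \<in> F \<Longrightarrow> inverse x \<in> F"
proof (cases "x = 0")
  case False
  assume x: "x \<in> F"
  then obtain a b where ab: "x = of_rat a + of_rat b * w" unfolding mem_F_iff by blast
  have "x * cnj x = of_rat (a * a) - of_rat (b * b) * (w * w)"
    by (simp add: ab cnj_w cnj_of_rat algebra_simps of_rat_mult)
  then have N: "x * cnj x = of_rat (a * a + b * b * of_nat d)" (is "_ = of_rat ?r")
    by (simp add: w_sq of_rat_add of_rat_mult)
  have "inverse x = cnj x * inverse (x * cnj x)" using False by simp
  then have "inverse x = cnj x * of_rat (inverse ?r)" unfolding N of_rat_inverse .
  then show ?thesis using F_mult[OF F_cnj[OF x] Rats_F] by simp
qed (use Rats_F[of 0] in simp)

lemma F_divide: "x \<in> F \<Longrightarrow> y \<in> F \<Longrightarrow> x / y \<in> F"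
  by (simp add: divide_inverse F_mult F_inverse)

lemma F_minus: "x \<in> F \<Longrightarrow> - x \<in> F"
  using F_mult[OF Rats_F[of "-1"]] by (simp add: of_rat_minus)

lemma F_0: "0 \<in> F" and F_1: "1 \<in> F"
  using Rats_F[of 0] Rats_F[of 1] by auto

lemma F_sum: "(\<And>i. i \<in> A \<Longrightarrow> f i \<in> F) \<Longrightarrow> sum f A \<in> F"
  using F_0 by (induction A rule: infinite_finite_induct) (auto intro: F_add)

lemma cdot_F: "x \<in> vecs F \<Longrightarrow> y \<in> vecs F \<Longrightarrow> cdot x y \<in> F"
  unfolding cdot_def by (intro F_sum F_mult F_cnj) (auto simp: vecs_def)

lemma vecs_F_add: "x \<in> vecs F \<Longrightarrow> y \<in> vecs F \<Longrightarrow> x + y \<in> vecs F"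
  and vecs_F_smult: "c \<in> F \<Longrightarrow> x \<in> vecs F \<Longrightarrow> c *s x \<in> vecs F"
  by (simp_all add: vecs_def F_add F_mult)

lemma scaleR_mult_vec: "(r *\<^sub>R A) *v y = r *\<^sub>R (A *v (y :: complex ^ 'n))"
  by (simp add: Finite_Cartesian_Product.vec_eq_iff matrix_vector_mult_def scaleR_sum_right)

lemma cdot_sum_right: "cdot x (\<Sum>i\<in>I. f i) = (\<Sum>i\<in>I. cdot x (f i))"
  by (induction I rule: infinite_finite_induct) (simp_all add: cdot_zero_right cdot_add_right)

text \<open>
  In a representation of \<open>y\<close> with the least number of terms the coefficients are linearly
  independent over \<open>F\<close>, because a relation would eliminate one of them.
\<close>

lemma independent_representation:
  fixes y :: "complex ^ 'n"
  assumes y: "y \<in> vecs K"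
  shows "\<exists>(I :: 'n set) c u. (\<forall>i\<in>I. c i \<in> K \<and> u i \<in> vecs F) \<and> y = (\<Sum>i\<in>I. c i *s u i) \<and>
     (\<forall>a. (\<forall>i\<in>I. a i \<in> F) \<and> (\<Sum>i\<in>I. c i * a i) = 0 \<longrightarrow> (\<forall>i\<in>I. a i = 0))"
proof -
  define rep where "rep I c u \<longleftrightarrow> (\<forall>i\<in>I. c i \<in> K \<and> u i \<in> vecs F) \<and> y = (\<Sum>i\<in>I. c i *s u i)"
    for I :: "'n set" and c :: "'n \<Rightarrow> complex" and u :: "'n \<Rightarrow> complex ^ 'n"
  have "rep UNIV (\<lambda>i. y $ i) (\<lambda>i. axis i 1)"
    unfolding rep_def using y axis_Oi vecs_Oi_F by (auto simp: vecs_def[of K] basis_expansion)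
  then have ex: "\<exists>n I c u. rep I c u \<and> card I = n" by blast
  define n where "n = (LEAST n. \<exists>I c u. rep I c u \<and> card I = n)"
  obtain I c u where I: "rep I c u" "card I = n"
    using LeastI_ex[OF ex] unfolding n_def by blast
  have min: "n \<le> card J" if "rep J c' u'" for J c' u'
    unfolding n_def by (rule Least_le) (use that in blast)
  have "a j = 0" if a: "\<forall>i\<in>I. a i \<in> F" "(\<Sum>i\<in>I. c i * a i) = 0" and j: "j \<in> I" for a j
  proof (rule ccontr)
    assume aj: "a j \<noteq> 0"
    have fin: "finite I" by simp
    have "c j * a j = - (\<Sum>i\<in>I - {j}. c i * a i)"
      using a(2) sum.remove[OF fin j, of "\<lambda>i. c i * a i"] by (simp add: eq_neg_iff_add_eq_0)
    then have cj: "c j = (\<Sum>i\<in>I - {j}. c i * (- (a i / a j)))"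
      using aj by (simp add: field_simps sum_negf sum_divide_distrib[symmetric])
    define u' where "u' i = u i + (- (a i / a j)) *s u j" for i
    have "y = c j *s u j + (\<Sum>i\<in>I - {j}. c i *s u i)"
      using I(1) sum.remove[OF fin j, of "\<lambda>i. c i *s u i"] by (simp add: rep_def)
    also have "c j *s u j = (\<Sum>i\<in>I - {j}. (c i * (- (a i / a j))) *s u j)"
      by (subst cj) (simp only: vec.scale_sum_left)
    also have "\<dots> + (\<Sum>i\<in>I - {j}. c i *s u i) = (\<Sum>i\<in>I - {j}. c i *s u' i)"
      by (simp add: u'_def sum.distrib[symmetric] vector_add_ldistrib vector_smult_assoc add.commute)
    finally have "y = (\<Sum>i\<in>I - {j}. c i *s u' i)" .
    moreover have "u' i \<in> vecs F" if i: "i \<in> I" for i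
    proof -
      have "u i \<in> vecs F" "u j \<in> vecs F" using I(1) i j by (auto simp: rep_def)
      moreover have "- (a i / a j) \<in> F" using a(1) i j by (intro F_minus F_divide) auto
      ultimately show ?thesis unfolding u'_def by (intro vecs_F_add vecs_F_smult)
    qed
    ultimately have "rep (I - {j}) c u'" using I(1) by (simp add: rep_def)
    from min[OF this] have "card I \<le> card (I - {j})" using I(2) by simp
    then show False using card_Diff1_less[OF fin j] by simp
  qed
  then show ?thesis using I(1) unfolding rep_def by blast
qed

text \<open>
  The kernel of a sum of matrices \<open>l\<^sub>x x x\<^sup>*\<close> consists of the vectors orthogonal to the
  integral vectors \<open>x\<close> with \<open>l\<^sub>x \<noteq> 0\<close>, so it is given by linear equations over \<open>F\<close>. In a
  representation of a solution with coefficients independent over \<open>F\<close>, each term is a solution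
  by itself; hence the solutions in \<open>F\<^sup>n\<close> span the kernel.
\<close>

lemma vcone_pos_cone_star:
  fixes S :: "(complex ^ 'n) set"
  assumes S: "finite S" "S \<subseteq> vecs Oi" and Z: "Z \<in> vcone S" "Z \<noteq> 0"
  shows "Z \<in> pos_cone_star F"
proof -
  obtain l where l: "Z = (\<Sum>x\<in>S. l x *\<^sub>R rank_one x)" "\<And>x. 0 \<le> l x" using Z(1) unfolding vcone_def by blast
  have ZH: "Z \<in> herm F" unfolding l(1)
    using S(2) rank_one_herm vecs_Oi_K by (auto intro!: subspace_sum[OF subspace_herm] subspace_scale[OF subspace_herm])
  define S0 where "S0 = {x \<in> S. l x \<noteq> 0}"
  have ker: "Z *v y = 0 \<longleftrightarrow> (\<forall>x\<in>S0. cdot x y = 0)" for y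
  proof
    assume "Z *v y = 0"
    then have "form_at Z y = 0" by (simp add: form_at_cdot cdot_zero_right)
    then have "(\<Sum>x\<in>S. l x * (cmod (cdot x y))\<^sup>2) = 0" unfolding l(1) form_at_vcone .
    then have "\<forall>x\<in>S. l x * (cmod (cdot x y))\<^sup>2 = 0"
      using sum_nonneg_eq_0_iff[OF S(1), of "\<lambda>x. l x * (cmod (cdot x y))\<^sup>2"] l(2) by simp
    then show "\<forall>x\<in>S0. cdot x y = 0" by (auto simp: S0_def)
  next
    assume "\<forall>x\<in>S0. cdot x y = 0"
    then have "(l x *\<^sub>R rank_one x) *v y = 0" if "x \<in> S" for x
      using that by (cases "l x = 0") (simp_all add: S0_def scaleR_mult_vec rank_one_mult_vec)
    then show "Z *v y = 0" unfolding l(1) sum_matrix_vector by simp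
  qed
  define W where "W = {y \<in> vecs F. \<forall>x\<in>S0. cdot x y = 0}"
  have "linear_subspace F W"
    unfolding linear_subspace_def W_def
    by (auto simp: vecs_def F_0 F_add F_mult cdot_zero_right cdot_add_right cdot_smult_right)
  moreover have "W \<subset> vecs F"
  proof -
    have "\<exists>x\<in>S. l x *\<^sub>R rank_one x \<noteq> 0" using Z(2) unfolding l(1) by (metis (no_types, lifting) sum.neutral)
    then obtain x where x: "x \<in> S" "l x \<noteq> 0" "x \<noteq> 0" by (auto simp: rank_one_eq_0_iff)
    then have "x \<in> S0" "cdot x x \<noteq> 0" by (simp_all add: S0_def cdot_self)
    then have "x \<notin> W" by (auto simp: W_def)
    moreover have "x \<in> vecs F" using x(1) S(2) vecs_Oi_F by blast
    ultimately show ?thesis by (auto simp: W_def)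
  qed
  moreover have "{y \<in> vecs K. Z *v y = 0} = linear_subspace K hull W"
  proof (intro equalityI subsetI)
    fix y assume "y \<in> linear_subspace K hull W"
    moreover have "linear_subspace K hull W \<subseteq> {y \<in> vecs K. Z *v y = 0}"
    proof (rule hull_minimal)
      show "W \<subseteq> {y \<in> vecs K. Z *v y = 0}" unfolding ker using F_K by (auto simp: W_def vecs_def)
      show "linear_subspace K {y \<in> vecs K. Z *v y = 0}"
        unfolding ker linear_subspace_def
        by (auto simp: vecs_def K_0 K_add K_mult cdot_zero_right cdot_add_right cdot_smult_right)
    qed
    ultimately show "y \<in> {y \<in> vecs K. Z *v y = 0}" by blast
  next
    fix y assume "y \<in> {y \<in> vecs K. Z *v y = 0}"
    then have y: "y \<in> vecs K" "\<forall>x\<in>S0. cdot x y = 0" by (auto simp: ker)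
    obtain I :: "'n set" and c u where I: "\<forall>i\<in>I. c i \<in> K \<and> u i \<in> vecs F" "y = (\<Sum>i\<in>I. c i *s u i)"
      "\<forall>a. (\<forall>i\<in>I. a i \<in> F) \<and> (\<Sum>i\<in>I. c i * a i) = 0 \<longrightarrow> (\<forall>i\<in>I. a i = 0)"
      using independent_representation[OF y(1)] by blast
    have uW: "u i \<in> W" if i: "i \<in> I" for i
    proof -
      have "cdot x (u i) = 0" if x: "x \<in> S0" for x
      proof -
        have "(\<Sum>i\<in>I. c i * cdot x (u i)) = cdot x y"
          by (simp only: I(2) cdot_sum_right cdot_smult_right)
        then have "(\<Sum>i\<in>I. c i * cdot x (u i)) = 0" using y(2) x by simp
        moreover have "x \<in> vecs F" using x S(2) vecs_Oi_F by (auto simp: S0_def)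
        then have "\<forall>i\<in>I. cdot x (u i) \<in> F" using I(1) cdot_F by blast
        ultimately show ?thesis using I(3)[rule_format, of "\<lambda>i. cdot x (u i)"] i by blast
      qed
      then show ?thesis using I(1) i by (simp add: W_def)
    qed
    show "y \<in> linear_subspace K hull W"
      unfolding hull_def
    proof (rule InterI)
      fix T assume "T \<in> {T. linear_subspace K T \<and> W \<subseteq> T}"
      then have T: "linear_subspace K T" "W \<subseteq> T" by auto
      have "(\<Sum>i\<in>J. c i *s u i) \<in> T" if "J \<subseteq> I" for J
        using finite[of J] that
      proof (induction J rule: finite_induct)
        case empty
        then show ?case using T(1) by (simp add: linear_subspace_def)
      next
        case (insert i J)
        then have "c i *s u i \<in> T" using T uW I(1) unfolding linear_subspace_def by blast
        then show ?case using insert T(1) by (simp add: linear_subspace_def)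
      qed
      then show "y \<in> T" using I(2) by blast
    qed
  qed
  moreover have "\<forall>x\<in>vecs K. 0 \<le> form_at Z x" using vcone_psd[OF Z(1)] by blast
  ultimately show ?thesis unfolding pos_cone_star_def using ZH by blast
qed

text \<open>
  If \<open>\<psi>\<close> is semidefinite, it annihilates all vectors \<open>x\<close> of the facet, so its image is
  orthogonal to them, and the barycentre of the facet is degenerate.
\<close>

lemma facet_boundary:
  assumes h: "unit_perfect h" and \<psi>: "facet_normal h \<psi>" and ps: "psd \<psi>" and ne: "facet h \<psi> \<noteq> {0}"
  shows "rel_interior (facet h \<psi>) \<inter> pos_cone_star_boundary F \<noteq> {}"
proof -
  define S where "S = {x \<in> min1 h. form_at \<psi> x = 0}"
  have fin: "finite S" using unit_perfect_finite[OF h] by (simp add: S_def)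
  define Z where "Z = (\<Sum>x\<in>S. rank_one x)"
  have Zr: "Z \<in> rel_interior (facet h \<psi>)" unfolding Z_def facet_def S_def[symmetric] by (rule bary_rel_interior[OF fin])
  have "S \<noteq> {}" using ne by (auto simp: facet_def S_def[symmetric] vcone_def)
  have Zf: "form_at Z v = (\<Sum>x\<in>S. (cmod (cdot x v))\<^sup>2)" for v
    using form_at_vcone[of "\<lambda>_. 1" S v] by (simp add: Z_def)
  have "Z \<noteq> 0"
  proof
    assume "Z = 0"
    obtain x where x: "x \<in> S" using \<open>S \<noteq> {}\<close> by blast
    have "(\<Sum>y\<in>S. (cmod (cdot y x))\<^sup>2) = 0" using Zf[of x] \<open>Z = 0\<close> by (simp add: form_at_zero_left)
    then have "\<forall>y\<in>S. (cmod (cdot y x))\<^sup>2 = 0"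
      using sum_nonneg_eq_0_iff[OF fin, of "\<lambda>y. (cmod (cdot y x))\<^sup>2"] by simp
    then have "cdot x x = 0" using x by simp
    then have "x = 0" by (simp add: cdot_self)
    then show False using x by (simp add: S_def min1_def)
  qed
  moreover have "S \<subseteq> vecs Oi" by (auto simp: S_def min1_def)
  moreover have "Z \<in> vcone S" unfolding Z_def using vcone_I[of "\<lambda>_. 1" S] by simp
  ultimately have "Z \<in> pos_cone_star F" using vcone_pos_cone_star[OF fin] by blast
  moreover have "Z \<notin> pos_cone F"
  proof
    assume Zp: "Z \<in> pos_cone F"
    have "\<exists>u\<in>vecs K. \<psi> *v u \<noteq> 0"
    proof (rule ccontr)
      assume "\<not> (\<exists>u\<in>vecs K. \<psi> *v u \<noteq> 0)"
      then have "form_at \<psi> u = 0" if "u \<in> vecs K" for u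
        using that by (simp add: form_at_cdot cdot_zero_right)
      then have "\<psi> = 0" by (rule herm_eq_0[OF facet_normalD(1)[OF \<psi>]])
      then show False using facet_normalD(2)[OF \<psi>] by blast
    qed
    then obtain u where u: "u \<in> vecs K" "\<psi> *v u \<noteq> 0" by blast
    have "cdot x (\<psi> *v u) = 0" if "x \<in> S" for x
    proof -
      have x: "x \<in> vecs K" "form_at \<psi> x = 0" using that min1_K by (auto simp: S_def)
      have "\<psi> *v x = 0" by (rule psd_null_vector[OF facet_normalD(1)[OF \<psi>] ps x])
      then show ?thesis
        unfolding cdot_conj_transpose herm_sym[OF facet_normalD(1)[OF \<psi>]] by (simp only: cdot_zero_left)
    qed
    then have "form_at Z (\<psi> *v u) = 0" unfolding Zf by simp
    moreover have "\<psi> *v u \<in> vecs K" using mats_K_vecs[OF herm_K[OF facet_normalD(1)[OF \<psi>]] u(1)] .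
    ultimately show False using Zp u(2) unfolding pos_cone_def by force
  qed
  ultimately show ?thesis using Zr by (auto simp: pos_cone_star_boundary_def)
qed

text \<open>
  Otherwise the Hermitian matrices form a line, and \<open>\<psi>\<close> is a positive multiple of the
  identity.
\<close>

lemma facet_nonzero:
  fixes h :: "complex ^ 'n ^ 'n"
  assumes h: "unit_perfect h" and \<psi>: "facet_normal h \<psi>" and np: "\<not> psd \<psi>"
  shows "facet h \<psi> \<noteq> {0}"
proof
  assume "facet h \<psi> = {0}"
  then have H: "{X \<in> herm F. \<psi> \<bullet> X = 0} = {0}" using span_facet[OF h \<psi>] by simp
  define c where "c = (\<psi> \<bullet> mat 1) / (\<psi> \<bullet> \<psi>)"
  have n: "\<psi> \<bullet> \<psi> \<noteq> 0" using facet_normalD(2)[OF \<psi>] by simp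
  have "mat 1 - c *\<^sub>R \<psi> \<in> {X \<in> herm F. \<psi> \<bullet> X = 0}"
    unfolding c_def
    by (intro CollectI conjI subspace_diff[OF subspace_herm] subspace_scale[OF subspace_herm]
        mat_1_herm facet_normalD(1)[OF \<psi>] herm_decomp(2)[OF n])
  then have eq: "mat 1 = c *\<^sub>R \<psi>" unfolding H by simp
  have form: "c * form_at \<psi> x = (norm x)\<^sup>2" for x
    unfolding mat_1_form[symmetric] eq form_at_scaleR_left ..
  obtain x where x: "x \<in> min1 h" using unit_perfect_nonempty[OF h] by blast
  then have "x \<noteq> 0" by (simp add: min1_def)
  then have "0 < c * form_at \<psi> x" unfolding form by simp
  then have "c > 0" using facet_normalD(3)[OF \<psi> x] by (simp add: zero_less_mult_iff)
  moreover have "0 \<le> c * form_at \<psi> y" for y unfolding form by simp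
  ultimately have "psd \<psi>" unfolding psd_def by (simp add: zero_le_mult_iff)
  then show False using np by blast
qed

subsection \<open>Extreme rays off a facet\<close>

lemma cone_vecs_vdom:
  assumes h: "unit_perfect h" and x: "x \<in> min1 h"
  shows "x \<in> cone_vecs F (vdom h)"
proof -
  have dom: "voronoi_domain F h = vdom h"
    by (simp add: voronoi_domain_vcone vdom_def unit_perfect_imp_perfect(2)[OF h])
  have "x \<noteq> 0" "x \<in> vecs Oi" using x by (simp_all add: min1_def)
  moreover have "vdom h face_of vdom h" unfolding vdom_def by (rule face_of_refl[OF convex_vcone])
  moreover have "(\<lambda>t. t *\<^sub>R rank_one x) ` {0..} face_of vdom h"
    unfolding vdom_def using ray_face_of_vcone[OF unit_perfect_finite[OF h] x] \<open>x \<noteq> 0\<close> by blast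
  ultimately show ?thesis
    unfolding cone_vecs_def using unit_perfect_imp_perfect[OF h] x dom by (intro CollectI conjI exI[of _ h]) auto
qed

lemma cone_vecs_mem: "x \<in> cone_vecs F \<sigma> \<Longrightarrow> rank_one x \<in> \<sigma>"
proof -
  assume "x \<in> cone_vecs F \<sigma>"
  then have "(\<lambda>t. t *\<^sub>R rank_one x) ` {0..} face_of \<sigma>" by (auto simp: cone_vecs_def)
  then have "(\<lambda>t. t *\<^sub>R rank_one x) ` {0..} \<subseteq> \<sigma>" by (rule face_of_imp_subset)
  moreover have "rank_one x = 1 *\<^sub>R rank_one x" by simp
  ultimately show ?thesis by (metis atLeast_iff image_subset_iff zero_le_one)
qed

lemma cone_vecs_face:
  assumes x: "x \<in> cone_vecs F \<sigma>" and \<tau>: "\<tau> face_of \<sigma>" "\<And>t. 0 \<le> t \<Longrightarrow> t *\<^sub>R rank_one x \<in> \<tau>"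
  shows "x \<in> cone_vecs F \<tau>"
proof -
  obtain h where h: "perfect_form F h" "\<sigma> face_of voronoi_domain F h" "x \<in> min_vecs F h"
    "(\<lambda>t. t *\<^sub>R rank_one x) ` {0..} face_of \<sigma>" "x \<in> vecs Oi"
    using x by (auto simp: cone_vecs_def)
  have "\<tau> face_of voronoi_domain F h" using face_of_trans[OF \<tau>(1) h(2)] .
  moreover have "(\<lambda>t. t *\<^sub>R rank_one x) ` {0..} face_of \<tau>"
    using \<tau>(2) by (intro face_of_subset[OF h(4) _ face_of_imp_subset[OF \<tau>(1)]]) auto
  ultimately show ?thesis unfolding cone_vecs_def using h(1,3,5) by blast
qed

text \<open>
  An extreme ray of the domain that lies in the facet is an extreme ray of the facet; so \<open>\<psi>\<close>
  is positive on the remaining ones.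
\<close>

lemma cone_vecs_off_facet:
  assumes h: "unit_perfect h" and \<psi>: "facet_normal h \<psi>"
  shows "\<exists>x. x \<in> cone_vecs F (vdom h) - cone_vecs F (facet h \<psi>)"
    and "\<And>x. x \<in> cone_vecs F (vdom h) - cone_vecs F (facet h \<psi>) \<Longrightarrow>
           rank_one x \<in> herm F \<and> 0 < \<psi> \<bullet> rank_one x"
proof -
  have nn: "\<And>x. x \<in> min1 h \<Longrightarrow> 0 \<le> form_at \<psi> x" using facet_normalD(3)[OF \<psi>] .
  have fe: "facet h \<psi> = vdom h \<inter> {X. \<psi> \<bullet> X = 0}" by (rule facet_eq[OF h nn])
  obtain x where x: "x \<in> min1 h" "form_at \<psi> x \<noteq> 0"
    using herm_eq_0_of_span[OF unit_perfect_span[OF h] facet_normalD(1)[OF \<psi>]] facet_normalD(2)[OF \<psi>] by blast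
  have "x \<notin> cone_vecs F (facet h \<psi>)"
  proof
    assume "x \<in> cone_vecs F (facet h \<psi>)"
    then have "rank_one x \<in> facet h \<psi>" by (rule cone_vecs_mem)
    then show False using x(2) unfolding fe by (simp add: form_at_inner)
  qed
  then show "\<exists>x. x \<in> cone_vecs F (vdom h) - cone_vecs F (facet h \<psi>)"
    using cone_vecs_vdom[OF h x(1)] by blast
  fix x assume x: "x \<in> cone_vecs F (vdom h) - cone_vecs F (facet h \<psi>)"
  have xd: "rank_one x \<in> vdom h" using x cone_vecs_mem by blast
  have "0 \<le> \<psi> \<bullet> rank_one x" using inner_vcone_nonneg[OF nn] xd unfolding vdom_def by blast
  moreover have "\<psi> \<bullet> rank_one x \<noteq> 0"
  proof
    assume z: "\<psi> \<bullet> rank_one x = 0"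
    have face: "facet h \<psi> face_of vdom h"
      unfolding fe unfolding vdom_def
      using inner_vcone_nonneg[OF nn] by (intro face_of_Int_supporting_hyperplane_ge convex_vcone) blast
    have "t *\<^sub>R rank_one x \<in> facet h \<psi>" if "0 \<le> t" for t
      unfolding fe using z xd vcone_scaleR[OF _ that] unfolding vdom_def by simp
    then have "x \<in> cone_vecs F (facet h \<psi>)" using x by (intro cone_vecs_face[OF _ face]) auto
    then show False using x by blast
  qed
  ultimately show "rank_one x \<in> herm F \<and> 0 < \<psi> \<bullet> rank_one x"
    using xd vdom_herm[OF h] by auto
qed

subsection \<open>The action on Voronoi domains\<close>

text \<open>
  The form \<open>x \<mapsto> h(\<gamma>\<^sup>-\<^sup>1 x)\<close> has the minimal vectors \<open>\<gamma> x\<close>.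
\<close>

lemma act_vdom:
  fixes h :: "complex ^ 'n ^ 'n"
  assumes g: "\<gamma> \<in> GLO" and h: "unit_perfect h"
  shows "\<exists>g. unit_perfect g \<and> act \<gamma> ` vdom h = vdom g \<and> min1 g = (*v) \<gamma> ` min1 h"
proof -
  obtain \<delta> where \<delta>: "\<delta> \<in> GLO" "\<gamma> ** \<delta> = mat 1" "\<delta> ** \<gamma> = mat 1" using GLO_inverse[OF g] by blast
  define k where "k = act (conj_transpose \<delta>) h"
  have "unit_perfect k" unfolding k_def by (rule unit_perfect_act[OF \<delta>(1) h])
  moreover have m: "min1 k = (*v) \<gamma> ` min1 h" unfolding k_def by (rule min1_act[OF \<delta>(1,3,2) GLO_Oi[OF g]])
  moreover have "inj_on ((*v) \<gamma>) (min1 h)"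
  proof (rule inj_onI)
    fix x y assume "\<gamma> *v x = \<gamma> *v y"
    then have "\<delta> *v (\<gamma> *v x) = \<delta> *v (\<gamma> *v y)" by simp
    then show "x = y" by (simp add: matrix_vector_mul_assoc \<delta>(3))
  qed
  then have "vdom k = act \<gamma> ` vdom h" unfolding vdom_def m by (rule vcone_image)
  ultimately show ?thesis by metis
qed

text \<open>
  Such a \<open>\<gamma>\<close> maps a basis of minimal vectors of \<open>h\<close> to minimal vectors of \<open>g\<close>, and it is
  determined by the images.
\<close>

lemma finite_transporter:
  fixes h g :: "complex ^ 'n ^ 'n"
  assumes h: "unit_perfect h" and g: "unit_perfect g"
  shows "finite {\<gamma> \<in> GLO. act \<gamma> ` vdom h = vdom g}"
proof -
  obtain M M' :: "complex ^ 'n ^ 'n" where M: "M ** M' = mat 1" "\<forall>j. M *v axis j 1 \<in> min1 h"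
    using min1_frame[OF h] by blast
  define f where "f \<gamma> = (\<chi> j. \<gamma> *v (M *v axis j 1))" for \<gamma> :: "complex ^ 'n ^ 'n"
  have "inj f"
  proof (rule injI)
    fix \<gamma> \<gamma>' assume "f \<gamma> = f \<gamma>'"
    then have "f \<gamma> $ j = f \<gamma>' $ j" for j by simp
    then have "\<gamma> *v (M *v axis j 1) = \<gamma>' *v (M *v axis j 1)" for j by (simp add: f_def)
    then have "(\<gamma> ** M) *v axis j 1 = (\<gamma>' ** M) *v axis j 1" for j
      by (simp only: matrix_vector_mul_assoc)
    then have "column j (\<gamma> ** M) = column j (\<gamma>' ** M)" for j
      by (simp only: mult_axis)
    then have "\<gamma> ** M = \<gamma>' ** M"
      by (simp add: column_def Finite_Cartesian_Product.vec_eq_iff)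
    then have "\<gamma> ** M ** M' = \<gamma>' ** M ** M'" by simp
    then show "\<gamma> = \<gamma>'" by (simp add: matrix_mul_assoc[symmetric] M(1))
  qed
  moreover have "f ` {\<gamma> \<in> GLO. act \<gamma> ` vdom h = vdom g} \<subseteq> {x. \<forall>j. x $ j \<in> min1 g}"
  proof clarify
    fix \<gamma> j assume \<gamma>: "\<gamma> \<in> GLO" "act \<gamma> ` vdom h = vdom g"
    obtain k where k: "unit_perfect k" "act \<gamma> ` vdom h = vdom k" "min1 k = (*v) \<gamma> ` min1 h"
      using act_vdom[OF \<gamma>(1) h] by blast
    have "k = g" using vdom_inj[OF k(1) g] k(2) \<gamma>(2) by simp
    then show "f \<gamma> $ j \<in> min1 g" using k(3) M(2) by (simp add: f_def)
  qed
  then have "finite (f ` {\<gamma> \<in> GLO. act \<gamma> ` vdom h = vdom g})"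
    using finite_vec_entries[OF unit_perfect_finite[OF g]] by (rule finite_subset)
  ultimately show ?thesis using finite_imageD inj_on_subset[OF _ subset_UNIV] by blast
qed

lemma finite_vdom_mod_GLO:
  "\<exists>S :: (complex ^ 'n ^ 'n) set. finite S \<and> (\<forall>h\<in>S. unit_perfect h) \<and>
     (\<forall>h. unit_perfect h \<longrightarrow> (\<exists>\<gamma>\<in>GLO. \<exists>g\<in>S. vdom h = act \<gamma> ` vdom g))"
proof -
  obtain S :: "(complex ^ 'n ^ 'n) set" where S: "finite S" "\<forall>h\<in>S. unit_perfect h"
    "\<forall>h. unit_perfect h \<longrightarrow> (\<exists>\<gamma>\<in>GLO. act (conj_transpose \<gamma>) h \<in> S)"
    using finite_unit_perfect_mod_GLO by blast
  have "\<exists>\<gamma>\<in>GLO. \<exists>g\<in>S. vdom h = act \<gamma> ` vdom g" if h: "unit_perfect h" for h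
  proof -
    obtain \<gamma> where \<gamma>: "\<gamma> \<in> GLO" "act (conj_transpose \<gamma>) h \<in> S" using S(3) h by blast
    define g where "g = act (conj_transpose \<gamma>) h"
    obtain \<delta> where \<delta>: "\<delta> \<in> GLO" "\<gamma> ** \<delta> = mat 1" "\<delta> ** \<gamma> = mat 1" using GLO_inverse[OF \<gamma>(1)] by blast
    have g: "unit_perfect g" using S(2) \<gamma>(2) by (simp add: g_def)
    obtain k where k: "unit_perfect k" "act \<gamma> ` vdom g = vdom k" "min1 k = (*v) \<gamma> ` min1 g"
      using act_vdom[OF \<gamma>(1) g] by blast
    have "min1 g = (*v) \<delta> ` min1 h" unfolding g_def by (rule min1_act[OF \<gamma>(1) \<delta>(2,3) GLO_Oi[OF \<delta>(1)]])
    then have "min1 k = min1 h" unfolding k(3) by (simp add: image_image matrix_vector_mul_assoc \<delta>(2))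
    then have "vdom k = vdom h" by (simp add: vdom_def)
    then have "vdom h = act \<gamma> ` vdom g" using k(2) by simp
    then show ?thesis using \<gamma> g_def by blast
  qed
  then show ?thesis using S(1,2) by blast
qed

subsection \<open>Connectedness through interior facets\<close>

text \<open>
  Neighbours across a wall: as \<open>\<psi>\<close> is not semidefinite, interior points of the common facet
  are positive definite.
\<close>

definition adjacent :: "complex ^ 'n ^ 'n \<Rightarrow> complex ^ 'n ^ 'n \<Rightarrow> bool" where
  "adjacent h g \<longleftrightarrow> unit_perfect h \<and> unit_perfect g \<and> g \<noteq> h \<and>
     (\<exists>\<psi>. facet_normal h \<psi> \<and> \<not> psd \<psi> \<and> facet_normal g (- \<psi>) \<and> facet g (- \<psi>) = facet h \<psi>)"

text \<open>
  A full-dimensional polyhedral cone is the intersection of the half-spaces of its facets.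
\<close>

lemma separating_facet:
  fixes h :: "complex ^ 'n ^ 'n"
  assumes h: "unit_perfect h" and X: "X \<in> herm F" "X \<notin> vdom h"
  shows "\<exists>\<psi>. facet_normal h \<psi> \<and> \<psi> \<bullet> X < 0"
proof -
  define \<sigma> where "\<sigma> = vdom h"
  have fin: "finite (min1 h)" using unit_perfect_finite[OF h] .
  have 0: "0 \<in> \<sigma>" unfolding \<sigma>_def vdom_def by (rule vcone_0)
  then have aff: "affine hull \<sigma> = herm F"
    using affine_hull_span_0[of \<sigma>] span_vdom[OF h] by (simp add: hull_inc \<sigma>_def)
  have "polyhedron \<sigma>" unfolding \<sigma>_def vdom_def by (rule polyhedron_vcone[OF fin])
  then obtain \<F> where \<F>: "finite \<F>" "\<sigma> = affine hull \<sigma> \<inter> \<Inter>\<F>"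
    "\<forall>f\<in>\<F>. \<exists>a b. a \<noteq> 0 \<and> f = {x. a \<bullet> x \<le> b} \<and> (\<forall>x\<in>affine hull \<sigma>. x + a \<in> affine hull \<sigma>)"
    "\<forall>F'. F' \<subset> \<F> \<longrightarrow> \<sigma> \<subset> affine hull \<sigma> \<inter> \<Inter>F'"
    unfolding polyhedron_Int_affine_parallel_minimal by blast
  have "\<forall>f\<in>\<F>. \<exists>p. fst p \<noteq> 0 \<and> f = {x. fst p \<bullet> x \<le> snd p} \<and> (\<forall>x\<in>affine hull \<sigma>. x + fst p \<in> affine hull \<sigma>)"
  proof
    fix f assume "f \<in> \<F>"
    then obtain a b where "a \<noteq> 0" "f = {x. a \<bullet> x \<le> b}" "\<forall>x\<in>affine hull \<sigma>. x + a \<in> affine hull \<sigma>"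
      using \<F>(3) by blast
    then show "\<exists>p. fst p \<noteq> 0 \<and> f = {x. fst p \<bullet> x \<le> snd p} \<and> (\<forall>x\<in>affine hull \<sigma>. x + fst p \<in> affine hull \<sigma>)"
      unfolding split_paired_Ex fst_conv snd_conv by blast
  qed
  from bchoice[OF this] obtain p where p: "\<forall>f\<in>\<F>. fst (p f) \<noteq> 0 \<and> f = {x. fst (p f) \<bullet> x \<le> snd (p f)} \<and>
      (\<forall>x\<in>affine hull \<sigma>. x + fst (p f) \<in> affine hull \<sigma>)" by blast
  have "X \<notin> \<Inter>\<F>" using X \<F>(2) aff unfolding \<sigma>_def by blast
  then obtain f where f: "f \<in> \<F>" "X \<notin> f" by blast
  define a b where "a = fst (p f)" and "b = snd (p f)"
  have ab: "f = {x. a \<bullet> x \<le> b}" "\<forall>x\<in>affine hull \<sigma>. x + a \<in> affine hull \<sigma>"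
    using p f(1) by (simp_all add: a_def b_def)
  have "(\<sigma> \<inter> {x. a \<bullet> x = b}) facet_of \<sigma> \<longleftrightarrow>
      (\<exists>f'. f' \<in> \<F> \<and> \<sigma> \<inter> {x. a \<bullet> x = b} = \<sigma> \<inter> {x. fst (p f') \<bullet> x = snd (p f')})"
  proof (rule facet_of_polyhedron_explicit[OF \<F>(1,2)])
    show "fst (p f) \<noteq> 0 \<and> f = {x. fst (p f) \<bullet> x \<le> snd (p f)}" if "f \<in> \<F>" for f
      using conjunct1[OF bspec[OF p that]] conjunct1[OF conjunct2[OF bspec[OF p that]]] by (rule conjI)
    show "\<sigma> \<subset> affine hull \<sigma> \<inter> \<Inter>F'" if "F' \<subset> \<F>" for F'
      using \<F>(4)[rule_format, OF that] .
  qed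
  then have facet: "(\<sigma> \<inter> {x. a \<bullet> x = b}) facet_of \<sigma>" using f(1) unfolding a_def b_def by blast
  define \<tau> where "\<tau> = \<sigma> \<inter> {x. a \<bullet> x = b}"
  have \<tau>: "\<tau> face_of \<sigma>" "\<tau> \<noteq> {}" "aff_dim \<tau> = aff_dim \<sigma> - 1"
    using facet unfolding facet_of_def \<tau>_def by auto
  have t0: "0 \<in> \<tau>" using cone_face_contains_0[OF _ \<tau>(1,2)] convex_cone_vdom unfolding \<sigma>_def by blast
  then have b0: "b = 0" by (simp add: \<tau>_def)
  have "0 + a \<in> affine hull \<sigma>" by (rule bspec[OF ab(2) hull_inc[OF 0]])
  then have aH: "a \<in> herm F" by (simp add: aff)
  have nH: "- a \<in> herm F" by (rule subspace_neg[OF subspace_herm aH])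
  have "\<sigma> \<subseteq> f" using \<F>(2) f(1) by blast
  then have nn: "0 \<le> form_at (- a) x" if "x \<in> min1 h" for x
    using rank_one_vcone[OF fin that] unfolding \<sigma>_def vdom_def ab(1) b0 by (auto simp: form_at_inner)
  have "\<tau> = vdom h \<inter> {X. (- a) \<bullet> X = 0}" unfolding \<tau>_def \<sigma>_def b0 by simp
  also have "\<dots> = facet h (- a)" by (rule facet_eq[OF h nn, symmetric])
  finally have fa: "facet h (- a) = \<tau>" ..
  have "int (dim \<tau>) = int (dim \<sigma>) - 1" using \<tau>(3) aff_dim_cone_face[OF t0] aff_dim_cone_face[OF 0] by simp
  then have "dim \<tau> + 1 = dim \<sigma>" by simp
  also have "dim \<sigma> = dim (herm F :: (complex ^ 'n ^ 'n) set)" using span_vdom[OF h] dim_span unfolding \<sigma>_def by metis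
  finally have "facet_normal h (- a)" using facet_normalI[OF h nH nn] by (simp add: fa)
  moreover have "(- a) \<bullet> X < 0" using f(2) unfolding ab(1) b0 by simp
  ultimately show ?thesis by blast
qed

text \<open>
  Voronoi's algorithm. If \<open>h \<noteq> g\<close>, a facet of \<open>vdom h\<close> separates \<open>bary g\<close> from it. The normal
  of this facet is negative at \<open>bary g\<close>, thus not semidefinite, and the neighbour across the
  facet has a smaller pairing with \<open>bary g\<close>. The pairing bounds the values at a basis of
  minimal vectors of \<open>g\<close>, so only finitely many perfect forms stay below a given bound.
\<close>

lemma adjacent_chain:
  fixes h g :: "complex ^ 'n ^ 'n"
  assumes h: "unit_perfect h" and g: "unit_perfect g"
  shows "adjacent\<^sup>*\<^sup>* h g"
proof -
  define L where "L k = k \<bullet> bary g" for k :: "complex ^ 'n ^ 'n"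
  have Lsum: "L k = (\<Sum>x\<in>min1 g. form_at k x)" for k
    by (simp add: L_def bary_def inner_sum_right form_at_inner)
  obtain M M' :: "complex ^ 'n ^ 'n" where M: "M \<in> mats Oi" "M ** M' = mat 1" "\<forall>j. M *v axis j 1 \<in> min1 g"
    using min1_frame[OF g] by blast
  have fin: "finite {k. unit_perfect k \<and> L k < c}" for c
  proof (rule finite_subset[OF _ finite_unit_perfect_bounded[OF mats_Oi_K[OF M(1)] M(2), of c]])
    show "{k. unit_perfect k \<and> L k < c} \<subseteq> {h. unit_perfect h \<and> (\<forall>j. form_at h (M *v axis j 1) \<le> c)}"
    proof clarify
      fix k j assume k: "unit_perfect k" "L k < c"
      have "form_at k (M *v axis j 1) \<le> L k"
        unfolding Lsum
      proof (rule member_le_sum)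
        show "M *v axis j 1 \<in> min1 g" using M(3) by blast
        show "finite (min1 g)" by (rule unit_perfect_finite[OF g])
        show "0 \<le> form_at k x" if "x \<in> min1 g - {M *v axis j 1}" for x
          using ryshkov_ge_1[OF unit_perfect_ryshkov[OF k(1)], of x g] that by simp
      qed
      then show "form_at k (M *v axis j 1) \<le> c" using k(2) by simp
    qed
  qed
  show ?thesis
    using h
  proof (induction "card {k. unit_perfect k \<and> L k < L h}" arbitrary: h rule: less_induct)
    case less
    show ?case
    proof (cases "h = g")
      case False
      have "bary g \<notin> vdom h" using bary_vdom_unique[OF g less.prems] False by blast
      moreover have "bary g \<in> herm F" using bary_vdom[OF g] vdom_herm[OF g] by blast
      ultimately obtain \<psi> where \<psi>: "facet_normal h \<psi>" "\<psi> \<bullet> bary g < 0"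
        using separating_facet[OF less.prems] by blast
      have np: "\<not> psd \<psi>"
      proof
        assume "psd \<psi>"
        then have "0 \<le> form_at \<psi> x" if "x \<in> min1 g" for x using min1_K[OF that] by (simp add: psd_def)
        then have "0 \<le> \<psi> \<bullet> bary g" by (simp add: bary_def inner_sum_right form_at_inner sum_nonneg)
        then show False using \<psi>(2) by simp
      qed
      obtain t where t: "t > 0" "unit_perfect (h + t *\<^sub>R \<psi>)" "facet_normal (h + t *\<^sub>R \<psi>) (- \<psi>)"
        "facet (h + t *\<^sub>R \<psi>) (- \<psi>) = facet h \<psi>" using facet_neighbour[OF less.prems \<psi>(1) np] by blast
      define h' where "h' = h + t *\<^sub>R \<psi>"
      have "h' \<noteq> h" using t(1) facet_normalD(2)[OF \<psi>(1)] by (simp add: h'_def)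
      then have adj: "adjacent h h'" unfolding adjacent_def using less.prems t \<psi>(1) np h'_def by blast
      have lt: "L h' < L h" using t(1) \<psi>(2) by (simp add: L_def h'_def inner_add_left mult_pos_neg)
      have "{k. unit_perfect k \<and> L k < L h'} \<subset> {k. unit_perfect k \<and> L k < L h}"
        using lt t(2) unfolding h'_def by force
      then have "card {k. unit_perfect k \<and> L k < L h'} < card {k. unit_perfect k \<and> L k < L h}"
        by (rule psubset_card_mono[OF fin])
      then have "adjacent\<^sup>*\<^sup>* h' g" using less.hyps t(2) unfolding h'_def by blast
      then show ?thesis using adj by (rule converse_rtranclp_into_rtranclp[rotated])
    qed simp
  qed
qed

end

section \<open>Ordered bases and orientations\<close>

lemma ordered_basesD:
  assumes "B \<in> ordered_bases W"
  shows "distinct B" "independent (set B)" "span (set B) = W" "length B = dim W" "set B \<subseteq> W"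
proof -
  show *: "distinct B" "independent (set B)" "span (set B) = W" using assms by (auto simp: ordered_bases_def)
  have "dim W = card (set B)" using *(2,3) by (metis dim_span dim_eq_card_independent)
  then show "length B = dim W" using *(1) by (simp add: distinct_card)
  show "set B \<subseteq> W" using *(3) span_superset by blast
qed

lemma ordered_basis_exists:
  assumes "subspace (W :: 'a::euclidean_space set)"
  shows "\<exists>B. B \<in> ordered_bases W"
proof -
  obtain S where S: "S \<subseteq> W" "independent S" "W \<subseteq> span S"
    using basis_exists[of W] by metis
  have "span S \<subseteq> W" by (rule span_minimal[OF S(1) assms])
  then have "span S = W" using S(3) by blast
  moreover obtain B where "distinct B" "set B = S"
    using finite_distinct_list[OF independent_imp_finite[OF S(2)]] by blast
  ultimately show ?thesis using S(2) by (auto simp: ordered_bases_def)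
qed

definition coord_mat :: "'a::euclidean_space list \<Rightarrow> 'a list \<Rightarrow> real Matrix.mat" where
  "coord_mat B C = Matrix.mat (length B) (length B) (\<lambda>(i, j). representation (set B) (C ! j) (B ! i))"

lemma basis_change_det_coord: "basis_change_det B C = Determinant.det (coord_mat B C)"
  by (simp add: basis_change_det_def coord_mat_def)

lemma coord_mat_carrier: "coord_mat B C \<in> carrier_mat (length B) (length B)"
  by (simp add: coord_mat_def)

lemma sum_set_nth: "distinct B \<Longrightarrow> (\<Sum>b\<in>set B. f b) = (\<Sum>k = 0..<length B. f (B ! k))"
  using sum.reindex_bij_betw[OF bij_betw_nth[of B "{0..<length B}" "set B"], of f]
  by (simp add: atLeast0LessThan)

lemma representation_expand:
  assumes B: "B \<in> ordered_bases W" and v: "v \<in> W"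
  shows "(\<Sum>b\<in>set B. representation (set B) v b *\<^sub>R b) = v"
  using ordered_basesD[OF B] v by (intro real_vector.sum_representation_eq) auto

lemma representation_trans:
  assumes B: "B \<in> ordered_bases W" and C: "C \<in> ordered_bases W" and v: "v \<in> W"
  shows "representation (set B) v b = (\<Sum>c\<in>set C. representation (set B) c b * representation (set C) v c)"
proof -
  note DB = ordered_basesD[OF B] and DC = ordered_basesD[OF C]
  have inW: "c \<in> span (set B)" if "c \<in> set C" for c using that DB(3) DC(5) by blast
  have "representation (set B) v b = representation (set B) (\<Sum>c\<in>set C. representation (set C) v c *\<^sub>R c) b"
    by (simp only: representation_expand[OF C v])
  also have "\<dots> = (\<Sum>c\<in>set C. representation (set B) (representation (set C) v c *\<^sub>R c) b)"
    using inW by (subst real_vector.representation_sum[OF DB(2)]) (auto intro: span_scale)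
  also have "\<dots> = (\<Sum>c\<in>set C. representation (set B) c b * representation (set C) v c)"
    using inW by (intro sum.cong) (auto simp: real_vector.representation_scale[OF DB(2)])
  finally show ?thesis .
qed

lemma basis_change_det_trans:
  assumes B: "B \<in> ordered_bases W" and C: "C \<in> ordered_bases W" and D: "length D = length B" "set D \<subseteq> W"
  shows "basis_change_det B D = basis_change_det B C * basis_change_det C D"
proof -
  note DB = ordered_basesD[OF B] and DC = ordered_basesD[OF C]
  have len: "length C = length B" using DB(4) DC(4) by simp
  have "coord_mat B D = coord_mat B C * coord_mat C D"
  proof (rule eq_matI)
    fix i j assume "i < dim_row (coord_mat B C * coord_mat C D)" "j < dim_col (coord_mat B C * coord_mat C D)"
    then have ij: "i < length B" "j < length B" by (simp_all add: coord_mat_def len)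
    have "D ! j \<in> W" using ij D by (simp add: subset_iff)
    then have "coord_mat B D $$ (i, j) = (\<Sum>c\<in>set C. representation (set B) c (B ! i) * representation (set C) (D ! j) c)"
      using ij representation_trans[OF B C] by (simp add: coord_mat_def)
    also have "\<dots> = (\<Sum>k = 0..<length C. representation (set B) (C ! k) (B ! i) * representation (set C) (D ! j) (C ! k))"
      by (rule sum_set_nth[OF DC(1)])
    also have "\<dots> = (coord_mat B C * coord_mat C D) $$ (i, j)"
      using ij by (simp add: coord_mat_def len scalar_prod_def)
    finally show "coord_mat B D $$ (i, j) = (coord_mat B C * coord_mat C D) $$ (i, j)" .
  qed (simp_all add: coord_mat_def len)
  then show ?thesis
    unfolding basis_change_det_coord
    using det_mult[OF coord_mat_carrier[of B C], of "coord_mat C D"] coord_mat_carrier[of C D] len by simp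
qed

lemma basis_change_det_self:
  assumes B: "B \<in> ordered_bases W"
  shows "basis_change_det B B = 1"
proof -
  note DB = ordered_basesD[OF B]
  have "coord_mat B B = 1\<^sub>m (length B)"
    by (rule eq_matI)
      (auto simp: coord_mat_def real_vector.representation_basis[OF DB(2)] nth_eq_iff_index_eq[OF DB(1)])
  then show ?thesis by (simp add: basis_change_det_coord)
qed

lemma basis_change_det_inverse:
  assumes "B \<in> ordered_bases W" "C \<in> ordered_bases W"
  shows "basis_change_det B C * basis_change_det C B = 1"
  using basis_change_det_trans[OF assms, of B] basis_change_det_self[OF assms(1)] ordered_basesD[OF assms(1)] by simp

lemma basis_change_det_nonzero:
  assumes "B \<in> ordered_bases W" "C \<in> ordered_bases W"
  shows "basis_change_det B C \<noteq> 0"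
  using basis_change_det_inverse[OF assms] by auto

lemma orientation_mem:
  assumes \<omega>: "\<omega> \<in> orientations W" and B: "B \<in> \<omega>"
  shows "B \<in> ordered_bases W" "C \<in> \<omega> \<longleftrightarrow> C \<in> ordered_bases W \<and> 0 < basis_change_det B C"
proof -
  obtain A where A: "A \<in> ordered_bases W" "\<omega> = same_orientation W `` {A}"
    using \<omega> by (auto simp: orientations_def quotient_def)
  have mem: "D \<in> \<omega> \<longleftrightarrow> D \<in> ordered_bases W \<and> 0 < basis_change_det A D" for D
    using A by (simp add: same_orientation_def)
  show B': "B \<in> ordered_bases W" using B mem by blast
  have "basis_change_det A C = basis_change_det A B * basis_change_det B C" if "C \<in> ordered_bases W"
    using basis_change_det_trans[OF A(1) B'] ordered_basesD[OF that] ordered_basesD[OF A(1)] by simp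
  then show "C \<in> \<omega> \<longleftrightarrow> C \<in> ordered_bases W \<and> 0 < basis_change_det B C"
    using mem[of C] mem[of B] B by (auto simp: zero_less_mult_iff)
qed

lemma orientation_nonempty:
  assumes "\<omega> \<in> orientations W"
  shows "\<exists>B. B \<in> \<omega>"
proof -
  obtain A where A: "A \<in> ordered_bases W" "\<omega> = same_orientation W `` {A}"
    using assms by (auto simp: orientations_def quotient_def)
  then have "A \<in> \<omega>" using basis_change_det_self[OF A(1)] by (simp add: same_orientation_def)
  then show ?thesis by blast
qed

lemma map_ordered_bases:
  assumes L: "linear L" "inj L" and B: "B \<in> ordered_bases W"
  shows "map L B \<in> ordered_bases (L ` W)"
proof -
  note DB = ordered_basesD[OF B]
  have "distinct (map L B)" using DB(1) L(2) by (simp add: distinct_map inj_on_subset[OF L(2) subset_UNIV])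
  moreover have "independent (set (map L B))"
    using linear_independent_injective_image[OF L(1) DB(2)] inj_on_subset[OF L(2) subset_UNIV] by simp
  moreover have "span (set (map L B)) = L ` W" using linear_span_image[OF L(1), of "set B"] DB(3) by simp
  ultimately show ?thesis by (simp add: ordered_bases_def)
qed

lemma basis_change_det_map:
  assumes L: "linear L" "inj L" and B: "B \<in> ordered_bases W" and C: "length C = length B" "set C \<subseteq> W"
  shows "basis_change_det (map L B) (map L C) = basis_change_det B C"
proof -
  note DB = ordered_basesD[OF B]
  have LB: "map L B \<in> ordered_bases (L ` W)" by (rule map_ordered_bases[OF L B])
  note DLB = ordered_basesD[OF LB]
  have rep: "representation (set (map L B)) (L v) (L b) = representation (set B) v b" if v: "v \<in> W" and b: "b \<in> set B" for v b
  proof -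
    have "L v = L (\<Sum>c\<in>set B. representation (set B) v c *\<^sub>R c)" by (simp only: representation_expand[OF B v])
    also have "\<dots> = (\<Sum>c\<in>set B. representation (set B) v c *\<^sub>R L c)"
      by (simp add: linear_sum[OF L(1)] linear_cmul[OF L(1)])
    finally have "representation (set (map L B)) (L v) (L b)
        = representation (set (map L B)) (\<Sum>c\<in>set B. representation (set B) v c *\<^sub>R L c) (L b)" by simp
    also have "\<dots> = (\<Sum>c\<in>set B. representation (set (map L B)) (representation (set B) v c *\<^sub>R L c) (L b))"
      by (subst real_vector.representation_sum[OF DLB(2)]) (auto intro: span_scale span_base)
    also have "\<dots> = (\<Sum>c\<in>set B. representation (set B) v c * representation (set (map L B)) (L c) (L b))"
    proof (rule sum.cong)
      fix c assume "c \<in> set B"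
      then have "L c \<in> span (set (map L B))" by (intro span_base) simp
      then show "representation (set (map L B)) (representation (set B) v c *\<^sub>R L c) (L b)
          = representation (set B) v c * representation (set (map L B)) (L c) (L b)"
        by (simp only: real_vector.representation_scale[OF DLB(2)])
    qed simp
    also have "\<dots> = (\<Sum>c\<in>set B. if c = b then representation (set B) v b else 0)"
    proof (rule sum.cong)
      fix c assume "c \<in> set B"
      then have "representation (set (map L B)) (L c) (L b) = (if L b = L c then 1 else 0)"
        by (subst real_vector.representation_basis[OF DLB(2)]) auto
      then show "representation (set B) v c * representation (set (map L B)) (L c) (L b) = (if c = b then representation (set B) v b else 0)"
        using injD[OF L(2), of b c] by auto
    qed simp
    also have "\<dots> = representation (set B) v b" using b by simp
    finally show ?thesis .
  qed
  have "coord_mat (map L B) (map L C) = coord_mat B C"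
  proof (rule eq_matI)
    fix i j assume "i < dim_row (coord_mat B C)" "j < dim_col (coord_mat B C)"
    then have ij: "i < length B" "j < length B" by (simp_all add: coord_mat_def)
    then have "C ! j \<in> W" "B ! i \<in> set B" using C by auto
    then show "coord_mat (map L B) (map L C) $$ (i, j) = coord_mat B C $$ (i, j)"
      using ij C(1) rep[of "C ! j" "B ! i"] by (simp add: coord_mat_def)
  qed (simp_all add: coord_mat_def)
  then show ?thesis by (simp add: basis_change_det_coord)
qed

text \<open>
  Conjugate endomorphisms have the same determinant.
\<close>

lemma basis_change_det_map_indep:
  assumes L: "linear L" "inj L" "L ` W = W" and B: "B \<in> ordered_bases W" and C: "C \<in> ordered_bases W"
  shows "basis_change_det B (map L B) = basis_change_det C (map L C)"
proof -
  note DB = ordered_basesD[OF B] and DC = ordered_basesD[OF C]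
  have LB: "map L B \<in> ordered_bases W" and LC: "map L C \<in> ordered_bases W"
    using map_ordered_bases[OF L(1,2) B] map_ordered_bases[OF L(1,2) C] L(3) by simp_all
  note DLB = ordered_basesD[OF LB] and DLC = ordered_basesD[OF LC]
  have "basis_change_det B (map L B) = basis_change_det B C * basis_change_det C (map L B)"
    by (rule basis_change_det_trans[OF B C]) (use DLB in auto)
  also have "basis_change_det C (map L B) = basis_change_det C (map L C) * basis_change_det (map L C) (map L B)"
    by (rule basis_change_det_trans[OF C LC]) (use DLB DB DC in auto)
  also have "basis_change_det (map L C) (map L B) = basis_change_det C B"
    by (rule basis_change_det_map[OF L(1,2) C]) (use DB DC in auto)
  also have "basis_change_det B C * (basis_change_det C (map L C) * basis_change_det C B)
      = basis_change_det C (map L C) * (basis_change_det B C * basis_change_det C B)" by simp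
  finally show ?thesis using basis_change_det_inverse[OF B C] by simp
qed

lemma basis_change_det_comp:
  assumes L: "linear L" "inj L" "L ` W = W" and M: "linear M" "inj M" "M ` W = W" and B: "B \<in> ordered_bases W"
  shows "basis_change_det B (map (\<lambda>x. L (M x)) B) = basis_change_det B (map L B) * basis_change_det B (map M B)"
proof -
  note DB = ordered_basesD[OF B]
  have LB: "map L B \<in> ordered_bases W" and MB: "map M B \<in> ordered_bases W"
    using map_ordered_bases[OF L(1,2) B] map_ordered_bases[OF M(1,2) B] L(3) M(3) by simp_all
  have LMB: "map L (map M B) \<in> ordered_bases W" using map_ordered_bases[OF L(1,2) MB] L(3) by simp
  have "basis_change_det B (map L (map M B)) = basis_change_det B (map L B) * basis_change_det (map L B) (map L (map M B))"
    by (rule basis_change_det_trans[OF B LB]) (use ordered_basesD[OF LMB] in auto)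
  also have "basis_change_det (map L B) (map L (map M B)) = basis_change_det B (map M B)"
    by (rule basis_change_det_map[OF L(1,2) B]) (use ordered_basesD[OF MB] in auto)
  finally show ?thesis by (simp add: comp_def)
qed

lemma representation_linear:
  assumes B: "B \<in> ordered_bases W"
  shows "\<exists>g :: 'a::euclidean_space \<Rightarrow> real. linear g \<and> (\<forall>v\<in>W. representation (set B) v b = g v)"
proof -
  note DB = ordered_basesD[OF B]
  obtain g :: "'a \<Rightarrow> real" where g: "linear g" "\<forall>x\<in>set B. g x = (if x = b then 1 else 0)"
    using linear_independent_extend[OF DB(2), of "\<lambda>x. if x = b then 1 else 0"] by blast
  have "representation (set B) v b = g v" if v: "v \<in> W" for v
  proof -
    have "g v = g (\<Sum>c\<in>set B. representation (set B) v c *\<^sub>R c)" by (simp only: representation_expand[OF B v])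
    also have "\<dots> = (\<Sum>c\<in>set B. representation (set B) v c * g c)"
      by (simp add: linear_sum[OF g(1)] linear_cmul[OF g(1)])
    also have "\<dots> = (\<Sum>c\<in>set B. if c = b then representation (set B) v b else 0)"
      using g(2) by (intro sum.cong) auto
    also have "\<dots> = representation (set B) v b"
      using real_vector.representation_ne_zero[of "set B" v b] by auto
    finally show ?thesis ..
  qed
  then show ?thesis using g(1) by blast
qed

text \<open>
  Coordinates with respect to a basis are linear functionals, and the determinant is a
  polynomial in them.
\<close>

lemma continuous_basis_change_det:
  assumes B: "B \<in> ordered_bases W" and len: "\<And>z. length (C z) = length B"
    and cont: "\<And>j. j < length B \<Longrightarrow> continuous_on S (\<lambda>z. C z ! j)"
    and W: "\<And>j z. j < length B \<Longrightarrow> z \<in> S \<Longrightarrow> C z ! j \<in> W"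
  shows "continuous_on S (\<lambda>z. basis_change_det B (C z))"
proof -
  define n where "n = length B"
  have entry: "continuous_on S (\<lambda>z. representation (set B) (C z ! j) b)" if j: "j < n" for j b
  proof -
    obtain g :: "'a \<Rightarrow> real" where g: "linear g" "\<forall>v\<in>W. representation (set B) v b = g v"
      using representation_linear[OF B] by blast
    have "continuous_on S (\<lambda>z. g (C z ! j))"
    proof (rule bounded_linear.continuous_on[of g])
      show "bounded_linear g" using g(1) linear_conv_bounded_linear[of g] by simp
      show "continuous_on S (\<lambda>z. C z ! j)" using cont j unfolding n_def .
    qed
    then show ?thesis
      by (rule continuous_on_eq) (use g(2) W j in \<open>auto simp: n_def\<close>)
  qed
  have "basis_change_det B (C z) = (\<Sum>p\<in>{p. p permutes {0..<n}}. signof p *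
      (\<Prod>i = 0..<n. representation (set B) (C z ! p i) (B ! i)))" for z
  proof -
    have "(\<Prod>i = 0..<n. coord_mat B (C z) $$ (i, p i)) = (\<Prod>i = 0..<n. representation (set B) (C z ! p i) (B ! i))"
      if "p permutes {0..<n}" for p
      using permutes_in_image[OF that] by (intro prod.cong) (auto simp: coord_mat_def n_def)
    then show ?thesis
      unfolding basis_change_det_coord Determinant.det_def by (simp add: coord_mat_def n_def)
  qed
  moreover have "continuous_on S (\<lambda>z. \<Sum>p\<in>{p. p permutes {0..<n}}. signof p *
      (\<Prod>i = 0..<n. representation (set B) (C z ! p i) (B ! i)))"
  proof (intro continuous_on_sum continuous_on_mult continuous_on_const continuous_on_prod entry)
    fix p i assume "p \<in> {p. p permutes {0..<n}}" "i \<in> {0..<n}"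
    then show "p i < n" using permutes_in_image[of p "{0..<n}" i] by auto
  qed
  ultimately show ?thesis by simp
qed

lemma append_ordered_bases:
  fixes W :: "'a::euclidean_space set"
  assumes W: "subspace W" and B: "B \<in> ordered_bases {X \<in> W. \<psi> \<bullet> X = 0}" and X: "X \<in> W" "\<psi> \<bullet> X \<noteq> 0"
  shows "B @ [X] \<in> ordered_bases W"
proof -
  note DB = ordered_basesD[OF B]
  have nX: "X \<notin> span (set B)" using X(2) DB(3) by simp
  then have "X \<notin> set B" using span_base by blast
  moreover have "independent (insert X (set B))" using nX DB(2) by (simp add: independent_insert)
  moreover have "span (insert X (set B)) = W"
  proof
    show "span (insert X (set B)) \<subseteq> W" using X(1) DB(5) W by (intro span_minimal) auto
    show "W \<subseteq> span (insert X (set B))"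
    proof
      fix Y assume Y: "Y \<in> W"
      define c where "c = (\<psi> \<bullet> Y) / (\<psi> \<bullet> X)"
      have "Y - c *\<^sub>R X \<in> {X \<in> W. \<psi> \<bullet> X = 0}"
        using X Y W by (simp add: subspace_diff subspace_scale inner_diff_right c_def)
      then have "Y - c *\<^sub>R X \<in> span (insert X (set B))" unfolding DB(3)[symmetric]
        using span_mono[of "set B" "insert X (set B)"] by blast
      moreover have "c *\<^sub>R X \<in> span (insert X (set B))" by (intro span_scale span_base) simp
      ultimately have "(Y - c *\<^sub>R X) + c *\<^sub>R X \<in> span (insert X (set B))" by (rule span_add)
      then show "Y \<in> span (insert X (set B))" by simp
    qed
  qed
  ultimately show ?thesis using DB(1) by (simp add: ordered_bases_def)
qed

text \<open>
  With respect to a basis that extends one of the hyperplane by \<open>X\<close>, the last coordinate is \<open>v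
  \<mapsto> \<psi>(v) / \<psi>(X)\<close>. It vanishes on \<open>C\<close>, so expansion along the last row leaves a single term.
\<close>

lemma basis_change_det_append:
  fixes W :: "'a::euclidean_space set"
  assumes W: "subspace W"
    and B: "B \<in> ordered_bases {X \<in> W. \<psi> \<bullet> X = 0}" and X: "X \<in> W" "\<psi> \<bullet> X \<noteq> 0"
    and C: "length C = length B" "set C \<subseteq> {X \<in> W. \<psi> \<bullet> X = 0}" and Y: "Y \<in> W"
  shows "basis_change_det (B @ [X]) (C @ [Y]) = basis_change_det B C * ((\<psi> \<bullet> Y) / (\<psi> \<bullet> X))"
proof -
  note DB = ordered_basesD[OF B]
  have BX: "B @ [X] \<in> ordered_bases W" by (rule append_ordered_bases[OF W B X])
  note DBX = ordered_basesD[OF BX]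
  define n where "n = length B"
  define A where "A = coord_mat (B @ [X]) (C @ [Y])"
  have A: "A \<in> carrier_mat (Suc n) (Suc n)" using coord_mat_carrier[of "B @ [X]" "C @ [Y]"] by (simp add: A_def n_def)
  have last: "representation (set (B @ [X])) v X = (\<psi> \<bullet> v) / (\<psi> \<bullet> X)" if v: "v \<in> W" for v
  proof -
    have "\<psi> \<bullet> v = \<psi> \<bullet> (\<Sum>b\<in>set (B @ [X]). representation (set (B @ [X])) v b *\<^sub>R b)"
      by (simp only: representation_expand[OF BX v])
    also have "\<dots> = (\<Sum>b\<in>set (B @ [X]). representation (set (B @ [X])) v b * (\<psi> \<bullet> b))"
      by (simp add: inner_sum_right)
    also have "\<dots> = (\<Sum>b\<in>{X}. representation (set (B @ [X])) v b * (\<psi> \<bullet> b))"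
      using DB(5) by (intro sum.mono_neutral_right) auto
    finally show ?thesis using X(2) by simp
  qed
  have entry: "A $$ (n, j) = (\<psi> \<bullet> ((C @ [Y]) ! j)) / (\<psi> \<bullet> X)" if "j < Suc n" for j
  proof -
    have "set (C @ [Y]) \<subseteq> W" "j < length (C @ [Y])" using C Y that by (auto simp: n_def)
    then have "(C @ [Y]) ! j \<in> W" using nth_mem by blast
    then show ?thesis using that last by (simp add: A_def coord_mat_def n_def)
  qed
  have zero: "A $$ (n, j) = 0" if "j < n" for j
  proof -
    have "C ! j \<in> set C" using C(1) that by (simp add: n_def)
    then have "C ! j \<in> {X \<in> W. \<psi> \<bullet> X = 0}" using C(2) by blast
    then show ?thesis using entry[of j] that C(1) by (simp add: nth_append n_def)
  qed
  have del: "mat_delete A n n = coord_mat B C"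
  proof (rule eq_matI)
    fix i j assume "i < dim_row (coord_mat B C)" "j < dim_col (coord_mat B C)"
    then have ij: "i < n" "j < n" by (simp_all add: coord_mat_def n_def)
    have "C ! j \<in> set C" using C(1) ij by (simp add: n_def)
    then have "C ! j \<in> span (set B)" unfolding DB(3) using C(2) by blast
    then have "representation (set (B @ [X])) (C ! j) = representation (set B) (C ! j)"
      by (intro real_vector.representation_extend DBX(2)) auto
    then show "mat_delete A n n $$ (i, j) = coord_mat B C $$ (i, j)"
      using ij C(1) by (simp add: mat_delete_def A_def coord_mat_def n_def nth_append)
  qed (simp_all add: coord_mat_def n_def A_def)
  have "Determinant.det A = (\<Sum>j<Suc n. A $$ (n, j) * cofactor A n j)"
    by (rule laplace_expansion_row[OF A]) simp
  also have "\<dots> = A $$ (n, n) * cofactor A n n" using zero by (simp add: lessThan_Suc)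
  also have "cofactor A n n = Determinant.det (coord_mat B C)" by (simp add: cofactor_def del)
  also have "A $$ (n, n) = (\<psi> \<bullet> Y) / (\<psi> \<bullet> X)" using entry[of n] C(1) by (simp add: nth_append n_def)
  finally show ?thesis by (simp add: basis_change_det_coord A_def)
qed


section \<open>The action preserves the orientation\<close>

lemma inj_act_invertible:
  assumes "det A \<noteq> 0"
  shows "inj (act A)"
proof -
  obtain B where "B ** A = mat 1" using assms invertible_det_nz[of A] invertible_def by blast
  then show ?thesis by (rule inj_act)
qed

context ground
begin

definition hbasis :: "(complex ^ 'n ^ 'n) list" where
  "hbasis = (SOME B. B \<in> ordered_bases (herm F))"

lemma hbasis: "hbasis \<in> ordered_bases (herm F)"
  unfolding hbasis_def using ordered_basis_exists[OF subspace_herm] by (rule someI_ex)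

text \<open>
  The determinant of \<open>X \<mapsto> A X A\<^sup>*\<close> on Hermitian matrices. It equals \<open>|det A|\<^sup>2\<^sup>n\<close> for \<open>K = \<complex>\<close>
  and \<open>det(A)\<^sup>n\<^sup>+\<^sup>1\<close> for \<open>K = \<real>\<close>; its sign decides whether \<open>A\<close> preserves orientations.
\<close>

definition act_det :: "complex ^ 'n ^ 'n \<Rightarrow> real" where
  "act_det A = basis_change_det hbasis (map (act A) hbasis)"

definition GLK :: "(complex ^ 'n ^ 'n) set" where
  "GLK = {A \<in> mats K. det A \<noteq> 0}"

lemma GLK_inverse:
  assumes "A \<in> GLK"
  obtains B where "B \<in> GLK" "A ** B = mat 1" "B ** A = mat 1"
proof -
  obtain B where B: "A ** B = mat 1" "B ** A = mat 1"
    using assms invertible_det_nz[of A] by (auto simp: GLK_def invertible_def)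
  have "det A * det B = 1" using B(1) det_mul[of A B] by simp
  then have "B \<in> GLK" using inverse_K[OF _ B(1)] assms by (auto simp: GLK_def)
  then show ?thesis using that B by blast
qed

lemma act_image_herm_K:
  assumes "A \<in> GLK"
  shows "act A ` herm F = herm F"
proof -
  obtain B where B: "B \<in> GLK" "A ** B = mat 1" using GLK_inverse[OF assms] by blast
  have "act A ` herm F \<subseteq> herm F" using act_herm assms by (auto simp: GLK_def)
  moreover have "herm F = act A ` act B ` herm F"
    using B(2) by (simp flip: act_image_mult add: act_image_one)
  moreover have "act B ` herm F \<subseteq> herm F" using act_herm B(1) by (auto simp: GLK_def)
  ultimately show ?thesis by blast
qed

lemma inj_act_GLK: "A \<in> GLK \<Longrightarrow> inj (act A)"
  by (rule inj_act_invertible) (simp add: GLK_def)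

lemma act_det_any:
  assumes A: "A \<in> GLK" and B: "B \<in> ordered_bases (herm F)"
  shows "basis_change_det B (map (act A) B) = act_det A"
  unfolding act_det_def
  by (rule basis_change_det_map_indep[OF linear_act inj_act_GLK[OF A] act_image_herm_K[OF A] B hbasis])

lemma act_det_mult:
  assumes A: "A \<in> GLK" and B: "B \<in> GLK"
  shows "act_det (A ** B) = act_det A * act_det B"
proof -
  have "act (A ** B) = (\<lambda>X. act A (act B X))" by (rule ext) (rule act_mult)
  then show ?thesis
    unfolding act_det_def
    using basis_change_det_comp[OF linear_act inj_act_GLK[OF A] act_image_herm_K[OF A]
        linear_act inj_act_GLK[OF B] act_image_herm_K[OF B] hbasis] by simp
qed

lemma act_det_nonzero:
  assumes A: "A \<in> GLK"
  shows "act_det A \<noteq> 0"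
  unfolding act_det_def
  using basis_change_det_nonzero[OF hbasis] map_ordered_bases[OF linear_act inj_act_GLK[OF A] hbasis]
    act_image_herm_K[OF A] by metis

lemma act_det_one: "act_det (mat 1) = 1"
proof -
  have "map (act (mat 1)) hbasis = (hbasis :: (complex ^ 'n ^ 'n) list)" by (simp add: act_one map_idI)
  then show ?thesis unfolding act_det_def using basis_change_det_self[OF hbasis] by metis
qed

lemma GLO_GLK: "\<gamma> \<in> GLO \<Longrightarrow> \<gamma> \<in> GLK"
proof -
  assume g: "\<gamma> \<in> GLO"
  then obtain \<delta> where "\<gamma> ** \<delta> = mat 1" by (rule GLO_inverse)
  then have "det \<gamma> * det \<delta> = 1" by (simp flip: det_mul)
  then show ?thesis using GLO_K[OF g] by (auto simp: GLK_def)
qed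

subsection \<open>Complex case\<close>

text \<open>
  The determinant is a polynomial in \<open>z\<close> whose value at \<open>0\<close> is \<open>1\<close>.
\<close>

lemma finite_singular_pencil:
  fixes A :: "complex ^ 'n ^ 'n"
  shows "finite {z. det (mat 1 + (\<chi> i j. z * A $ i $ j)) = 0}"
proof -
  define P :: "complex poly ^ 'n ^ 'n" where "P = (\<chi> i j. [:(mat 1 :: complex ^ 'n ^ 'n) $ i $ j, A $ i $ j:])"
  have ev: "poly (det P) z = det (mat 1 + (\<chi> i j. z * A $ i $ j))" for z
    unfolding Determinants.det_def by (simp add: poly_sum poly_prod P_def of_int_poly)
  have "mat 1 + (\<chi> i j. 0 * A $ i $ j) = mat 1" by (simp add: Finite_Cartesian_Product.vec_eq_iff)
  then have "poly (det P) 0 = 1" unfolding ev by (simp only: Determinants.det_I)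
  then have "det P \<noteq> 0" by auto
  then have "finite {z. poly (det P) z = 0}" by (rule poly_roots_finite)
  then show ?thesis unfolding ev .
qed

lemma continuous_act:
  assumes "\<And>i j. continuous_on S (\<lambda>z. C z $ i $ j)"
  shows "continuous_on S (\<lambda>z. act (C z) X)"
  unfolding act_def matrix_matrix_mult_def conj_transpose_def
  by (simp, intro continuous_intros assms)

text \<open>
  The matrices \<open>1 + z (A - 1)\<close> are invertible for all but finitely many \<open>z\<close>. The complement of
  a finite set in \<open>\<complex>\<close> is connected, so the nonvanishing continuous function \<open>act_det\<close> has the
  same sign at \<open>z = 0\<close> and at \<open>z = 1\<close>.
\<close>

lemma act_det_complex:
  fixes A :: "complex ^ 'n ^ 'n"
  assumes K: "K = UNIV" and A: "A \<in> GLK"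
  shows "0 < act_det A"
proof -
  define C :: "complex \<Rightarrow> complex ^ 'n ^ 'n" where "C z = mat 1 + (\<chi> i j. z * (A - mat 1) $ i $ j)" for z
  define S where "S = UNIV - {z. det (C z) = 0}"
  have "finite {z. det (C z) = 0}" unfolding C_def by (rule finite_singular_pencil)
  then have conn: "connected S" unfolding S_def by (intro connected_open_delete_finite) auto
  have C0: "C 0 = mat 1" and C1: "C 1 = A" by (simp_all add: C_def Finite_Cartesian_Product.vec_eq_iff)
  have S01: "0 \<in> S" "1 \<in> S" using A by (simp_all add: S_def C0 C1 GLK_def)
  have GC: "C z \<in> GLK" if "z \<in> S" for z using that K by (simp add: GLK_def S_def mats_def)
  have "continuous_on S (\<lambda>z. C z $ i $ j)" for i j
    unfolding C_def by (simp, intro continuous_intros)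
  then have cact: "continuous_on S (\<lambda>z. act (C z) X)" for X by (rule continuous_act)
  have cont: "continuous_on S (\<lambda>z. act_det (C z))"
    unfolding act_det_def
  proof (rule continuous_basis_change_det[OF hbasis])
    show "length (map (act (C z)) hbasis) = length (hbasis :: (complex ^ 'n ^ 'n) list)" for z by simp
    fix j assume j: "j < length (hbasis :: (complex ^ 'n ^ 'n) list)"
    then have "continuous_on S (\<lambda>z. map (act (C z)) hbasis ! j) \<longleftrightarrow> continuous_on S (\<lambda>z. act (C z) (hbasis ! j))"
      by (intro continuous_on_cong) auto
    then show "continuous_on S (\<lambda>z. map (act (C z)) hbasis ! j)" using cact by blast
    have "hbasis ! j \<in> (herm F :: (complex ^ 'n ^ 'n) set)" using ordered_basesD(5)[OF hbasis] nth_mem[OF j] by blast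
    then show "map (act (C z)) hbasis ! j \<in> herm F" if "z \<in> S" for z
      using j act_herm[of "C z"] GC[OF that] by (simp add: GLK_def)
  qed
  have conn': "connected ((\<lambda>z. act_det (C z)) ` S)" by (rule connected_continuous_image[OF cont conn])
  show ?thesis
  proof (rule ccontr)
    assume neg: "\<not> 0 < act_det A"
    have "act_det A \<in> (\<lambda>z. act_det (C z)) ` S" by (rule image_eqI[OF _ S01(2)]) (simp add: C1)
    moreover have "1 \<in> (\<lambda>z. act_det (C z)) ` S" by (rule image_eqI[OF _ S01(1)]) (simp add: C0 act_det_one)
    ultimately have "0 \<in> (\<lambda>z. act_det (C z)) ` S" using neg connectedD_interval[OF conn', of "act_det A" 1 0] by simp
    then obtain z where "z \<in> S" "act_det (C z) = 0" by auto
    then show False using act_det_nonzero[OF GC] by blast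
  qed
qed

subsection \<open>Real case\<close>

definition of_real_mat :: "real ^ 'n ^ 'n \<Rightarrow> complex ^ 'n ^ 'n" where
  "of_real_mat A = (\<chi> i j. of_real (A $ i $ j))"

lemma of_real_mat_mult: "of_real_mat (A ** B) = of_real_mat A ** of_real_mat B"
  by (simp add: of_real_mat_def matrix_matrix_mult_def Finite_Cartesian_Product.vec_eq_iff)

lemma of_real_mat_one: "of_real_mat (mat 1) = mat 1"
  by (simp add: of_real_mat_def Finite_Cartesian_Product.mat_def Finite_Cartesian_Product.vec_eq_iff)

lemma det_of_real_mat: "det (of_real_mat A) = of_real (det A)"
  by (simp add: Determinants.det_def of_real_mat_def)

lemma of_real_mat_GLK: "det A \<noteq> 0 \<Longrightarrow> of_real_mat A \<in> GLK"
  by (simp add: GLK_def det_of_real_mat) (simp add: mats_def of_real_mat_def K_real)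

definition coord_neg :: "'n set \<Rightarrow> real ^ 'n \<Rightarrow> real ^ 'n" where
  "coord_neg I x = (\<chi> k. if k \<in> I then - x $ k else x $ k)"

definition coord_rot :: "real \<Rightarrow> real \<Rightarrow> 'n \<Rightarrow> 'n \<Rightarrow> real ^ 'n \<Rightarrow> real ^ 'n" where
  "coord_rot c s m n x = (\<chi> k. if k = m then c * x $ m - s * x $ n else if k = n then s * x $ m + c * x $ n else x $ k)"

lemma linear_coord_neg: "linear (coord_neg I)"
  by (rule linearI) (simp_all add: coord_neg_def Finite_Cartesian_Product.vec_eq_iff)

lemma linear_coord_rot: "linear (coord_rot c s m n)"
  by (rule linearI) (simp_all add: coord_rot_def Finite_Cartesian_Product.vec_eq_iff algebra_simps)

text \<open>
  A property that is multiplicative and can be checked on elementary matrices: the sign of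
  \<open>act_det\<close> is positive on matrices of positive determinant, and on the others it is that of a
  fixed reflection. The coordinate \<open>undefined\<close> of the reflection is arbitrary.
\<close>

definition same_sign :: "real ^ 'n ^ 'n \<Rightarrow> bool" where
  "same_sign A \<longleftrightarrow> (0 < det A \<longrightarrow> 0 < act_det (of_real_mat A)) \<and>
     (det A < 0 \<longrightarrow> 0 < act_det (of_real_mat A) * act_det (of_real_mat (matrix (coord_neg {undefined :: 'n}))))"

lemma same_sign_mult:
  assumes "same_sign A" "same_sign B"
  shows "same_sign (A ** B)"
proof (cases "det A = 0 \<or> det B = 0")
  case True
  then show ?thesis by (auto simp: same_sign_def det_mul)
next
  case False
  then have eq: "act_det (of_real_mat (A ** B)) = act_det (of_real_mat A) * act_det (of_real_mat B)"
    by (simp add: of_real_mat_mult act_det_mult of_real_mat_GLK)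
  define a b e where "a = act_det (of_real_mat A)" and "b = act_det (of_real_mat B)"
    and "e = act_det (of_real_mat (matrix (coord_neg {undefined :: 'a})))"
  have A: "0 < det A \<longrightarrow> 0 < a" "det A < 0 \<longrightarrow> 0 < a * e" and B: "0 < det B \<longrightarrow> 0 < b" "det B < 0 \<longrightarrow> 0 < b * e"
    using assms by (simp_all add: same_sign_def a_def b_def e_def)
  have "(0 < det A * det B \<longrightarrow> 0 < a * b) \<and> (det A * det B < 0 \<longrightarrow> 0 < a * b * e)"
    using A B by (auto simp: zero_less_mult_iff mult_less_0_iff)
  then show ?thesis unfolding same_sign_def eq det_mul a_def b_def e_def .
qed

lemma same_sign_square: "same_sign (A ** A)"
proof (cases "det A = 0")
  case True
  then show ?thesis by (simp add: same_sign_def det_mul)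
next
  case False
  then have "act_det (of_real_mat (A ** A)) = act_det (of_real_mat A) * act_det (of_real_mat A)"
    by (simp add: of_real_mat_mult act_det_mult of_real_mat_GLK)
  moreover have "act_det (of_real_mat A) \<noteq> 0" using act_det_nonzero of_real_mat_GLK[OF False] by blast
  moreover have "\<not> det (A ** A) < 0" unfolding det_mul by (simp add: not_less)
  ultimately show ?thesis unfolding same_sign_def by (auto simp: zero_less_mult_iff linorder_neq_iff)
qed

lemma matrix_comp: "linear f \<Longrightarrow> linear g \<Longrightarrow> matrix (\<lambda>x. g (f x)) = matrix g ** (matrix f :: real ^ 'n ^ 'n)"
  using matrix_compose[of f g] by (simp add: comp_def)

lemma quarter_turn_square:
  assumes "m \<noteq> n"
  shows "matrix (coord_rot 0 1 m n) = matrix (coord_rot (1 / sqrt 2) (1 / sqrt 2) m n) ** (matrix (coord_rot (1 / sqrt 2) (1 / sqrt 2) m n) :: real ^ 'n ^ 'n)"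
proof -
  have h: "(1 / sqrt 2) * ((1 / sqrt 2) * r) = r / 2" for r by simp
  have "coord_rot (1 / sqrt 2) (1 / sqrt 2) m n (coord_rot (1 / sqrt 2) (1 / sqrt 2) m n x) = coord_rot 0 1 m n x" for x
    using assms unfolding coord_rot_def Finite_Cartesian_Product.vec_eq_iff
    by (auto simp: right_diff_distrib distrib_left h)
  then show ?thesis by (subst matrix_comp[symmetric]) (simp_all add: linear_coord_rot)
qed

lemma same_sign_quarter_turn: "m \<noteq> n \<Longrightarrow> same_sign (matrix (coord_rot 0 1 m n))"
  unfolding quarter_turn_square by (rule same_sign_square)

lemma det_coord_neg: "det (matrix (coord_neg {i})) = -1"
proof -
  have e: "matrix (coord_neg {i}) $ a $ b = (if a = b then (if a = i then -1 else 1) else 0)" for a b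
    by (simp add: matrix_def coord_neg_def axis_def)
  have "det (matrix (coord_neg {i})) = (\<Prod>a\<in>UNIV. matrix (coord_neg {i}) $ a $ a)"
    by (rule det_diagonal) (simp add: e)
  also have "\<dots> = (\<Prod>a\<in>UNIV. if a = i then -1 else 1)" by (simp add: e)
  also have "\<dots> = -1" by simp
  finally show ?thesis .
qed

text \<open>
  The product of two reflections in different coordinates is a half turn, the square of a
  quarter turn.
\<close>

lemma same_sign_coord_neg_single: "same_sign (matrix (coord_neg {i}))"
proof -
  define e :: 'a where "e = undefined"
  have G: "of_real_mat (matrix (coord_neg {k})) \<in> GLK" for k :: 'a
    by (rule of_real_mat_GLK) (simp add: det_coord_neg)
  have eq: "act_det (of_real_mat (matrix (coord_neg {i}))) * act_det (of_real_mat (matrix (coord_neg {e})))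
      = act_det (of_real_mat (matrix (coord_neg {i}) ** matrix (coord_neg {e})))"
    by (simp add: of_real_mat_mult act_det_mult[OF G G])
  have "0 < act_det (of_real_mat (matrix (coord_neg {i}) ** matrix (coord_neg {e})))"
  proof (cases "i = e")
    case True
    then show ?thesis
      using same_sign_square[of "matrix (coord_neg {e})"] by (simp add: same_sign_def det_mul det_coord_neg)
  next
    case False
    have "coord_neg {i} (coord_neg {e} x) = coord_rot 0 1 i e (coord_rot 0 1 i e x)" for x
      using False unfolding coord_rot_def coord_neg_def Finite_Cartesian_Product.vec_eq_iff by auto
    then have "matrix (\<lambda>x. coord_neg {i} (coord_neg {e} x)) = matrix (\<lambda>x. coord_rot 0 1 i e (coord_rot 0 1 i e x))"
      by simp
    then have "matrix (coord_neg {i}) ** matrix (coord_neg {e}) = matrix (coord_rot 0 1 i e) ** matrix (coord_rot 0 1 i e)"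
      by (simp only: matrix_comp linear_coord_neg linear_coord_rot)
    then show ?thesis
      using same_sign_square[of "matrix (coord_rot 0 1 i e)"] det_mul[of "matrix (coord_neg {i})" "matrix (coord_neg {e})"]
      by (simp add: same_sign_def det_coord_neg)
  qed
  then show ?thesis using eq by (simp add: same_sign_def det_coord_neg e_def)
qed

lemma same_sign_one: "same_sign (mat 1)"
  by (simp add: same_sign_def of_real_mat_one act_det_one)

lemma same_sign_coord_neg: "finite I \<Longrightarrow> same_sign (matrix (coord_neg (I :: 'n::finite set)))"
proof (induction I rule: finite_induct)
  case empty
  have "matrix (coord_neg ({} :: 'n set)) = mat 1"
    by (simp add: matrix_def coord_neg_def axis_def Finite_Cartesian_Product.mat_def Finite_Cartesian_Product.vec_eq_iff)
  then show ?case by (simp add: same_sign_one)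
next
  case (insert i I)
  have "coord_neg (insert i I) x = coord_neg {i} (coord_neg I x)" for x
    using insert(2) unfolding coord_neg_def Finite_Cartesian_Product.vec_eq_iff by auto
  then have "coord_neg (insert i I) = (\<lambda>x. coord_neg {i} (coord_neg I x))" by (rule ext)
  then have "matrix (coord_neg (insert i I)) = matrix (coord_neg {i}) ** matrix (coord_neg I)"
    by (simp only: matrix_comp[OF linear_coord_neg linear_coord_neg])
  then show ?case using same_sign_mult[OF same_sign_coord_neg_single insert(3)] by simp
qed

text \<open>
  The absolute values of the diagonal entries are squares; the signs are reflections.
\<close>

lemma same_sign_diagonal:
  assumes "\<And>i j. i \<noteq> j \<Longrightarrow> A $ i $ j = 0"
  shows "same_sign A"
proof -
  define r where "r x = (\<chi> k. sqrt \<bar>A $ k $ k\<bar> * x $ k)" for x :: "real ^ 'a"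
  define I where "I = {k. A $ k $ k < 0}"
  have lr: "linear r" by (rule linearI) (simp_all add: r_def Finite_Cartesian_Product.vec_eq_iff algebra_simps)
  have lrr: "linear (\<lambda>x. r (r x))" using linear_compose[OF lr lr] by (simp add: comp_def)
  have sq: "sqrt \<bar>t\<bar> * (sqrt \<bar>t\<bar> * u) = \<bar>t\<bar> * u" for t u :: real by (simp add: mult.assoc[symmetric])
  have "A = matrix (\<lambda>x. coord_neg I (r (r x)))"
    using assms by (auto simp: matrix_def coord_neg_def r_def sq I_def axis_def Finite_Cartesian_Product.vec_eq_iff)
  also have "\<dots> = matrix (coord_neg I) ** (matrix r ** matrix r)"
    by (simp only: matrix_comp[OF lrr linear_coord_neg] matrix_comp[OF lr lr])
  finally show ?thesis using same_sign_mult[OF same_sign_coord_neg[of I] same_sign_square[of "matrix r"]] by simp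
qed

text \<open>
  A transposition of coordinates is a reflection followed by a quarter turn.
\<close>

lemma same_sign_swap:
  assumes "m \<noteq> n"
  shows "same_sign (\<chi> i j. mat 1 $ i $ Transposition.transpose m n j)"
proof -
  have "(\<chi> i j. mat 1 $ i $ Transposition.transpose m n j) = matrix (\<lambda>x :: real ^ 'a. coord_rot 0 1 m n (coord_neg {n} x))"
    using assms
    by (auto simp: matrix_def coord_neg_def coord_rot_def axis_def Finite_Cartesian_Product.mat_def
        Finite_Cartesian_Product.vec_eq_iff Transposition.transpose_def)
  also have "\<dots> = matrix (coord_rot 0 1 m n) ** matrix (coord_neg {n})"
    by (rule matrix_comp[OF linear_coord_neg linear_coord_rot])
  finally show ?thesis
    using same_sign_mult[OF same_sign_quarter_turn[OF assms] same_sign_coord_neg_single[of n]] by simp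
qed

text \<open>
  A transvection is the square of the one with half the coefficient.
\<close>

lemma same_sign_transvection:
  assumes "m \<noteq> n"
  shows "same_sign (\<chi> i j. if i = m \<and> j = n then c else of_bool (i = j))"
proof -
  define r where "r x = (\<chi> k. if k = m then x $ m + c / 2 * x $ n else x $ k)" for x :: "real ^ 'a"
  have lr: "linear r" by (rule linearI) (simp_all add: r_def Finite_Cartesian_Product.vec_eq_iff algebra_simps)
  have "(\<chi> i j. if i = m \<and> j = n then c else of_bool (i = j)) = matrix (\<lambda>x. r (r x))"
    using assms by (auto simp: matrix_def r_def axis_def Finite_Cartesian_Product.vec_eq_iff)
  also have "\<dots> = matrix r ** matrix r" by (rule matrix_comp[OF lr lr])
  finally show ?thesis using same_sign_square by simp
qed

lemma same_sign_all: "same_sign (A :: real ^ 'n ^ 'n)"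
proof (rule induct_matrix_elementary[of same_sign])
  show "same_sign (A ** B)" if "same_sign A" "same_sign B" for A B :: "real ^ 'n ^ 'n"
    using that by (rule same_sign_mult)
  show "same_sign A" if "Finite_Cartesian_Product.row i A = 0" for A :: "real ^ 'n ^ 'n" and i
    using that by (simp add: det_zero_row same_sign_def)
  show "same_sign A" if "\<And>i j. i \<noteq> j \<Longrightarrow> A $ i $ j = 0" for A :: "real ^ 'n ^ 'n"
    using that by (rule same_sign_diagonal)
  show "same_sign (\<chi> i j. mat 1 $ i $ Transposition.transpose m n j)" if "m \<noteq> n" for m n :: 'n
    using that by (rule same_sign_swap)
  show "same_sign (\<chi> i j. if i = m \<and> j = n then c else of_bool (i = j))" if "m \<noteq> n" for m n :: 'n and c
    using that by (rule same_sign_transvection)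
qed

lemma act_det_real:
  assumes K: "K = \<real>" and A: "A \<in> GLK" and pos: "0 < Re (det A)"
  shows "0 < act_det A"
proof -
  define B where "B = (\<chi> i j. Re (A $ i $ j))"
  have "A $ i $ j = of_real (Re (A $ i $ j))" for i j
    using A K by (simp add: GLK_def mats_def complex_is_Real_iff complex_eq_iff)
  then have A_eq: "A = of_real_mat B"
    by (simp add: B_def of_real_mat_def Finite_Cartesian_Product.vec_eq_iff)
  have "0 < det B" using pos by (simp add: A_eq det_of_real_mat)
  then show ?thesis using same_sign_all[of B] by (simp add: same_sign_def A_eq)
qed

lemma act_uminus: "act (- A) X = act A X"
proof -
  have "conj_transpose (- A) = - conj_transpose A" by (simp add: conj_transpose_def Finite_Cartesian_Product.vec_eq_iff)
  then show ?thesis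
    by (simp add: act_def matrix_matrix_mult_def Finite_Cartesian_Product.vec_eq_iff sum_negf)
qed

text \<open>
  For \<open>K = \<real>\<close> and even dimension, \<open>det \<gamma> = 1\<close>. In odd dimension one may pass to \<open>- \<gamma>\<close>, which
  acts in the same way and has the opposite determinant.
\<close>

theorem act_det_positive:
  fixes \<Gamma> :: "(complex ^ 'n ^ 'n) set"
  assumes \<Gamma>: "(F = \<rat> \<and> even CARD('n) \<and> finite_index_subgroup \<Gamma> (SL (ring_of_ints F))) \<or>
              (F = \<rat> \<and> odd CARD('n) \<and> finite_index_subgroup \<Gamma> (GL (ring_of_ints F))) \<or>
              (imaginary_quadratic F \<and> finite_index_subgroup \<Gamma> (GL (ring_of_ints F)))"
    and \<gamma>: "\<gamma> \<in> \<Gamma>" "\<gamma> \<in> GLO"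
  shows "0 < act_det \<gamma>"
proof (cases "F = \<rat>")
  case False
  then have "K = UNIV" by (simp add: local_field_def)
  then show ?thesis using act_det_complex GLO_GLK[OF \<gamma>(2)] by blast
next
  case True
  then have K: "K = \<real>" by (simp add: local_field_def)
  have g: "\<gamma> \<in> GLK" by (rule GLO_GLK[OF \<gamma>(2)])
  have real: "Im (det \<gamma>) = 0"
  proof -
    have "\<gamma> $ i $ j \<in> \<real>" for i j using g K by (simp add: GLK_def mats_def)
    then have "det \<gamma> \<in> \<real>" unfolding Determinants.det_def by (intro sum_in_Reals prod_in_Reals Reals_mult) auto
    then show ?thesis by (simp add: complex_is_Real_iff)
  qed
  have ne: "Re (det \<gamma>) \<noteq> 0" using g real by (auto simp: GLK_def complex_eq_iff)
  show ?thesis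
  proof (cases "odd CARD('n)")
    case True
    show ?thesis
    proof (cases "0 < Re (det \<gamma>)")
      case False
      have "det (- \<gamma>) = det (\<chi> i. (- 1) *s \<gamma> $ i)"
        by (rule arg_cong[where f = det]) (simp add: Finite_Cartesian_Product.vec_eq_iff)
      also have "\<dots> = (\<Prod>i\<in>(UNIV :: 'n set). - 1) * det (\<chi> i. \<gamma> $ i)" using Determinants.det_rows_mul[of "\<lambda>_. - 1" "\<lambda>i. \<gamma> $ i"] by simp
      finally have "det (- \<gamma>) = - det \<gamma>" using True by simp
      then have "0 < Re (det (- \<gamma>))" using False ne by simp
      moreover have "- \<gamma> \<in> GLK" using g \<open>det (- \<gamma>) = - det \<gamma>\<close> by (simp add: GLK_def mats_def K_minus)
      ultimately have "0 < act_det (- \<gamma>)" using act_det_real[OF K] by blast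
      then show ?thesis by (simp add: act_det_def act_uminus[abs_def])
    qed (use act_det_real[OF K g] in blast)
  next
    case False
    have "\<not> imaginary_quadratic F" using imaginary_quadratic_not_Rats True by blast
    then have "finite_index_subgroup \<Gamma> (SL (ring_of_ints F))" using \<Gamma> False by blast
    then have "\<Gamma> \<subseteq> carrier (SL (ring_of_ints F))" by (simp add: finite_index_subgroup_def subgroup_def)
    then have "det \<gamma> = 1" using \<gamma>(1) by (auto simp: SL_def)
    then show ?thesis using act_det_real[OF K g] by simp
  qed
qed

end

section \<open>Finite index subgroups\<close>

lemma finite_index_cosets:
  assumes sub: "subgroup \<Gamma> G" and fin: "finite (rcosets\<^bsub>G\<^esub> \<Gamma>)"
  shows "\<exists>T. finite T \<and> T \<subseteq> carrier G \<and> (\<forall>\<gamma>\<in>carrier G. \<exists>t\<in>T. \<exists>h\<in>\<Gamma>. \<exists>h'\<in>\<Gamma>. h \<otimes>\<^bsub>G\<^esub> \<gamma> = h' \<otimes>\<^bsub>G\<^esub> t)"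
proof -
  have "\<forall>C\<in>rcosets\<^bsub>G\<^esub> \<Gamma>. \<exists>t. t \<in> carrier G \<and> C = \<Gamma> #>\<^bsub>G\<^esub> t" by (auto simp: RCOSETS_def)
  from bchoice[OF this] obtain f where f: "\<forall>C\<in>rcosets\<^bsub>G\<^esub> \<Gamma>. f C \<in> carrier G \<and> C = \<Gamma> #>\<^bsub>G\<^esub> f C" by blast
  have "\<exists>t\<in>f ` (rcosets\<^bsub>G\<^esub> \<Gamma>). \<exists>h\<in>\<Gamma>. \<exists>h'\<in>\<Gamma>. h \<otimes>\<^bsub>G\<^esub> \<gamma> = h' \<otimes>\<^bsub>G\<^esub> t" if g: "\<gamma> \<in> carrier G" for \<gamma>
  proof -
    define C where "C = \<Gamma> #>\<^bsub>G\<^esub> \<gamma>"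
    have C: "C \<in> rcosets\<^bsub>G\<^esub> \<Gamma>" using g by (auto simp: RCOSETS_def C_def)
    have one: "\<one>\<^bsub>G\<^esub> \<in> \<Gamma>" by (rule subgroup.one_closed[OF sub])
    have "\<one>\<^bsub>G\<^esub> \<otimes>\<^bsub>G\<^esub> \<gamma> \<in> C" unfolding C_def r_coset_def using one by blast
    also have "C = \<Gamma> #>\<^bsub>G\<^esub> f C" using f C by blast
    finally obtain h where "h \<in> \<Gamma>" "\<one>\<^bsub>G\<^esub> \<otimes>\<^bsub>G\<^esub> \<gamma> = h \<otimes>\<^bsub>G\<^esub> f C" unfolding r_coset_def by blast
    then show ?thesis using one C by blast
  qed
  moreover have "f ` (rcosets\<^bsub>G\<^esub> \<Gamma>) \<subseteq> carrier G" using f by blast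
  ultimately show ?thesis using finite_imageI[OF fin, of f] by blast
qed

context ground
begin

lemma det_Oi: "A \<in> mats Oi \<Longrightarrow> det A \<in> Oi"
proof -
  assume A: "A \<in> mats Oi"
  have prod: "(\<Prod>i\<in>I. f i) \<in> Oi" if "\<And>i. i \<in> I \<Longrightarrow> f i \<in> Oi" for f :: "'a \<Rightarrow> complex" and I
    using that Oi_1 by (induction I rule: infinite_finite_induct) (auto intro: Oi_mult)
  show ?thesis
    unfolding Determinants.det_def using A by (intro Oi_sum Oi_mult Oi_int prod) (simp add: mats_def)
qed

lemma det_GLO_norm:
  assumes "\<gamma> \<in> GLO"
  shows "cmod (det \<gamma>) = 1"
proof -
  obtain \<delta> where \<delta>: "\<delta> \<in> GLO" "\<gamma> ** \<delta> = mat 1" using GLO_inverse[OF assms] by blast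
  have "det \<gamma> * det \<delta> = 1" using \<delta>(2) det_mul[of \<gamma> \<delta>] by simp
  then have n: "cmod (det \<gamma>) * cmod (det \<delta>) = 1" "det \<gamma> \<noteq> 0" "det \<delta> \<noteq> 0"
    by (auto simp flip: norm_mult)
  have ge: "1 \<le> cmod (det \<gamma>)" "1 \<le> cmod (det \<delta>)"
    using n(2,3) Oi_norm_ge_1 det_Oi GLO_Oi assms \<delta>(1) by blast+
  have "cmod (det \<gamma>) * 1 \<le> cmod (det \<gamma>) * cmod (det \<delta>)" using ge by (intro mult_left_mono) auto
  then show ?thesis using n(1) ge by simp
qed

lemma SL_subset: "carrier (SL Oi) = {\<gamma> \<in> GLO. det \<gamma> = 1}"
  by (simp add: SL_def)

lemma GLO_mult: "\<gamma> \<in> GLO \<Longrightarrow> \<gamma>' \<in> GLO \<Longrightarrow> \<gamma> ** \<gamma>' \<in> GLO"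
proof -
  assume g: "\<gamma> \<in> GLO" "\<gamma>' \<in> GLO"
  obtain \<delta> \<delta>' where d: "\<delta> \<in> GLO" "\<gamma> ** \<delta> = mat 1" "\<delta>' \<in> GLO" "\<gamma>' ** \<delta>' = mat 1"
    using GLO_inverse[OF g(1)] GLO_inverse[OF g(2)] by metis
  have "(\<gamma> ** \<gamma>') ** (\<delta>' ** \<delta>) = \<gamma> ** (\<gamma>' ** \<delta>') ** \<delta>" by (simp only: matrix_mul_assoc)
  then have "(\<gamma> ** \<gamma>') ** (\<delta>' ** \<delta>) = mat 1" by (simp add: d)
  moreover from this have "(\<delta>' ** \<delta>) ** (\<gamma> ** \<gamma>') = mat 1" by (rule matrix_left_right_inverse1)
  ultimately show ?thesis unfolding GLO_iff using g d mats_Oi_mult GLO_Oi by blast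
qed

lemma subgroup_inverse:
  assumes sub: "subgroup \<Gamma> G" and G: "G = GL Oi \<or> G = SL Oi" and \<gamma>: "\<gamma> \<in> \<Gamma>"
  shows "\<exists>\<delta>\<in>\<Gamma>. \<gamma> ** \<delta> = mat 1 \<and> \<delta> ** \<gamma> = mat 1"
proof -
  have gG: "\<gamma> \<in> carrier G" using subgroup.subset[OF sub] \<gamma> by blast
  then have gO: "\<gamma> \<in> GLO" using G SL_subset by auto
  obtain \<delta> where \<delta>: "\<delta> \<in> GLO" "\<gamma> ** \<delta> = mat 1" "\<delta> ** \<gamma> = mat 1" using GLO_inverse[OF gO] by blast
  have "det \<gamma> * det \<delta> = 1" using \<delta>(2) det_mul[of \<gamma> \<delta>] by simp
  then have dG: "\<delta> \<in> carrier G" using \<delta>(1) G gG by (auto simp: SL_subset)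
  have ops: "x \<otimes>\<^bsub>G\<^esub> y = x ** y" "\<one>\<^bsub>G\<^esub> = mat 1" for x y using G by (auto simp: GL_def SL_def)
  have "inv\<^bsub>G\<^esub> \<gamma> = \<delta>"
    unfolding m_inv_def ops
  proof (rule the_equality)
    show "\<delta> \<in> carrier G \<and> \<gamma> ** \<delta> = mat 1 \<and> \<delta> ** \<gamma> = mat 1" using dG \<delta> by blast
    fix y assume y: "y \<in> carrier G \<and> \<gamma> ** y = mat 1 \<and> y ** \<gamma> = mat 1"
    have "y = y ** (\<gamma> ** \<delta>)" by (simp add: \<delta>)
    also have "\<dots> = (y ** \<gamma>) ** \<delta>" by (simp only: matrix_mul_assoc)
    finally show "y = \<delta>" using y by simp
  qed
  moreover have "inv\<^bsub>G\<^esub> \<gamma> \<in> \<Gamma>" by (rule subgroup.m_inv_closed[OF sub \<gamma>])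
  ultimately show ?thesis using \<delta> by blast
qed

text \<open>
  For \<open>SL\<^sub>n(\<O>)\<close> this uses that determinants of elements of \<open>GL\<^sub>n(\<O>)\<close> have absolute value \<open>1\<close>,
  so that there are finitely many of them; an element for each gives representatives of the
  cosets of \<open>SL\<^sub>n(\<O>)\<close>.
\<close>

lemma finite_index_GLO:
  fixes \<Gamma> :: "(complex ^ 'n ^ 'n) set"
  assumes fi: "finite_index_subgroup \<Gamma> G" and G: "G = GL Oi \<or> G = SL Oi"
  shows "\<exists>T. finite T \<and> T \<subseteq> GLO \<and> (\<forall>\<gamma>\<in>GLO. \<exists>t\<in>T. \<exists>h\<in>\<Gamma>. \<gamma> = h ** t)"
proof -
  have sub: "subgroup \<Gamma> G" and fin: "finite (rcosets\<^bsub>G\<^esub> \<Gamma>)" using fi by (auto simp: finite_index_subgroup_def)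
  have ops: "x \<otimes>\<^bsub>G\<^esub> y = x ** y" for x y using G by (auto simp: GL_def SL_def)
  obtain T where T: "finite T" "T \<subseteq> carrier G" "\<forall>\<gamma>\<in>carrier G. \<exists>t\<in>T. \<exists>h\<in>\<Gamma>. \<exists>h'\<in>\<Gamma>. h ** \<gamma> = h' ** t"
    using finite_index_cosets[OF sub fin] unfolding ops by blast
  have cl: "x ** y \<in> \<Gamma>" if "x \<in> \<Gamma>" "y \<in> \<Gamma>" for x y
    using subgroup.m_closed[OF sub that] by (simp add: ops)
  have TG: "\<exists>t\<in>T. \<exists>h\<in>\<Gamma>. \<gamma> = h ** t" if g: "\<gamma> \<in> carrier G" for \<gamma>
  proof -
    obtain t h h' where t: "t \<in> T" "h \<in> \<Gamma>" "h' \<in> \<Gamma>" "h ** \<gamma> = h' ** t" using T(3) g by blast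
    obtain k where k: "k \<in> \<Gamma>" "k ** h = mat 1" using subgroup_inverse[OF sub G t(2)] by blast
    have "k ** (h ** \<gamma>) = (k ** h') ** t" by (simp only: t(4) matrix_mul_assoc)
    then have "\<gamma> = (k ** h') ** t" by (simp add: matrix_mul_assoc k(2))
    then show ?thesis using cl[OF k(1) t(3)] t(1) by blast
  qed
  show ?thesis
  proof (cases "G = GL Oi")
    case True
    then show ?thesis using T(1,2) TG by blast
  next
    case False
    then have GS: "G = SL Oi" using G by blast
    define U where "U = det ` (GLO :: (complex ^ 'n ^ 'n) set)"
    have "U \<subseteq> {x \<in> Oi. cmod x \<le> 1}" unfolding U_def using det_Oi GLO_Oi det_GLO_norm by force
    then have "finite U" using finite_Oi_ball finite_subset by blast
    have "\<forall>u\<in>U. \<exists>\<gamma>. \<gamma> \<in> (GLO :: (complex ^ 'n ^ 'n) set) \<and> det \<gamma> = u" unfolding U_def by blast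
    from bchoice[OF this] obtain c where c: "\<forall>u\<in>U. c u \<in> (GLO :: (complex ^ 'n ^ 'n) set) \<and> det (c u) = u" by blast
    define T' where "T' = (\<lambda>(t, u). t ** c u) ` (T \<times> U)"
    have "finite T'" unfolding T'_def using T(1) \<open>finite U\<close> by simp
    moreover have "T' \<subseteq> GLO"
      unfolding T'_def using T(2) c GLO_mult by (auto simp: GS SL_subset)
    moreover have "\<exists>t\<in>T'. \<exists>h\<in>\<Gamma>. \<gamma> = h ** t" if g: "\<gamma> \<in> GLO" for \<gamma>
    proof -
      have u: "det \<gamma> \<in> U" using g by (simp add: U_def)
      then have cu: "c (det \<gamma>) \<in> GLO" "det (c (det \<gamma>)) = det \<gamma>" using c by blast+
      obtain e where e: "e \<in> GLO" "c (det \<gamma>) ** e = mat 1" "e ** c (det \<gamma>) = mat 1" using GLO_inverse[OF cu(1)] by blast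
      have "det \<gamma> * det e = 1" using e(2) det_mul[of "c (det \<gamma>)" e] cu(2) by simp
      then have "\<gamma> ** e \<in> carrier G" using GLO_mult[OF g e(1)] by (simp add: GS SL_subset det_mul)
      then obtain t h where th: "t \<in> T" "h \<in> \<Gamma>" "\<gamma> ** e = h ** t" using TG by blast
      have "\<gamma> = \<gamma> ** (e ** c (det \<gamma>))" by (simp add: e(3))
      also have "\<dots> = h ** (t ** c (det \<gamma>))" by (simp only: matrix_mul_assoc th(3))
      finally have eq: "\<gamma> = h ** (t ** c (det \<gamma>))" .
      have "t ** c (det \<gamma>) \<in> T'" unfolding T'_def using th(1) u by force
      then show ?thesis using eq th(2) by blast
    qed
    ultimately show ?thesis by blast
  qed
qed

text \<open>
  The normal of a transported facet is the transported normal, by the adjoint of the inverse.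
\<close>

lemma facet_normal_act:
  fixes g k \<psi> :: "complex ^ 'n ^ 'n"
  assumes \<gamma>: "\<gamma> \<in> GLO" "\<gamma> ** \<delta> = mat 1" "\<delta> ** \<gamma> = mat 1" "\<delta> \<in> GLO"
    and \<psi>: "facet_normal g \<psi>" and k: "min1 k = (*v) \<gamma> ` min1 g"
  shows "facet_normal k (act (conj_transpose \<delta>) \<psi>)"
    and "facet k (act (conj_transpose \<delta>) \<psi>) = act \<gamma> ` facet g \<psi>"
    and "act (conj_transpose \<delta>) \<psi> \<bullet> act \<gamma> X = \<psi> \<bullet> X"
    and "psd (act (conj_transpose \<delta>) \<psi>) \<Longrightarrow> psd \<psi>"
proof -
  define \<psi>' where "\<psi>' = act (conj_transpose \<delta>) \<psi>"
  have inner: "\<psi>' \<bullet> act \<gamma> X = \<psi> \<bullet> X" for X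
    unfolding \<psi>'_def act_adjoint conj_transpose_conj_transpose
    by (simp add: act_mult[symmetric] \<gamma>(3) act_one)
  then show "act (conj_transpose \<delta>) \<psi> \<bullet> act \<gamma> X = \<psi> \<bullet> X" by (simp add: \<psi>'_def)
  have form: "form_at \<psi>' (\<gamma> *v x) = form_at \<psi> x" for x
    using inner[of "rank_one x"] by (simp only: form_at_inner act_rank_one)
  have zero: "{x \<in> min1 k. form_at \<psi>' x = 0} = (*v) \<gamma> ` {x \<in> min1 g. form_at \<psi> x = 0}"
    unfolding k using form by auto
  have inj: "inj ((*v) \<gamma>)" using \<gamma>(3) matrix_left_invertible_injective by blast
  show "facet k (act (conj_transpose \<delta>) \<psi>) = act \<gamma> ` facet g \<psi>"
    unfolding facet_def \<psi>'_def[symmetric] zero by (rule vcone_image[OF inj_on_subset[OF inj subset_UNIV]])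
  have H: "\<psi>' \<in> herm F"
    unfolding \<psi>'_def by (intro act_herm mats_K_conj_transpose GLO_K \<gamma> facet_normalD(1)[OF \<psi>])
  have n0: "\<psi>' \<noteq> 0"
  proof
    assume "\<psi>' = 0"
    then have "\<psi> \<bullet> \<psi> = 0" using inner[of \<psi>] by simp
    then show False using facet_normalD(2)[OF \<psi>] by simp
  qed
  have "rank_one ` {x \<in> min1 k. form_at \<psi>' x = 0} = act \<gamma> ` rank_one ` {x \<in> min1 g. form_at \<psi> x = 0}"
    unfolding zero by (simp add: image_image act_rank_one)
  then have "span (rank_one ` {x \<in> min1 k. form_at \<psi>' x = 0}) = act \<gamma> ` {X \<in> herm F. \<psi> \<bullet> X = 0}"
    by (simp add: linear_span_image[OF linear_act] facet_normalD(4)[OF \<psi>])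
  also have "\<dots> = {X \<in> herm F. \<psi>' \<bullet> X = 0}"
  proof (intro equalityI subsetI)
    fix Y assume "Y \<in> act \<gamma> ` {X \<in> herm F. \<psi> \<bullet> X = 0}"
    then show "Y \<in> {X \<in> herm F. \<psi>' \<bullet> X = 0}" using inner act_herm[OF GLO_K[OF \<gamma>(1)]] by auto
  next
    fix Y assume Y: "Y \<in> {X \<in> herm F. \<psi>' \<bullet> X = 0}"
    then obtain X where X: "X \<in> herm F" "Y = act \<gamma> X" using act_image_herm[OF \<gamma>(1)] by blast
    then have "\<psi> \<bullet> X = 0" using Y inner by simp
    then show "Y \<in> act \<gamma> ` {X \<in> herm F. \<psi> \<bullet> X = 0}" using X by blast
  qed
  finally have "span (rank_one ` {x \<in> min1 k. form_at \<psi>' x = 0}) = {X \<in> herm F. \<psi>' \<bullet> X = 0}" .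
  moreover have "\<forall>x\<in>min1 k. 0 \<le> form_at \<psi>' x" unfolding k using form facet_normalD(3)[OF \<psi>] by simp
  ultimately show "facet_normal k (act (conj_transpose \<delta>) \<psi>)"
    unfolding \<psi>'_def[symmetric] facet_normal_def using H n0 by blast
  show "psd \<psi>" if "psd (act (conj_transpose \<delta>) \<psi>)"
    unfolding psd_def
  proof
    fix x :: "complex ^ 'n" assume "x \<in> vecs K"
    then have "\<gamma> *v x \<in> vecs K" using mats_K_vecs[OF GLO_K[OF \<gamma>(1)]] by blast
    then have "0 \<le> form_at \<psi>' (\<gamma> *v x)" using that by (simp add: psd_def \<psi>'_def)
    then show "0 \<le> form_at \<psi> x" by (simp only: form)
  qed
qed

lemma orientation_iff:
  assumes \<omega>: "\<omega> \<in> orientations W" and C: "C \<in> ordered_bases W" and D: "D \<in> ordered_bases W"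
  shows "D \<in> \<omega> \<longleftrightarrow> (C \<in> \<omega> \<longleftrightarrow> 0 < basis_change_det C D)"
proof -
  obtain A where A: "A \<in> \<omega>" using orientation_nonempty[OF \<omega>] by blast
  note m = orientation_mem[OF \<omega> A]
  have "basis_change_det A D = basis_change_det A C * basis_change_det C D"
    by (rule basis_change_det_trans[OF m(1) C]) (use ordered_basesD[OF D] ordered_basesD[OF m(1)] in auto)
  moreover have "basis_change_det A C \<noteq> 0" "basis_change_det C D \<noteq> 0"
    using basis_change_det_nonzero m(1) C D by blast+
  ultimately show ?thesis using m(2)[of C] m(2)[of D] C D by (auto simp: zero_less_mult_iff)
qed

end

section \<open>Orbits of Voronoi domains\<close>

text \<open>
  The three cases of the hypothesis on \<open>\<Gamma>\<close> enter through these closure properties, the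
  finiteness of the index in \<open>GL\<^sub>n(\<O>)\<close> and the fact that \<open>\<Gamma>\<close> preserves the orientation of the
  Hermitian matrices.
\<close>

locale voronoi_complex = ground F d for F :: "complex set" and d :: nat +
  fixes \<Gamma> :: "(complex ^ 'n::finite ^ 'n) set"
    and R :: "'n cone set"
    and ori :: "'n cone \<Rightarrow> 'n orientation"
    and \<omega> :: "'n orientation"
    and D :: int
  assumes \<Gamma>_GLO: "\<Gamma> \<subseteq> carrier (GL (ring_of_ints F))"
    and \<Gamma>_one: "mat 1 \<in> \<Gamma>"
    and \<Gamma>_mult: "\<gamma> \<in> \<Gamma> \<Longrightarrow> \<gamma>' \<in> \<Gamma> \<Longrightarrow> \<gamma> ** \<gamma>' \<in> \<Gamma>"
    and \<Gamma>_inverse: "\<gamma> \<in> \<Gamma> \<Longrightarrow> \<exists>\<delta>\<in>\<Gamma>. \<gamma> ** \<delta> = mat 1 \<and> \<delta> ** \<gamma> = mat 1"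
    and \<Gamma>_index: "\<exists>T. finite T \<and> T \<subseteq> carrier (GL (ring_of_ints F)) \<and>
       (\<forall>\<gamma>\<in>carrier (GL (ring_of_ints F)). \<exists>t\<in>T. \<exists>h\<in>\<Gamma>. \<gamma> = h ** t)"
    and \<Gamma>_pos: "\<gamma> \<in> \<Gamma> \<Longrightarrow> B \<in> ordered_bases (herm F) \<Longrightarrow> 0 < basis_change_det B (map (act \<gamma>) B)"
    and D: "D = top_degree F CARD('n)"
    and R: "orbit_representatives F \<Gamma> R"
    and ori: "\<forall>\<sigma> \<in> voronoi_cones F. ori \<sigma> \<in> orientations (span \<sigma>)"
    and \<omega>: "\<omega> \<in> orientations (herm F)"
    and ori_top: "\<forall>\<sigma> \<in> Sigma_orientable F \<Gamma> R D. ori \<sigma> = \<omega>"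
begin

abbreviation Sigma_top where "Sigma_top \<equiv> Sigma_orientable F \<Gamma> R D"

lemma act_inverse:
  assumes "\<gamma> ** \<delta> = mat 1"
  shows "act \<gamma> (act \<delta> X) = X" "act \<gamma> ` act \<delta> ` S = S"
  using assms by (simp_all flip: act_mult act_image_mult add: act_one act_image_one)

definition rep :: "'n cone \<Rightarrow> 'n cone" where
  "rep \<sigma> = (THE \<tau>. \<tau> \<in> R \<and> (\<exists>\<gamma>\<in>\<Gamma>. \<sigma> = act \<gamma> ` \<tau>))"

lemma rep:
  assumes "\<sigma> \<in> voronoi_cones F"
  shows "rep \<sigma> \<in> R" "\<exists>\<gamma>\<in>\<Gamma>. \<sigma> = act \<gamma> ` rep \<sigma>"
proof -
  have "\<exists>!\<tau>. \<tau> \<in> R \<and> (\<exists>\<gamma>\<in>\<Gamma>. \<sigma> = act \<gamma> ` \<tau>)" using R assms by (simp add: orbit_representatives_def)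
  then have "rep \<sigma> \<in> R \<and> (\<exists>\<gamma>\<in>\<Gamma>. \<sigma> = act \<gamma> ` rep \<sigma>)" unfolding rep_def by (rule theI')
  then show "rep \<sigma> \<in> R" "\<exists>\<gamma>\<in>\<Gamma>. \<sigma> = act \<gamma> ` rep \<sigma>" by blast+
qed

lemma rep_eq:
  assumes "\<sigma> \<in> voronoi_cones F" "\<tau> \<in> R" "\<gamma> \<in> \<Gamma>" "\<sigma> = act \<gamma> ` \<tau>"
  shows "rep \<sigma> = \<tau>"
proof -
  have "\<exists>!\<tau>. \<tau> \<in> R \<and> (\<exists>\<gamma>\<in>\<Gamma>. \<sigma> = act \<gamma> ` \<tau>)" using R assms(1) by (simp add: orbit_representatives_def)
  then show ?thesis using rep[OF assms(1)] assms(2,3,4) by blast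
qed

lemma R_cones: "R \<subseteq> voronoi_cones F"
  using R by (simp add: orbit_representatives_def)

lemma vdom_cone: "unit_perfect h \<Longrightarrow> vdom h \<in> voronoi_cones F"
  using top_cones unfolding voronoi_cones_def by blast

lemma facet_cone:
  assumes "unit_perfect h" "facet_normal h \<psi>" "\<not> psd \<psi>"
  shows "facet h \<psi> \<in> voronoi_cones_codim F 1" "facet h \<psi> \<in> voronoi_cones F"
proof -
  have "facet h \<psi> \<in> faces_codim 1 (vdom h)" by (rule facet_faces_codim[OF assms(1,2) facet_nonzero[OF assms]])
  then show "facet h \<psi> \<in> voronoi_cones_codim F 1" unfolding voronoi_cones_codim_eq using assms(1) by blast
  then show "facet h \<psi> \<in> voronoi_cones F" unfolding voronoi_cones_def by blast
qed

lemma rep_invariant: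
  assumes "\<sigma> \<in> voronoi_cones F" "act \<gamma> ` \<sigma> \<in> voronoi_cones F" "\<gamma> \<in> \<Gamma>"
  shows "rep (act \<gamma> ` \<sigma>) = rep \<sigma>"
proof -
  obtain \<gamma>' where g: "\<gamma>' \<in> \<Gamma>" "\<sigma> = act \<gamma>' ` rep \<sigma>" using rep(2)[OF assms(1)] by blast
  have "act \<gamma> ` \<sigma> = act (\<gamma> ** \<gamma>') ` rep \<sigma>" using g(2) by (simp add: act_image_mult)
  then show ?thesis using rep_eq[OF assms(2) rep(1)[OF assms(1)] \<Gamma>_mult[OF assms(3) g(1)]] by blast
qed

text \<open>
  In codimension \<open>0\<close> the conditions on the interior and on the stabilizer hold automatically:
  interior points of Voronoi domains are positive definite, and \<open>\<Gamma>\<close> preserves orientations.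
\<close>

lemma top_iff: "\<sigma> \<in> Sigma_top \<longleftrightarrow> \<sigma> \<in> R \<and> (\<exists>h. unit_perfect h \<and> \<sigma> = vdom h)"
proof
  assume "\<sigma> \<in> Sigma_top"
  then obtain k :: nat where k: "\<sigma> \<in> R" "D = top_degree F CARD('n) - int k" "\<sigma> \<in> voronoi_cones_codim F k"
    by (auto simp: Sigma_orientable_def Sigma_star_def)
  then have "k = 0" using D by simp
  then show "\<sigma> \<in> R \<and> (\<exists>h. unit_perfect h \<and> \<sigma> = vdom h)" using k top_cones by auto
next
  assume "\<sigma> \<in> R \<and> (\<exists>h. unit_perfect h \<and> \<sigma> = vdom h)"
  then obtain h where h: "\<sigma> \<in> R" "unit_perfect h" "\<sigma> = vdom h" by blast
  have "\<sigma> \<in> voronoi_cones_codim F 0" using h(2,3) top_cones by blast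
  moreover have "rel_interior \<sigma> \<inter> pos_cone_star_boundary F = {}"
    using vdom_interior[OF h(2)] by (auto simp: h(3) pos_cone_star_boundary_def)
  ultimately have "\<sigma> \<in> Sigma_star F R D" using h(1) D by (auto simp: Sigma_star_def intro!: exI[of _ "0::nat"])
  moreover have "\<not> reverses_orientation \<gamma> (span \<sigma>)" if "\<gamma> \<in> stabilizer \<Gamma> \<sigma>" for \<gamma>
  proof -
    have "\<gamma> \<in> \<Gamma>" using that by (simp add: stabilizer_def)
    then show ?thesis using \<Gamma>_pos unfolding h(3) span_vdom[OF h(2)] reverses_orientation_def
      by (meson not_less_iff_gr_or_eq)
  qed
  ultimately show "\<sigma> \<in> Sigma_top" by (auto simp: Sigma_orientable_def)
qed

lemma act_vdom_\<Gamma>: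
  assumes "\<gamma> \<in> \<Gamma>" "unit_perfect h"
  shows "\<exists>g. unit_perfect g \<and> act \<gamma> ` vdom h = vdom g \<and> min1 g = (*v) \<gamma> ` min1 h"
  using act_vdom[OF _ assms(2)] \<Gamma>_GLO assms(1) by blast

lemma rep_top:
  assumes h: "unit_perfect h"
  shows "rep (vdom h) \<in> Sigma_top"
proof -
  obtain \<gamma> where g: "\<gamma> \<in> \<Gamma>" "vdom h = act \<gamma> ` rep (vdom h)" using rep(2)[OF vdom_cone[OF h]] by blast
  obtain \<delta> where d: "\<delta> \<in> \<Gamma>" "\<delta> ** \<gamma> = mat 1" using \<Gamma>_inverse[OF g(1)] by blast
  have "act \<delta> ` vdom h = rep (vdom h)" by (subst g(2)) (rule act_inverse(2)[OF d(2)])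
  then have "\<exists>g. unit_perfect g \<and> rep (vdom h) = vdom g" using act_vdom_\<Gamma>[OF d(1) h] by metis
  then show ?thesis unfolding top_iff using rep(1)[OF vdom_cone[OF h]] by blast
qed

lemma finite_top: "finite Sigma_top"
proof -
  obtain T where T: "finite T" "T \<subseteq> GLO" "\<forall>\<gamma>\<in>GLO. \<exists>t\<in>T. \<exists>h\<in>\<Gamma>. \<gamma> = h ** t" using \<Gamma>_index by blast
  obtain S :: "(complex ^ 'n ^ 'n) set" where S: "finite S" "\<forall>h\<in>S. unit_perfect h"
    "\<forall>h. unit_perfect h \<longrightarrow> (\<exists>\<gamma>\<in>GLO. \<exists>g\<in>S. vdom h = act \<gamma> ` vdom g)"
    using finite_vdom_mod_GLO by blast
  have "Sigma_top \<subseteq> rep ` (\<lambda>(t, g). act t ` vdom g) ` (T \<times> S)"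
  proof
    fix \<sigma> assume s: "\<sigma> \<in> Sigma_top"
    then obtain h where h: "\<sigma> \<in> R" "unit_perfect h" "\<sigma> = vdom h" unfolding top_iff by blast
    obtain \<gamma> g where g: "\<gamma> \<in> GLO" "g \<in> S" "vdom h = act \<gamma> ` vdom g" using S(3) h(2) by blast
    obtain t k where t: "t \<in> T" "k \<in> \<Gamma>" "\<gamma> = k ** t" using T(3) g(1) by blast
    obtain l where l: "l \<in> \<Gamma>" "l ** k = mat 1" using \<Gamma>_inverse[OF t(2)] by blast
    have "\<sigma> = act k ` act t ` vdom g" unfolding h(3) g(3) t(3) act_image_mult ..
    then have eq: "act t ` vdom g = act l ` \<sigma>" by (simp only: act_inverse(2)[OF l(2)])
    have "\<exists>f. unit_perfect f \<and> act t ` vdom g = vdom f" using act_vdom T(2) t(1) S(2) g(2) by blast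
    then have "act t ` vdom g \<in> voronoi_cones F" using vdom_cone by auto
    then have "rep (act t ` vdom g) = \<sigma>" using rep_eq[OF _ h(1) l(1) eq] by blast
    then show "\<sigma> \<in> rep ` (\<lambda>(t, g). act t ` vdom g) ` (T \<times> S)" using t(1) g(2) by force
  qed
  then show ?thesis using T(1) S(1) by (meson finite_SigmaI finite_imageI finite_subset)
qed

lemma top_nonempty: "Sigma_top \<noteq> {}"
  using unit_perfect_exists rep_top by blast

lemma faces_codim_1_facet:
  assumes h: "unit_perfect h" and t: "\<tau> \<in> faces_codim 1 (vdom h)"
  shows "\<exists>\<psi>. facet_normal h \<psi> \<and> \<tau> = facet h \<psi> \<and> facet h \<psi> \<noteq> {0}"
  using codim_1_face_facet[OF h, of \<tau>] t by (auto simp: faces_codim_def)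

text \<open>
  A facet with semidefinite normal is excluded, because its interior meets the boundary.
\<close>

lemma Sigma_star_facet:
  assumes "\<tau> \<in> Sigma_star F R (D - 1)"
  shows "\<exists>h \<psi>. unit_perfect h \<and> facet_normal h \<psi> \<and> \<not> psd \<psi> \<and> \<tau> = facet h \<psi>"
proof -
  obtain k :: nat where k: "D - 1 = top_degree F CARD('n) - int k" "\<tau> \<in> voronoi_cones_codim F k"
    "rel_interior \<tau> \<inter> pos_cone_star_boundary F = {}"
    using assms by (auto simp: Sigma_star_def)
  then have "k = 1" using D by simp
  then obtain h where h: "unit_perfect h" "\<tau> \<in> faces_codim 1 (vdom h)" using k(2) unfolding voronoi_cones_codim_eq by blast
  obtain \<psi> where \<psi>: "facet_normal h \<psi>" "\<tau> = facet h \<psi>" "facet h \<psi> \<noteq> {0}" using faces_codim_1_facet[OF h] by blast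
  have "\<not> psd \<psi>" using facet_boundary[OF h(1) \<psi>(1) _ \<psi>(3)] k(3) \<psi>(2) by blast
  then show ?thesis using h(1) \<psi> by blast
qed

lemma facet_Sigma_star:
  assumes h: "unit_perfect h" "facet_normal h \<psi>" "\<not> psd \<psi>" and "facet h \<psi> \<in> R"
  shows "facet h \<psi> \<in> Sigma_star F R (D - 1)"
proof -
  have "rel_interior (facet h \<psi>) \<inter> pos_cone_star_boundary F = {}"
    using facet_interior[OF h] by (auto simp: pos_cone_star_boundary_def)
  then show ?thesis
    unfolding Sigma_star_def using assms(4) facet_cone(1)[OF h] D by (auto intro!: exI[of _ "1::nat"])
qed

lemma finite_faces: "unit_perfect h \<Longrightarrow> finite (faces_codim k (vdom h))"
  using finite_polyhedron_faces[OF polyhedron_vcone[OF unit_perfect_finite]]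
  unfolding vdom_def faces_codim_def by (rule finite_subset[rotated]) auto

lemma faces_codim_act:
  assumes "\<gamma> \<in> \<Gamma>"
  shows "faces_codim k (act \<gamma> ` \<sigma>) = (`) (act \<gamma>) ` faces_codim k \<sigma>"
proof -
  obtain \<delta> where "\<delta> ** \<gamma> = mat 1" using \<Gamma>_inverse[OF assms] by blast
  then show ?thesis by (intro faces_codim_image linear_act inj_act)
qed

lemma finite_Sigma_star: "finite (Sigma_star F R (D - 1))"
proof -
  have "Sigma_star F R (D - 1) \<subseteq> rep ` (\<Union>\<sigma>\<in>Sigma_top. faces_codim 1 \<sigma>)"
  proof
    fix \<tau> assume t: "\<tau> \<in> Sigma_star F R (D - 1)"
    then have tR: "\<tau> \<in> R" by (simp add: Sigma_star_def)
    obtain h \<psi> where h: "unit_perfect h" "facet_normal h \<psi>" "\<not> psd \<psi>" "\<tau> = facet h \<psi>" using Sigma_star_facet[OF t] by blast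
    have f: "\<tau> \<in> faces_codim 1 (vdom h)" unfolding h(4) by (rule facet_faces_codim[OF h(1,2) facet_nonzero[OF h(1,2,3)]])
    obtain \<gamma> where g: "\<gamma> \<in> \<Gamma>" "vdom h = act \<gamma> ` rep (vdom h)" using rep(2)[OF vdom_cone[OF h(1)]] by blast
    obtain \<tau>' where t': "\<tau>' \<in> faces_codim 1 (rep (vdom h))" "\<tau> = act \<gamma> ` \<tau>'"
      using f g(2) faces_codim_act[OF g(1), of 1 "rep (vdom h)"] by auto
    have Sigma_top: "rep (vdom h) \<in> Sigma_top" by (rule rep_top[OF h(1)])
    then obtain f where "unit_perfect f" "rep (vdom h) = vdom f" unfolding top_iff by blast
    then have c: "\<tau>' \<in> voronoi_cones F" using t'(1) unfolding voronoi_cones_def voronoi_cones_codim_eq by auto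
    obtain \<delta> where d: "\<delta> \<in> \<Gamma>" "\<delta> ** \<gamma> = mat 1" using \<Gamma>_inverse[OF g(1)] by blast
    have "\<tau>' = act \<delta> ` \<tau>" unfolding t'(2) by (simp only: act_inverse(2)[OF d(2)])
    then have "rep \<tau>' = \<tau>" by (rule rep_eq[OF c tR d(1)])
    then show "\<tau> \<in> rep ` (\<Union>\<sigma>\<in>Sigma_top. faces_codim 1 \<sigma>)" using t'(1) Sigma_top by blast
  qed
  moreover have "finite (faces_codim 1 \<sigma>)" if "\<sigma> \<in> Sigma_top" for \<sigma>
    using that finite_faces unfolding top_iff by auto
  ultimately show ?thesis using finite_top by (meson finite_UN_I finite_imageI finite_subset)
qed

lemma finite_\<Gamma>_transporter:
  assumes "unit_perfect h" "unit_perfect g"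
  shows "finite {\<gamma> \<in> \<Gamma>. act \<gamma> ` vdom h = vdom g}"
  by (rule finite_subset[OF _ finite_transporter[OF assms]]) (use \<Gamma>_GLO in blast)

lemma finite_stabilizer: "\<sigma> \<in> Sigma_top \<Longrightarrow> finite (stabilizer \<Gamma> \<sigma>)"
  unfolding top_iff stabilizer_def using finite_\<Gamma>_transporter by auto

lemma stabilizer_one: "mat 1 \<in> stabilizer \<Gamma> \<sigma>"
  by (simp add: stabilizer_def \<Gamma>_one act_image_one)

lemma card_stabilizer_pos: "\<sigma> \<in> Sigma_top \<Longrightarrow> 0 < card (stabilizer \<Gamma> \<sigma>)"
  using finite_stabilizer stabilizer_one by (auto simp: card_gt_0_iff)

lemma card_transporter:
  assumes g0: "\<gamma>0 \<in> \<Gamma>"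
  shows "card {\<gamma> \<in> \<Gamma>. act \<gamma> ` \<tau> = act \<gamma>0 ` \<tau>} = card (stabilizer \<Gamma> \<tau>)"
proof -
  obtain \<delta> where d: "\<delta> \<in> \<Gamma>" "\<gamma>0 ** \<delta> = mat 1" "\<delta> ** \<gamma>0 = mat 1" using \<Gamma>_inverse[OF g0] by blast
  have "bij_betw (\<lambda>e. \<gamma>0 ** e) (stabilizer \<Gamma> \<tau>) {\<gamma> \<in> \<Gamma>. act \<gamma> ` \<tau> = act \<gamma>0 ` \<tau>}"
  proof (rule bij_betw_byWitness[where f' = "\<lambda>\<gamma>. \<delta> ** \<gamma>"])
    show "\<forall>a\<in>stabilizer \<Gamma> \<tau>. \<delta> ** (\<gamma>0 ** a) = a" by (simp add: matrix_mul_assoc d(3))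
    show "\<forall>a\<in>{\<gamma> \<in> \<Gamma>. act \<gamma> ` \<tau> = act \<gamma>0 ` \<tau>}. \<gamma>0 ** (\<delta> ** a) = a" by (simp add: matrix_mul_assoc d(2))
    show "(\<lambda>e. \<gamma>0 ** e) ` stabilizer \<Gamma> \<tau> \<subseteq> {\<gamma> \<in> \<Gamma>. act \<gamma> ` \<tau> = act \<gamma>0 ` \<tau>}"
    proof (rule image_subsetI)
      fix e assume e: "e \<in> stabilizer \<Gamma> \<tau>"
      have "act (\<gamma>0 ** e) ` \<tau> = act \<gamma>0 ` act e ` \<tau>" by (rule act_image_mult)
      then show "\<gamma>0 ** e \<in> {\<gamma> \<in> \<Gamma>. act \<gamma> ` \<tau> = act \<gamma>0 ` \<tau>}"
        using e \<Gamma>_mult[OF g0] by (simp add: stabilizer_def)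
    qed
    show "(\<lambda>\<gamma>. \<delta> ** \<gamma>) ` {\<gamma> \<in> \<Gamma>. act \<gamma> ` \<tau> = act \<gamma>0 ` \<tau>} \<subseteq> stabilizer \<Gamma> \<tau>"
    proof clarify
      fix \<gamma> assume g: "\<gamma> \<in> \<Gamma>" "act \<gamma> ` \<tau> = act \<gamma>0 ` \<tau>"
      have "act (\<delta> ** \<gamma>) ` \<tau> = act \<delta> ` act \<gamma>0 ` \<tau>" unfolding act_image_mult g(2) ..
      also have "\<dots> = \<tau>" by (rule act_inverse(2)[OF d(3)])
      finally show "\<delta> ** \<gamma> \<in> stabilizer \<Gamma> \<tau>" using \<Gamma>_mult[OF d(1) g(1)] by (simp add: stabilizer_def)
    qed
  qed
  then show ?thesis by (simp add: bij_betw_same_card)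
qed

text \<open>
  The transporter to \<open>\<sigma>\<close> is empty or a coset of the stabilizer of \<open>\<sigma>\<close>.
\<close>

lemma card_transporter_top:
  assumes h: "unit_perfect h" and s: "\<sigma> \<in> Sigma_top"
  shows "card {\<gamma> \<in> \<Gamma>. act \<gamma> ` vdom h = \<sigma>} = (if rep (vdom h) = \<sigma> then card (stabilizer \<Gamma> \<sigma>) else 0)"
proof (cases "rep (vdom h) = \<sigma>")
  case True
  then obtain \<gamma> where g: "\<gamma> \<in> \<Gamma>" "vdom h = act \<gamma> ` \<sigma>" using rep(2)[OF vdom_cone[OF h]] by blast
  obtain \<delta> where d: "\<delta> \<in> \<Gamma>" "\<gamma> ** \<delta> = mat 1" "\<delta> ** \<gamma> = mat 1" using \<Gamma>_inverse[OF g(1)] by blast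
  have sd: "\<sigma> = act \<delta> ` vdom h" unfolding g(2) by (simp only: act_inverse(2)[OF d(3)])
  have "bij_betw (\<lambda>e. e ** \<gamma>) {e \<in> \<Gamma>. act e ` vdom h = \<sigma>} (stabilizer \<Gamma> \<sigma>)"
  proof (rule bij_betw_byWitness[where f' = "\<lambda>e. e ** \<delta>"])
    show "\<forall>a\<in>{e \<in> \<Gamma>. act e ` vdom h = \<sigma>}. (a ** \<gamma>) ** \<delta> = a" by (simp add: matrix_mul_assoc[symmetric] d(2))
    show "\<forall>a\<in>stabilizer \<Gamma> \<sigma>. (a ** \<delta>) ** \<gamma> = a" by (simp add: matrix_mul_assoc[symmetric] d(3))
    show "(\<lambda>e. e ** \<gamma>) ` {e \<in> \<Gamma>. act e ` vdom h = \<sigma>} \<subseteq> stabilizer \<Gamma> \<sigma>"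
    proof (rule image_subsetI)
      fix e assume e: "e \<in> {e \<in> \<Gamma>. act e ` vdom h = \<sigma>}"
      have "act (e ** \<gamma>) ` \<sigma> = act e ` act \<gamma> ` \<sigma>" by (rule act_image_mult)
      also have "\<dots> = \<sigma>" using e g(2) by simp
      finally show "e ** \<gamma> \<in> stabilizer \<Gamma> \<sigma>" using e \<Gamma>_mult[OF _ g(1)] by (simp add: stabilizer_def)
    qed
    show "(\<lambda>e. e ** \<delta>) ` stabilizer \<Gamma> \<sigma> \<subseteq> {e \<in> \<Gamma>. act e ` vdom h = \<sigma>}"
    proof (rule image_subsetI)
      fix e assume e: "e \<in> stabilizer \<Gamma> \<sigma>"
      have "act (e ** \<delta>) ` vdom h = act e ` act \<delta> ` vdom h" by (rule act_image_mult)
      also have "\<dots> = \<sigma>" unfolding sd[symmetric] using e by (simp add: stabilizer_def)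
      finally show "e ** \<delta> \<in> {e \<in> \<Gamma>. act e ` vdom h = \<sigma>}"
        using e \<Gamma>_mult[OF _ d(1)] by (simp add: stabilizer_def)
    qed
  qed
  then show ?thesis using True by (simp add: bij_betw_same_card)
next
  case False
  have "act \<gamma> ` vdom h \<noteq> \<sigma>" if g: "\<gamma> \<in> \<Gamma>" for \<gamma>
  proof
    assume eq: "act \<gamma> ` vdom h = \<sigma>"
    obtain \<delta> where d: "\<delta> \<in> \<Gamma>" "\<delta> ** \<gamma> = mat 1" using \<Gamma>_inverse[OF g] by blast
    have "vdom h = act \<delta> ` \<sigma>" unfolding eq[symmetric] by (simp only: act_inverse(2)[OF d(2)])
    then have "rep (vdom h) = \<sigma>" using rep_eq[OF vdom_cone[OF h] _ d(1)] s unfolding top_iff by blast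
    then show False using False by blast
  qed
  then have empty: "{\<gamma> \<in> \<Gamma>. act \<gamma> ` vdom h = \<sigma>} = {}" by blast
  show ?thesis unfolding empty using False by simp
qed


section \<open>Incidence numbers\<close>

text \<open>
  Compare \<open>Y\<close> with the vector \<open>\<psi>\<close>, which is transversal to its own hyperplane.
\<close>

lemma append_in_orientation:
  assumes B: "B \<in> ordered_bases {X \<in> herm F. \<psi> \<bullet> X = 0}" and \<psi>: "\<psi> \<in> herm F" "\<psi> \<noteq> 0"
    and Y: "Y \<in> herm F" "\<psi> \<bullet> Y \<noteq> 0"
  shows "B @ [Y] \<in> \<omega> \<longleftrightarrow> (B @ [\<psi>] \<in> \<omega> \<longleftrightarrow> 0 < \<psi> \<bullet> Y)"
proof -
  have p: "0 < \<psi> \<bullet> \<psi>" and n: "\<psi> \<bullet> \<psi> \<noteq> 0" using \<psi>(2) inner_gt_zero_iff[of \<psi>] by auto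
  have P: "B @ [\<psi>] \<in> ordered_bases (herm F)" by (rule append_ordered_bases[OF subspace_herm B \<psi>(1) n])
  have Q: "B @ [Y] \<in> ordered_bases (herm F)" by (rule append_ordered_bases[OF subspace_herm B Y])
  have "basis_change_det (B @ [\<psi>]) (B @ [Y]) = basis_change_det B B * ((\<psi> \<bullet> Y) / (\<psi> \<bullet> \<psi>))"
    by (rule basis_change_det_append[OF subspace_herm B \<psi>(1) n _ ordered_basesD(5)[OF B] Y(1)]) simp
  then have "0 < basis_change_det (B @ [\<psi>]) (B @ [Y]) \<longleftrightarrow> 0 < \<psi> \<bullet> Y"
    unfolding basis_change_det_self[OF B] using p by (simp add: pos_less_divide_eq)
  then show ?thesis using orientation_iff[OF \<omega> P Q] by simp
qed

lemma append_change_basis: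
  assumes B: "B \<in> ordered_bases {X \<in> herm F. \<psi> \<bullet> X = 0}" and C: "C \<in> ordered_bases {X \<in> herm F. \<psi> \<bullet> X = 0}"
    and Y: "Y \<in> herm F" "\<psi> \<bullet> Y \<noteq> 0"
  shows "C @ [Y] \<in> \<omega> \<longleftrightarrow> (B @ [Y] \<in> \<omega> \<longleftrightarrow> 0 < basis_change_det B C)"
proof -
  have P: "B @ [Y] \<in> ordered_bases (herm F)" by (rule append_ordered_bases[OF subspace_herm B Y])
  have Q: "C @ [Y] \<in> ordered_bases (herm F)" by (rule append_ordered_bases[OF subspace_herm C Y])
  have "basis_change_det (B @ [Y]) (C @ [Y]) = basis_change_det B C * ((\<psi> \<bullet> Y) / (\<psi> \<bullet> Y))"
    by (rule basis_change_det_append[OF subspace_herm B Y _ ordered_basesD(5)[OF C] Y(1)])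
      (simp add: ordered_basesD(4)[OF B] ordered_basesD(4)[OF C])
  then show ?thesis using orientation_iff[OF \<omega> P Q] Y(2) by simp
qed

lemma act_orientation:
  assumes g: "\<gamma> \<in> \<Gamma>" and B: "B \<in> ordered_bases (herm F)"
  shows "map (act \<gamma>) B \<in> ordered_bases (herm F)" "map (act \<gamma>) B \<in> \<omega> \<longleftrightarrow> B \<in> \<omega>"
proof -
  obtain \<delta> where "\<delta> ** \<gamma> = mat 1" using \<Gamma>_inverse[OF g] by blast
  then have "inj (act \<gamma>)" by (rule inj_act)
  then have "map (act \<gamma>) B \<in> ordered_bases (act \<gamma> ` herm F)" by (rule map_ordered_bases[OF linear_act _ B])
  then show m: "map (act \<gamma>) B \<in> ordered_bases (herm F)" using act_image_herm[of \<gamma>] \<Gamma>_GLO g by auto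
  show "map (act \<gamma>) B \<in> \<omega> \<longleftrightarrow> B \<in> \<omega>" using orientation_iff[OF \<omega> B m] \<Gamma>_pos[OF g B] by simp
qed

lemma facet_faces: "unit_perfect h \<Longrightarrow> facet_normal h \<psi> \<Longrightarrow> \<not> psd \<psi> \<Longrightarrow> facet h \<psi> \<in> faces_codim 1 (vdom h)"
  using facet_faces_codim facet_nonzero by blast

lemma neq_minus:
  fixes \<psi> :: "complex ^ 'n ^ 'n"
  assumes "\<psi> \<noteq> 0"
  shows "\<psi> \<noteq> - \<psi>"
proof
  assume "\<psi> = - \<psi>"
  then have "\<psi> \<bullet> \<psi> = (- \<psi>) \<bullet> \<psi>" by (rule arg_cong)
  then show False using inner_gt_zero_iff[of \<psi>] assms unfolding inner_minus_left by linarith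
qed

text \<open>
  Both signs are determined by comparison with the transported basis \<open>\<gamma> B\<close>. If the chosen
  orientation of \<open>\<gamma> \<tau>\<close> is changed, \<open>\<eta>\<close> and \<open>\<epsilon>\<close> both change; their product says whether \<open>\<gamma> B\<close>
  followed by a vector \<open>x x\<^sup>*\<close> of \<open>\<sigma>\<close> is positive. Since \<open>\<gamma>\<close> preserves the orientation, the
  same question can be asked for \<open>B\<close> and \<open>\<gamma>\<^sup>-\<^sup>1 x x\<^sup>*\<close>, and the answer depends on the side of
  \<open>\<tau>\<close> at which the domain of \<open>g\<close> lies. That \<open>\<eta>\<close> does not depend on \<open>\<gamma>\<close> is the orientability of
  \<open>\<tau>\<close>.
\<close>

lemma sign_product:
  assumes h: "unit_perfect h" "facet_normal h \<psi>" "\<not> psd \<psi>" and \<tau>: "\<tau> = facet h \<psi>"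
    and to: "\<tau> \<in> Sigma_orientable F \<Gamma> R (D - 1)" and B: "B \<in> ori \<tau>"
    and \<sigma>: "\<sigma> \<in> Sigma_top" and \<gamma>: "\<gamma> \<in> \<Gamma>" "act \<gamma> ` vdom g = \<sigma>"
    and g: "unit_perfect g" "facet_normal g \<phi>" "\<tau> = facet g \<phi>" "\<phi> = \<psi> \<or> \<phi> = - \<psi>"
  shows "sign_eta \<Gamma> ori \<tau> (act \<gamma> ` \<tau>) * sign_eps F ori \<sigma> (act \<gamma> ` \<tau>)
       = (if B @ [\<psi>] \<in> \<omega> \<longleftrightarrow> \<phi> = \<psi> then 1 else -1)"
proof -
  have \<psi>H: "\<psi> \<in> herm F" "\<psi> \<noteq> 0" using facet_normalD[OF h(2)] by blast+
  have minus: "\<psi> \<noteq> - \<psi>" by (rule neq_minus[OF \<psi>H(2)])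
  have gO: "\<gamma> \<in> GLO" using \<Gamma>_GLO \<gamma>(1) by blast
  obtain \<delta> where d: "\<delta> \<in> \<Gamma>" "\<gamma> ** \<delta> = mat 1" "\<delta> ** \<gamma> = mat 1" using \<Gamma>_inverse[OF \<gamma>(1)] by blast
  have dO: "\<delta> \<in> GLO" using \<Gamma>_GLO d(1) by blast
  obtain k where k: "unit_perfect k" "act \<gamma> ` vdom g = vdom k" "min1 k = (*v) \<gamma> ` min1 g"
    using act_vdom_\<Gamma>[OF \<gamma>(1) g(1)] by blast
  define \<phi>' where "\<phi>' = act (conj_transpose \<delta>) \<phi>"
  note fa = facet_normal_act[OF gO d(2,3) dO g(2) k(3)]
  have fn: "facet_normal k \<phi>'" and ff: "facet k \<phi>' = act \<gamma> ` \<tau>" and inner: "\<phi>' \<bullet> act \<gamma> X = \<phi> \<bullet> X" for X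
    using fa(1,2,3) g(3) by (simp_all add: \<phi>'_def)
  have sk: "\<sigma> = vdom k" using k(2) \<gamma>(2) by simp
  define \<tau>' where "\<tau>' = act \<gamma> ` \<tau>"
  have \<tau>'k: "\<tau>' = facet k \<phi>'" by (simp add: \<tau>'_def ff)
  have st: "span \<tau> = {X \<in> herm F. \<psi> \<bullet> X = 0}" unfolding \<tau> by (rule span_facet[OF h(1,2)])
  have st': "span \<tau>' = {X \<in> herm F. \<phi>' \<bullet> X = 0}" unfolding \<tau>'k by (rule span_facet[OF k(1) fn])
  have tc: "\<tau> \<in> voronoi_cones F" unfolding \<tau> by (rule facet_cone(2)[OF h])
  have ot: "ori \<tau> \<in> orientations {X \<in> herm F. \<psi> \<bullet> X = 0}" using bspec[OF ori tc] unfolding st .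
  have "\<tau> \<in> faces_codim 1 (vdom h)" unfolding \<tau> by (rule facet_faces[OF h])
  then have "\<tau>' \<in> faces_codim 1 (act \<gamma> ` vdom h)" unfolding \<tau>'_def faces_codim_act[OF \<gamma>(1)] by blast
  moreover obtain f where "unit_perfect f" "act \<gamma> ` vdom h = vdom f" using act_vdom_\<Gamma>[OF \<gamma>(1) h(1)] by blast
  ultimately have "\<tau>' \<in> voronoi_cones_codim F 1" unfolding voronoi_cones_codim_eq by auto
  then have tc': "\<tau>' \<in> voronoi_cones F" unfolding voronoi_cones_def by blast
  define o' where "o' = ori \<tau>'"
  have ot': "o' \<in> orientations {X \<in> herm F. \<phi>' \<bullet> X = 0}" using bspec[OF ori tc'] unfolding o'_def st' .
  have Bb: "B \<in> ordered_bases {X \<in> herm F. \<psi> \<bullet> X = 0}" by (rule orientation_mem(1)[OF ot B])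
  \<comment> \<open>The reference basis of the span of \<open>\<gamma> \<tau>\<close>.\<close>
  define M where "M = map (act \<gamma>) B"
  have inj: "inj (act \<gamma>)" using d(3) by (rule inj_act)
  have "act \<gamma> ` span \<tau> = span \<tau>'" unfolding \<tau>'_def by (simp add: linear_span_image[OF linear_act])
  then have Mb: "M \<in> ordered_bases {X \<in> herm F. \<phi>' \<bullet> X = 0}"
    using map_ordered_bases[OF linear_act inj Bb] unfolding M_def st st' by simp
  define q where "q \<longleftrightarrow> (B @ [\<psi>] \<in> \<omega> \<longleftrightarrow> \<phi> = \<psi>)"
  have eps: "B' @ [rank_one x] \<in> \<omega> \<longleftrightarrow> (M \<in> o' \<longleftrightarrow> q)"
    if B': "B' \<in> o'" and x: "x \<in> cone_vecs F \<sigma> - cone_vecs F \<tau>'" for B' x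
  proof -
    have xY: "rank_one x \<in> herm F" "0 < \<phi>' \<bullet> rank_one x"
      using cone_vecs_off_facet(2)[OF k(1) fn] x unfolding sk \<tau>'k by blast+
    have B'b: "B' \<in> ordered_bases {X \<in> herm F. \<phi>' \<bullet> X = 0}" by (rule orientation_mem(1)[OF ot' B'])
    have "M \<in> o' \<longleftrightarrow> 0 < basis_change_det M B'"
      using orientation_iff[OF ot' Mb B'b] B' by simp
    then have 1: "B' @ [rank_one x] \<in> \<omega> \<longleftrightarrow> (M @ [rank_one x] \<in> \<omega> \<longleftrightarrow> M \<in> o')"
      using append_change_basis[OF Mb B'b xY(1)] xY(2) by simp
    define X where "X = act \<delta> (rank_one x)"
    have gX: "act \<gamma> X = rank_one x" unfolding X_def by (rule act_inverse(1)[OF d(2)])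
    have XH: "X \<in> herm F" unfolding X_def using act_herm[OF GLO_K[OF dO] xY(1)] .
    have "0 < \<phi> \<bullet> X" using inner[of X] xY(2) gX by simp
    then have Xs: "\<psi> \<bullet> X \<noteq> 0" "0 < \<psi> \<bullet> X \<longleftrightarrow> \<phi> = \<psi>" using g(4) minus by auto
    have BX: "B @ [X] \<in> ordered_bases (herm F)" by (rule append_ordered_bases[OF subspace_herm Bb XH Xs(1)])
    have "M @ [rank_one x] = map (act \<gamma>) (B @ [X])" by (simp add: M_def gX)
    then have "M @ [rank_one x] \<in> \<omega> \<longleftrightarrow> B @ [X] \<in> \<omega>" using act_orientation(2)[OF \<gamma>(1) BX] by simp
    also have "\<dots> \<longleftrightarrow> q" unfolding q_def using append_in_orientation[OF Bb \<psi>H XH Xs(1)] Xs(2) by simp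
    finally show ?thesis using 1 by blast
  qed
  have oris: "ori \<sigma> = \<omega>" using ori_top \<sigma> by blast
  have "(\<exists>B' \<in> ori \<tau>'. \<exists>x \<in> cone_vecs F \<sigma> - cone_vecs F \<tau>'. B' @ [rank_one x] \<in> ori \<sigma>) \<longleftrightarrow> (M \<in> o' \<longleftrightarrow> q)"
  proof -
    obtain B' where B': "B' \<in> o'" using orientation_nonempty[OF ot'] by blast
    obtain x where x: "x \<in> cone_vecs F \<sigma> - cone_vecs F \<tau>'"
      using cone_vecs_off_facet(1)[OF k(1) fn] unfolding sk \<tau>'k by blast
    show ?thesis unfolding oris o'_def[symmetric] using eps B' x by blast
  qed
  then have E: "sign_eps F ori \<sigma> \<tau>' = (if M \<in> o' \<longleftrightarrow> q then 1 else -1)"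
    unfolding sign_eps_def by simp
  have "(\<exists>\<gamma>1 \<in> \<Gamma>. \<tau>' = act \<gamma>1 ` \<tau> \<and> (\<exists>B1 \<in> ori \<tau>. map (act \<gamma>1) B1 \<in> ori \<tau>')) \<longleftrightarrow> M \<in> o'"
  proof
    assume "M \<in> o'"
    then show "\<exists>\<gamma>1 \<in> \<Gamma>. \<tau>' = act \<gamma>1 ` \<tau> \<and> (\<exists>B1 \<in> ori \<tau>. map (act \<gamma>1) B1 \<in> ori \<tau>')"
      using \<gamma>(1) B unfolding M_def o'_def \<tau>'_def by blast
  next
    assume "\<exists>\<gamma>1 \<in> \<Gamma>. \<tau>' = act \<gamma>1 ` \<tau> \<and> (\<exists>B1 \<in> ori \<tau>. map (act \<gamma>1) B1 \<in> ori \<tau>')"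
    then obtain \<gamma>1 B1 where 1: "\<gamma>1 \<in> \<Gamma>" "\<tau>' = act \<gamma>1 ` \<tau>" "B1 \<in> ori \<tau>" "map (act \<gamma>1) B1 \<in> o'"
      unfolding o'_def by blast
    \<comment> \<open>Another transporter \<open>\<gamma>\<^sub>1\<close> differs from \<open>\<gamma>\<close> by an element of the stabilizer of \<open>\<tau>\<close>, which
      does not reverse the orientation.\<close>
    define e where "e = \<delta> ** \<gamma>1"
    have eG: "e \<in> \<Gamma>" unfolding e_def by (rule \<Gamma>_mult[OF d(1) 1(1)])
    have et: "act e ` \<tau> = \<tau>"
      unfolding e_def act_image_mult 1(2)[symmetric] \<tau>'_def by (rule act_inverse(2)[OF d(3)])
    have eH: "act e ` {X \<in> herm F. \<psi> \<bullet> X = 0} = {X \<in> herm F. \<psi> \<bullet> X = 0}"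
      unfolding st[symmetric] by (simp add: linear_span_image[OF linear_act, symmetric] et)
    obtain e' where "e' ** e = mat 1" using \<Gamma>_inverse[OF eG] by blast
    then have einj: "inj (act e)" by (rule inj_act)
    have B1b: "B1 \<in> ordered_bases {X \<in> herm F. \<psi> \<bullet> X = 0}" by (rule orientation_mem(1)[OF ot 1(3)])
    have eB1: "map (act e) B1 \<in> ordered_bases {X \<in> herm F. \<psi> \<bullet> X = 0}"
      using map_ordered_bases[OF linear_act einj B1b] eH by simp
    have "\<not> basis_change_det B1 (map (act e) B1) < 0"
    proof -
      have "e \<in> stabilizer \<Gamma> \<tau>" using eG et by (simp add: stabilizer_def)
      then have "\<not> reverses_orientation e (span \<tau>)" using to by (auto simp: Sigma_orientable_def)
      then show ?thesis unfolding reverses_orientation_def st using B1b by blast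
    qed
    then have pos: "0 < basis_change_det B1 (map (act e) B1)"
      using basis_change_det_nonzero[OF B1b eB1] by linarith
    have "map (act e) B1 \<in> ori \<tau>" using orientation_iff[OF ot B1b eB1] 1(3) pos by simp
    then have pB: "0 < basis_change_det B (map (act e) B1)" using orientation_mem(2)[OF ot B] by blast
    have mm: "map (act \<gamma>) (map (act e) B1) = map (act \<gamma>1) B1"
      unfolding map_map comp_def e_def act_mult act_inverse(1)[OF d(2)] ..
    have "basis_change_det (map (act \<gamma>) B) (map (act \<gamma>) (map (act e) B1)) = basis_change_det B (map (act e) B1)"
      by (rule basis_change_det_map[OF linear_act inj Bb])
        (use ordered_basesD[OF eB1] ordered_basesD(4)[OF Bb] in auto)
    then have pM: "0 < basis_change_det M (map (act \<gamma>1) B1)" using pB unfolding M_def mm by (simp only:)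
    have "map (act \<gamma>1) B1 \<in> ordered_bases {X \<in> herm F. \<phi>' \<bullet> X = 0}" by (rule orientation_mem(1)[OF ot' 1(4)])
    then show "M \<in> o'" using orientation_iff[OF ot' Mb] pM 1(4) by blast
  qed
  then have "sign_eta \<Gamma> ori \<tau> \<tau>' = (if M \<in> o' then 1 else -1)" unfolding sign_eta_def by simp
  then show ?thesis unfolding \<tau>'_def[symmetric] E q_def[symmetric] by auto
qed

text \<open>
  A domain at the wall other than that of \<open>h\<close> belongs to the one perfect form found in the
  direction \<open>\<psi>\<close>.
\<close>

lemma facet_two_cones:
  assumes h: "unit_perfect h" "facet_normal h \<psi>" "\<not> psd \<psi>"
    and h': "unit_perfect h'" "facet_normal h' (- \<psi>)" "facet h' (- \<psi>) = facet h \<psi>" "h' \<noteq> h"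
    and g: "unit_perfect g" "facet h \<psi> \<in> faces_codim 1 (vdom g)"
  shows "g = h \<or> g = h'"
proof (cases "g = h")
  case False
  have sub: "facet h \<psi> \<subseteq> vdom f" if "facet h \<psi> \<in> faces_codim 1 (vdom f)" for f
    using that unfolding faces_codim_def by (auto dest: face_of_imp_subset)
  have "facet h' (- \<psi>) \<noteq> {0}" unfolding h'(3) by (rule facet_nonzero[OF h])
  then have "facet h \<psi> \<in> faces_codim 1 (vdom h')" using facet_faces_codim[OF h'(1,2)] unfolding h'(3) by blast
  then show ?thesis using facet_shared_unique[OF h(1,2) g(1) False sub[OF g(2)] h'(1,4)] sub by blast
qed simp

text \<open>
  Double counting of the \<open>\<gamma> \<in> \<Gamma>\<close> for which \<open>\<gamma> \<tau>\<close> is a facet of \<open>\<sigma>\<close>, each with the product of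
  its signs. Grouped by the facet \<open>\<gamma> \<tau>\<close>, they give the left-hand side. On the other hand \<open>\<gamma>\<close>
  carries precisely one of the two domains at \<open>\<tau>\<close> to \<open>\<sigma>\<close>, and the product of the signs is \<open>s\<close>
  or \<open>- s\<close> accordingly.
\<close>

lemma incidence_formula:
  assumes h: "unit_perfect h" "facet_normal h \<psi>" "\<not> psd \<psi>" and \<tau>: "\<tau> = facet h \<psi>"
    and to: "\<tau> \<in> Sigma_orientable F \<Gamma> R (D - 1)"
    and h': "unit_perfect h'" "facet_normal h' (- \<psi>)" "facet h' (- \<psi>) = facet h \<psi>" "h' \<noteq> h"
  shows "\<exists>s\<in>{1, -1}. \<forall>\<sigma>\<in>Sigma_top. incidence F \<Gamma> ori \<sigma> \<tau> * int (card (stabilizer \<Gamma> \<tau>)) =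
     s * ((if rep (vdom h) = \<sigma> then int (card (stabilizer \<Gamma> \<sigma>)) else 0)
        - (if rep (vdom h') = \<sigma> then int (card (stabilizer \<Gamma> \<sigma>)) else 0))"
    and "0 < card (stabilizer \<Gamma> \<tau>)"
proof -
  have "\<psi> \<noteq> 0" using facet_normalD[OF h(2)] by blast
  then have minus: "- \<psi> \<noteq> \<psi>" using neq_minus by metis
  have th: "\<tau> \<in> faces_codim 1 (vdom h)" unfolding \<tau> by (rule facet_faces[OF h])
  have ne: "facet h' (- \<psi>) \<noteq> {0}" unfolding h'(3) by (rule facet_nonzero[OF h])
  have th': "\<tau> \<in> faces_codim 1 (vdom h')" unfolding \<tau> h'(3)[symmetric] by (rule facet_faces_codim[OF h'(1,2) ne])
  have two: "g = h \<or> g = h'" if "unit_perfect g" "\<tau> \<in> faces_codim 1 (vdom g)" for g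
    using facet_two_cones[OF h h' that(1)] that(2) unfolding \<tau> by blast
  obtain B where B: "B \<in> ori \<tau>"
    using orientation_nonempty ori facet_cone(2)[OF h] unfolding \<tau> by blast
  define s :: int where "s = (if B @ [\<psi>] \<in> \<omega> then 1 else -1)"
  define f where "f \<sigma> \<tau>' = sign_eta \<Gamma> ori \<tau> \<tau>' * sign_eps F ori \<sigma> \<tau>'" for \<sigma> \<tau>'
  have f1: "f \<sigma> (act \<gamma> ` \<tau>) = s" if "\<sigma> \<in> Sigma_top" "\<gamma> \<in> \<Gamma>" "act \<gamma> ` vdom h = \<sigma>" for \<sigma> \<gamma>
    unfolding f_def s_def using sign_product[OF h \<tau> to B that h(1,2) \<tau>] by simp
  have f2: "f \<sigma> (act \<gamma> ` \<tau>) = - s" if "\<sigma> \<in> Sigma_top" "\<gamma> \<in> \<Gamma>" "act \<gamma> ` vdom h' = \<sigma>" for \<sigma> \<gamma>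
  proof -
    have "\<tau> = facet h' (- \<psi>)" using h'(3) \<tau> by simp
    then show ?thesis unfolding f_def s_def using sign_product[OF h \<tau> to B that h'(1,2)] minus by simp
  qed
  have "stabilizer \<Gamma> \<tau> \<subseteq> {\<gamma> \<in> \<Gamma>. act \<gamma> ` vdom h = vdom h} \<union> {\<gamma> \<in> \<Gamma>. act \<gamma> ` vdom h = vdom h'}"
  proof
    fix \<gamma> assume "\<gamma> \<in> stabilizer \<Gamma> \<tau>"
    then have g: "\<gamma> \<in> \<Gamma>" "act \<gamma> ` \<tau> = \<tau>" by (auto simp: stabilizer_def)
    obtain k where k: "unit_perfect k" "act \<gamma> ` vdom h = vdom k" using act_vdom_\<Gamma>[OF g(1) h(1)] by blast
    have "act \<gamma> ` \<tau> \<in> faces_codim 1 (act \<gamma> ` vdom h)" unfolding faces_codim_act[OF g(1)] using th by blast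
    then have "k = h \<or> k = h'" using two[OF k(1)] g(2) k(2) by simp
    then show "\<gamma> \<in> {\<gamma> \<in> \<Gamma>. act \<gamma> ` vdom h = vdom h} \<union> {\<gamma> \<in> \<Gamma>. act \<gamma> ` vdom h = vdom h'}" using g(1) k(2) by blast
  qed
  then have "finite (stabilizer \<Gamma> \<tau>)"
    by (rule finite_subset) (intro finite_UnI finite_\<Gamma>_transporter h(1) h'(1))
  then show "0 < card (stabilizer \<Gamma> \<tau>)" using stabilizer_one[of \<tau>] by (auto simp: card_gt_0_iff)
  have "incidence F \<Gamma> ori \<sigma> \<tau> * int (card (stabilizer \<Gamma> \<tau>)) =
     s * ((if rep (vdom h) = \<sigma> then int (card (stabilizer \<Gamma> \<sigma>)) else 0)
        - (if rep (vdom h') = \<sigma> then int (card (stabilizer \<Gamma> \<sigma>)) else 0))" if \<sigma>: "\<sigma> \<in> Sigma_top" for \<sigma>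
  proof -
    define A1 A2 where "A1 = {\<gamma> \<in> \<Gamma>. act \<gamma> ` vdom h = \<sigma>}" and "A2 = {\<gamma> \<in> \<Gamma>. act \<gamma> ` vdom h' = \<sigma>}"
    define A where "A = {\<gamma> \<in> \<Gamma>. act \<gamma> ` \<tau> \<in> faces_codim 1 \<sigma>}"
    obtain k where k: "unit_perfect k" "\<sigma> = vdom k" using \<sigma> unfolding top_iff by blast
    have fin: "finite A1" "finite A2" unfolding A1_def A2_def k(2) using finite_\<Gamma>_transporter h(1) h'(1) k(1) by blast+
    have disj: "A1 \<inter> A2 = {}"
    proof (rule ccontr)
      assume "A1 \<inter> A2 \<noteq> {}"
      then obtain \<gamma> where g: "\<gamma> \<in> \<Gamma>" "act \<gamma> ` vdom h = act \<gamma> ` vdom h'" unfolding A1_def A2_def by blast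
      obtain \<delta> where "\<delta> ** \<gamma> = mat 1" using \<Gamma>_inverse[OF g(1)] by blast
      then have "vdom h = vdom h'" using g(2) by (simp add: inj_image_eq_iff[OF inj_act])
      then show False using vdom_inj[OF h(1) h'(1)] h'(4) by blast
    qed
    have A: "A = A1 \<union> A2"
    proof (intro equalityI subsetI)
      fix \<gamma> assume "\<gamma> \<in> A"
      then have g: "\<gamma> \<in> \<Gamma>" "act \<gamma> ` \<tau> \<in> faces_codim 1 \<sigma>" by (auto simp: A_def)
      obtain \<delta> where d: "\<delta> \<in> \<Gamma>" "\<gamma> ** \<delta> = mat 1" "\<delta> ** \<gamma> = mat 1" using \<Gamma>_inverse[OF g(1)] by blast
      obtain l where l: "unit_perfect l" "act \<delta> ` vdom k = vdom l" using act_vdom_\<Gamma>[OF d(1) k(1)] by blast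
      have "act \<delta> ` act \<gamma> ` \<tau> \<in> faces_codim 1 (act \<delta> ` \<sigma>)" unfolding faces_codim_act[OF d(1)] using g(2) by blast
      then have "\<tau> \<in> faces_codim 1 (vdom l)" unfolding act_inverse(2)[OF d(3)] k(2) l(2) .
      then have "l = h \<or> l = h'" by (rule two[OF l(1)])
      moreover have "act \<gamma> ` vdom l = \<sigma>" unfolding l(2)[symmetric] k(2) by (rule act_inverse(2)[OF d(2)])
      ultimately show "\<gamma> \<in> A1 \<union> A2" using g(1) unfolding A1_def A2_def by blast
    next
      fix \<gamma> assume "\<gamma> \<in> A1 \<union> A2"
      then show "\<gamma> \<in> A" using th th' faces_codim_act[of \<gamma> 1] unfolding A1_def A2_def A_def by blast
    qed
    have sub: "facet_orbit \<Gamma> \<sigma> \<tau> \<subseteq> faces_codim 1 \<sigma>" by (auto simp: facet_orbit_def)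
    have finO: "finite (facet_orbit \<Gamma> \<sigma> \<tau>)" using finite_subset[OF sub] finite_faces[OF k(1)] k(2) by blast
    have card: "card {\<gamma> \<in> A. act \<gamma> ` \<tau> = \<tau>'} = card (stabilizer \<Gamma> \<tau>)" if t': "\<tau>' \<in> facet_orbit \<Gamma> \<sigma> \<tau>" for \<tau>'
    proof -
      obtain \<gamma>0 where g0: "\<gamma>0 \<in> \<Gamma>" "\<tau>' = act \<gamma>0 ` \<tau>" "\<tau>' \<in> faces_codim 1 \<sigma>"
        using t' unfolding facet_orbit_def by blast
      have "{\<gamma> \<in> A. act \<gamma> ` \<tau> = \<tau>'} = {\<gamma> \<in> \<Gamma>. act \<gamma> ` \<tau> = act \<gamma>0 ` \<tau>}"
        using g0(2,3) unfolding A_def by auto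
      then show ?thesis using card_transporter[OF g0(1)] by simp
    qed
    have "(\<Sum>\<gamma>\<in>A. f \<sigma> (act \<gamma> ` \<tau>)) = (\<Sum>\<tau>'\<in>facet_orbit \<Gamma> \<sigma> \<tau>. of_nat (card {\<gamma> \<in> A. act \<gamma> ` \<tau> = \<tau>'}) * f \<sigma> \<tau>')"
      by (rule sum_fun_comp[where f = "f \<sigma>" and g = "\<lambda>\<gamma>. act \<gamma> ` \<tau>"])
        (use fin A finO in \<open>auto simp: A_def facet_orbit_def\<close>)
    also have "\<dots> = (\<Sum>\<tau>'\<in>facet_orbit \<Gamma> \<sigma> \<tau>. int (card (stabilizer \<Gamma> \<tau>)) * f \<sigma> \<tau>')"
      using card by (intro sum.cong) auto
    also have "\<dots> = incidence F \<Gamma> ori \<sigma> \<tau> * int (card (stabilizer \<Gamma> \<tau>))"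
      by (simp add: incidence_def f_def sum_distrib_left sum_distrib_right mult.commute)
    finally have "incidence F \<Gamma> ori \<sigma> \<tau> * int (card (stabilizer \<Gamma> \<tau>)) = (\<Sum>\<gamma>\<in>A. f \<sigma> (act \<gamma> ` \<tau>))" ..
    also have "\<dots> = (\<Sum>\<gamma>\<in>A1. f \<sigma> (act \<gamma> ` \<tau>)) + (\<Sum>\<gamma>\<in>A2. f \<sigma> (act \<gamma> ` \<tau>))"
      unfolding A by (rule sum.union_disjoint[OF fin disj])
    also have "(\<Sum>\<gamma>\<in>A1. f \<sigma> (act \<gamma> ` \<tau>)) = (\<Sum>\<gamma>\<in>A1. s)" using f1[OF \<sigma>] by (intro sum.cong) (auto simp: A1_def)
    also have "(\<Sum>\<gamma>\<in>A2. f \<sigma> (act \<gamma> ` \<tau>)) = (\<Sum>\<gamma>\<in>A2. - s)" using f2[OF \<sigma>] by (intro sum.cong) (auto simp: A2_def)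
    also have "(\<Sum>\<gamma>\<in>A1. s) + (\<Sum>\<gamma>\<in>A2. - s) = s * (int (card A1) - int (card A2))" by (simp add: algebra_simps)
    finally show ?thesis
      using card_transporter_top[OF h(1) \<sigma>] card_transporter_top[OF h'(1) \<sigma>] unfolding A1_def A2_def by simp
  qed
  moreover have "s \<in> {1, -1}" by (simp add: s_def)
  ultimately show "\<exists>s\<in>{1, -1}. \<forall>\<sigma>\<in>Sigma_top. incidence F \<Gamma> ori \<sigma> \<tau> * int (card (stabilizer \<Gamma> \<tau>)) =
     s * ((if rep (vdom h) = \<sigma> then int (card (stabilizer \<Gamma> \<sigma>)) else 0)
        - (if rep (vdom h') = \<sigma> then int (card (stabilizer \<Gamma> \<sigma>)) else 0))" by blast
qed

end

section \<open>Cycles of Sigma_top degree\<close>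

context voronoi_complex
begin

text \<open>
  The domain is mapped to one of the two domains at the wall. If it were mapped to itself,
  then a basis of the wall followed by a vector on the positive side would be mapped to a
  basis of the opposite orientation, contrary to the choice of \<open>\<Gamma>\<close>.
\<close>

lemma reversing_swaps:
  assumes h: "unit_perfect h" "facet_normal h \<psi>" "\<not> psd \<psi>"
    and h': "unit_perfect h'" "facet_normal h' (- \<psi>)" "facet h' (- \<psi>) = facet h \<psi>" "h' \<noteq> h"
    and e: "e \<in> stabilizer \<Gamma> (facet h \<psi>)" "reverses_orientation e (span (facet h \<psi>))"
  shows "act e ` vdom h = vdom h'"
proof -
  have eG: "e \<in> \<Gamma>" and et: "act e ` facet h \<psi> = facet h \<psi>" using e(1) by (auto simp: stabilizer_def)
  obtain l where l: "unit_perfect l" "act e ` vdom h = vdom l" using act_vdom_\<Gamma>[OF eG h(1)] by blast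
  have "act e ` facet h \<psi> \<in> faces_codim 1 (act e ` vdom h)"
    unfolding faces_codim_act[OF eG] using facet_faces[OF h] by blast
  then have f: "facet h \<psi> \<in> faces_codim 1 (vdom l)" unfolding et l(2) .
  have "l \<noteq> h"
  proof
    assume lh: "l = h"
    have st: "span (facet h \<psi>) = {X \<in> herm F. \<psi> \<bullet> X = 0}" by (rule span_facet[OF h(1,2)])
    obtain B where B: "B \<in> ordered_bases {X \<in> herm F. \<psi> \<bullet> X = 0}" "basis_change_det B (map (act e) B) < 0"
      using e(2) unfolding reverses_orientation_def st by blast
    obtain x where x: "x \<in> cone_vecs F (vdom h) - cone_vecs F (facet h \<psi>)"
      using cone_vecs_off_facet(1)[OF h(1,2)] by blast
    have X: "rank_one x \<in> herm F" "0 < \<psi> \<bullet> rank_one x"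
      using cone_vecs_off_facet(2)[OF h(1,2)] x by blast+
    have "rank_one x \<in> vdom h" using x cone_vecs_mem by blast
    then have "act e (rank_one x) \<in> vdom h" using l(2) lh by blast
    then have nn: "0 \<le> \<psi> \<bullet> act e (rank_one x)" and eH: "act e (rank_one x) \<in> herm F"
      using inner_vcone_nonneg[of "min1 h" \<psi>] facet_normalD(3)[OF h(2)] vdom_herm[OF h(1)] unfolding vdom_def by blast+
    have "act e ` {X \<in> herm F. \<psi> \<bullet> X = 0} = {X \<in> herm F. \<psi> \<bullet> X = 0}"
      unfolding st[symmetric] by (simp add: linear_span_image[OF linear_act, symmetric] et)
    then have sub: "set (map (act e) B) \<subseteq> {X \<in> herm F. \<psi> \<bullet> X = 0}"
      using ordered_basesD(5)[OF B(1)] by auto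
    have Xn: "\<psi> \<bullet> rank_one x \<noteq> 0" using X(2) by simp
    have BX: "B @ [rank_one x] \<in> ordered_bases (herm F)"
      by (rule append_ordered_bases[OF subspace_herm B(1) X(1) Xn])
    have "basis_change_det (B @ [rank_one x]) (map (act e) B @ [act e (rank_one x)]) =
        basis_change_det B (map (act e) B) * ((\<psi> \<bullet> act e (rank_one x)) / (\<psi> \<bullet> rank_one x))"
      by (rule basis_change_det_append[OF subspace_herm B(1) X(1) Xn _ sub eH]) simp
    also have "\<dots> \<le> 0"
      using B(2) nn X(2) by (intro mult_nonpos_nonneg divide_nonneg_pos) auto
    finally show False using \<Gamma>_pos[OF eG BX] by simp
  qed
  then have "l = h'" using facet_two_cones[OF h h' l(1) f] by blast
  then show ?thesis using l(2) by simp
qed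

text \<open>
  In this normalisation the fundamental chain is the constant \<open>1\<close>.
\<close>

definition weight :: "('n cone \<Rightarrow>\<^sub>0 rat) \<Rightarrow> 'n cone \<Rightarrow> rat" where
  "weight z \<sigma> = Poly_Mapping.lookup z \<sigma> * of_nat (card (stabilizer \<Gamma> \<sigma>))"

text \<open>
  The coefficient of \<open>\<tau>\<close> in the boundary of \<open>z\<close> is, up to the factor \<open>\<plusminus> \<bar>\<Gamma>\<^sub>\<tau>\<bar>\<close>, the difference
  of the weights at the two sides of \<open>\<tau>\<close>.
\<close>

lemma boundary_weight:
  fixes z :: "'n cone \<Rightarrow>\<^sub>0 rat"
  assumes h: "unit_perfect h" "facet_normal h \<psi>" "\<not> psd \<psi>" and \<tau>: "\<tau> = facet h \<psi>"
    and to: "\<tau> \<in> Sigma_orientable F \<Gamma> R (D - 1)"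
    and h': "unit_perfect h'" "facet_normal h' (- \<psi>)" "facet h' (- \<psi>) = facet h \<psi>" "h' \<noteq> h"
  shows "(\<Sum>\<sigma>\<in>Sigma_top. Poly_Mapping.lookup z \<sigma> * of_int (incidence F \<Gamma> ori \<sigma> \<tau>)) = 0 \<longleftrightarrow>
    weight z (rep (vdom h)) = weight z (rep (vdom h'))"
proof -
  obtain s :: int where s: "s \<in> {1, -1}" "\<forall>\<sigma>\<in>Sigma_top. incidence F \<Gamma> ori \<sigma> \<tau> * int (card (stabilizer \<Gamma> \<tau>)) =
     s * ((if rep (vdom h) = \<sigma> then int (card (stabilizer \<Gamma> \<sigma>)) else 0)
        - (if rep (vdom h') = \<sigma> then int (card (stabilizer \<Gamma> \<sigma>)) else 0))"
    using incidence_formula(1)[OF h \<tau> to h'] by blast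
  define c :: rat where "c = of_nat (card (stabilizer \<Gamma> \<tau>))"
  have c: "c \<noteq> 0" using incidence_formula(2)[OF h \<tau> to h'] by (simp add: c_def)
  have inc: "of_int (incidence F \<Gamma> ori \<sigma> \<tau>) * c =
     (of_int s :: rat) * ((if rep (vdom h) = \<sigma> then of_nat (card (stabilizer \<Gamma> \<sigma>)) else 0)
        - (if rep (vdom h') = \<sigma> then of_nat (card (stabilizer \<Gamma> \<sigma>)) else 0))" if "\<sigma> \<in> Sigma_top" for \<sigma>
    using arg_cong[OF bspec[OF s(2) that], of "of_int :: int \<Rightarrow> rat"] by (simp add: c_def split: if_splits)
  have "(\<Sum>\<sigma>\<in>Sigma_top. Poly_Mapping.lookup z \<sigma> * of_int (incidence F \<Gamma> ori \<sigma> \<tau>)) * c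
      = (\<Sum>\<sigma>\<in>Sigma_top. Poly_Mapping.lookup z \<sigma> * (of_int (incidence F \<Gamma> ori \<sigma> \<tau>) * c))"
    by (simp add: sum_distrib_right mult.assoc)
  also have "\<dots> = (\<Sum>\<sigma>\<in>Sigma_top. of_int s * ((if \<sigma> = rep (vdom h) then weight z \<sigma> else 0)
        - (if \<sigma> = rep (vdom h') then weight z \<sigma> else 0)))"
  proof (intro sum.cong refl)
    fix \<sigma> assume "\<sigma> \<in> Sigma_top"
    then show "Poly_Mapping.lookup z \<sigma> * (of_int (incidence F \<Gamma> ori \<sigma> \<tau>) * c) =
      of_int s * ((if \<sigma> = rep (vdom h) then weight z \<sigma> else 0) - (if \<sigma> = rep (vdom h') then weight z \<sigma> else 0))"
      unfolding inc[OF \<open>\<sigma> \<in> Sigma_top\<close>] weight_def eq_commute[of \<sigma>]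
      by (simp add: right_diff_distrib mult.left_commute)
  qed
  also have "\<dots> = of_int s * (weight z (rep (vdom h)) - weight z (rep (vdom h')))"
    using rep_top[OF h(1)] rep_top[OF h'(1)] finite_top
    by (simp add: sum_distrib_left[symmetric] sum_subtractf sum.delta)
  finally have eq: "(\<Sum>\<sigma>\<in>Sigma_top. Poly_Mapping.lookup z \<sigma> * of_int (incidence F \<Gamma> ori \<sigma> \<tau>)) * c =
    of_int s * (weight z (rep (vdom h)) - weight z (rep (vdom h')))" .
  have s0: "of_int s \<noteq> (0::rat)" using s(1) by auto
  have "x = 0 \<longleftrightarrow> y = y'" if "x * c = of_int s * (y - y')" for x y y' :: rat
  proof -
    have "x = 0 \<longleftrightarrow> x * c = 0" using c by simp
    also have "\<dots> \<longleftrightarrow> y = y'" unfolding that using s0 by simp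
    finally show ?thesis .
  qed
  then show ?thesis using eq .
qed

lemma lookup_boundary:
  fixes z :: "'n cone \<Rightarrow>\<^sub>0 rat"
  assumes z: "Poly_Mapping.keys z \<subseteq> Sigma_top"
  shows "Poly_Mapping.lookup (vor_boundary F \<Gamma> R ori D z) \<tau> = (if \<tau> \<in> Sigma_orientable F \<Gamma> R (D - 1)
    then \<Sum>\<sigma>\<in>Sigma_top. Poly_Mapping.lookup z \<sigma> * of_int (incidence F \<Gamma> ori \<sigma> \<tau>) else 0)"
proof -
  have fin: "finite (Sigma_orientable F \<Gamma> R (D - 1))"
    by (rule finite_subset[OF _ finite_Sigma_star]) (auto simp: Sigma_orientable_def)
  have "Poly_Mapping.lookup (vor_boundary F \<Gamma> R ori D z) \<tau> =
    (\<Sum>\<sigma>\<in>Poly_Mapping.keys z. if \<tau> \<in> Sigma_orientable F \<Gamma> R (D - 1)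
      then Poly_Mapping.lookup z \<sigma> * of_int (incidence F \<Gamma> ori \<sigma> \<tau>) else 0)"
    unfolding vor_boundary_def lookup_sum lookup_single when_def using fin by (simp add: sum.delta)
  also have "\<dots> = (\<Sum>\<sigma>\<in>Sigma_top. if \<tau> \<in> Sigma_orientable F \<Gamma> R (D - 1)
      then Poly_Mapping.lookup z \<sigma> * of_int (incidence F \<Gamma> ori \<sigma> \<tau>) else 0)"
    by (rule sum.mono_neutral_left[OF finite_top z]) (simp add: in_keys_iff)
  finally show ?thesis by simp
qed

lemma cycle_boundary_iff:
  fixes z :: "'n cone \<Rightarrow>\<^sub>0 rat"
  shows "z \<in> vor_cycles F \<Gamma> R ori D \<longleftrightarrow> Poly_Mapping.keys z \<subseteq> Sigma_top \<and>
    (\<forall>\<tau>\<in>Sigma_orientable F \<Gamma> R (D - 1).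
      (\<Sum>\<sigma>\<in>Sigma_top. Poly_Mapping.lookup z \<sigma> * of_int (incidence F \<Gamma> ori \<sigma> \<tau>)) = 0)"
proof (cases "Poly_Mapping.keys z \<subseteq> Sigma_top")
  case True
  have "vor_boundary F \<Gamma> R ori D z = 0 \<longleftrightarrow> (\<forall>\<tau>. Poly_Mapping.lookup (vor_boundary F \<Gamma> R ori D z) \<tau> = 0)"
    by (auto intro: poly_mapping_eqI)
  then show ?thesis
    using True unfolding vor_cycles_def kernel_def lookup_boundary[OF True] by (auto simp: vor_chains_def)
qed (simp add: vor_cycles_def kernel_def vor_chains_def)

lemma rep_self: "\<sigma> \<in> Sigma_top \<Longrightarrow> rep \<sigma> = \<sigma>"
  using rep_eq[OF _ _ \<Gamma>_one] R_cones unfolding top_iff act_image_one by blast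

text \<open>
  Move the wall to the representative of its orbit. If it is orientable, the boundary
  condition at it equates the weights. Otherwise an element of \<open>\<Gamma>\<close> exchanges the two domains,
  and they have the same representative.
\<close>

lemma cycle_adjacent:
  assumes z: "z \<in> vor_cycles F \<Gamma> R ori D" and ad: "adjacent h g"
  shows "weight z (rep (vdom h)) = weight z (rep (vdom g))"
proof -
  obtain \<psi> where h: "unit_perfect h" "unit_perfect g" "g \<noteq> h" "facet_normal h \<psi>" "\<not> psd \<psi>"
    "facet_normal g (- \<psi>)" "facet g (- \<psi>) = facet h \<psi>"
    using ad unfolding adjacent_def by blast
  have fc: "facet h \<psi> \<in> voronoi_cones F" by (rule facet_cone(2)[OF h(1,4,5)])
  obtain \<gamma> where \<gamma>: "\<gamma> \<in> \<Gamma>" "facet h \<psi> = act \<gamma> ` rep (facet h \<psi>)" using rep(2)[OF fc] by blast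
  obtain \<delta> where \<delta>: "\<delta> \<in> \<Gamma>" "\<gamma> ** \<delta> = mat 1" "\<delta> ** \<gamma> = mat 1" using \<Gamma>_inverse[OF \<gamma>(1)] by blast
  have GL: "\<gamma> \<in> GLO" "\<delta> \<in> GLO" using \<gamma>(1) \<delta>(1) \<Gamma>_GLO by blast+
  have \<tau>: "act \<delta> ` facet h \<psi> = rep (facet h \<psi>)" by (subst \<gamma>(2)) (rule act_inverse(2)[OF \<delta>(3)])
  obtain k where k: "unit_perfect k" "act \<delta> ` vdom h = vdom k" "min1 k = (*v) \<delta> ` min1 h"
    using act_vdom_\<Gamma>[OF \<delta>(1) h(1)] by blast
  obtain k' where k': "unit_perfect k'" "act \<delta> ` vdom g = vdom k'" "min1 k' = (*v) \<delta> ` min1 g"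
    using act_vdom_\<Gamma>[OF \<delta>(1) h(2)] by blast
  define \<psi>' where "\<psi>' = act (conj_transpose \<gamma>) \<psi>"
  note a = facet_normal_act[OF GL(2) \<delta>(3,2) GL(1) h(4) k(3), folded \<psi>'_def]
  have m: "act (conj_transpose \<gamma>) (- \<psi>) = - \<psi>'" unfolding \<psi>'_def by (rule linear_neg[OF linear_act])
  note b = facet_normal_act[OF GL(2) \<delta>(3,2) GL(1) h(6) k'(3), unfolded m]
  have np: "\<not> psd \<psi>'" using a(4) h(5) by blast
  have fk: "facet k \<psi>' = rep (facet h \<psi>)" using a(2) \<tau> by simp
  have fk': "facet k' (- \<psi>') = facet k \<psi>'" using b(2) a(2) h(7) by simp
  have ne: "k' \<noteq> k"
  proof
    assume "k' = k"
    then have "act \<gamma> ` act \<delta> ` vdom g = act \<gamma> ` act \<delta> ` vdom h" using k(2) k'(2) by simp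
    then have "vdom g = vdom h" unfolding act_inverse(2)[OF \<delta>(2)] .
    then show False using vdom_inj[OF h(2,1)] h(3) by blast
  qed
  have rk: "rep (vdom k) = rep (vdom h)" "rep (vdom k') = rep (vdom g)"
    unfolding k(2)[symmetric] k'(2)[symmetric]
    by (rule rep_invariant[OF _ _ \<delta>(1)]; simp add: k k' h vdom_cone)+
  have st: "facet k \<psi>' \<in> Sigma_star F R (D - 1)"
    by (rule facet_Sigma_star[OF k(1) a(1) np]) (simp add: fk rep(1)[OF fc])
  have "weight z (rep (vdom k)) = weight z (rep (vdom k'))"
  proof (cases "facet k \<psi>' \<in> Sigma_orientable F \<Gamma> R (D - 1)")
    case True
    then show ?thesis
      using boundary_weight[OF k(1) a(1) np refl True k'(1) b(1) fk' ne] z cycle_boundary_iff by blast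
  next
    case False
    then obtain e where e: "e \<in> stabilizer \<Gamma> (facet k \<psi>')" "reverses_orientation e (span (facet k \<psi>'))"
      using st unfolding Sigma_orientable_def by blast
    have "act e ` vdom k = vdom k'" by (rule reversing_swaps[OF k(1) a(1) np k'(1) b(1) fk' ne e])
    moreover have "e \<in> \<Gamma>" using e(1) by (simp add: stabilizer_def)
    ultimately have "rep (vdom k') = rep (vdom k)"
      using rep_invariant[of "vdom k" e] vdom_cone[OF k(1)] vdom_cone[OF k'(1)] by simp
    then show ?thesis by simp
  qed
  then show ?thesis unfolding rk .
qed

lemma cycle_constant:
  assumes z: "z \<in> vor_cycles F \<Gamma> R ori D" and s: "\<sigma> \<in> Sigma_top" "\<sigma>' \<in> Sigma_top"
  shows "weight z \<sigma> = weight z \<sigma>'"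
proof -
  obtain h g where h: "unit_perfect h" "\<sigma> = vdom h" "unit_perfect g" "\<sigma>' = vdom g" using s unfolding top_iff by blast
  have "adjacent\<^sup>*\<^sup>* h g" by (rule adjacent_chain[OF h(1,3)])
  then have "weight z (rep (vdom h)) = weight z (rep (vdom g))"
    by (induction rule: rtranclp_induct) (auto dest: cycle_adjacent[OF z])
  then show ?thesis using rep_self[OF s(1)] rep_self[OF s(2)] h by simp
qed

lemma constant_cycle:
  assumes z: "Poly_Mapping.keys z \<subseteq> Sigma_top" and c: "\<And>\<sigma>. \<sigma> \<in> Sigma_top \<Longrightarrow> weight z \<sigma> = c"
  shows "z \<in> vor_cycles F \<Gamma> R ori D"
  unfolding cycle_boundary_iff
proof (intro conjI z ballI)
  fix \<tau> assume t: "\<tau> \<in> Sigma_orientable F \<Gamma> R (D - 1)"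
  then have "\<tau> \<in> Sigma_star F R (D - 1)" by (simp add: Sigma_orientable_def)
  then obtain h \<psi> where h: "unit_perfect h" "facet_normal h \<psi>" "\<not> psd \<psi>" "\<tau> = facet h \<psi>"
    using Sigma_star_facet by blast
  obtain t where t0: "t > 0" "unit_perfect (h + t *\<^sub>R \<psi>)" "facet_normal (h + t *\<^sub>R \<psi>) (- \<psi>)"
    "facet (h + t *\<^sub>R \<psi>) (- \<psi>) = facet h \<psi>"
    using facet_neighbour[OF h(1,2,3)] by blast
  have "h + t *\<^sub>R \<psi> \<noteq> h" using t0(1) facet_normalD(2)[OF h(2)] by simp
  then show "(\<Sum>\<sigma>\<in>Sigma_top. Poly_Mapping.lookup z \<sigma> * of_int (incidence F \<Gamma> ori \<sigma> \<tau>)) = 0"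
    using boundary_weight[OF h t t0(2,3,4)] c rep_top[OF h(1)] rep_top[OF t0(2)] by simp
qed


section \<open>Top homology\<close>

text \<open>
  There are no cells of codimension \<open>-1\<close>.
\<close>

lemma vor_boundaries_top: "vor_boundaries F \<Gamma> R ori D = {0 :: 'n cone \<Rightarrow>\<^sub>0 rat}"
proof -
  have "Sigma_orientable F \<Gamma> R (D + 1) = {}"
    using D by (auto simp: Sigma_orientable_def Sigma_star_def)
  then have "carrier (vor_chains F \<Gamma> R (D + 1)) = {0 :: 'n cone \<Rightarrow>\<^sub>0 rat}"
    by (auto simp: vor_chains_def)
  then show ?thesis by (simp add: vor_boundaries_def vor_boundary_def)
qed

lemma homology_class_top: "homology_class F \<Gamma> R ori D (z :: 'n cone \<Rightarrow>\<^sub>0 rat) = {z}"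
  by (simp add: homology_class_def vor_boundaries_top r_coset_def vor_chains_def)

lemma vor_homology_top:
  fixes H :: "('n cone \<Rightarrow>\<^sub>0 rat) set monoid"
  defines "H \<equiv> vor_homology F \<Gamma> R ori D"
  shows "carrier H = (\<lambda>z. {z}) ` vor_cycles F \<Gamma> R ori D" "one H = {0}"
    "{x} \<otimes>\<^bsub>H\<^esub> {y} = {x + y}"
  unfolding H_def vor_homology_def vor_boundaries_top
  by (auto simp: FactGroup_def RCOSETS_def r_coset_def set_mult_def vor_chains_def)

definition scale :: "rat \<Rightarrow> ('n cone \<Rightarrow>\<^sub>0 rat) \<Rightarrow> ('n cone \<Rightarrow>\<^sub>0 rat)" where
  "scale q = Poly_Mapping.map ((*) q)"

lemma lookup_scale: "Poly_Mapping.lookup (scale q z) \<sigma> = q * Poly_Mapping.lookup z \<sigma>"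
  by (simp add: scale_def Poly_Mapping.map.rep_eq when_def)

lemma weight_scale: "weight (scale q z) \<sigma> = q * weight z \<sigma>"
  by (simp add: weight_def lookup_scale)

lemma lookup_fundamental_chain:
  "Poly_Mapping.lookup (fundamental_chain F \<Gamma> R) \<sigma> = (if \<sigma> \<in> Sigma_top then 1 / of_nat (card (stabilizer \<Gamma> \<sigma>)) else 0)"
  unfolding fundamental_chain_def D[symmetric] lookup_sum lookup_single when_def
  using finite_top by (simp add: sum.delta)

lemma weight_fundamental_chain: "\<sigma> \<in> Sigma_top \<Longrightarrow> weight (fundamental_chain F \<Gamma> R) \<sigma> = 1"
  using card_stabilizer_pos by (simp add: weight_def lookup_fundamental_chain)

lemma scale_fundamental_cycle: "scale q (fundamental_chain F \<Gamma> R) \<in> vor_cycles F \<Gamma> R ori D"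
proof (rule constant_cycle[where c = q])
  show "Poly_Mapping.keys (scale q (fundamental_chain F \<Gamma> R)) \<subseteq> Sigma_top"
    by (auto simp: in_keys_iff lookup_scale lookup_fundamental_chain split: if_splits)
qed (simp add: weight_scale weight_fundamental_chain)

lemma cycle_eqI:
  assumes z: "z \<in> vor_cycles F \<Gamma> R ori D" "z' \<in> vor_cycles F \<Gamma> R ori D"
    and s: "\<sigma> \<in> Sigma_top" "weight z \<sigma> = weight z' \<sigma>"
  shows "z = z'"
proof (rule poly_mapping_eqI)
  fix \<sigma>'
  have k: "Poly_Mapping.keys z \<subseteq> Sigma_top" "Poly_Mapping.keys z' \<subseteq> Sigma_top" using z cycle_boundary_iff by blast+
  show "Poly_Mapping.lookup z \<sigma>' = Poly_Mapping.lookup z' \<sigma>'"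
  proof (cases "\<sigma>' \<in> Sigma_top")
    case True
    have "weight z \<sigma>' = weight z' \<sigma>'"
      using cycle_constant[OF z(1) s(1) True] cycle_constant[OF z(2) s(1) True] s(2) by simp
    then show ?thesis using card_stabilizer_pos[OF True] by (simp add: weight_def)
  next
    case False
    then have "\<sigma>' \<notin> Poly_Mapping.keys z" "\<sigma>' \<notin> Poly_Mapping.keys z'" using k by blast+
    then show ?thesis by (simp add: in_keys_iff)
  qed
qed

text \<open>
  A homology class is a single cycle, and a cycle is determined by its weight at any chosen
  \<open>\<sigma>\<close>; the multiples of the fundamental chain attain all weights.
\<close>

theorem top_homology:
  shows "(\<exists>\<phi>. \<phi> \<in> iso (vor_homology F \<Gamma> R ori D :: ('n cone \<Rightarrow>\<^sub>0 rat) set monoid) rat_additive \<and>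
            (\<forall>q. \<forall>z \<in> vor_cycles F \<Gamma> R ori D.
               \<phi> (homology_class F \<Gamma> R ori D (Poly_Mapping.map ((*) q) z)) =
               q * \<phi> (homology_class F \<Gamma> R ori D z)))"
    and "fundamental_chain F \<Gamma> R \<in> vor_cycles F \<Gamma> R ori D"
    and "homology_class F \<Gamma> R ori D (fundamental_chain F \<Gamma> R) \<noteq> one (vor_homology F \<Gamma> R ori D)"
proof -
  obtain \<sigma>0 where s0: "\<sigma>0 \<in> Sigma_top" using top_nonempty by blast
  have one: "scale 1 z = z" for z :: "'n cone \<Rightarrow>\<^sub>0 rat"
    by (rule poly_mapping_eqI) (simp add: lookup_scale)
  show "fundamental_chain F \<Gamma> R \<in> vor_cycles F \<Gamma> R ori D"
    using scale_fundamental_cycle[of 1] unfolding one .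
  have "fundamental_chain F \<Gamma> R \<noteq> 0"
    using weight_fundamental_chain[OF s0] by (auto simp: weight_def)
  then show "homology_class F \<Gamma> R ori D (fundamental_chain F \<Gamma> R) \<noteq> one (vor_homology F \<Gamma> R ori D)"
    by (simp add: homology_class_top vor_homology_top)
  define \<phi> :: "('n cone \<Rightarrow>\<^sub>0 rat) set \<Rightarrow> rat" where "\<phi> C = weight (the_elem C) \<sigma>0" for C
  have "\<phi> \<in> iso (vor_homology F \<Gamma> R ori D :: ('n cone \<Rightarrow>\<^sub>0 rat) set monoid) rat_additive"
    unfolding iso_def hom_def vor_homology_top(1) rat_additive_def
  proof (clarsimp, intro conjI ballI)
    fix x y
    show "\<phi> ({x} \<otimes>\<^bsub>vor_homology F \<Gamma> R ori D\<^esub> {y}) = \<phi> {x} + \<phi> {y}"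
      by (simp add: vor_homology_top(3) \<phi>_def weight_def lookup_add distrib_right)
  next
    show "bij_betw \<phi> ((\<lambda>z. {z}) ` vor_cycles F \<Gamma> R ori D) UNIV"
      unfolding bij_betw_def
    proof
      show "inj_on \<phi> ((\<lambda>z. {z}) ` vor_cycles F \<Gamma> R ori D)"
        using cycle_eqI[OF _ _ s0] by (auto simp: inj_on_def \<phi>_def)
      have "q \<in> \<phi> ` (\<lambda>z. {z}) ` vor_cycles F \<Gamma> R ori D" for q
      proof -
        have "\<phi> {scale q (fundamental_chain F \<Gamma> R)} = q"
          by (simp add: \<phi>_def weight_scale weight_fundamental_chain[OF s0])
        then show ?thesis using scale_fundamental_cycle[of q] by force
      qed
      then show "\<phi> ` (\<lambda>z. {z}) ` vor_cycles F \<Gamma> R ori D = UNIV" by blast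
    qed
  qed
  moreover have "\<phi> (homology_class F \<Gamma> R ori D (Poly_Mapping.map ((*) q) z)) =
               q * \<phi> (homology_class F \<Gamma> R ori D z)" for q z
    unfolding homology_class_top scale_def[symmetric] by (simp add: \<phi>_def weight_scale)
  ultimately show "\<exists>\<phi>. \<phi> \<in> iso (vor_homology F \<Gamma> R ori D :: ('n cone \<Rightarrow>\<^sub>0 rat) set monoid) rat_additive \<and>
            (\<forall>q. \<forall>z \<in> vor_cycles F \<Gamma> R ori D.
               \<phi> (homology_class F \<Gamma> R ori D (Poly_Mapping.map ((*) q) z)) =
               q * \<phi> (homology_class F \<Gamma> R ori D z))" by blast
qed

end

section \<open>The fundamental class\<close>

theorem theorem0p1:
  fixes F :: "complex set"
    and \<Gamma> :: "(complex ^ 'n::finite ^ 'n) set"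
    and R :: "'n cone set"
    and ori :: "'n cone \<Rightarrow> 'n orientation"
    and \<omega> :: "'n orientation"
    and d :: int
  assumes \<Gamma>: "(F = \<rat> \<and> even CARD('n) \<and> finite_index_subgroup \<Gamma> (SL (ring_of_ints F))) \<or>
              (F = \<rat> \<and> odd CARD('n) \<and> finite_index_subgroup \<Gamma> (GL (ring_of_ints F))) \<or>
              (imaginary_quadratic F \<and> finite_index_subgroup \<Gamma> (GL (ring_of_ints F)))"
    and d: "d = top_degree F CARD('n)"
    and R: "orbit_representatives F \<Gamma> R"
    and ori: "\<forall>\<sigma> \<in> voronoi_cones F. ori \<sigma> \<in> orientations (span \<sigma>)"
    and \<omega>: "\<omega> \<in> orientations (herm F)"
    and ori_top: "\<forall>\<sigma> \<in> Sigma_orientable F \<Gamma> R d. ori \<sigma> = \<omega>"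
  shows "(\<exists>\<phi>. \<phi> \<in> iso (vor_homology F \<Gamma> R ori d :: ('n cone \<Rightarrow>\<^sub>0 rat) set monoid) rat_additive \<and>
            (\<forall>q. \<forall>z \<in> vor_cycles F \<Gamma> R ori d.
               \<phi> (homology_class F \<Gamma> R ori d (Poly_Mapping.map ((*) q) z)) =
               q * \<phi> (homology_class F \<Gamma> R ori d z))) \<and>
         fundamental_chain F \<Gamma> R \<in> vor_cycles F \<Gamma> R ori d \<and>
         homology_class F \<Gamma> R ori d (fundamental_chain F \<Gamma> R) \<noteq>
           one (vor_homology F \<Gamma> R ori d)"
proof -
  have "F = \<rat> \<or> imaginary_quadratic F" using \<Gamma> by blast
  then obtain d0 where "ground F d0" using ground_cases by blast
  then interpret ground F d0 .
  define G :: "(complex ^ 'n ^ 'n) monoid"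
    where "G = (if F = \<rat> \<and> even CARD('n) then SL (ring_of_ints F) else GL (ring_of_ints F))"
  have iq: "F \<noteq> \<rat>" if "imaginary_quadratic F" using that by (rule imaginary_quadratic_not_Rats)
  have G: "finite_index_subgroup \<Gamma> G" "G = GL (ring_of_ints F) \<or> G = SL (ring_of_ints F)"
    using \<Gamma> iq by (auto simp: G_def)
  have sub: "subgroup \<Gamma> G" using G(1) by (simp add: finite_index_subgroup_def)
  have ops: "x \<otimes>\<^bsub>G\<^esub> y = x ** y" "\<one>\<^bsub>G\<^esub> = mat 1" for x y using G(2) by (auto simp: GL_def SL_def)
  have GLO: "\<Gamma> \<subseteq> carrier (GL (ring_of_ints F))"
    using subgroup.subset[OF sub] G(2) SL_subset by auto
  interpret voronoi_complex F d0 \<Gamma> R ori \<omega> d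
  proof
    show "\<Gamma> \<subseteq> carrier (GL (ring_of_ints F))" by (rule GLO)
    show "mat 1 \<in> \<Gamma>" using subgroup.one_closed[OF sub] by (simp add: ops)
    show "\<gamma> ** \<gamma>' \<in> \<Gamma>" if "\<gamma> \<in> \<Gamma>" "\<gamma>' \<in> \<Gamma>" for \<gamma> \<gamma>'
      using subgroup.m_closed[OF sub that] by (simp add: ops)
    show "\<exists>\<delta>\<in>\<Gamma>. \<gamma> ** \<delta> = mat 1 \<and> \<delta> ** \<gamma> = mat 1" if "\<gamma> \<in> \<Gamma>" for \<gamma>
      by (rule subgroup_inverse[OF sub G(2) that])
    show "\<exists>T. finite T \<and> T \<subseteq> carrier (GL (ring_of_ints F)) \<and>
       (\<forall>\<gamma>\<in>carrier (GL (ring_of_ints F)). \<exists>t\<in>T. \<exists>h\<in>\<Gamma>. \<gamma> = h ** t)"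
      by (rule finite_index_GLO[OF G])
    show "0 < basis_change_det B (map (act \<gamma>) B)" if "\<gamma> \<in> \<Gamma>" "B \<in> ordered_bases (herm F)" for \<gamma> B
    proof -
      have "\<gamma> \<in> carrier (GL (ring_of_ints F))" using that(1) GLO by blast
      then show ?thesis
        using act_det_positive[OF \<Gamma> that(1)] act_det_any[OF GLO_GLK that(2)] by simp
    qed
  qed (fact d R ori \<omega> ori_top)+
  show ?thesis using top_homology by blast
qed

end
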